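(* Let $\mathcal{H}$ be a regular unitarily invariant complete Pick space on $\mathbb{B}_d$. For a compact set $E\subset\partial\mathbb{B}_d$ the following are equivalent: (i) $E$ is $\operatorname{Mult}(\mathcal{H})$-totally null; (ii) $E$ is an unboundedness set for $\mathcal{H}$; (iii) $E$ is a weak unboundedness set for $\mathcal{H}$.
   Context: A regular unitarily invariant space is a reproducing kernel Hilbert space $\mathcal{H}$ on $\mathbb{B}_d$ with kernel $K(z,w)=\sum_{n\ge0}a_n\langle z,w\rangle^n$, $a_0=1$, $a_n>0$, $\lim a_n/a_{n+1}=1$; it is a complete Pick space if the coefficients $b_n$ given by $\sum_{n\ge1}b_nt^n=1-(\sum_{n\ge0}a_nt^n)^{-1}$ are all $\ge0$. $\operatorname{Mult}(\mathcal{H})$ is the multiplier algebra with multiplier norm, a dual space (as a WOT-closed subalgebra of $\mathcal{B}(\mathcal{H})$) with weak-$*$ topology. A complex regular Borel measure $\mu$ on $\partial\mathbb{B}_d$ is $\operatorname{Mult}(\mathcal{H})$-Henkin if $p\mapsto\int p\,d\mu$ on polynomials extends to a weak-$*$ continuous functional on $\operatorname{Mult}(\mathcal{H})$; a Borel set $E$ is $\operatorname{Mult}(\mathcal{H})$-totally null if $|\mu|(E)=0$ for all Henkin $\mu$. $E$ is an unboundedness set for $\mathcal{H}$ if there is $f\in\mathcal{H}$ with $\lim_{r\nearrow1}|f(r\zeta)|=\infty$ for all $\zeta\in E$; $E$ is a weak unboundedness set for $\mathcal{H}$ if there exist a separable Hilbert space $\mathcal{E}$ and $f\in\mathcal{H}\otimes\mathcal{E}$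 (an $\mathcal{E}$-valued function on $\mathbb{B}_d$) with $\lim_{r\nearrow1}\|f(r\zeta)\|=\infty$ for all $\zeta\in E$. *)

theory Defs
  imports "HOL-Analysis.Analysis" "HOL-Computational_Algebra.Formal_Power_Series"
begin

definition cinner :: "complex^'d \<Rightarrow> complex^'d \<Rightarrow> complex" where
  "cinner z w = (\<Sum>i\<in>UNIV. z $ i * cnj (w $ i))"

definition ui_kernel :: "(nat \<Rightarrow> real) \<Rightarrow> complex^'d \<Rightarrow> complex^'d \<Rightarrow> complex" where
  "ui_kernel a z w = (\<Sum>n. of_real (a n) * (cinner z w) ^ n)"

definition regular_ui :: "(nat \<Rightarrow> real) \<Rightarrow> bool" where
  "regular_ui a \<longleftrightarrow> a 0 = 1 \<and> (\<forall>n. a n > 0) \<and> (\<lambda>n. a n / a (Suc n)) \<longlonglongrightarrow> 1"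

definition complete_pick :: "(nat \<Rightarrow> real) \<Rightarrow> bool" where
  "complete_pick a \<longleftrightarrow> (\<forall>n\<ge>1. fps_nth (1 - inverse (Abs_fps a)) n \<ge> 0)"

text \<open>Aronszajn: f belongs to H(K) iff there is C with
  |sum c_i f(z_i)|^2 <= C sum c_i conj(c_j) K(z_i,z_j) for all finite families of points
  in the ball; the squared norm of f is the least such C.\<close>
definition rk_bound :: "(complex^'d \<Rightarrow> complex^'d \<Rightarrow> complex) \<Rightarrow> (complex^'d \<Rightarrow> complex) \<Rightarrow> real \<Rightarrow> bool" where
  "rk_bound K f C \<longleftrightarrow> (\<forall>(m::nat) (z::nat \<Rightarrow> complex^'d) (c::nat \<Rightarrow> complex).
      (\<forall>i<m. z i \<in> ball 0 1) \<longrightarrow>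
      (cmod (\<Sum>i<m. c i * f (z i)))\<^sup>2 \<le> C * Re (\<Sum>i<m. \<Sum>j<m. c i * cnj (c j) * K (z i) (z j)))"

definition in_H :: "(complex^'d \<Rightarrow> complex^'d \<Rightarrow> complex) \<Rightarrow> (complex^'d \<Rightarrow> complex) \<Rightarrow> bool" where
  "in_H K f \<longleftrightarrow> (\<exists>C. rk_bound K f C)"

definition hnorm2 :: "(complex^'d \<Rightarrow> complex^'d \<Rightarrow> complex) \<Rightarrow> (complex^'d \<Rightarrow> complex) \<Rightarrow> real" where
  "hnorm2 K f = Inf {C. rk_bound K f C}"

text \<open>Inner product of H (linear in the first argument), by polarization.\<close>
definition hinner :: "(complex^'d \<Rightarrow> complex^'d \<Rightarrow> complex) \<Rightarrow> (complex^'d \<Rightarrow> complex) \<Rightarrow> (complex^'d \<Rightarrow> complex) \<Rightarrow> complex" where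
  "hinner K f g = (1/4) * (\<Sum>k<(4::nat). \<i> ^ k * of_real (hnorm2 K (\<lambda>z. f z + \<i> ^ k * g z)))"

definition is_mult :: "(complex^'d \<Rightarrow> complex^'d \<Rightarrow> complex) \<Rightarrow> (complex^'d \<Rightarrow> complex) \<Rightarrow> bool" where
  "is_mult K \<phi> \<longleftrightarrow> (\<forall>f. in_H K f \<longrightarrow> in_H K (\<lambda>z. \<phi> z * f z))"

text \<open>Admissible pairs of sequences for sigma-weak (ultraweak) functionals
  phi |-> sum_n < M_phi f_n, g_n >.\<close>
definition admissible_pair :: "(complex^'d \<Rightarrow> complex^'d \<Rightarrow> complex) \<Rightarrow> (nat \<Rightarrow> complex^'d \<Rightarrow> complex) \<Rightarrow> (nat \<Rightarrow> complex^'d \<Rightarrow> complex) \<Rightarrow> bool" where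
  "admissible_pair K F G \<longleftrightarrow> (\<forall>n. in_H K (F n) \<and> in_H K (G n)) \<and>
      summable (\<lambda>n. hnorm2 K (F n)) \<and> summable (\<lambda>n. hnorm2 K (G n))"

definition sw_functional :: "(complex^'d \<Rightarrow> complex^'d \<Rightarrow> complex) \<Rightarrow> (nat \<Rightarrow> complex^'d \<Rightarrow> complex) \<Rightarrow> (nat \<Rightarrow> complex^'d \<Rightarrow> complex) \<Rightarrow> (complex^'d \<Rightarrow> complex) \<Rightarrow> complex" where
  "sw_functional K F G \<phi> = (\<Sum>n. hinner K (\<lambda>z. \<phi> z * F n z) (G n))"

text \<open>Weak-* topology on Mult(H): relative sigma-weak topology of B(H), i.e. the coarsest
  topology on the multipliers making all sigma-weak functionals continuous.\<close>
definition wstar_top :: "(complex^'d \<Rightarrow> complex^'d \<Rightarrow> complex) \<Rightarrow> (complex^'d \<Rightarrow> complex) topology" where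
  "wstar_top K = subtopology
     (topology_generated_by
        {{\<phi>. sw_functional K F G \<phi> \<in> U} | F G U. admissible_pair K F G \<and> open U})
     {\<phi>. is_mult K \<phi>}"

definition wstar_cont_functional :: "(complex^'d \<Rightarrow> complex^'d \<Rightarrow> complex) \<Rightarrow> ((complex^'d \<Rightarrow> complex) \<Rightarrow> complex) \<Rightarrow> bool" where
  "wstar_cont_functional K L \<longleftrightarrow>
     (\<forall>\<phi> \<psi>. is_mult K \<phi> \<longrightarrow> is_mult K \<psi> \<longrightarrow> L (\<lambda>z. \<phi> z + \<psi> z) = L \<phi> + L \<psi>) \<and>
     (\<forall>\<phi> c. is_mult K \<phi> \<longrightarrow> L (\<lambda>z. c * \<phi> z) = c * L \<phi>) \<and>
     continuous_map (wstar_top K) euclidean L"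

definition is_poly :: "(complex^'d \<Rightarrow> complex) \<Rightarrow> bool" where
  "is_poly p \<longleftrightarrow> (\<exists>A c. finite A \<and>
     p = (\<lambda>z. \<Sum>\<alpha>\<in>A. c \<alpha> * (\<Prod>i\<in>UNIV. (z $ i) ^ (\<alpha> i))))"

text \<open>A complex regular Borel measure mu on the sphere is represented by its polar decomposition
  d mu = h d|mu|: nu = |mu| a finite Borel measure carried by the sphere, h Borel with |h| = 1.
  (Regularity is automatic for finite Borel measures on a compact metric space.)\<close>
definition cmeasure_rep :: "(complex^'d) measure \<Rightarrow> (complex^'d \<Rightarrow> complex) \<Rightarrow> bool" where
  "cmeasure_rep \<nu> h \<longleftrightarrow> sets \<nu> = sets borel \<and> finite_measure \<nu> \<and>
     emeasure \<nu> (UNIV - sphere 0 1) = 0 \<and> h \<in> borel_measurable borel \<and> (\<forall>z. cmod (h z) = 1)"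

definition henkin :: "(complex^'d \<Rightarrow> complex^'d \<Rightarrow> complex) \<Rightarrow> (complex^'d) measure \<Rightarrow> (complex^'d \<Rightarrow> complex) \<Rightarrow> bool" where
  "henkin K \<nu> h \<longleftrightarrow> cmeasure_rep \<nu> h \<and>
     (\<exists>L. wstar_cont_functional K L \<and>
          (\<forall>p. is_poly p \<longrightarrow> L p = integral\<^sup>L \<nu> (\<lambda>z. p z * h z)))"

definition totally_null :: "(complex^'d \<Rightarrow> complex^'d \<Rightarrow> complex) \<Rightarrow> (complex^'d) set \<Rightarrow> bool" where
  "totally_null K E \<longleftrightarrow> E \<in> sets borel \<and> (\<forall>\<nu> h. henkin K \<nu> h \<longrightarrow> emeasure \<nu> E = 0)"

definition unboundedness_set :: "(complex^'d \<Rightarrow> complex^'d \<Rightarrow> complex) \<Rightarrow> (complex^'d) set \<Rightarrow> bool" where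
  "unboundedness_set K E \<longleftrightarrow> (\<exists>f. in_H K f \<and>
     (\<forall>\<zeta>\<in>E. filterlim (\<lambda>r::real. cmod (f (r *\<^sub>R \<zeta>))) at_top (at_left 1)))"

text \<open>H tensor E for separable E, written in an orthonormal basis (e_n) of E (padding with
  zeros if E is finite dimensional): f = sum_n f_n e_n with sum ||f_n||^2 < infinity, and
  ||f(z)||_E^2 = sum_n |f_n(z)|^2.\<close>
definition weak_unboundedness_set :: "(complex^'d \<Rightarrow> complex^'d \<Rightarrow> complex) \<Rightarrow> (complex^'d) set \<Rightarrow> bool" where
  "weak_unboundedness_set K E \<longleftrightarrow> (\<exists>F :: nat \<Rightarrow> complex^'d \<Rightarrow> complex.
     (\<forall>n. in_H K (F n)) \<and> summable (\<lambda>n. hnorm2 K (F n)) \<and>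
     (\<forall>\<zeta>\<in>E. filterlim (\<lambda>r::real. sqrt (\<Sum>n. (cmod (F n (r *\<^sub>R \<zeta>)))\<^sup>2)) at_top (at_left 1)))"

end

theory Submission
  imports Defs "HOL-Complex_Analysis.Conformal_Mappings"
begin

text \<open>
  A function whose radial limits are infinite on \<open>E\<close> forces \<open>E\<close> to be totally null. Normalise it to a unit vector
  \<open>f\<close> of \<open>H \<otimes> \<ell>\<^sup>2\<close> and put \<open>V z = \<langle>f, K\<^sub>z f\<rangle>\<close>, \<open>\<psi> = 1 - 1/V\<close> and \<open>q\<^sub>i z = \<kappa> \<langle>f, z\<^sub>i K\<^sub>z f\<rangle> / V z\<close> with \<open>\<kappa>\<^sup>2 = b\<^sub>1\<close>. By the Pick property
  these functions satisfy a Schwarz--Pick inequality, so that \<open>\<psi>\<close> and \<open>q\<^sub>i\<close> are contractive multipliers and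
  \<open>|q\<^sub>i z - \<kappa> cnj z\<^sub>i|\<^sup>2 \<le> 2 - 2 Re (\<psi> z)\<close>. Moreover \<open>1 + \<parallel>f z\<parallel>\<^sup>2 \<le> 2 Re (V z)\<close>, so \<open>\<psi>\<close> tends to 1 radially on \<open>E\<close>. Given a
  Henkin measure \<open>\<mu>\<close>, almost norm-minimal midpoint combinations of dilations of \<open>\<psi>\<close> and the \<open>q\<^sub>i\<close> converge \<open>|\<mu>|\<close>-almost
  everywhere to boundary functions that are compatible with the functional induced by \<open>\<mu>\<close>. Since \<open>\<psi> ^ n \<rightarrow> 0\<close> weak-*,
  \<open>\<mu>\<close> restricted to \<open>{\<psi> = 1}\<close> annihilates all products of polynomials and the \<open>q\<^sub>i\<close>. There \<open>q\<^sub>i = \<kappa> cnj z\<^sub>i\<close>, so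
  the restriction vanishes by the Stone--Weierstrass theorem.

  Conversely, let \<open>E\<close> be totally null. For every \<open>\<epsilon> > 0\<close> there is a polynomial of norm less than \<open>\<epsilon>\<close> with
  nonnegative real part on the sphere and real part at least 1 on \<open>E\<close>: otherwise the Hahn--Banach and
  Riesz--Markov theorems yield a positive Henkin measure that charges \<open>E\<close>. The sum of a sequence of such polynomials
  with summable norms is unbounded along the radii to \<open>E\<close>, by the maximum principle.
\<close>

section \<open>Reproducing kernel Hilbert spaces\<close>

text \<open>The norm of \<open>H\<close> is given only as a best constant in inequalities for finite
  combinations of point values. Hence the Hilbert space geometry is recovered from the density of
  kernel functions, and weak-* continuity enters only through bounded, pointwise convergent
  sequences of multipliers. \<open>2 * V - 1\<close> is the analogue of the Herglotz integral of the
  unit vector and \<open>\<psi>\<close> is its Cayley transform, so that a blow-up of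
  \<open>V\<close> drives \<open>\<psi>\<close> to 1. The powers of \<open>\<psi>\<close> alone show
  only that the restricted measure annihilates the polynomials, which are not dense in the
  continuous functions on the sphere. The \<open>q i\<close> supply the missing conjugate
  coordinates: they obey a Schwarz--Pick inequality jointly with \<open>\<psi>\<close>, and
  \<open>\<psi> = 1\<close> is its extremal case. For an arbitrary measure radial limits of
  multipliers need not exist almost everywhere; midpoint combinations converge anyway, and convexity
  preserves multiplier bounds, the estimate for \<open>q i\<close>, and every limit that the
  dilations already have. In the converse, the separation must give a positive measure with mass on
  \<open>E\<close>; a parameter \<open>t\<close> that counts excess over \<open>E\<close> is built
  into the sublinear functional for this purpose.\<close>

text \<open>A list of pairs \<open>(c, z)\<close> stands for the functional \<open>f \<mapsto> \<Sum> c * f z\<close>. In these terms \<^term>\<open>in_H K f\<close> says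
  that \<^term>\<open>f\<close> is bounded as a functional on the lists with respect to the form of \<^term>\<open>K\<close>.\<close>

definition ev :: "(complex \<times> 'a) list \<Rightarrow> ('a \<Rightarrow> complex) \<Rightarrow> complex" where
  "ev l f = (\<Sum>(c, z)\<leftarrow>l. c * f z)"

definition smul :: "complex \<Rightarrow> (complex \<times> 'a) list \<Rightarrow> (complex \<times> 'a) list" where
  "smul t l = map (\<lambda>(c, z). (t * c, z)) l"

text \<open>The adjoint of multiplication by \<open>\<phi>\<close>, acting on functionals. Bounds
  for multipliers thus become inequalities between forms of lists.\<close>

definition twist :: "('a \<Rightarrow> complex) \<Rightarrow> (complex \<times> 'a) list \<Rightarrow> (complex \<times> 'a) list" where
  "twist \<phi> l = map (\<lambda>(c, z). (c * \<phi> z, z)) l"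

text \<open>The sum of all \<open>c * cnj c' * P z w\<close>, linear in the first and conjugate
  linear in the second list. Nesting two \<open>ev\<close> makes the rules for \<open>form\<close>
  consequences of those for \<open>ev\<close>.\<close>

definition form :: "('a \<Rightarrow> 'a \<Rightarrow> complex) \<Rightarrow> (complex \<times> 'a) list \<Rightarrow> (complex \<times> 'a) list \<Rightarrow> complex" where
  "form P l l' = ev l (\<lambda>z. cnj (ev l' (\<lambda>w. cnj (P z w))))"

lemma ev_Nil [simp]: "ev [] f = 0"
  and ev_Cons [simp]: "ev (x # l) f = fst x * f (snd x) + ev l f"
  by (simp_all add: ev_def case_prod_beta)

lemma ev_append [simp]: "ev (l @ l') f = ev l f + ev l' f"
  by (simp add: ev_def)

lemma ev_smul [simp]: "ev (smul t l) f = t * ev l f"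
  by (induction l) (auto simp: smul_def algebra_simps)

lemma ev_twist [simp]: "ev (twist \<phi> l) f = ev l (\<lambda>z. \<phi> z * f z)"
  by (induction l) (auto simp: twist_def algebra_simps)

lemma ev_zero [simp]: "ev l (\<lambda>z. 0) = 0"
  by (induction l) auto

lemma ev_add: "ev l (\<lambda>z. f z + g z) = ev l f + ev l g"
  by (induction l) (auto simp: algebra_simps)

lemma ev_diff: "ev l (\<lambda>z. f z - g z) = ev l f - ev l g"
  by (induction l) (auto simp: algebra_simps)

lemma ev_cmul: "ev l (\<lambda>z. c * f z) = c * ev l f"
  by (induction l) (auto simp: algebra_simps)

lemma ev_cmulr: "ev l (\<lambda>z. f z * c) = ev l f * c"
  by (induction l) (auto simp: algebra_simps)

lemma ev_sum: "ev l (\<lambda>z. \<Sum>i\<in>I. f i z) = (\<Sum>i\<in>I. ev l (f i))"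
  by (induction l) (auto simp: sum_distrib_left sum.distrib)

lemma ev_cong: "(\<And>z. z \<in> snd ` set l \<Longrightarrow> f z = g z) \<Longrightarrow> ev l f = ev l g"
  by (induction l) auto

lemma ev_tendsto:
  "(\<And>z. z \<in> snd ` set l \<Longrightarrow> ((\<lambda>n. f n z) \<longlongrightarrow> g z) F) \<Longrightarrow> ((\<lambda>n. ev l (f n)) \<longlongrightarrow> ev l g) F"
  by (induction l) (auto intro!: tendsto_intros)

lemma ev_swap: "ev l (\<lambda>z. ev l' (\<lambda>w. P z w)) = ev l' (\<lambda>w. ev l (\<lambda>z. P z w))"
  by (induction l) (auto simp: ev_add ev_cmul)

lemma cnj_ev: "cnj (ev l f) = ev (map (\<lambda>(c, z). (cnj c, z)) l) (\<lambda>z. cnj (f z))"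
  by (induction l) auto

lemma points_simps [simp]:
  "snd ` set (smul t l) = snd ` set l" "snd ` set (twist \<phi> l) = snd ` set l"
  by (auto simp: smul_def twist_def image_image case_prod_beta)

lemma form_append_left [simp]: "form P (l @ m) l' = form P l l' + form P m l'"
  by (simp add: form_def)

lemma form_append_right [simp]: "form P l (l' @ m) = form P l l' + form P l m"
  by (simp add: form_def ev_add)

lemma form_smul_left [simp]: "form P (smul t l) l' = t * form P l l'"
  by (simp add: form_def)

lemma form_smul_right [simp]: "form P l (smul t l') = cnj t * form P l l'"
  by (simp add: form_def ev_cmul)

lemma form_twist: "form P (twist \<phi> l) (twist \<psi> l') = form (\<lambda>z w. \<phi> z * cnj (\<psi> w) * P z w) l l'"
proof -
  have "\<phi> z * cnj (ev l' (\<lambda>w. \<psi> w * cnj (P z w))) = cnj (ev l' (\<lambda>w. cnj (\<phi> z * cnj (\<psi> w) * P z w)))" for z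
    by (simp add: ev_cmul [symmetric] mult_ac cnj_ev)
  then show ?thesis by (simp add: form_def)
qed

lemma form_add: "form (\<lambda>z w. P z w + Q z w) l l' = form P l l' + form Q l l'"
  by (simp add: form_def ev_add)

lemma form_diff: "form (\<lambda>z w. P z w - Q z w) l l' = form P l l' - form Q l l'"
  by (simp add: form_def ev_diff)

lemma form_cmul: "form (\<lambda>z w. c * P z w) l l' = c * form P l l'"
  by (simp add: form_def ev_cmul)

lemma form_sum: "form (\<lambda>z w. \<Sum>i\<in>I. P i z w) l l' = (\<Sum>i\<in>I. form (P i) l l')"
  by (simp add: form_def ev_sum)

lemma form_rank_one: "form (\<lambda>z w. f z * cnj (g w)) l l' = ev l f * cnj (ev l' g)"
  by (simp add: form_def ev_cmulr ev_cmul)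

lemma form_cong:
  "(\<And>z w. z \<in> snd ` set l \<Longrightarrow> w \<in> snd ` set l' \<Longrightarrow> P z w = Q z w) \<Longrightarrow> form P l l' = form Q l l'"
  unfolding form_def by (intro ev_cong arg_cong [where f = cnj]) simp

lemma form_tendsto:
  assumes "\<And>z w. z \<in> snd ` set l \<Longrightarrow> w \<in> snd ` set l' \<Longrightarrow> ((\<lambda>n. P n z w) \<longlongrightarrow> Q z w) F"
  shows "((\<lambda>n. form (P n) l l') \<longlongrightarrow> form Q l l') F"
  unfolding form_def using assms by (intro ev_tendsto tendsto_cnj) auto

lemma form_swap:
  assumes "\<And>z w. z \<in> snd ` set l \<Longrightarrow> w \<in> snd ` set l' \<Longrightarrow> P z w = cnj (P w z)"
  shows "form P l l' = cnj (form P l' l)"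
proof -
  let ?c = "map (\<lambda>(c, z). (cnj c, z)) :: (complex \<times> 'a) list \<Rightarrow> _"
  have "cnj (form P l' l) = ev (?c l') (\<lambda>z. ev l (\<lambda>w. cnj (P z w)))"
    by (simp add: form_def cnj_ev comp_def case_prod_beta)
  also have "\<dots> = ev l (\<lambda>w. ev (?c l') (\<lambda>z. cnj (P z w)))" by (rule ev_swap)
  also have "\<dots> = form P l l'"
    unfolding form_def cnj_ev using assms
    by (intro ev_cong) (force simp: image_image case_prod_beta)
  finally show ?thesis by simp
qed

section \<open>Positive kernels and the Cauchy--Schwarz inequality\<close>

definition bpts :: "(complex \<times> (complex^'d)) list set" where
  "bpts = {l. snd ` set l \<subseteq> ball 0 1}"

lemma bpts_simps [simp]:
  "[] \<in> bpts" "x # l \<in> bpts \<longleftrightarrow> snd x \<in> ball 0 1 \<and> l \<in> bpts"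
  "l @ l' \<in> bpts \<longleftrightarrow> l \<in> bpts \<and> l' \<in> bpts"
  "smul t l \<in> bpts \<longleftrightarrow> l \<in> bpts" "twist \<phi> l \<in> bpts \<longleftrightarrow> l \<in> bpts"
  by (auto simp: bpts_def image_Un)

lemma bptsD: "l \<in> bpts \<Longrightarrow> z \<in> snd ` set l \<Longrightarrow> z \<in> ball 0 1"
  by (auto simp: bpts_def)

text \<open>Positivity is required of real parts only, so Hermitian symmetry is a separate clause.
  As in \<open>in_H\<close>, only points of the ball are tested; kernels may be arbitrary
  elsewhere.\<close>

definition psd :: "(complex^'d \<Rightarrow> complex^'d \<Rightarrow> complex) \<Rightarrow> bool" where
  "psd P \<longleftrightarrow> (\<forall>z\<in>ball 0 1. \<forall>w\<in>ball 0 1. P z w = cnj (P w z)) \<and> (\<forall>l\<in>bpts. 0 \<le> Re (form P l l))"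

lemma psd_nonneg: "psd P \<Longrightarrow> l \<in> bpts \<Longrightarrow> 0 \<le> Re (form P l l)"
  by (simp add: psd_def)

lemma psd_herm: "psd P \<Longrightarrow> z \<in> ball 0 1 \<Longrightarrow> w \<in> ball 0 1 \<Longrightarrow> P z w = cnj (P w z)"
  unfolding psd_def by blast

lemma psd_form_swap: "psd P \<Longrightarrow> l \<in> bpts \<Longrightarrow> l' \<in> bpts \<Longrightarrow> form P l l' = cnj (form P l' l)"
  by (intro form_swap psd_herm) (auto simp: bpts_def)

text \<open>Minimise over \<open>t\<close>. For \<open>C > 0\<close> the minimiser is
  \<open>- cnj B / C\<close>; for \<open>C = 0\<close> the expression is unbounded below along
  \<open>- cnj B\<close> unless \<open>B\<close> vanishes.\<close>

lemma quadratic_discriminant_le: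
  fixes A C :: real
  assumes "\<And>t. 0 \<le> A + 2 * Re (t * B) + (cmod t)\<^sup>2 * C" "0 \<le> C"
  shows "(cmod B)\<^sup>2 \<le> A * C"
proof (cases "C = 0")
  case True
  have "B = 0"
  proof (rule ccontr)
    assume "B \<noteq> 0"
    \<comment> \<open>Chosen so that \<open>2 * s * (cmod B)\<^sup>2\<close> exceeds
      \<open>\<bar>A\<bar>\<close>.\<close>
    define s where "s = (\<bar>A\<bar> + 1) / (cmod B)\<^sup>2"
    have "0 \<le> A + 2 * Re (- of_real s * cnj B * B)" using assms(1)[of "- of_real s * cnj B"] True by simp
    also have "Re (- of_real s * cnj B * B) = - s * (cmod B)\<^sup>2"
      unfolding cmod_power2 by (simp add: algebra_simps power2_eq_square)
    also have "\<dots> = - (\<bar>A\<bar> + 1)" using \<open>B \<noteq> 0\<close> by (simp add: s_def)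
    finally show False using abs_ge_self [of A] abs_ge_zero [of A] by (simp add: algebra_simps)
  qed
  then show ?thesis using True by simp
next
  case False
  then have C: "C > 0" using assms by simp
  define t where "t = - of_real (1 / C) * cnj B"
  have "t * B = of_real (- (cmod B)\<^sup>2 / C)"
    using complex_norm_square [of B] by (simp add: t_def mult_ac)
  then have "Re (t * B) = - (cmod B)\<^sup>2 / C" by simp
  moreover have "(cmod t)\<^sup>2 * C = (cmod B)\<^sup>2 / C"
    using C by (simp add: t_def norm_mult norm_divide power_divide power_mult_distrib power2_eq_square)
  ultimately have "0 \<le> A - (cmod B)\<^sup>2 / C" using assms(1)[of t] by simp
  then show ?thesis using C by (simp add: field_simps)
qed

lemma Re_form_scale:
  "Re (a * (cnj a * u)) = (cmod a)\<^sup>2 * Re u" "Re (cnj a * (a * u)) = (cmod a)\<^sup>2 * Re u"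
  unfolding cmod_power2 by (simp_all add: algebra_simps power2_eq_square)

lemma psd_form_add_smul:
  assumes "psd P" "l \<in> bpts" "l' \<in> bpts"
  shows "Re (form P (l @ smul t l') (l @ smul t l')) =
    Re (form P l l) + 2 * Re (t * cnj (form P l l')) + (cmod t)\<^sup>2 * Re (form P l' l')"
proof -
  have "form P l' l = cnj (form P l l')" using assms by (metis psd_form_swap)
  moreover have "Re (t * (cnj t * form P l' l')) = (cmod t)\<^sup>2 * Re (form P l' l')" by (rule Re_form_scale)
  moreover have "Re (cnj t * form P l l') = Re (t * cnj (form P l l'))" by simp
  ultimately show ?thesis
    by (simp only: form_append_left form_append_right form_smul_left form_smul_right distrib_left plus_complex.sel
      mult.left_commute [of "cnj t"])
qed

lemma psd_Cauchy_Schwarz: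
  assumes "psd P" "l \<in> bpts" "l' \<in> bpts"
  shows "(cmod (form P l l'))\<^sup>2 \<le> Re (form P l l) * Re (form P l' l')"
proof -
  have "(cmod (cnj (form P l l')))\<^sup>2 \<le> Re (form P l l) * Re (form P l' l')"
  proof (rule quadratic_discriminant_le)
    fix t show "0 \<le> Re (form P l l) + 2 * Re (t * cnj (form P l l')) + (cmod t)\<^sup>2 * Re (form P l' l')"
      using psd_form_add_smul [OF assms, of t] psd_nonneg [OF assms(1), of "l @ smul t l'"] assms by simp
  qed (use assms psd_nonneg in blast)
  then show ?thesis by simp
qed

text \<open>Translates the indexed families of the definition of \<open>H\<close> into lists;
  afterwards \<open>H\<close> is handled through \<open>ev\<close> and \<open>form\<close>
  alone.\<close>

lemma rk_bound_iff:
  fixes f :: "complex^'d \<Rightarrow> complex"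
  shows "rk_bound K f C \<longleftrightarrow> (\<forall>l\<in>bpts. (cmod (ev l f))\<^sup>2 \<le> C * Re (form K l l))"
proof -
  have conv: "ev (map (\<lambda>i. (c i, z i)) [0..<m]) g = (\<Sum>i<m. c i * g (z i))" for c z g m
    by (simp add: ev_def comp_def interv_sum_list_conv_sum_set_nat atLeast0LessThan)
  have form: "form K (map (\<lambda>i. (c i, z i)) [0..<m]) (map (\<lambda>i. (c i, z i)) [0..<m])
      = (\<Sum>i<m. \<Sum>j<m. c i * cnj (c j) * K (z i) (z j))" for c z m
    by (simp add: form_def conv sum_distrib_left mult.assoc)
  show ?thesis
  proof
    assume r: "rk_bound K f C"
    show "\<forall>l\<in>bpts. (cmod (ev l f))\<^sup>2 \<le> C * Re (form K l l)"
    proof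
      fix l :: "(complex \<times> (complex^'d)) list" assume l: "l \<in> bpts"
      define m where "m = length l"
      have e: "l = map (\<lambda>i. (fst (l ! i), snd (l ! i))) [0..<m]" by (simp add: m_def map_nth)
      have "\<forall>i<m. snd (l ! i) \<in> ball 0 1" using l nth_mem unfolding bpts_def m_def by blast
      then show "(cmod (ev l f))\<^sup>2 \<le> C * Re (form K l l)"
        using r unfolding rk_bound_def by (subst (1 2 3) e) (simp only: conv form)
    qed
  next
    assume r: "\<forall>l\<in>bpts. (cmod (ev l f))\<^sup>2 \<le> C * Re (form K l l)"
    show "rk_bound K f C" unfolding rk_bound_def
    proof (intro allI impI)
      fix m :: nat and z c assume "\<forall>i<m. z i \<in> ball (0 :: complex^'d) 1"
      then have "map (\<lambda>i. (c i, z i)) [0..<m] \<in> bpts" by (auto simp: bpts_def)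
      from bspec [OF r this] show "(cmod (\<Sum>i<m. c i * f (z i)))\<^sup>2 \<le> C * Re (\<Sum>i<m. \<Sum>j<m. c i * cnj (c j) * K (z i) (z j))"
        by (simp only: conv form)
    qed
  qed
qed

section \<open>Norm and inner product of a reproducing kernel Hilbert space\<close>

definition hn :: "(complex^'d \<Rightarrow> complex^'d \<Rightarrow> complex) \<Rightarrow> (complex^'d \<Rightarrow> complex) \<Rightarrow> real" where
  "hn K f = sqrt (hnorm2 K f)"

text \<open>Positivity at the origin excludes the zero kernel, for which negative constants would
  also be bounds and the infimum in \<open>hnorm2\<close> would lose its meaning.\<close>

locale rkhs =
  fixes K :: "complex^'d \<Rightarrow> complex^'d \<Rightarrow> complex"
  assumes psd_K: "psd K" and K_0_pos: "0 < Re (K 0 0)"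
begin

abbreviation N where "N l \<equiv> Re (form K l l)"

lemma N_nonneg: "l \<in> bpts \<Longrightarrow> 0 \<le> N l"
  by (rule psd_nonneg [OF psd_K])

lemma rk_bound_nonneg:
  assumes "rk_bound K f C" shows "0 \<le> C"
proof -
  have "(cmod (ev [(1, 0)] f))\<^sup>2 \<le> C * N [(1, 0)]" using assms unfolding rk_bound_iff by (rule bspec) simp
  then have "0 \<le> C * Re (K 0 0)"
    by (simp add: form_def) (meson order_trans zero_le_power2)
  then show ?thesis using K_0_pos by (simp add: zero_le_mult_iff)
qed

text \<open>The infimum is attained, because each list separately bounds all admissible constants
  from below by the same quotient.\<close>

lemma rk_bound_hnorm2:
  assumes "in_H K f" shows "rk_bound K f (hnorm2 K f)"
  unfolding rk_bound_iff
proof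
  fix l :: "(complex \<times> (complex^'d)) list" assume l: "l \<in> bpts"
  have ne: "{C. rk_bound K f C} \<noteq> {}" using assms by (auto simp: in_H_def)
  have *: "(cmod (ev l f))\<^sup>2 \<le> C * N l" if "rk_bound K f C" for C
    using that l by (auto simp: rk_bound_iff)
  show "(cmod (ev l f))\<^sup>2 \<le> hnorm2 K f * N l"
  proof (cases "N l = 0")
    case True then show ?thesis using ne * by auto
  next
    case False
    then have p: "N l > 0" using N_nonneg [OF l] by simp
    have "(cmod (ev l f))\<^sup>2 / N l \<le> hnorm2 K f" unfolding hnorm2_def
      using * p by (intro cInf_greatest [OF ne]) (auto simp: divide_simps)
    then show ?thesis using p by (simp add: divide_simps)
  qed
qed

lemma hnorm2_le: "rk_bound K f C \<Longrightarrow> hnorm2 K f \<le> C"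
  unfolding hnorm2_def by (rule cInf_lower) (auto intro: bdd_belowI [of _ 0] rk_bound_nonneg)

lemma hnorm2_nonneg: "in_H K f \<Longrightarrow> 0 \<le> hnorm2 K f"
  using rk_bound_hnorm2 rk_bound_nonneg by blast

lemma hn_nonneg: "in_H K f \<Longrightarrow> 0 \<le> hn K f"
  by (simp add: hn_def hnorm2_nonneg)

lemma hn_power2: "in_H K f \<Longrightarrow> (hn K f)\<^sup>2 = hnorm2 K f"
  by (simp add: hn_def hnorm2_nonneg)

lemma ev_le: "in_H K f \<Longrightarrow> l \<in> bpts \<Longrightarrow> (cmod (ev l f))\<^sup>2 \<le> hnorm2 K f * N l"
  using rk_bound_hnorm2 by (auto simp: rk_bound_iff)

lemma ev_le_hn: "in_H K f \<Longrightarrow> l \<in> bpts \<Longrightarrow> cmod (ev l f) \<le> hn K f * sqrt (N l)"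
  using ev_le [of f l] by (simp add: hn_def real_sqrt_mult [symmetric] real_le_rsqrt)

lemma hn_leI:
  assumes "\<And>l. l \<in> bpts \<Longrightarrow> cmod (ev l f) \<le> C * sqrt (N l)" "0 \<le> C"
  shows "in_H K f" "hn K f \<le> C"
proof -
  have r: "rk_bound K f (C\<^sup>2)" unfolding rk_bound_iff
  proof
    fix l :: "(complex \<times> (complex^'d)) list" assume l: "l \<in> bpts"
    have "(cmod (ev l f))\<^sup>2 \<le> (C * sqrt (N l))\<^sup>2" using assms(1)[OF l] by (intro power_mono) auto
    then show "(cmod (ev l f))\<^sup>2 \<le> C\<^sup>2 * N l" using N_nonneg [OF l] by (simp add: power_mult_distrib)
  qed
  then show "in_H K f" by (auto simp: in_H_def)
  show "hn K f \<le> C" using hnorm2_le [OF r] assms(2) by (simp add: hn_def real_le_lsqrt)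
qed

lemma in_H_add: assumes "in_H K f" "in_H K g"
  shows "in_H K (\<lambda>z. f z + g z)" and hn_add: "hn K (\<lambda>z. f z + g z) \<le> hn K f + hn K g"
proof -
  have "cmod (ev l (\<lambda>z. f z + g z)) \<le> (hn K f + hn K g) * sqrt (N l)" if "l \<in> bpts" for l
    using norm_triangle_ineq [of "ev l f" "ev l g"] ev_le_hn [OF assms(1) that] ev_le_hn [OF assms(2) that]
    by (simp add: ev_add algebra_simps)
  from hn_leI [OF this] show "in_H K (\<lambda>z. f z + g z)" "hn K (\<lambda>z. f z + g z) \<le> hn K f + hn K g"
    using hn_nonneg assms by simp_all
qed

lemma in_H_cmul: assumes "in_H K f"
  shows "in_H K (\<lambda>z. c * f z)" and hn_cmul_le: "hn K (\<lambda>z. c * f z) \<le> cmod c * hn K f"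
proof -
  have "cmod (ev l (\<lambda>z. c * f z)) \<le> (cmod c * hn K f) * sqrt (N l)" if "l \<in> bpts" for l
    using ev_le_hn [OF assms(1) that] by (simp add: ev_cmul norm_mult mult_left_mono mult.assoc)
  from hn_leI [OF this] show "in_H K (\<lambda>z. c * f z)" "hn K (\<lambda>z. c * f z) \<le> cmod c * hn K f"
    using hn_nonneg assms by simp_all
qed

lemma in_H_zero [simp]: "in_H K (\<lambda>z. 0)" and hn_zero [simp]: "hn K (\<lambda>z. 0) = 0"
proof -
  have "in_H K (\<lambda>z. 0) \<and> hn K (\<lambda>z. 0) \<le> 0" using hn_leI [of "\<lambda>z. 0" 0] by simp
  then show "in_H K (\<lambda>z. 0)" "hn K (\<lambda>z. 0) = 0" using hn_nonneg by (auto intro: antisym)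
qed

lemma hnorm2_zero [simp]: "hnorm2 K (\<lambda>z. 0) = 0"
  using hn_zero by (simp add: hn_def del: hn_zero)

lemma hn_cmul: assumes "in_H K f" shows "hn K (\<lambda>z. c * f z) = cmod c * hn K f"
proof (cases "c = 0")
  case False
  have "hn K (\<lambda>z. inverse c * (c * f z)) \<le> cmod (inverse c) * hn K (\<lambda>z. c * f z)"
    by (rule hn_cmul_le) (rule in_H_cmul [OF assms])
  then have "cmod c * hn K f \<le> hn K (\<lambda>z. c * f z)"
    using False by (simp add: norm_inverse norm_divide field_simps)
  then show ?thesis using hn_cmul_le [OF assms, of c] by simp
qed simp

lemma hnorm2_cmul: assumes "in_H K f" shows "hnorm2 K (\<lambda>z. c * f z) = (cmod c)\<^sup>2 * hnorm2 K f"
  using hn_cmul [OF assms, of c] hn_power2 assms in_H_cmul by (metis power_mult_distrib)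

lemma in_H_diff: assumes "in_H K f" "in_H K g"
  shows "in_H K (\<lambda>z. f z - g z)" and hn_diff: "hn K (\<lambda>z. f z - g z) \<le> hn K f + hn K g"
  using in_H_add [OF assms(1) in_H_cmul(1) [OF assms(2), of "-1"]] hn_add [OF assms(1) in_H_cmul(1) [OF assms(2), of "-1"]]
    hn_cmul [OF assms(2), of "-1"] by simp_all

lemma in_H_sum: "(\<And>i. i \<in> I \<Longrightarrow> in_H K (f i)) \<Longrightarrow> in_H K (\<lambda>z. \<Sum>i\<in>I. f i z)"
  by (induction I rule: infinite_finite_induct) (auto intro: in_H_add)

lemma hn_sum: "(\<And>i. i \<in> I \<Longrightarrow> in_H K (f i)) \<Longrightarrow> hn K (\<lambda>z. \<Sum>i\<in>I. f i z) \<le> (\<Sum>i\<in>I. hn K (f i))"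
proof (induction I rule: infinite_finite_induct)
  case (insert x I)
  then show ?case using hn_add [of "f x" "\<lambda>z. \<Sum>i\<in>I. f i z"] in_H_sum [of I f] by fastforce
qed auto

lemma hn_diff_commute: assumes "in_H K f" "in_H K g"
  shows "hn K (\<lambda>z. f z - g z) = hn K (\<lambda>z. g z - f z)"
  using hn_cmul [OF in_H_diff(1) [OF assms], of "-1"] by simp

lemma hn_abs_diff: assumes "in_H K f" "in_H K g"
  shows "\<bar>hn K f - hn K g\<bar> \<le> hn K (\<lambda>z. f z - g z)"
  using hn_add [OF in_H_diff(1) [OF assms] assms(2)] hn_add [OF in_H_diff(1) [OF assms(2,1)] assms(1)]
    hn_diff_commute [OF assms] by simp

text \<open>Dual proof of the parallelogram inequality: the sum is tested on \<open>l\<close>, the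
  difference on \<open>l'\<close>. Regrouping moves \<open>f\<close> to the sum and \<open>g\<close>
  to the difference of the rescaled lists, where the parallelogram law of the form and
  Cauchy--Schwarz in the plane give \<open>T * T \<le> c * T\<close> with the wanted bound
  \<open>c\<close>.\<close>

lemma parallelogram_aux:
  assumes "in_H K f" "in_H K g" "l \<in> bpts" "l' \<in> bpts"
  shows "(cmod (ev l (\<lambda>z. f z + g z)))\<^sup>2 * N l' + (cmod (ev l' (\<lambda>z. f z - g z)))\<^sup>2 * N l
    \<le> 2 * (hnorm2 K f + hnorm2 K g) * N l * N l'"
proof -
  define x where "x = cmod (ev l (\<lambda>z. f z + g z))"
  define y where "y = cmod (ev l' (\<lambda>z. f z - g z))"
  define T where "T = x\<^sup>2 * N l' + y\<^sup>2 * N l"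
  define D where "D = hnorm2 K f + hnorm2 K g"
  have nn: "0 \<le> N l" "0 \<le> N l'" "0 \<le> D" using N_nonneg assms hnorm2_nonneg by (auto simp: D_def)
  \<comment> \<open>These scalings make the two evaluations real with sum \<open>T\<close>, and give
    \<open>N m + N m' = N l * N l' * T\<close>.\<close>
  define m where "m = smul (of_real (N l') * cnj (ev l (\<lambda>z. f z + g z))) l"
  define m' where "m' = smul (of_real (N l) * cnj (ev l' (\<lambda>z. f z - g z))) l'"
  have Nm: "N m = (N l')\<^sup>2 * x\<^sup>2 * N l" "N m' = (N l)\<^sup>2 * y\<^sup>2 * N l'"
  proof -
    show "N m = (N l')\<^sup>2 * x\<^sup>2 * N l" "N m' = (N l)\<^sup>2 * y\<^sup>2 * N l'"
      using nn by (simp_all only: m_def m'_def form_smul_left form_smul_right Re_form_scale norm_mult x_def y_def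
        complex_mod_cnj norm_of_real power_mult_distrib power2_abs)
  qed
  have mb: "m \<in> bpts" "m' \<in> bpts" using assms by (auto simp: m_def m'_def)
  let ?p = "m @ smul 1 m'" and ?q = "m @ smul (-1) m'"
  have pq: "N ?p + N ?q = 2 * N m + 2 * N m'"
    using psd_form_add_smul [OF psd_K mb, of 1] psd_form_add_smul [OF psd_K mb, of "-1"] by simp
  have "of_real T = ev m (\<lambda>z. f z + g z) + ev m' (\<lambda>z. f z - g z)"
    by (simp add: T_def m_def m'_def x_def y_def complex_norm_square mult_ac del: of_real_power)
  also have "\<dots> = ev ?p f + ev ?q g" by (simp add: ev_add ev_diff)
  finally have "\<bar>T\<bar> \<le> cmod (ev ?p f) + cmod (ev ?q g)"
    by (metis norm_of_real norm_triangle_ineq)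
  also have "\<dots> \<le> hn K f * sqrt (N ?p) + hn K g * sqrt (N ?q)"
    using mb assms by (intro add_mono ev_le_hn) auto
  finally have "T\<^sup>2 \<le> (hn K f * sqrt (N ?p) + hn K g * sqrt (N ?q))\<^sup>2"
    by (metis abs_ge_zero power2_abs power_mono)
  also have "\<dots> \<le> ((hn K f)\<^sup>2 + (hn K g)\<^sup>2) * ((sqrt (N ?p))\<^sup>2 + (sqrt (N ?q))\<^sup>2)"
  proof -
    have "0 \<le> (hn K f * sqrt (N ?q) - hn K g * sqrt (N ?p))\<^sup>2" by simp
    then show ?thesis by (simp add: power2_eq_square algebra_simps)
  qed
  also have "\<dots> = D * (N ?p + N ?q)"
    using hn_power2 assms N_nonneg [of ?p] N_nonneg [of ?q] mb by (simp add: D_def del: form_append_left form_append_right)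
  also have "\<dots> = (2 * D * N l * N l') * T" unfolding pq Nm T_def by (simp add: power2_eq_square algebra_simps)
  finally have "T * T \<le> (2 * D * N l * N l') * T" by (simp add: power2_eq_square)
  moreover have "0 \<le> T" using nn by (simp add: T_def)
  ultimately have "T \<le> 2 * D * N l * N l'"
    using nn by (cases "T = 0") (auto simp: mult_le_cancel_right)
  then show ?thesis by (simp add: T_def x_def y_def D_def)
qed

text \<open>In \<open>parallelogram_aux\<close> the lists are independent, so the least constant can
  be taken first for the difference and then for the sum.\<close>

lemma parallelogram_le:
  assumes "in_H K f" "in_H K g"
  shows "hnorm2 K (\<lambda>z. f z + g z) + hnorm2 K (\<lambda>z. f z - g z) \<le> 2 * (hnorm2 K f + hnorm2 K g)"
proof -
  let ?D = "2 * (hnorm2 K f + hnorm2 K g)"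
  let ?b = "hnorm2 K (\<lambda>z. f z - g z)"
  have "rk_bound K (\<lambda>z. f z + g z) (?D - ?b)" unfolding rk_bound_iff
  proof
    fix l :: "(complex \<times> (complex^'d)) list" assume l: "l \<in> bpts"
    let ?x = "(cmod (ev l (\<lambda>z. f z + g z)))\<^sup>2"
    show "?x \<le> (?D - ?b) * N l"
    proof (cases "N l = 0")
      case True then show ?thesis using ev_le [OF in_H_add(1) [OF assms] l] by simp
    next
      case False
      then have p: "N l > 0" using N_nonneg [OF l] by simp
      have "rk_bound K (\<lambda>z. f z - g z) (?D - ?x / N l)" unfolding rk_bound_iff
      proof
        fix l' :: "(complex \<times> (complex^'d)) list" assume l': "l' \<in> bpts"
        show "(cmod (ev l' (\<lambda>z. f z - g z)))\<^sup>2 \<le> (?D - ?x / N l) * N l'"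
          using parallelogram_aux [OF assms l l'] p by (simp add: field_simps)
      qed
      then have "?b \<le> ?D - ?x / N l" by (rule hnorm2_le)
      then show ?thesis using p by (simp add: field_simps)
    qed
  qed
  then show ?thesis using hnorm2_le by fastforce
qed

text \<open>The combination of kernel functions that represents the functional \<open>l\<close>. Its
  coefficients are conjugated so that pairing a function with \<open>sec l\<close> gives
  \<open>ev l\<close>.\<close>

definition sec where "sec l = (\<lambda>z. cnj (ev l (\<lambda>w. cnj (K z w))))"

lemma sec_Nil [simp]: "sec [] = (\<lambda>z. 0)"
  by (simp add: sec_def)

lemma sec_append: "sec (l @ l') = (\<lambda>z. sec l z + sec l' z)"
  by (simp add: sec_def)

lemma sec_smul: "sec (smul t l) = (\<lambda>z. cnj t * sec l z)"
  by (simp add: sec_def)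

lemma ev_sec: "ev l' (sec l) = form K l' l"
  by (simp add: sec_def form_def)

lemma N_smul: "N (smul t l) = (cmod t)\<^sup>2 * N l"
  unfolding form_smul_left form_smul_right Re_form_scale ..

lemma in_H_sec: assumes "l \<in> bpts" shows "in_H K (sec l)" and hnorm2_sec: "hnorm2 K (sec l) = N l"
proof -
  have r: "rk_bound K (sec l) (N l)" unfolding rk_bound_iff ev_sec
    using psd_Cauchy_Schwarz [OF psd_K _ assms] by (simp add: mult.commute)
  then show H: "in_H K (sec l)" by (auto simp: in_H_def)
  have "(N l)\<^sup>2 \<le> (cmod (ev l (sec l)))\<^sup>2"
    unfolding ev_sec by (simp add: cmod_power2)
  also have "\<dots> \<le> hnorm2 K (sec l) * N l" by (rule ev_le [OF H assms])
  finally have "N l \<le> hnorm2 K (sec l)"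
    using N_nonneg [OF assms] hnorm2_nonneg [OF H]
    by (cases "N l = 0") (auto simp: power2_eq_square mult_le_cancel_right)
  then show "hnorm2 K (sec l) = N l" using hnorm2_le [OF r] by simp
qed

text \<open>No inner product is available yet, so orthogonal complements are replaced by uniform
  convexity: a section \<open>m\<close> that almost norms \<open>g\<close> and has the same norm
  makes \<open>g + sec m\<close> almost twice as long, and the parallelogram inequality forces
  \<open>g - sec m\<close> to be short.\<close>

lemma sec_dense:
  assumes g: "in_H K g" and e: "0 < e"
  shows "\<exists>l\<in>bpts. hnorm2 K (\<lambda>z. g z - sec l z) < e"
proof (cases "hnorm2 K g = 0")
  case True
  then show ?thesis using e by (intro bexI [of _ "[]"]) auto
next
  case False
  define A where "A = hnorm2 K g"
  have A: "A > 0" using False hnorm2_nonneg [OF g] by (simp add: A_def)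
  \<comment> \<open>The final estimate is
    \<open>hnorm2 K (\<lambda>z. g z - sec m z) \<le> 4 * \<delta>\<close>; the first entry keeps
    \<open>A - \<delta>\<close> positive.\<close>
  define \<delta> where "\<delta> = min (A / 2) (e / 5)"
  have \<delta>: "0 < \<delta>" "\<delta> < A" "4 * \<delta> < e" using A e by (auto simp: \<delta>_def min_def)
  have "\<not> rk_bound K g (A - \<delta>)" using hnorm2_le [of g "A - \<delta>"] \<delta> by (auto simp: A_def)
  then obtain l where l: "l \<in> bpts" "(cmod (ev l g))\<^sup>2 > (A - \<delta>) * N l"
    by (auto simp: rk_bound_iff not_le)
  have "N l \<noteq> 0"
  proof
    assume "N l = 0" then show False using ev_le [OF g l(1)] l(2) by simp
  qed
  then have n: "N l > 0" using N_nonneg [OF l(1)] by simp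
  define x where "x = cmod (ev l g)"
  have x: "x > 0"
  proof -
    have "x\<^sup>2 > 0" using l(2) n \<delta> unfolding x_def by (smt (verit) mult_pos_pos)
    then show ?thesis by (simp add: x_def)
  qed
  \<comment> \<open>The modulus of the factor gives \<open>N m = A\<close>, its phase makes
    \<open>ev m g\<close> real and positive.\<close>
  define m where "m = smul (of_real (sqrt (A / N l) / x) * cnj (ev l g)) l"
  have m: "m \<in> bpts" using l by (simp add: m_def)
  have Nm: "N m = A"
    unfolding m_def N_smul using x n A by (simp add: norm_mult norm_divide x_def [symmetric] power_mult_distrib power_divide)
  define y where "y = sqrt (A / N l) * x"
  have evm: "ev m g = of_real y"
  proof -
    have a: "ev l g * cnj (ev l g) = of_real (x\<^sup>2)" using complex_norm_square [of "ev l g"] by (simp add: x_def)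
    have "ev m g = of_real (sqrt (A / N l) / x) * (ev l g * cnj (ev l g))" by (simp add: m_def mult_ac)
    also have "\<dots> = of_real y" unfolding a
      using x by (simp add: y_def power2_eq_square flip: of_real_mult of_real_divide of_real_power)
    finally show ?thesis .
  qed
  have "y\<^sup>2 > (A - \<delta>) * A"
  proof -
    have "y\<^sup>2 = A / N l * x\<^sup>2" using A n by (simp add: y_def power_mult_distrib)
    also have "\<dots> > A / N l * ((A - \<delta>) * N l)" using l(2) A n unfolding x_def by (intro mult_strict_left_mono) auto
    finally show ?thesis using n by (simp add: mult.commute)
  qed
  moreover have "(A - \<delta>) * A \<ge> (A - \<delta>)\<^sup>2" using \<delta> by (simp add: power2_eq_square mult_left_mono)
  ultimately have "y \<ge> A - \<delta>"
    using x n A by (intro power2_le_imp_le [of "A - \<delta>" y]) (auto simp: y_def)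
  then have y2: "y + A \<ge> 2 * A - \<delta>" by simp
  have "(2 * A - \<delta>)\<^sup>2 \<le> (y + A)\<^sup>2" using y2 \<delta> A by (intro power_mono) auto
  also have "\<dots> = (cmod (ev m (\<lambda>z. g z + sec m z)))\<^sup>2"
  proof -
    have "ev m (sec m) = of_real A"
      using psd_form_swap [OF psd_K m m] Nm by (simp add: ev_sec complex_eq_iff)
    then show ?thesis by (simp add: ev_add evm flip: of_real_add)
  qed
  also have "\<dots> \<le> hnorm2 K (\<lambda>z. g z + sec m z) * A"
    using ev_le [OF in_H_add(1) [OF g in_H_sec(1) [OF m]] m] Nm by simp
  finally have "4 * A * A - 4 * \<delta> * A \<le> hnorm2 K (\<lambda>z. g z + sec m z) * A"
    by (simp add: power2_eq_square algebra_simps) (smt (verit) zero_le_square)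
  then have "(4 * A - 4 * \<delta>) * A \<le> hnorm2 K (\<lambda>z. g z + sec m z) * A" by (simp add: algebra_simps)
  then have "4 * A - 4 * \<delta> \<le> hnorm2 K (\<lambda>z. g z + sec m z)" using A by simp
  then have "hnorm2 K (\<lambda>z. g z - sec m z) < e"
    using parallelogram_le [OF g in_H_sec(1) [OF m]] hnorm2_sec [OF m] Nm \<delta> by (simp add: A_def)
  then show ?thesis using m by blast
qed

text \<open>Transports identities to all of \<open>H\<close>: the rules for \<open>hinner\<close>
  below are checked with sections in one or both arguments, where they concern \<open>ev\<close> or
  \<open>form\<close>, and then pass to the limit.\<close>

lemma sec_seq:
  assumes g: "in_H K g"
  obtains l where "\<And>n. l n \<in> bpts" "(\<lambda>n. hn K (\<lambda>z. sec (l n) z - g z)) \<longlonglongrightarrow> 0"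
proof -
  have "\<forall>n. \<exists>l. l \<in> bpts \<and> hnorm2 K (\<lambda>z. g z - sec l z) < 1 / real (Suc n)"
    using sec_dense [OF g, of "1 / real (Suc n)" for n] by auto
  then obtain l where l: "\<And>n. l n \<in> bpts" "\<And>n. hnorm2 K (\<lambda>z. g z - sec (l n) z) < 1 / real (Suc n)" by metis
  have "(\<lambda>n. hnorm2 K (\<lambda>z. g z - sec (l n) z)) \<longlonglongrightarrow> 0"
    using l hnorm2_nonneg in_H_diff(1) [OF g in_H_sec(1)]
    by (intro real_tendsto_sandwich [OF _ _ tendsto_const LIMSEQ_inverse_real_of_nat])
       (auto intro!: eventuallyI simp: inverse_eq_divide intro: less_imp_le)
  then have "(\<lambda>n. hn K (\<lambda>z. g z - sec (l n) z)) \<longlonglongrightarrow> sqrt 0"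
    unfolding hn_def by (rule tendsto_real_sqrt)
  then have "(\<lambda>n. hn K (\<lambda>z. sec (l n) z - g z)) \<longlonglongrightarrow> 0"
    using hn_diff_commute [OF g in_H_sec(1)] l(1) by simp
  then show ?thesis using that l(1) by blast
qed

lemma hn_tendsto:
  assumes "\<And>n. in_H K (f n)" "in_H K g" "(\<lambda>n. hn K (\<lambda>z. f n z - g z)) \<longlonglongrightarrow> 0"
  shows "(\<lambda>n. hn K (f n)) \<longlonglongrightarrow> hn K g"
proof -
  have "(\<lambda>n. hn K (f n) - hn K g) \<longlonglongrightarrow> 0"
    by (rule Lim_null_comparison [OF _ assms(3)]) (use hn_abs_diff assms in \<open>auto intro!: eventuallyI\<close>)
  then show ?thesis by (rule LIM_zero_cancel)
qed

text \<open>By polarization \<open>hinner\<close> is a combination of four squared norms, so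
  continuity of the norm suffices; sesquilinearity is not yet known here.\<close>

lemma hinner_tendsto:
  assumes f: "\<And>n. in_H K (f n)" "in_H K f'" "(\<lambda>n. hn K (\<lambda>z. f n z - f' z)) \<longlonglongrightarrow> 0"
    and g: "\<And>n. in_H K (g n)" "in_H K g'" "(\<lambda>n. hn K (\<lambda>z. g n z - g' z)) \<longlonglongrightarrow> 0"
  shows "(\<lambda>n. hinner K (f n) (g n)) \<longlonglongrightarrow> hinner K f' g'"
proof -
  have "(\<lambda>n. hnorm2 K (\<lambda>z. f n z + \<i> ^ k * g n z)) \<longlonglongrightarrow> hnorm2 K (\<lambda>z. f' z + \<i> ^ k * g' z)" for k
  proof -
    let ?u = "\<lambda>n z. f n z + \<i> ^ k * g n z" and ?v = "\<lambda>z. f' z + \<i> ^ k * g' z"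
    have H: "in_H K (?u n)" "in_H K ?v" for n using f g by (auto intro!: in_H_add in_H_cmul)
    have "hn K (\<lambda>z. ?u n z - ?v z) \<le> hn K (\<lambda>z. f n z - f' z) + hn K (\<lambda>z. g n z - g' z)" for n
    proof -
      have "(\<lambda>z. ?u n z - ?v z) = (\<lambda>z. (f n z - f' z) + \<i> ^ k * (g n z - g' z))" by (auto simp: algebra_simps)
      then show ?thesis using hn_add [of "\<lambda>z. f n z - f' z" "\<lambda>z. \<i> ^ k * (g n z - g' z)"]
        hn_cmul [of "\<lambda>z. g n z - g' z" "\<i> ^ k"] f g in_H_diff(1) in_H_cmul(1)
        by (auto simp: norm_power)
    qed
    moreover have "(\<lambda>n. hn K (\<lambda>z. f n z - f' z) + hn K (\<lambda>z. g n z - g' z)) \<longlonglongrightarrow> 0"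
      using tendsto_add [OF f(3) g(3)] by simp
    moreover have "0 \<le> hn K (\<lambda>z. ?u n z - ?v z)" for n
      by (rule hn_nonneg, rule in_H_diff(1) [OF H])
    ultimately have b: "\<forall>n. norm (hn K (\<lambda>z. ?u n z - ?v z)) \<le> hn K (\<lambda>z. f n z - f' z) + hn K (\<lambda>z. g n z - g' z)"
      and t: "(\<lambda>n. hn K (\<lambda>z. f n z - f' z) + hn K (\<lambda>z. g n z - g' z)) \<longlonglongrightarrow> 0" by simp_all
    have "(\<lambda>n. hn K (\<lambda>z. ?u n z - ?v z)) \<longlonglongrightarrow> 0"
      by (rule Lim_null_comparison [OF always_eventually [OF b] t])
    from tendsto_power [OF hn_tendsto [OF H this], of 2]
    show ?thesis using hn_power2 H by simp
  qed
  then show ?thesis unfolding hinner_def by (intro tendsto_intros)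
qed

text \<open>The order is reversed because \<open>sec\<close> is conjugate linear in the list while
  \<open>form\<close> is linear in its first list.\<close>

lemma hinner_sec_sec:
  assumes "l \<in> bpts" "l' \<in> bpts" shows "hinner K (sec l') (sec l) = form K l l'"
proof -
  let ?X = "form K l l'"
  have *: "hnorm2 K (\<lambda>z. sec l' z + t * sec l z) = N l' + 2 * Re (cnj t * ?X) + (cmod t)\<^sup>2 * N l" for t
  proof -
    have "(\<lambda>z. sec l' z + t * sec l z) = sec (l' @ smul (cnj t) l)" by (simp add: sec_append sec_smul)
    then have "hnorm2 K (\<lambda>z. sec l' z + t * sec l z) = N (l' @ smul (cnj t) l)" using hnorm2_sec assms by simp
    also have "\<dots> = N l' + 2 * Re (cnj t * cnj (form K l' l)) + (cmod t)\<^sup>2 * N l"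
      using psd_form_add_smul [OF psd_K assms(2,1), of "cnj t"] by simp
    also have "cnj (form K l' l) = ?X" using psd_form_swap [OF psd_K assms] by simp
    finally show ?thesis .
  qed
  show ?thesis
    unfolding hinner_def *
    by (simp add: complex_eq_iff numeral_eq_Suc lessThan_Suc norm_power norm_mult)
qed

lemma hinner_sec:
  assumes f: "in_H K f" and l: "l \<in> bpts" shows "hinner K f (sec l) = ev l f"
proof -
  obtain m where m: "\<And>n. m n \<in> bpts" "(\<lambda>n. hn K (\<lambda>z. sec (m n) z - f z)) \<longlonglongrightarrow> 0"
    using sec_seq [OF f] by blast
  have 1: "(\<lambda>n. hinner K (sec (m n)) (sec l)) \<longlonglongrightarrow> hinner K f (sec l)"
    by (intro hinner_tendsto in_H_sec m f l) auto
  have "(\<lambda>n. ev l (\<lambda>z. sec (m n) z - f z)) \<longlonglongrightarrow> 0"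
  proof (rule Lim_null_comparison)
    show "(\<lambda>n. hn K (\<lambda>z. sec (m n) z - f z) * sqrt (N l)) \<longlonglongrightarrow> 0" using m(2) by (rule tendsto_mult_left_zero)
    show "\<forall>\<^sub>F n in sequentially. norm (ev l (\<lambda>z. sec (m n) z - f z)) \<le> hn K (\<lambda>z. sec (m n) z - f z) * sqrt (N l)"
      using m(1) by (intro always_eventually allI ev_le_hn in_H_diff in_H_sec f l) auto
  qed
  then have "(\<lambda>n. ev l (sec (m n)) - ev l f) \<longlonglongrightarrow> 0" by (simp add: ev_diff)
  then have "(\<lambda>n. hinner K (sec (m n)) (sec l)) \<longlonglongrightarrow> ev l f"
    using m(1) l by (simp add: LIM_zero_iff hinner_sec_sec ev_sec)
  with 1 show ?thesis by (rule LIMSEQ_unique)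
qed

lemma hinner_sym:
  assumes f: "in_H K f" and g: "in_H K g" shows "hinner K g f = cnj (hinner K f g)"
proof -
  obtain m where m: "\<And>n. m n \<in> bpts" "(\<lambda>n. hn K (\<lambda>z. sec (m n) z - f z)) \<longlonglongrightarrow> 0"
    using sec_seq [OF f] by blast
  obtain l where l: "\<And>n. l n \<in> bpts" "(\<lambda>n. hn K (\<lambda>z. sec (l n) z - g z)) \<longlonglongrightarrow> 0"
    using sec_seq [OF g] by blast
  have 1: "(\<lambda>n. cnj (hinner K (sec (m n)) (sec (l n)))) \<longlonglongrightarrow> cnj (hinner K f g)"
    by (intro tendsto_cnj hinner_tendsto in_H_sec m f l g)
  have 2: "(\<lambda>n. hinner K (sec (l n)) (sec (m n))) \<longlonglongrightarrow> hinner K g f"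
    by (intro hinner_tendsto in_H_sec m f l g)
  have "hinner K (sec (l n)) (sec (m n)) = cnj (hinner K (sec (m n)) (sec (l n)))" for n
    using m(1) l(1) psd_form_swap [OF psd_K] by (metis hinner_sec_sec)
  with 1 2 show ?thesis using LIMSEQ_unique by fastforce
qed

lemma hinner_add:
  assumes f: "in_H K f" and f': "in_H K f'" and g: "in_H K g"
  shows "hinner K (\<lambda>z. f z + f' z) g = hinner K f g + hinner K f' g"
proof -
  obtain l where l: "\<And>n. l n \<in> bpts" "(\<lambda>n. hn K (\<lambda>z. sec (l n) z - g z)) \<longlonglongrightarrow> 0"
    using sec_seq [OF g] by blast
  have *: "(\<lambda>n. ev (l n) u) \<longlonglongrightarrow> hinner K u g" if u: "in_H K u" for u
  proof -
    have "(\<lambda>n. hinner K u (sec (l n))) \<longlonglongrightarrow> hinner K u g"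
      by (intro hinner_tendsto in_H_sec l g u) auto
    then show ?thesis using l u by (simp add: hinner_sec)
  qed
  have "(\<lambda>n. ev (l n) (\<lambda>z. f z + f' z)) \<longlonglongrightarrow> hinner K f g + hinner K f' g"
    unfolding ev_add by (intro tendsto_add * f f')
  with * [OF in_H_add(1) [OF f f']] show ?thesis using LIMSEQ_unique by blast
qed

lemma hinner_cmul:
  assumes f: "in_H K f" and g: "in_H K g"
  shows "hinner K (\<lambda>z. c * f z) g = c * hinner K f g"
proof -
  obtain l where l: "\<And>n. l n \<in> bpts" "(\<lambda>n. hn K (\<lambda>z. sec (l n) z - g z)) \<longlonglongrightarrow> 0"
    using sec_seq [OF g] by blast
  have *: "(\<lambda>n. ev (l n) u) \<longlonglongrightarrow> hinner K u g" if u: "in_H K u" for u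
  proof -
    have "(\<lambda>n. hinner K u (sec (l n))) \<longlonglongrightarrow> hinner K u g"
      by (intro hinner_tendsto in_H_sec l g u) auto
    then show ?thesis using l u by (simp add: hinner_sec)
  qed
  have "(\<lambda>n. ev (l n) (\<lambda>z. c * f z)) \<longlonglongrightarrow> c * hinner K f g"
    unfolding ev_cmul by (intro tendsto_intros * f)
  with * [OF in_H_cmul(1) [OF f]] show ?thesis using LIMSEQ_unique by blast
qed

lemma hinner_add_right:
  assumes "in_H K f" "in_H K g" "in_H K g'"
  shows "hinner K f (\<lambda>z. g z + g' z) = hinner K f g + hinner K f g'"
  using hinner_sym [OF in_H_add(1) [OF assms(2,3)] assms(1)] hinner_add [OF assms(2,3,1)]
    hinner_sym [OF assms(2,1)] hinner_sym [OF assms(3,1)] by simp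

lemma hinner_cmul_right:
  assumes "in_H K f" "in_H K g"
  shows "hinner K f (\<lambda>z. c * g z) = cnj c * hinner K f g"
  using hinner_sym [OF in_H_cmul(1) [OF assms(2)] assms(1)] hinner_cmul [OF assms(2,1)]
    hinner_sym [OF assms(2,1)] by simp

lemma hinner_zero_left [simp]: "in_H K g \<Longrightarrow> hinner K (\<lambda>z. 0) g = 0"
  using hinner_cmul [of "\<lambda>z. 0" g 0] by simp

lemma hinner_zero_right [simp]: "in_H K g \<Longrightarrow> hinner K g (\<lambda>z. 0) = 0"
  using hinner_cmul_right [of g "\<lambda>z. 0" 0] by simp

lemma hinner_diff:
  assumes "in_H K f" "in_H K f'" "in_H K g"
  shows "hinner K (\<lambda>z. f z - f' z) g = hinner K f g - hinner K f' g"
  using hinner_add [OF assms(1) in_H_cmul(1) [OF assms(2), of "-1"] assms(3)] hinner_cmul [OF assms(2,3), of "-1"]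
  by simp

lemma hinner_diff_right:
  assumes "in_H K f" "in_H K g" "in_H K g'"
  shows "hinner K f (\<lambda>z. g z - g' z) = hinner K f g - hinner K f g'"
  using hinner_sym [OF in_H_diff(1) [OF assms(2,3)] assms(1)] hinner_diff [OF assms(2,3,1)]
    hinner_sym [OF assms(2,1)] hinner_sym [OF assms(3,1)] by simp

lemma hinner_sum:
  assumes "\<And>i. i \<in> I \<Longrightarrow> in_H K (f i)" "in_H K g"
  shows "hinner K (\<lambda>z. \<Sum>i\<in>I. f i z) g = (\<Sum>i\<in>I. hinner K (f i) g)"
  using assms(1)
proof (induction I rule: infinite_finite_induct)
  case (insert x I)
  then show ?case using hinner_add [of "f x" "\<lambda>z. \<Sum>i\<in>I. f i z" g] in_H_sum [of I f] assms(2) by simp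
qed (use assms in auto)

lemma hinner_self: assumes f: "in_H K f" shows "hinner K f f = of_real (hnorm2 K f)"
proof -
  obtain m where m: "\<And>n. m n \<in> bpts" "(\<lambda>n. hn K (\<lambda>z. sec (m n) z - f z)) \<longlonglongrightarrow> 0"
    using sec_seq [OF f] by blast
  have 1: "(\<lambda>n. hinner K (sec (m n)) (sec (m n))) \<longlonglongrightarrow> hinner K f f"
    by (intro hinner_tendsto in_H_sec m f)
  have "hinner K (sec (m n)) (sec (m n)) = of_real ((hn K (sec (m n)))\<^sup>2)" for n
    using psd_form_swap [OF psd_K m(1) m(1), of n n] m(1)[of n]
    by (simp add: hinner_sec_sec hn_power2 in_H_sec hnorm2_sec complex_eq_iff)
  moreover have "(\<lambda>n. complex_of_real ((hn K (sec (m n)))\<^sup>2)) \<longlonglongrightarrow> of_real ((hn K f)\<^sup>2)"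
    by (intro tendsto_intros hn_tendsto in_H_sec m f)
  ultimately have "(\<lambda>n. hinner K (sec (m n)) (sec (m n))) \<longlonglongrightarrow> of_real (hnorm2 K f)"
    using hn_power2 [OF f] by simp
  with 1 show ?thesis by (rule LIMSEQ_unique)
qed

lemma hinner_le: assumes f: "in_H K f" and g: "in_H K g"
  shows "cmod (hinner K f g) \<le> hn K f * hn K g"
proof -
  have "(cmod (cnj (hinner K f g)))\<^sup>2 \<le> hnorm2 K f * hnorm2 K g"
  proof (rule quadratic_discriminant_le)
    fix t :: complex
    have "0 \<le> hnorm2 K (\<lambda>z. f z + t * g z)" using f g by (intro hnorm2_nonneg in_H_add in_H_cmul)
    also have "\<dots> = Re (hinner K (\<lambda>z. f z + t * g z) (\<lambda>z. f z + t * g z))"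
      using f g by (subst hinner_self) (auto intro: in_H_add in_H_cmul)
    also have "\<dots> = hnorm2 K f + 2 * Re (t * cnj (hinner K f g)) + (cmod t)\<^sup>2 * hnorm2 K g"
      using f g hinner_sym [OF f g]
      using Re_form_scale(1) [of t "of_real (hnorm2 K g)"]
      by (simp add: hinner_add hinner_cmul hinner_add_right hinner_cmul_right in_H_add in_H_cmul hinner_self
        algebra_simps)
    finally show "0 \<le> hnorm2 K f + 2 * Re (t * cnj (hinner K f g)) + (cmod t)\<^sup>2 * hnorm2 K g" .
  qed (use hnorm2_nonneg g in auto)
  then have "(cmod (hinner K f g))\<^sup>2 \<le> (hn K f * hn K g)\<^sup>2" using hn_power2 f g by (simp add: power_mult_distrib)
  then show ?thesis by (rule power2_le_imp_le) (use hn_nonneg f g in auto)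
qed

end

section \<open>Multipliers\<close>

context rkhs
begin

text \<open>Quantitative version of \<open>is_mult\<close>: the adjoint of multiplication is bounded
  by \<open>C\<close> on the span of the kernel functions. Each instance involves finitely many
  values of \<open>\<phi>\<close> in the ball.\<close>

definition kmult :: "(complex^'d \<Rightarrow> complex) \<Rightarrow> real \<Rightarrow> bool" where
  "kmult \<phi> C \<longleftrightarrow> 0 \<le> C \<and> (\<forall>l\<in>bpts. N (twist \<phi> l) \<le> C\<^sup>2 * N l)"

lemma kmult_nonneg: "kmult \<phi> C \<Longrightarrow> 0 \<le> C"
  by (simp add: kmult_def)

lemma kmultD: "kmult \<phi> C \<Longrightarrow> l \<in> bpts \<Longrightarrow> sqrt (N (twist \<phi> l)) \<le> C * sqrt (N l)"
  using real_sqrt_le_mono [of "N (twist \<phi> l)" "C\<^sup>2 * N l"] by (auto simp: kmult_def real_sqrt_mult)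

lemma kmultI:
  assumes "0 \<le> C" "\<And>l. l \<in> bpts \<Longrightarrow> sqrt (N (twist \<phi> l)) \<le> C * sqrt (N l)"
  shows "kmult \<phi> C"
  unfolding kmult_def
proof (intro conjI ballI)
  fix l :: "(complex \<times> (complex^'d)) list" assume l: "l \<in> bpts"
  have "(sqrt (N (twist \<phi> l)))\<^sup>2 \<le> (C * sqrt (N l))\<^sup>2"
    using l assms(2) N_nonneg by (intro power_mono) auto
  then show "N (twist \<phi> l) \<le> C\<^sup>2 * N l" using N_nonneg l by (simp add: power_mult_distrib)
qed (rule assms)

lemma kmult_H: assumes k: "kmult \<phi> C" and f: "in_H K f"
  shows "in_H K (\<lambda>z. \<phi> z * f z)" and hn_kmult: "hn K (\<lambda>z. \<phi> z * f z) \<le> C * hn K f"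
proof -
  have "cmod (ev l (\<lambda>z. \<phi> z * f z)) \<le> (C * hn K f) * sqrt (N l)" if l: "l \<in> bpts" for l
  proof -
    have "cmod (ev l (\<lambda>z. \<phi> z * f z)) \<le> hn K f * sqrt (N (twist \<phi> l))"
      using ev_le_hn [OF f, of "twist \<phi> l"] l by simp
    also have "\<dots> \<le> hn K f * (C * sqrt (N l))"
      by (intro mult_left_mono kmultD [OF k l] hn_nonneg f)
    finally show ?thesis by (simp add: mult_ac)
  qed
  from hn_leI [OF this] show "in_H K (\<lambda>z. \<phi> z * f z)" "hn K (\<lambda>z. \<phi> z * f z) \<le> C * hn K f"
    using hn_nonneg f kmult_nonneg [OF k] by simp_all
qed

lemma kmult_is_mult: "kmult \<phi> C \<Longrightarrow> is_mult K \<phi>"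
  by (auto simp: is_mult_def intro: kmult_H)

text \<open>Lists that induce the same functional may be exchanged; sums and products of multipliers
  are treated in this way.\<close>

lemma form_ev_cong: "(\<And>g. ev l g = ev l' g) \<Longrightarrow> form P l l = form P l' l'"
  by (simp add: form_def)

lemma sqrt_N_append:
  assumes "l \<in> bpts" "l' \<in> bpts" shows "sqrt (N (l @ l')) \<le> sqrt (N l) + sqrt (N l')"
proof -
  have "sqrt (N (l @ l')) = hn K (\<lambda>z. sec l z + sec l' z)"
    using hnorm2_sec [of "l @ l'"] assms by (simp add: hn_def sec_append)
  also have "\<dots> \<le> hn K (sec l) + hn K (sec l')" using assms by (intro hn_add in_H_sec)
  also have "\<dots> = sqrt (N l) + sqrt (N l')" using assms by (simp add: hn_def hnorm2_sec)
  finally show ?thesis .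
qed

lemma kmult_add: assumes "kmult \<phi> C" "kmult \<psi> D" shows "kmult (\<lambda>z. \<phi> z + \<psi> z) (C + D)"
proof (rule kmultI)
  fix l :: "(complex \<times> (complex^'d)) list" assume l: "l \<in> bpts"
  have "form K (twist (\<lambda>z. \<phi> z + \<psi> z) l) (twist (\<lambda>z. \<phi> z + \<psi> z) l) =
      form K (twist \<phi> l @ twist \<psi> l) (twist \<phi> l @ twist \<psi> l)"
    by (intro form_ev_cong) (simp add: algebra_simps ev_add)
  then have "sqrt (N (twist (\<lambda>z. \<phi> z + \<psi> z) l)) = sqrt (N (twist \<phi> l @ twist \<psi> l))" by simp
  also have "\<dots> \<le> sqrt (N (twist \<phi> l)) + sqrt (N (twist \<psi> l))" using l by (intro sqrt_N_append) auto
  also have "\<dots> \<le> (C + D) * sqrt (N l)" using kmultD [OF assms(1) l] kmultD [OF assms(2) l] by (simp add: algebra_simps)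
  finally show "sqrt (N (twist (\<lambda>z. \<phi> z + \<psi> z) l)) \<le> (C + D) * sqrt (N l)" .
qed (use assms kmult_nonneg in auto)

lemma kmult_mult: assumes "kmult \<phi> C" "kmult \<psi> D" shows "kmult (\<lambda>z. \<phi> z * \<psi> z) (C * D)"
proof (rule kmultI)
  fix l :: "(complex \<times> (complex^'d)) list" assume l: "l \<in> bpts"
  have "form K (twist (\<lambda>z. \<phi> z * \<psi> z) l) (twist (\<lambda>z. \<phi> z * \<psi> z) l) =
      form K (twist \<phi> (twist \<psi> l)) (twist \<phi> (twist \<psi> l))"
    by (intro form_ev_cong) (simp add: mult_ac)
  then have "sqrt (N (twist (\<lambda>z. \<phi> z * \<psi> z) l)) = sqrt (N (twist \<phi> (twist \<psi> l)))" by simp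
  also have "\<dots> \<le> C * sqrt (N (twist \<psi> l))" using l by (intro kmultD assms) auto
  also have "\<dots> \<le> C * (D * sqrt (N l))"
    by (intro mult_left_mono kmultD assms l kmult_nonneg [OF assms(1)])
  finally show "sqrt (N (twist (\<lambda>z. \<phi> z * \<psi> z) l)) \<le> (C * D) * sqrt (N l)" by (simp add: mult_ac)
qed (use assms kmult_nonneg in auto)

lemma kmult_const: "kmult (\<lambda>z. c) (cmod c)"
proof (rule kmultI)
  fix l :: "(complex \<times> (complex^'d)) list" assume l: "l \<in> bpts"
  have "form K (twist (\<lambda>z. c) l) (twist (\<lambda>z. c) l) = form K (smul c l) (smul c l)"
    by (intro form_ev_cong) (simp add: ev_cmul)
  then show "sqrt (N (twist (\<lambda>z. c) l)) \<le> cmod c * sqrt (N l)"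
    using N_smul [of c l] by (simp add: real_sqrt_mult del: form_smul_left form_smul_right)
qed simp

lemma kmult_cmul: "kmult \<phi> C \<Longrightarrow> kmult (\<lambda>z. c * \<phi> z) (cmod c * C)"
  by (intro kmult_mult kmult_const)

lemma kmult_sum:
  "(\<And>i. i \<in> I \<Longrightarrow> kmult (\<phi> i) (C i)) \<Longrightarrow> kmult (\<lambda>z. \<Sum>i\<in>I. \<phi> i z) (\<Sum>i\<in>I. C i)"
proof (induction I rule: infinite_finite_induct)
  case (insert x I)
  then show ?case by (simp add: kmult_add)
qed (use kmult_const [of 0] in simp_all)

lemma kmult_power: "kmult \<phi> C \<Longrightarrow> kmult (\<lambda>z. \<phi> z ^ n) (C ^ n)"
  by (induction n) (use kmult_const [of 1] in \<open>auto intro: kmult_mult\<close>)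

lemma kmult_mono: assumes "kmult \<phi> C" "C \<le> D" shows "kmult \<phi> D"
proof (rule kmultI)
  show "0 \<le> D" using assms kmult_nonneg by fastforce
  fix l :: "(complex \<times> (complex^'d)) list" assume l: "l \<in> bpts"
  show "sqrt (N (twist \<phi> l)) \<le> D * sqrt (N l)"
    using kmultD [OF assms(1) l] mult_right_mono [OF assms(2), of "sqrt (N l)"] N_nonneg [OF l] by simp
qed

text \<open>For a fixed list the defining inequality depends continuously on finitely many values of
  the multiplier.\<close>

lemma kmult_tendsto:
  assumes k: "\<And>n. kmult (\<phi> n) C" and lim: "\<And>z. z \<in> ball 0 1 \<Longrightarrow> (\<lambda>n. \<phi> n z) \<longlonglongrightarrow> \<psi> z"
  shows "kmult \<psi> C"
  unfolding kmult_def
proof (intro conjI ballI)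
  show "0 \<le> C" using kmult_nonneg k by blast
  fix l :: "(complex \<times> (complex^'d)) list" assume l: "l \<in> bpts"
  have "(\<lambda>n. N (twist (\<phi> n) l)) \<longlonglongrightarrow> N (twist \<psi> l)"
    unfolding form_twist using bptsD [OF l] by (intro tendsto_intros form_tendsto lim)
  then show "N (twist \<psi> l) \<le> C\<^sup>2 * N l"
    by (rule LIMSEQ_le_const2) (use k l in \<open>auto simp: kmult_def\<close>)
qed

lemma kmult_cong:
  "kmult \<phi> C \<Longrightarrow> (\<And>z. z \<in> ball 0 1 \<Longrightarrow> \<phi> z = \<psi> z) \<Longrightarrow> kmult \<psi> C"
  by (rule kmult_tendsto [of "\<lambda>n. \<phi>"]) auto

text \<open>The Pick-type criterion: the norm bound is positivity of \<open>C\<^sup>2\<close> minus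
  the rank-one kernel of \<open>\<phi>\<close>, times \<open>K\<close>. Closure properties of
  positive kernels can then be used for multipliers.\<close>

lemma kmult_iff_psd:
  assumes "0 \<le> C"
  shows "kmult \<phi> C \<longleftrightarrow> psd (\<lambda>z w. (of_real (C\<^sup>2) - \<phi> z * cnj (\<phi> w)) * K z w)"
proof -
  have herm: "(of_real (C\<^sup>2) - \<phi> z * cnj (\<phi> w)) * K z w = cnj ((of_real (C\<^sup>2) - \<phi> w * cnj (\<phi> z)) * K w z)"
    if "z \<in> ball 0 1" "w \<in> ball 0 1" for z w
    using psd_herm [OF psd_K that] by (simp add: mult.commute)
  have "form (\<lambda>z w. (of_real (C\<^sup>2) - \<phi> z * cnj (\<phi> w)) * K z w) l l = of_real (C\<^sup>2) * form K l l - form K (twist \<phi> l) (twist \<phi> l)" for l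
    unfolding form_twist by (simp only: left_diff_distrib form_diff form_cmul)
  then have "Re (form (\<lambda>z w. (of_real (C\<^sup>2) - \<phi> z * cnj (\<phi> w)) * K z w) l l) = C\<^sup>2 * N l - N (twist \<phi> l)" for l
    by (simp only: minus_complex.sel Re_complex_of_real times_complex.sel Im_complex_of_real mult_zero_left diff_zero)
  then show ?thesis using assms herm unfolding psd_def kmult_def by simp
qed

lemma kmult_le:
  assumes "kmult \<phi> C" "z \<in> ball 0 1" "0 < Re (K z z)" shows "cmod (\<phi> z) \<le> C"
proof -
  have "N (twist \<phi> [(1, z)]) \<le> C\<^sup>2 * N [(1, z)]" using assms by (auto simp: kmult_def simp del: mem_ball_0)
  moreover have "N (twist \<phi> [(1, z)]) = (cmod (\<phi> z))\<^sup>2 * Re (K z z)"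
    using Re_form_scale(1) [of "\<phi> z" "K z z"] by (simp add: twist_def form_def)
  ultimately have "(cmod (\<phi> z))\<^sup>2 \<le> C\<^sup>2" using assms(3) by (simp add: form_def)
  then show ?thesis using kmult_nonneg [OF assms(1)] by (rule power2_le_imp_le)
qed

text \<open>Bounded pointwise convergence is weak convergence: \<open>g\<close> is replaced by a
  nearby section, on which pairing is evaluation at finitely many points.\<close>

lemma hinner_weak_tendsto:
  assumes f: "\<And>n. in_H K (f n)" "\<And>n. hn K (f n) \<le> B" and f': "in_H K f'" and g: "in_H K g"
    and lim: "\<And>z. z \<in> ball 0 1 \<Longrightarrow> (\<lambda>n. f n z) \<longlonglongrightarrow> f' z"
  shows "(\<lambda>n. hinner K (f n) g) \<longlonglongrightarrow> hinner K f' g"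
proof (rule LIMSEQ_I)
  fix e :: real assume e: "e > 0"
  define M where "M = B + hn K f' + 1"
  have M: "M > 0" using hn_nonneg [OF f(1)[of 0]] f(2)[of 0] hn_nonneg [OF f'] by (simp add: M_def)
  obtain l where l: "\<And>n. l n \<in> bpts" "(\<lambda>n. hn K (\<lambda>z. sec (l n) z - g z)) \<longlonglongrightarrow> 0"
    using sec_seq [OF g] by blast
  have "\<forall>\<^sub>F n in sequentially. hn K (\<lambda>z. sec (l n) z - g z) < e / (2 * M)"
    using order_tendstoD(2) [OF l(2), of "e / (2 * M)"] e M by simp
  then obtain m where m: "m \<in> bpts" "hn K (\<lambda>z. g z - sec m z) < e / (2 * M)"
    using l(1) hn_diff_commute [OF g in_H_sec(1)] unfolding eventually_sequentially by fastforce
  have "(\<lambda>n. ev m (f n)) \<longlonglongrightarrow> ev m f'" using bptsD [OF m(1)] by (intro ev_tendsto lim)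
  then obtain n0 where n0: "\<And>n. n \<ge> n0 \<Longrightarrow> cmod (ev m (f n) - ev m f') < e / 2"
    using LIMSEQ_D [of "\<lambda>n. ev m (f n)" "ev m f'" "e / 2"] e by auto
  show "\<exists>no. \<forall>n\<ge>no. norm (hinner K (f n) g - hinner K f' g) < e"
  proof (intro exI allI impI)
    fix n assume n: "n \<ge> n0"
    have d: "in_H K (\<lambda>z. f n z - f' z)" "in_H K (\<lambda>z. g z - sec m z)" using f(1) f' g m by (auto intro!: in_H_diff in_H_sec)
    have "hinner K (f n) g - hinner K f' g = hinner K (\<lambda>z. f n z - f' z) g"
      by (simp add: hinner_diff f f' g)
    also have "\<dots> = hinner K (\<lambda>z. f n z - f' z) (\<lambda>z. g z - sec m z) + ev m (\<lambda>z. f n z - f' z)"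
      using hinner_diff_right [OF d(1) g in_H_sec(1) [OF m(1)]] hinner_sec [OF d(1) m(1)] by simp
    finally have "cmod (hinner K (f n) g - hinner K f' g) \<le>
        cmod (hinner K (\<lambda>z. f n z - f' z) (\<lambda>z. g z - sec m z)) + cmod (ev m (f n) - ev m f')"
      by (simp add: norm_triangle_ineq ev_diff)
    also have "cmod (hinner K (\<lambda>z. f n z - f' z) (\<lambda>z. g z - sec m z)) \<le> hn K (\<lambda>z. f n z - f' z) * hn K (\<lambda>z. g z - sec m z)"
      by (rule hinner_le [OF d])
    also have "\<dots> \<le> M * (e / (2 * M))"
      using hn_diff [OF f(1) f', of n] f(2)[of n] m(2) M hn_nonneg d by (intro mult_mono) (auto simp: M_def)
    also have "\<dots> = e / 2" using M by simp
    finally show "norm (hinner K (f n) g - hinner K f' g) < e" using n0 [OF n] by simp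
  qed
qed

text \<open>Termwise weak convergence plus dominated convergence for series; the majorant comes from
  bounding a product of norms by the sum of their squares.\<close>

lemma sw_functional_tendsto:
  assumes adm: "admissible_pair K F G" and k: "\<And>n. kmult (\<phi> n) C"
    and lim: "\<And>z. z \<in> ball 0 1 \<Longrightarrow> (\<lambda>n. \<phi> n z) \<longlonglongrightarrow> \<psi> z"
  shows "(\<lambda>n. sw_functional K F G (\<phi> n)) \<longlonglongrightarrow> sw_functional K F G \<psi>"
proof -
  have H: "in_H K (F j)" "in_H K (G j)" for j using adm by (auto simp: admissible_pair_def)
  have sum: "summable (\<lambda>n. hnorm2 K (F n))" "summable (\<lambda>n. hnorm2 K (G n))"
    using adm by (auto simp: admissible_pair_def)
  have k': "kmult \<psi> C" by (rule kmult_tendsto [OF k lim])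
  let ?a = "\<lambda>j n. hinner K (\<lambda>z. \<phi> n z * F j z) (G j)"
  let ?M = "\<lambda>j. C * (hnorm2 K (F j) + hnorm2 K (G j))"
  have b: "cmod (?a j n) \<le> ?M j" for j n
  proof -
    have "cmod (?a j n) \<le> hn K (\<lambda>z. \<phi> n z * F j z) * hn K (G j)" by (intro hinner_le kmult_H [OF k] H)
    also have "\<dots> \<le> (C * hn K (F j)) * hn K (G j)" by (intro mult_right_mono hn_kmult k H hn_nonneg)
    also have "\<dots> = C * (hn K (F j) * hn K (G j))" by simp
    also have "\<dots> \<le> C * ((hn K (F j))\<^sup>2 + (hn K (G j))\<^sup>2)"
    proof (intro mult_left_mono kmult_nonneg [OF k])
      show "hn K (F j) * hn K (G j) \<le> (hn K (F j))\<^sup>2 + (hn K (G j))\<^sup>2"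
        using sum_squares_bound [of "hn K (F j)" "hn K (G j)"] hn_nonneg [OF H(1)] hn_nonneg [OF H(2)]
          mult_nonneg_nonneg [OF hn_nonneg [OF H(1) [of j]] hn_nonneg [OF H(2) [of j]]] by linarith
    qed
    finally show ?thesis using hn_power2 H by simp
  qed
  have "((\<lambda>n. \<Sum>j. ?a j n) \<longlongrightarrow> (\<Sum>j. hinner K (\<lambda>z. \<psi> z * F j z) (G j))) sequentially"
  proof (rule tannerys_theorem [THEN conjunct2, THEN conjunct2])
    show "(\<lambda>n. ?a j n) \<longlonglongrightarrow> hinner K (\<lambda>z. \<psi> z * F j z) (G j)" for j
      by (rule hinner_weak_tendsto [where B = "C * hn K (F j)"])
         (auto intro!: kmult_H [OF k] kmult_H [OF k'] hn_kmult H k tendsto_intros lim)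
    show "\<forall>\<^sub>F (j, n) in sequentially \<times>\<^sub>F sequentially. cmod (?a j n) \<le> ?M j"
      using b by (intro always_eventually) auto
    show "summable ?M" by (intro summable_mult summable_add sum)
  qed auto
  then show ?thesis by (simp add: sw_functional_def)
qed

text \<open>The only way in which weak-* continuity is exploited. Induction on the generation of an
  open set reduces convergence to that of the individual functionals
  \<open>sw_functional\<close>.\<close>

lemma wstar_cont_tendsto:
  assumes L: "wstar_cont_functional K L" and k: "\<And>n. kmult (\<phi> n) C"
    and lim: "\<And>z. z \<in> ball 0 1 \<Longrightarrow> (\<lambda>n. \<phi> n z) \<longlonglongrightarrow> \<psi> z"
  shows "(\<lambda>n. L (\<phi> n)) \<longlonglongrightarrow> L \<psi>"
proof (rule topological_tendstoI)
  fix V assume V: "open V" "L \<psi> \<in> V"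
  let ?S = "{{\<phi>. sw_functional K F G \<phi> \<in> U} | F G U. admissible_pair K F G \<and> open U}"
  \<comment> \<open>One admissible pair is enough for the generating sets to cover all functions, so
    the topological space consists of all multipliers.\<close>
  have adm0: "admissible_pair K (\<lambda>n z. 0) (\<lambda>n z. 0)" by (simp add: admissible_pair_def)
  have top: "topspace (wstar_top K) = {\<phi>. is_mult K \<phi>}"
  proof -
    have "\<Union>?S = UNIV" using adm0 by (fastforce intro: exI [of _ UNIV])
    then show ?thesis by (simp add: wstar_top_def)
  qed
  have "continuous_map (wstar_top K) euclidean L" using L by (simp add: wstar_cont_functional_def)
  then have "openin (wstar_top K) {x \<in> topspace (wstar_top K). L x \<in> V}"
    using V by (simp add: continuous_map_def)
  then obtain W where W: "generate_topology_on ?S W" "{x \<in> topspace (wstar_top K). L x \<in> V} = W \<inter> {\<phi>. is_mult K \<phi>}"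
    unfolding wstar_top_def openin_subtopology openin_topology_generated_by_iff by blast
  have "\<psi> \<in> W \<Longrightarrow> \<forall>\<^sub>F n in sequentially. \<phi> n \<in> W"
    using W(1)
  proof induction
    case (Int a b) then show ?case by (auto intro: eventually_conj)
  next
    case (UN KK)
    then obtain k where "k \<in> KK" "\<psi> \<in> k" by blast
    with UN have "\<forall>\<^sub>F n in sequentially. \<phi> n \<in> k" by blast
    then show ?case by (rule eventually_mono) (use \<open>k \<in> KK\<close> in blast)
  next
    case (Basis s)
    then obtain F G U where s: "s = {\<phi>. sw_functional K F G \<phi> \<in> U}" "admissible_pair K F G" "open U" by blast
    then show ?case using Basis(2) topological_tendstoD [OF sw_functional_tendsto [OF s(2) k lim] s(3)] by simp
  qed simp
  moreover have "\<psi> \<in> W" using W(2) V(2) top kmult_is_mult [OF kmult_tendsto [OF k lim]] by blast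
  ultimately have "\<forall>\<^sub>F n in sequentially. \<phi> n \<in> W" by blast
  then show "\<forall>\<^sub>F n in sequentially. L (\<phi> n) \<in> V"
    by (rule eventually_mono) (use W(2) kmult_is_mult [OF k] in blast)
qed

end

section \<open>Complete Pick kernels\<close>

lemma cinner_simps [simp]:
  "cinner (z + z') w = cinner z w + cinner z' w" "cinner z (w + w') = cinner z w + cinner z w'"
  "cinner (c *s z) w = c * cinner z w" "cinner z (c *s w) = cnj c * cinner z w"
  "cinner 0 w = 0" "cinner z 0 = 0"
  by (simp_all add: cinner_def sum.distrib algebra_simps sum_distrib_left)

lemma cinner_le: "cmod (cinner z w) \<le> norm z * norm w"
proof -
  have "cmod (cinner z w) \<le> (\<Sum>i\<in>UNIV. \<bar>norm (z $ i)\<bar> * \<bar>norm (w $ i)\<bar>)"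
    unfolding cinner_def by (rule order_trans [OF norm_sum]) (simp add: norm_mult)
  also have "\<dots> \<le> norm z * norm w" unfolding norm_vec_def by (rule L2_set_mult_ineq)
  finally show ?thesis .
qed

lemma cinner_self: "cinner z z = of_real ((norm z)\<^sup>2)"
  by (simp add: cinner_def norm_vec_def L2_set_def sum_nonneg complex_norm_square [symmetric] del: of_real_power)

lemma norm_cscale [simp]: "norm (c *s (z :: complex^'d)) = cmod c * norm z"
  by (simp add: norm_vec_def norm_mult L2_set_right_distrib)

lemma scaleR_eq_cscale: "r *\<^sub>R (z :: complex^'d) = of_real r *s z"
  unfolding vec_eq_iff vector_scaleR_component vector_smult_component by (simp add: scaleR_conv_of_real)

lemma cinner_ball: "z \<in> ball 0 1 \<Longrightarrow> w \<in> ball 0 1 \<Longrightarrow> cmod (cinner z w) < 1"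
  using cinner_le [of z w] mult_strict_mono' [of "norm z" 1 "norm w" 1] by simp

section \<open>Operations that preserve positivity of kernels\<close>

lemma psd_cong:
  assumes "psd P" "\<And>z w. z \<in> ball 0 1 \<Longrightarrow> w \<in> ball 0 1 \<Longrightarrow> P z w = Q z w"
  shows "psd Q"
proof -
  have "form Q l l = form P l l" if "l \<in> bpts" for l
    using bptsD [OF that] assms(2) by (intro form_cong) auto
  then show ?thesis using assms unfolding psd_def by metis
qed

lemma psdI:
  assumes "\<And>z w. z \<in> ball 0 1 \<Longrightarrow> w \<in> ball 0 1 \<Longrightarrow> P z w = cnj (P w z)"
    "\<And>l. l \<in> bpts \<Longrightarrow> 0 \<le> Re (form P l l)"
  shows "psd P"
  using assms unfolding psd_def by blast

lemma psd_add: assumes "psd P" "psd Q" shows "psd (\<lambda>z w. P z w + Q z w)"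
proof (rule psdI)
  show "P z w + Q z w = cnj (P w z + Q w z)" if "z \<in> ball 0 1" "w \<in> ball 0 1" for z w
    using psd_herm [OF assms(1) that] psd_herm [OF assms(2) that] by simp
qed (simp add: form_add psd_nonneg assms)

lemma psd_zero [simp]: "psd (\<lambda>z w. 0)"
  by (rule psdI) (simp_all add: form_def)

lemma psd_sum: "(\<And>i. i \<in> I \<Longrightarrow> psd (P i)) \<Longrightarrow> psd (\<lambda>z w. \<Sum>i\<in>I. P i z w)"
  by (induction I rule: infinite_finite_induct) (simp_all add: psd_add)

lemma psd_cmul: assumes "psd P" "0 \<le> c" shows "psd (\<lambda>z w. of_real c * P z w)"
proof (rule psdI)
  show "of_real c * P z w = cnj (of_real c * P w z)" if "z \<in> ball 0 1" "w \<in> ball 0 1" for z w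
    using psd_herm [OF assms(1) that] by simp
qed (simp add: form_cmul psd_nonneg assms)

lemma psd_twist: assumes "psd P" shows "psd (\<lambda>z w. f z * cnj (f w) * P z w)"
proof (rule psdI)
  show "f z * cnj (f w) * P z w = cnj (f w * cnj (f z) * P w z)" if "z \<in> ball 0 1" "w \<in> ball 0 1" for z w
    using psd_herm [OF assms(1) that] by simp
qed (simp add: form_twist [symmetric] psd_nonneg assms)

lemma psd_rank_one: "psd (\<lambda>z w. f z * cnj (f w))"
  by (rule psdI) (simp_all add: form_rank_one)

lemma psd_one: "psd (\<lambda>z w. 1)"
  using psd_rank_one [of "\<lambda>z. 1"] by simp

lemma psd_tendsto:
  fixes Q :: "complex^'d \<Rightarrow> complex^'d \<Rightarrow> complex"
  assumes "\<And>n. psd (P n)" "\<And>z w. z \<in> ball 0 1 \<Longrightarrow> w \<in> ball 0 1 \<Longrightarrow> (\<lambda>n. P n z w) \<longlonglongrightarrow> Q z w"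
  shows "psd Q"
proof (rule psdI)
  fix z w :: "complex^'d" assume zw: "z \<in> ball 0 1" "w \<in> ball 0 1"
  have "(\<lambda>n. P n z w) \<longlonglongrightarrow> cnj (Q w z)"
    using tendsto_cnj [OF assms(2) [OF zw(2,1)]] psd_herm [OF assms(1) zw] by simp
  then show "Q z w = cnj (Q w z)" using assms(2) [OF zw] LIMSEQ_unique by blast
next
  fix l :: "(complex \<times> (complex^'d)) list" assume l: "l \<in> bpts"
  have "(\<lambda>n. Re (form (P n) l l)) \<longlonglongrightarrow> Re (form Q l l)"
    using bptsD [OF l] by (intro tendsto_intros form_tendsto assms(2))
  then show "0 \<le> Re (form Q l l)"
    by (rule LIMSEQ_le_const) (use psd_nonneg assms(1) l in blast)
qed

text \<open>\<open>cinner\<close> is a finite sum of rank-one kernels, and multiplying by such a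
  kernel is a twist. Together with limits this replaces the general Schur product theorem for power
  series in \<open>cinner\<close>.\<close>

lemma psd_cinner_mult: assumes "psd P" shows "psd (\<lambda>z w. cinner z w * P z w)"
  unfolding cinner_def sum_distrib_right using assms by (intro psd_sum psd_twist)

lemma psd_cinner_power: "psd P \<Longrightarrow> psd (\<lambda>z w. cinner z w ^ n * P z w)"
  by (induction n) (auto dest: psd_cinner_mult simp: mult.assoc)

lemma psd_series:
  assumes P: "psd P" and c: "\<And>n. 0 \<le> c n"
    and s: "\<And>z w. z \<in> ball 0 1 \<Longrightarrow> w \<in> ball 0 1 \<Longrightarrow> (\<lambda>n. of_real (c n) * cinner z w ^ n) sums S z w"
  shows "psd (\<lambda>z w. S z w * P z w)"
proof (rule psd_tendsto)
  show "psd (\<lambda>z w. \<Sum>n<k. of_real (c n) * (cinner z w ^ n * P z w))" for k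
    using P c by (intro psd_sum psd_cmul psd_cinner_power)
  show "(\<lambda>k. \<Sum>n<k. of_real (c n) * (cinner z w ^ n * P z w)) \<longlonglongrightarrow> S z w * P z w"
    if "z \<in> ball 0 1" "w \<in> ball 0 1" for z w
    using sums_mult2 [OF s [OF that], of "P z w"] by (simp add: sums_def mult.assoc)
qed

lemma psd_dilate:
  fixes P :: "complex^'d \<Rightarrow> complex^'d \<Rightarrow> complex"
  assumes P: "psd P" and c: "cmod c \<le> 1"
  shows "psd (\<lambda>z w. P (c *s z) (c *s w))"
proof -
  have cb: "c *s z \<in> ball 0 1" if "z \<in> ball 0 1" for z :: "complex^'d"
    using that c mult_mono [of "cmod c" 1 "norm z" "norm z"] by auto
  define m where "m = (map (\<lambda>(d, z). (d, c *s z)) :: (complex \<times> (complex^'d)) list \<Rightarrow> _)"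
  have ev: "ev l (\<lambda>z. f (c *s z)) = ev (m l) f" for l f
    by (induction l) (auto simp: m_def)
  have mb: "m l \<in> bpts" if "l \<in> bpts" for l using that cb unfolding bpts_def m_def by fastforce
  have "form (\<lambda>z w. P (c *s z) (c *s w)) l l = form P (m l) (m l)" for l
    unfolding form_def by (simp add: ev [symmetric])
  then show ?thesis using mb cb by (intro psdI) (simp_all only: psd_herm [OF P, symmetric] psd_nonneg [OF P])
qed

text \<open>The Cauchy--Schwarz inequality of \<open>D\<close> between an arbitrary list and the
  single point \<open>w\<close>, read as positivity of a kernel.\<close>

lemma psd_Schur_complement:
  fixes D :: "complex^'d \<Rightarrow> complex^'d \<Rightarrow> complex"
  assumes D: "psd D" and w: "w \<in> ball 0 1"
  shows "psd (\<lambda>z z'. D w w * D z z' - D z w * cnj (D z' w))"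
proof (rule psdI)
  have r: "D w w = of_real (Re (D w w))" using psd_herm [OF D w w] by (simp add: complex_eq_iff)
  fix l :: "(complex \<times> (complex^'d)) list" assume l: "l \<in> bpts"
  have "form (\<lambda>z z'. D w w * D z z' - D z w * cnj (D z' w)) l l
      = of_real (Re (D w w)) * form D l l - form D l [(1, w)] * cnj (form D l [(1, w)])"
    unfolding form_diff form_cmul form_rank_one using r by (simp add: form_def)
  also have "form D l [(1, w)] * cnj (form D l [(1, w)]) = of_real ((cmod (form D l [(1, w)]))\<^sup>2)"
    by (rule complex_norm_square [symmetric])
  finally have "Re (form (\<lambda>z z'. D w w * D z z' - D z w * cnj (D z' w)) l l)
      = Re (D w w) * Re (form D l l) - (cmod (form D l [(1, w)]))\<^sup>2" by simp
  moreover have "(cmod (form D l [(1, w)]))\<^sup>2 \<le> Re (form D l l) * Re (form D [(1, w)] [(1, w)])"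
    by (rule psd_Cauchy_Schwarz [OF D l]) (use w in simp)
  moreover have "form D [(1, w)] [(1, w)] = D w w" by (simp add: form_def)
  ultimately show "0 \<le> Re (form (\<lambda>z z'. D w w * D z z' - D z w * cnj (D z' w)) l l)" by (simp add: mult.commute)
next
  fix z z' :: "complex^'d" assume zz: "z \<in> ball 0 1" "z' \<in> ball 0 1"
  show "D w w * D z z' - D z w * cnj (D z' w) = cnj (D w w * D z' z - D z' w * cnj (D z w))"
    using psd_herm [OF D w w] psd_herm [OF D zz] by simp
qed

section \<open>Algebra of polynomials\<close>

lemma is_polyI: "finite A \<Longrightarrow> p = (\<lambda>z. \<Sum>\<alpha>\<in>A. c \<alpha> * (\<Prod>i\<in>UNIV. (z $ i) ^ (\<alpha> i))) \<Longrightarrow> is_poly p"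
  unfolding is_poly_def by blast

lemma is_poly_zero: "is_poly (\<lambda>z. 0)"
  by (rule is_polyI [of "{}" _ "\<lambda>_. 0"]) auto

lemma is_poly_const: "is_poly (\<lambda>z. c)"
  by (rule is_polyI [of "{\<lambda>_. 0}" _ "\<lambda>_. c"]) auto

lemma is_poly_coord: "is_poly (\<lambda>z :: complex^'d. z $ j)"
proof -
  have "(\<Prod>i\<in>UNIV. (z $ i) ^ (if i = j then 1 else 0)) = z $ j" for z :: "complex^'d"
  proof -
    have "(\<Prod>i\<in>UNIV. (z $ i) ^ (if i = j then 1 else 0)) = (\<Prod>i\<in>UNIV. if i = j then z $ i else 1)"
      by (rule prod.cong) auto
    then show ?thesis by simp
  qed
  then show ?thesis by (intro is_polyI [of "{\<lambda>i. if i = j then 1 else 0}" _ "\<lambda>_. 1"]) auto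
qed

lemma is_poly_add: assumes "is_poly p" "is_poly q" shows "is_poly (\<lambda>z. p z + q z)"
proof -
  obtain A c where A: "finite A" "p = (\<lambda>z. \<Sum>\<alpha>\<in>A. c \<alpha> * (\<Prod>i\<in>UNIV. (z $ i) ^ (\<alpha> i)))"
    using assms(1) unfolding is_poly_def by blast
  obtain B d where B: "finite B" "q = (\<lambda>z. \<Sum>\<alpha>\<in>B. d \<alpha> * (\<Prod>i\<in>UNIV. (z $ i) ^ (\<alpha> i)))"
    using assms(2) unfolding is_poly_def by blast
  let ?m = "\<lambda>z (\<alpha> :: 'a \<Rightarrow> nat). \<Prod>i\<in>UNIV. ((z :: complex^'a) $ i) ^ (\<alpha> i)"
  have "p z = (\<Sum>\<alpha>\<in>A \<union> B. (if \<alpha> \<in> A then c \<alpha> else 0) * ?m z \<alpha>)" for z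
    unfolding A(2) using A(1) B(1) by (intro sum.mono_neutral_cong_left) auto
  moreover have "q z = (\<Sum>\<alpha>\<in>A \<union> B. (if \<alpha> \<in> B then d \<alpha> else 0) * ?m z \<alpha>)" for z
    unfolding B(2) using A(1) B(1) by (intro sum.mono_neutral_cong_left) auto
  ultimately show ?thesis
    by (intro is_polyI [of "A \<union> B" _ "\<lambda>\<alpha>. (if \<alpha> \<in> A then c \<alpha> else 0) + (if \<alpha> \<in> B then d \<alpha> else 0)"])
       (use A(1) B(1) in \<open>auto simp: fun_eq_iff sum.distrib distrib_right\<close>)
qed

lemma is_poly_mult: assumes "is_poly p" "is_poly q" shows "is_poly (\<lambda>z. p z * q z)"
proof -
  obtain A c where A: "finite A" "p = (\<lambda>z. \<Sum>\<alpha>\<in>A. c \<alpha> * (\<Prod>i\<in>UNIV. (z $ i) ^ (\<alpha> i)))"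
    using assms(1) unfolding is_poly_def by blast
  obtain B d where B: "finite B" "q = (\<lambda>z. \<Sum>\<alpha>\<in>B. d \<alpha> * (\<Prod>i\<in>UNIV. (z $ i) ^ (\<alpha> i)))"
    using assms(2) unfolding is_poly_def by blast
  let ?m = "\<lambda>z (\<alpha> :: 'a \<Rightarrow> nat). \<Prod>i\<in>UNIV. ((z :: complex^'a) $ i) ^ (\<alpha> i)"
  \<comment> \<open>Different pairs of exponents may have the same sum, so coefficients are
    collected over the fibres of \<open>h\<close>.\<close>
  define h :: "('a \<Rightarrow> nat) \<times> ('a \<Rightarrow> nat) \<Rightarrow> 'a \<Rightarrow> nat" where "h = (\<lambda>(\<alpha>, \<beta>) i. \<alpha> i + \<beta> i)"
  define e where "e = (\<lambda>\<gamma>. \<Sum>x\<in>{x \<in> A \<times> B. h x = \<gamma>}. c (fst x) * d (snd x))"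
  have "p z * q z = (\<Sum>\<gamma>\<in>h ` (A \<times> B). e \<gamma> * ?m z \<gamma>)" for z
  proof -
    have "p z * q z = (\<Sum>x\<in>A \<times> B. (c (fst x) * d (snd x)) * ?m z (h x))"
      by (simp add: A B sum_product sum.cartesian_product h_def case_prod_beta power_add prod.distrib mult_ac)
    also have "\<dots> = (\<Sum>\<gamma>\<in>h ` (A \<times> B). \<Sum>x\<in>{x \<in> A \<times> B. h x = \<gamma>}. (c (fst x) * d (snd x)) * ?m z (h x))"
      using A(1) B(1) by (intro sum.image_gen) auto
    also have "\<dots> = (\<Sum>\<gamma>\<in>h ` (A \<times> B). e \<gamma> * ?m z \<gamma>)"
      by (intro sum.cong refl) (simp add: e_def sum_distrib_right)
    finally show ?thesis .
  qed
  then show ?thesis using A(1) B(1) by (intro is_polyI [of "h ` (A \<times> B)" _ e]) auto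
qed

lemma is_poly_sum: "(\<And>i. i \<in> I \<Longrightarrow> is_poly (p i)) \<Longrightarrow> is_poly (\<lambda>z. \<Sum>i\<in>I. p i z)"
  by (induction I rule: infinite_finite_induct) (auto intro: is_poly_add is_poly_zero)

lemma is_poly_cmul: "is_poly p \<Longrightarrow> is_poly (\<lambda>z. c * p z)"
  by (rule is_poly_mult [OF is_poly_const])

lemma is_poly_diff: "is_poly p \<Longrightarrow> is_poly q \<Longrightarrow> is_poly (\<lambda>z. p z - q z)"
  using is_poly_add [OF _ is_poly_cmul [of q "-1"]] by simp

lemma is_poly_continuous: assumes "is_poly p" shows "continuous_on S p"
proof -
  obtain A c where A: "finite A" "p = (\<lambda>z. \<Sum>\<alpha>\<in>A. c \<alpha> * (\<Prod>i\<in>UNIV. (z $ i) ^ (\<alpha> i)))"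
    using assms(1) unfolding is_poly_def by blast
  then show ?thesis by (auto intro!: continuous_intros)
qed

section \<open>Pick kernels and their elementary multipliers\<close>

locale pick_space =
  fixes a :: "nat \<Rightarrow> real" and K :: "complex^'d \<Rightarrow> complex^'d \<Rightarrow> complex"
  assumes regular: "regular_ui a" and pick: "complete_pick a" and K_eq: "K = ui_kernel a"
begin

definition b :: "nat \<Rightarrow> real" where "b n = fps_nth (1 - inverse (Abs_fps a)) n"

definition kf :: "complex \<Rightarrow> complex" where "kf t = (\<Sum>n. of_real (a n) * t ^ n)"
definition bf :: "complex \<Rightarrow> complex" where "bf t = (\<Sum>n. of_real (b n) * t ^ n)"
definition B :: "complex^'d \<Rightarrow> complex^'d \<Rightarrow> complex" where "B z w = bf (cinner z w)"

lemma a_0: "a 0 = 1" and a_pos: "0 < a n" and a_lim: "(\<lambda>n. a n / a (Suc n)) \<longlonglongrightarrow> 1"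
  using regular by (auto simp: regular_ui_def)

lemma b_0: "b 0 = 0"
  by (simp add: b_def a_0)

lemma b_nonneg: "0 \<le> b n"
  using pick b_0 unfolding complete_pick_def b_def [symmetric] by (cases n) auto

lemma a_eq_conv: "a n = (if n = 0 then 1 else 0) + (\<Sum>i\<le>n. b i * a (n - i))"
proof -
  have "inverse (Abs_fps a) * Abs_fps a = 1" by (rule inverse_mult_eq_1) (simp add: a_0)
  then have "Abs_fps a = 1 + (1 - inverse (Abs_fps a)) * Abs_fps a" by (simp add: algebra_simps)
  then have "fps_nth (Abs_fps a) n = fps_nth (1 + (1 - inverse (Abs_fps a)) * Abs_fps a) n" by simp
  then show ?thesis unfolding fps_add_nth fps_mult_nth b_def [symmetric]
    by (simp add: atLeast0AtMost)
qed

text \<open>Keep only the last summand of the convolution, where \<open>a 0 = 1\<close>. This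
  transfers absolute convergence from the series of \<open>K\<close> to that of
  \<open>B\<close>.\<close>

lemma b_le_a: "b n \<le> a n"
proof -
  have "b n * a (n - n) \<le> (\<Sum>i\<le>n. b i * a (n - i))"
    by (rule member_le_sum) (auto simp: b_nonneg less_imp_le a_pos)
  then show ?thesis using a_eq_conv [of n] a_0 by (auto split: if_splits)
qed

lemma b_1: "b 1 = a 1"
  using a_eq_conv [of 1] by (simp add: b_0 a_0)

text \<open>The degree-one part of \<open>B z w\<close> is \<open>b 1 * cinner z w\<close>; hence
  \<open>\<kappa> * z $ i\<close> are the degree-one components of a feature map of
  \<open>B\<close>.\<close>

definition \<kappa> :: real where "\<kappa> = sqrt (b 1)"

lemma kappa_pos: "0 < \<kappa>" and kappa_power2: "\<kappa>\<^sup>2 = b 1"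
  using a_pos [of 1] unfolding \<kappa>_def b_1 by simp_all

lemma summable_a: assumes "cmod t < 1" shows "summable (\<lambda>n. norm (of_real (a n) * t ^ n))"
proof -
  have "(\<lambda>n. inverse (a n / a (Suc n)) * cmod t) \<longlonglongrightarrow> inverse 1 * cmod t"
    by (intro tendsto_intros a_lim) auto
  then have lim: "(\<lambda>n. inverse (a n / a (Suc n)) * cmod t) \<longlonglongrightarrow> cmod t" by simp
  have "cmod t < (1 + cmod t) / 2" using assms by simp
  from order_tendstoD(2) [OF lim this] obtain n0 where
    n0: "\<And>n. n \<ge> n0 \<Longrightarrow> inverse (a n / a (Suc n)) * cmod t < (1 + cmod t) / 2"
    by (auto simp: eventually_sequentially)
  show ?thesis
  proof (rule summable_ratio_test [where c = "(1 + cmod t) / 2" and N = n0])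
    show "(1 + cmod t) / 2 < 1" using assms by simp
    fix n assume "n0 \<le> n"
    from n0 [OF this] have "a (Suc n) * cmod t \<le> (1 + cmod t) / 2 * a n"
      using a_pos [of n] a_pos [of "Suc n"] by (simp add: field_simps)
    then have "(a (Suc n) * cmod t) * cmod t ^ n \<le> ((1 + cmod t) / 2 * a n) * cmod t ^ n"
      by (rule mult_right_mono) simp
    then show "norm (norm (of_real (a (Suc n)) * t ^ Suc n)) \<le> (1 + cmod t) / 2 * norm (norm (of_real (a n) * t ^ n))"
      using a_pos [of n] a_pos [of "Suc n"] by (simp add: norm_mult norm_power abs_mult mult_ac)
  qed
qed

lemma summable_b: assumes "cmod t < 1" shows "summable (\<lambda>n. norm (of_real (b n) * t ^ n))"
  by (rule summable_comparison_test' [OF summable_a [OF assms]])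
     (auto simp: norm_mult norm_power b_nonneg a_pos less_imp_le b_le_a intro: mult_right_mono)

lemma kf_sums: "cmod t < 1 \<Longrightarrow> (\<lambda>n. of_real (a n) * t ^ n) sums kf t"
  unfolding kf_def by (rule summable_sums [OF summable_norm_cancel [OF summable_a]])

lemma bf_sums: "cmod t < 1 \<Longrightarrow> (\<lambda>n. of_real (b n) * t ^ n) sums bf t"
  unfolding bf_def by (rule summable_sums [OF summable_norm_cancel [OF summable_b]])

lemma bf_kf: assumes "cmod t < 1" shows "(1 - bf t) * kf t = 1"
proof -
  have "(\<lambda>n. \<Sum>i\<le>n. (of_real (b i) * t ^ i) * (of_real (a (n - i)) * t ^ (n - i))) sums (bf t * kf t)"
    unfolding bf_def kf_def by (rule Cauchy_product_sums [OF summable_b [OF assms] summable_a [OF assms]])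
  moreover have "(\<Sum>i\<le>n. (of_real (b i) * t ^ i) * (of_real (a (n - i)) * t ^ (n - i))) =
      of_real (a n) * t ^ n - (if n = 0 then 1 else 0)" for n
  proof -
    have "(\<Sum>i\<le>n. (of_real (b i) * t ^ i) * (of_real (a (n - i)) * t ^ (n - i))) =
        (\<Sum>i\<le>n. of_real (b i * a (n - i)) * t ^ n)"
    proof (rule sum.cong)
      fix i assume "i \<in> {..n}"
      then have "t ^ n = t ^ i * t ^ (n - i)" by (simp flip: power_add)
      then show "(of_real (b i) * t ^ i) * (of_real (a (n - i)) * t ^ (n - i)) = of_real (b i * a (n - i)) * t ^ n"
        by simp
    qed simp
    also have "\<dots> = of_real (\<Sum>i\<le>n. b i * a (n - i)) * t ^ n" by (simp add: sum_distrib_right)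
    also have "(\<Sum>i\<le>n. b i * a (n - i)) = a n - (if n = 0 then 1 else 0)" using a_eq_conv [of n] by simp
    finally show ?thesis by (cases "n = 0") (simp_all add: algebra_simps)
  qed
  ultimately have "(\<lambda>n. of_real (a n) * t ^ n - (if n = 0 then 1 else 0)) sums (bf t * kf t)" by simp
  moreover have "(\<lambda>n. of_real (a n) * t ^ n - (if n = 0 then 1 else 0)) sums (kf t - 1)"
    using sums_diff [OF kf_sums [OF assms] sums_single [of 0 "\<lambda>_. 1 :: complex"]] by (simp add: eq_commute)
  ultimately have "bf t * kf t = kf t - 1" by (rule sums_unique2)
  then show ?thesis by (simp add: algebra_simps)
qed

lemma K_kf: "K z w = kf (cinner z w)"
  by (simp add: K_eq ui_kernel_def kf_def)

lemma K_sums: "z \<in> ball 0 1 \<Longrightarrow> w \<in> ball 0 1 \<Longrightarrow> (\<lambda>n. of_real (a n) * cinner z w ^ n) sums K z w"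
  unfolding K_kf by (rule kf_sums [OF cinner_ball])

lemma B_sums: "z \<in> ball 0 1 \<Longrightarrow> w \<in> ball 0 1 \<Longrightarrow> (\<lambda>n. of_real (b n) * cinner z w ^ n) sums B z w"
  unfolding B_def by (rule bf_sums [OF cinner_ball])

lemma B_K: "z \<in> ball 0 1 \<Longrightarrow> w \<in> ball 0 1 \<Longrightarrow> (1 - B z w) * K z w = 1"
  unfolding B_def K_kf by (rule bf_kf [OF cinner_ball])

lemma B_mult_K: "z \<in> ball 0 1 \<Longrightarrow> w \<in> ball 0 1 \<Longrightarrow> B z w * K z w = K z w - 1"
  using B_K [of z w] by (simp add: algebra_simps)

lemma psd_K_mult: "psd P \<Longrightarrow> psd (\<lambda>z w. K z w * P z w)"
  by (rule psd_series [OF _ _ K_sums]) (auto intro: less_imp_le a_pos)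

lemma psd_B_mult: "psd P \<Longrightarrow> psd (\<lambda>z w. B z w * P z w)"
  by (rule psd_series [OF _ _ B_sums]) (auto intro: b_nonneg)

lemma psd_kernel: "psd K"
  using psd_K_mult [OF psd_one] by simp

lemma psd_B: "psd B"
  using psd_B_mult [OF psd_one] by simp

lemma K_0 [simp]: "K z 0 = 1" "K 0 z = 1"
  by (simp_all add: K_kf kf_def powser_zero a_0)

sublocale rkhs K
  by unfold_locales (simp_all add: psd_kernel)

lemma K_real: "z \<in> ball 0 1 \<Longrightarrow> K z z = of_real (Re (K z z))"
  using psd_herm [OF psd_kernel, of z z] by (simp add: complex_eq_iff)

lemma B_real: "z \<in> ball 0 1 \<Longrightarrow> B z z = of_real (Re (B z z))"
  using psd_herm [OF psd_B, of z z] by (simp add: complex_eq_iff)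

lemma K_ge_1: assumes z: "z \<in> ball 0 1" shows "1 \<le> Re (K z z)"
proof -
  have "(\<lambda>n. of_real (a n) * (of_real ((norm z)\<^sup>2)) ^ n) sums K z z" using K_sums [OF z z] by (simp add: cinner_self)
  then have "(\<lambda>n. Re (of_real (a n) * (of_real ((norm z)\<^sup>2)) ^ n)) sums Re (K z z)" by (rule sums_Re)
  then have s: "(\<lambda>n. a n * ((norm z)\<^sup>2) ^ n) sums Re (K z z)"
    by (metis (no_types, lifting) Re_complex_of_real of_real_mult of_real_power sums_cong)
  have "(\<Sum>n\<in>{0}. a n * ((norm z)\<^sup>2) ^ n) \<le> Re (K z z)"
    unfolding sums_unique [OF s] using a_pos by (intro sum_le_suminf sums_summable [OF s]) (auto simp: less_imp_le)
  then show ?thesis by (simp add: a_0)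
qed

lemma K_pos: "z \<in> ball 0 1 \<Longrightarrow> 0 < Re (K z z)"
  using K_ge_1 [of z] by simp

lemma B_less_1: assumes z: "z \<in> ball 0 1" shows "Re (B z z) < 1" "0 \<le> Re (B z z)" "1 - Re (B z z) = 1 / Re (K z z)"
proof -
  have "complex_of_real ((1 - Re (B z z)) * Re (K z z)) = 1"
    using B_K [OF z z] K_real [OF z] B_real [OF z] by (metis of_real_1 of_real_diff of_real_mult)
  then have e: "(1 - Re (B z z)) * Re (K z z) = 1" by (simp only: of_real_eq_1_iff)
  then show "1 - Re (B z z) = 1 / Re (K z z)" using K_pos [OF z] by (simp add: field_simps)
  then show "Re (B z z) < 1" using K_pos [OF z] by (metis diff_gt_0_iff_gt zero_less_divide_1_iff)
  have "0 \<le> Re (form B [(1, z)] [(1, z)])" by (rule psd_nonneg [OF psd_B]) (use z in simp)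
  then show "0 \<le> Re (B z z)" by (simp add: form_def)
qed

lemma in_H_one: "in_H K (\<lambda>z. 1)" and hn_one: "hn K (\<lambda>z. 1) = 1"
proof -
  have b: "[(1, 0)] \<in> bpts" and s: "sec [(1, 0)] = (\<lambda>z. 1)" by (simp_all add: sec_def)
  show "in_H K (\<lambda>z. 1)" "hn K (\<lambda>z. 1) = 1"
    using in_H_sec [OF b] hnorm2_sec [OF b] unfolding s by (simp_all add: hn_def form_def)
qed

lemma kmult_in_H: "kmult \<phi> C \<Longrightarrow> in_H K \<phi>"
  using kmult_H(1) [OF _ in_H_one] by simp

lemma kmult_bound: "kmult \<phi> C \<Longrightarrow> z \<in> ball 0 1 \<Longrightarrow> cmod (\<phi> z) \<le> C"
  using kmult_le K_pos by blast

text \<open>Truncations of \<^term>\<open>B\<close> keep the contraction property because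
  \<^term>\<open>K z w * (1 - s) = 1 + (B z w - s) * K z w\<close>.\<close>

lemma psd_K_minus_part:
  assumes "\<And>n. 0 \<le> c n" "\<And>n. c n \<le> b n"
    "\<And>z w. z \<in> ball 0 1 \<Longrightarrow> w \<in> ball 0 1 \<Longrightarrow> (\<lambda>n. of_real (c n) * cinner z w ^ n) sums D z w"
  shows "psd (\<lambda>z w. (1 - D z w) * K z w)"
proof (rule psd_cong)
  show "psd (\<lambda>z w. 1 + (B z w - D z w) * K z w)"
  proof (intro psd_add psd_one psd_series [OF psd_kernel])
    show "0 \<le> b n - c n" for n using assms(2) by simp
    show "(\<lambda>n. of_real (b n - c n) * cinner z w ^ n) sums (B z w - D z w)" if "z \<in> ball 0 1" "w \<in> ball 0 1" for z w
      using sums_diff [OF B_sums [OF that] assms(3) [OF that]] by (simp add: left_diff_distrib)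
  qed
  show "1 + (B z w - D z w) * K z w = (1 - D z w) * K z w" if "z \<in> ball 0 1" "w \<in> ball 0 1" for z w
    using B_mult_K [OF that] by (simp add: algebra_simps)
qed

text \<open>The truncation of \<open>B\<close> to degree one is admissible in
  \<open>psd_K_minus_part\<close>. Adding back the positive contributions of the other coordinates
  leaves only coordinate \<open>i\<close>; dividing by \<open>b 1\<close> gives the constant
  \<open>1 / \<kappa>\<close>.\<close>

lemma kmult_coord: "kmult (\<lambda>z. z $ i) (1 / \<kappa>)"
proof -
  let ?D = "\<lambda>z w :: complex^'d. of_real (b 1) * cinner z w"
  have "psd (\<lambda>z w. (1 - ?D z w) * K z w)"
  proof (rule psd_K_minus_part [where c = "\<lambda>n. if n = 1 then b 1 else 0"])
    show "(\<lambda>n. of_real (if n = 1 then b 1 else 0) * cinner z w ^ n) sums ?D z w" for z w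
      using sums_single [of 1 "\<lambda>n. of_real (b 1) * cinner z w ^ n"] by (simp add: if_distrib if_distribR cong: if_cong)
  qed (auto simp: b_nonneg)
  moreover have "psd (\<lambda>z w. of_real (b 1) * (\<Sum>j\<in>UNIV - {i}. z $ j * cnj (w $ j) * K z w))"
    by (intro psd_cmul psd_sum psd_twist psd_kernel b_nonneg)
  ultimately have "psd (\<lambda>z w. (1 - ?D z w) * K z w + of_real (b 1) * (\<Sum>j\<in>UNIV - {i}. z $ j * cnj (w $ j) * K z w))"
    by (rule psd_add)
  then have "psd (\<lambda>z w. of_real (1 / b 1) * ((1 - ?D z w) * K z w + of_real (b 1) * (\<Sum>j\<in>UNIV - {i}. z $ j * cnj (w $ j) * K z w)))"
    by (rule psd_cmul) (simp add: b_nonneg)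
  moreover have "of_real (1 / b 1) * ((1 - ?D z w) * K z w + of_real (b 1) * (\<Sum>j\<in>UNIV - {i}. z $ j * cnj (w $ j) * K z w))
      = (of_real ((1 / \<kappa>)\<^sup>2) - z $ i * cnj (w $ i)) * K z w" for z w
  proof -
    have "cinner z w = z $ i * cnj (w $ i) + (\<Sum>j\<in>UNIV - {i}. z $ j * cnj (w $ j))"
      unfolding cinner_def by (rule sum.remove) auto
    then have "(1 - ?D z w) * K z w + of_real (b 1) * (\<Sum>j\<in>UNIV - {i}. z $ j * cnj (w $ j) * K z w)
      = (1 - of_real (b 1) * (z $ i * cnj (w $ i))) * K z w"
      by (simp add: sum_distrib_right [symmetric] sum_distrib_left algebra_simps)
    moreover have "complex_of_real (b 1) \<noteq> 0" using kappa_power2 kappa_pos by auto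
    moreover have "complex_of_real ((1 / \<kappa>)\<^sup>2) = 1 / of_real (b 1)" using kappa_power2 by (simp add: power_divide)
    ultimately show ?thesis by (simp add: field_simps)
  qed
  ultimately have "psd (\<lambda>z w. (of_real ((1 / \<kappa>)\<^sup>2) - z $ i * cnj (w $ i)) * K z w)" by simp
  then show ?thesis using kappa_pos by (subst kmult_iff_psd) auto
qed

lemma kmult_poly: assumes "is_poly p" shows "\<exists>C. kmult p C"
proof -
  obtain A c where A: "p = (\<lambda>z. \<Sum>\<alpha>\<in>A. c \<alpha> * (\<Prod>i\<in>UNIV. (z $ i) ^ (\<alpha> i)))"
    using assms(1) unfolding is_poly_def by blast
  have pr: "\<exists>C. kmult (\<lambda>z. \<Prod>i\<in>I. (z $ i) ^ (\<alpha> i)) C" for \<alpha> and I :: "'d set"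
  proof (induction I rule: infinite_finite_induct)
    case (insert x F)
    then obtain C where "kmult (\<lambda>z. \<Prod>i\<in>F. (z $ i) ^ (\<alpha> i)) C" by blast
    then have "kmult (\<lambda>z. (z $ x) ^ \<alpha> x * (\<Prod>i\<in>F. (z $ i) ^ (\<alpha> i))) ((1 / \<kappa>) ^ \<alpha> x * C)"
      by (rule kmult_mult [OF kmult_power [OF kmult_coord]])
    then show ?case using insert by auto
  qed (use kmult_const [of 1] in auto)
  have "\<forall>\<alpha>. \<exists>C. kmult (\<lambda>z. \<Prod>i\<in>UNIV. (z $ i) ^ (\<alpha> i)) C" using pr by blast
  from choice [OF this] obtain C where C: "\<And>\<alpha>. kmult (\<lambda>z. \<Prod>i\<in>UNIV. (z $ i) ^ (\<alpha> i)) (C \<alpha>)" by blast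
  have "kmult p (\<Sum>\<alpha>\<in>A. cmod (c \<alpha>) * C \<alpha>)" unfolding A by (intro kmult_sum kmult_cmul C)
  then show ?thesis by blast
qed

lemma poly_in_H: "is_poly p \<Longrightarrow> in_H K p"
  using kmult_poly kmult_in_H by blast

text \<open>Substitution gives positivity with the dilated kernel. The quotient of \<open>K\<close>
  by that kernel is \<open>1 + (B - B') * K\<close>, where \<open>B'\<close> is the dilated
  \<open>B\<close>, and \<open>B - B'\<close> has the nonnegative coefficients
  \<open>b n * (1 - (cmod c)\<^sup>2 ^ n)\<close>. Complex \<open>c\<close> covers rotations
  too.\<close>

lemma kmult_dilate:
  assumes k: "kmult \<phi> C" and c: "cmod c \<le> 1"
  shows "kmult (\<lambda>z. \<phi> (c *s z)) C"
proof -
  let ?P = "\<lambda>z w. (of_real (C\<^sup>2) - \<phi> z * cnj (\<phi> w)) * K z w"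
  let ?Q = "\<lambda>z w. ?P (c *s z) (c *s w)"
  have C: "0 \<le> C" using kmult_nonneg k by blast
  have cb: "c *s z \<in> ball 0 1" if "z \<in> ball 0 1" for z :: "complex^'d"
    using that c mult_mono [of "cmod c" 1 "norm z" "norm z"] by auto
  have Q: "psd ?Q" using psd_dilate [OF k [unfolded kmult_iff_psd [OF C]] c] .
  let ?D = "\<lambda>z w. B z w - B (c *s z) (c *s w)"
  have "psd (\<lambda>z w. ?D z w * (K z w * ?Q z w))"
  proof (rule psd_series [OF psd_K_mult [OF Q]])
    show "0 \<le> b n * (1 - ((cmod c)\<^sup>2) ^ n)" for n
      using c b_nonneg by (intro mult_nonneg_nonneg) (auto simp: power_le_one)
    show "(\<lambda>n. of_real (b n * (1 - ((cmod c)\<^sup>2) ^ n)) * cinner z w ^ n) sums ?D z w" if "z \<in> ball 0 1" "w \<in> ball 0 1" for z w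
    proof -
      have "c * cnj c = of_real ((cmod c)\<^sup>2)" by (rule complex_norm_square [symmetric])
      then have "cinner (c *s z) (c *s w) = of_real ((cmod c)\<^sup>2) * cinner z w"
        by (simp add: mult.assoc [symmetric] mult.commute [of "cnj c"])
      then show ?thesis using sums_diff [OF B_sums [OF that] B_sums [OF cb cb, OF that, unfolded \<open>cinner (c *s z) (c *s w) = _\<close>]]
        by (simp add: algebra_simps power_mult_distrib)
    qed
  qed
  with Q have "psd (\<lambda>z w. ?Q z w + ?D z w * (K z w * ?Q z w))" by (rule psd_add)
  then have "psd (\<lambda>z w. (of_real (C\<^sup>2) - \<phi> (c *s z) * cnj (\<phi> (c *s w))) * K z w)"
  proof (rule psd_cong)
    fix z w :: "complex^'d" assume zw: "z \<in> ball 0 1" "w \<in> ball 0 1"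
    let ?x = "of_real (C\<^sup>2) - \<phi> (c *s z) * cnj (\<phi> (c *s w))"
    have "?Q z w + ?D z w * (K z w * ?Q z w) = ?x * K (c *s z) (c *s w) * (1 + B z w * K z w - B (c *s z) (c *s w) * K z w)"
      by (simp add: algebra_simps)
    also have "1 + B z w * K z w = K z w" using B_mult_K [OF zw] by simp
    also have "?x * K (c *s z) (c *s w) * (K z w - B (c *s z) (c *s w) * K z w) =
      ?x * ((1 - B (c *s z) (c *s w)) * K (c *s z) (c *s w)) * K z w" by (simp add: algebra_simps)
    also have "\<dots> = ?x * K z w" using B_K [OF cb cb, OF zw] by simp
    finally show "?Q z w + ?D z w * (K z w * ?Q z w) = ?x * K z w" .
  qed
  then show ?thesis by (simp add: kmult_iff_psd [OF C])
qed

text \<open>Multiply the Schur complement of \<open>B\<close> at \<open>w\<close> by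
  \<open>K\<close> and use \<open>B * K = K - 1\<close>; the missing term is the positive constant
  \<open>B w w\<close>.\<close>

lemma kmult_B: assumes w: "w \<in> ball 0 1" shows "kmult (\<lambda>z. B z w) (sqrt (Re (B w w)))"
proof -
  have "psd (\<lambda>z z'. B w w + K z z' * (B w w * B z z' - B z w * cnj (B z' w)))"
  proof (rule psd_add)
    show "psd (\<lambda>z z'. B w w)" using psd_cmul [OF psd_one B_less_1(2) [OF w]] B_real [OF w] by simp
  qed (rule psd_K_mult [OF psd_Schur_complement [OF psd_B w]])
  then have "psd (\<lambda>z z'. (B w w - B z w * cnj (B z' w)) * K z z')"
  proof (rule psd_cong)
    fix z z' :: "complex^'d" assume zw: "z \<in> ball 0 1" "z' \<in> ball 0 1"
    have "B w w + K z z' * (B w w * B z z' - B z w * cnj (B z' w)) =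
      B w w * (1 + B z z' * K z z') - K z z' * B z w * cnj (B z' w)" by (simp add: algebra_simps)
    also have "1 + B z z' * K z z' = K z z'" using B_mult_K [OF zw] by simp
    finally show "B w w + K z z' * (B w w * B z z' - B z w * cnj (B z' w)) = (B w w - B z w * cnj (B z' w)) * K z z'"
      by (simp add: algebra_simps)
  qed
  moreover have "complex_of_real ((sqrt (Re (B w w)))\<^sup>2) = B w w"
    using B_real [OF w] B_less_1(2) [OF w] by simp
  ultimately show ?thesis using B_less_1(2) [OF w] by (subst kmult_iff_psd) auto
qed

text \<open>As a function of the first argument, \<open>K\<close> is the geometric series of
  \<open>B\<close>, whose multiplier norm is below 1. That kernel functions are multipliers is what
  allows them to act on the vector in the definition of \<open>V\<close>.\<close>

lemma kmult_K: assumes w: "w \<in> ball 0 1" shows "\<exists>C. kmult (\<lambda>z. K z w) C"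
proof -
  define \<rho> where "\<rho> = sqrt (Re (B w w))"
  have \<rho>: "0 \<le> \<rho>" "\<rho> < 1" using B_less_1 [OF w] by (auto simp: \<rho>_def)
  have "kmult (\<lambda>z. K z w) (1 / (1 - \<rho>))"
  proof (rule kmult_tendsto)
    fix n
    have "kmult (\<lambda>z. \<Sum>k<n. B z w ^ k) (\<Sum>k<n. \<rho> ^ k)"
      unfolding \<rho>_def by (intro kmult_sum kmult_power kmult_B w)
    moreover have "(\<Sum>k<n. \<rho> ^ k) \<le> (\<Sum>k. \<rho> ^ k)" using \<rho> by (intro sum_le_suminf summable_geometric) auto
    moreover have "(\<Sum>k. \<rho> ^ k) = 1 / (1 - \<rho>)" using \<rho> by (intro suminf_geometric) auto
    ultimately show "kmult (\<lambda>z. \<Sum>k<n. B z w ^ k) (1 / (1 - \<rho>))" by (metis kmult_mono)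
  next
    fix z :: "complex^'d" assume z: "z \<in> ball 0 1"
    have "cmod (B z w) < 1" using kmult_bound [OF kmult_B [OF w] z] \<rho>(2) unfolding \<rho>_def by (rule le_less_trans)
    then have "(\<lambda>k. B z w ^ k) sums (1 / (1 - B z w))" by (rule geometric_sums)
    moreover have "1 / (1 - B z w) = K z w" using B_K [OF z w]
      by (metis div_by_1 divide_divide_eq_right mult.commute nonzero_mult_div_cancel_left mult_eq_0_iff zero_neq_one)
    ultimately show "(\<lambda>n. \<Sum>k<n. B z w ^ k) \<longlonglongrightarrow> K z w" by (simp add: sums_def)
  qed
  then show ?thesis by blast
qed

text \<open>Kernel domination: the space of a kernel below \<open>K\<close> sits contractively in
  \<open>H\<close>. Applied to the tails of the series of \<open>K\<close>.\<close>

lemma in_H_part: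
  assumes R: "psd R" and KR: "psd (\<lambda>z w. K z w - R z w)" and z: "z \<in> ball 0 1"
  shows "in_H K (\<lambda>\<zeta>. R \<zeta> z)" "hnorm2 K (\<lambda>\<zeta>. R \<zeta> z) \<le> Re (R z z)"
proof -
  have "rk_bound K (\<lambda>\<zeta>. R \<zeta> z) (Re (R z z))" unfolding rk_bound_iff
  proof
    fix l :: "(complex \<times> (complex^'d)) list" assume l: "l \<in> bpts"
    have zb: "[(1, z)] \<in> bpts" using z by simp
    have "ev l (\<lambda>\<zeta>. R \<zeta> z) = form R l [(1, z)]" by (simp add: form_def)
    then have "(cmod (ev l (\<lambda>\<zeta>. R \<zeta> z)))\<^sup>2 \<le> Re (form R l l) * Re (R z z)"
      using psd_Cauchy_Schwarz [OF R l zb] by (simp add: form_def)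
    also have "\<dots> \<le> Re (form K l l) * Re (R z z)"
      using psd_nonneg [OF KR l] psd_nonneg [OF R zb] by (intro mult_right_mono) (simp add: form_diff, simp add: form_def)
    finally show "(cmod (ev l (\<lambda>\<zeta>. R \<zeta> z)))\<^sup>2 \<le> Re (R z z) * N l" by (simp add: mult.commute)
  qed
  then show "in_H K (\<lambda>\<zeta>. R \<zeta> z)" "hnorm2 K (\<lambda>\<zeta>. R \<zeta> z) \<le> Re (R z z)"
    by (auto simp: in_H_def intro: hnorm2_le)
qed

end

lemma rk_bound_cong: "(\<And>z. z \<in> ball 0 1 \<Longrightarrow> f z = g z) \<Longrightarrow> rk_bound K f C = rk_bound K g C"
proof -
  assume "\<And>z. z \<in> ball 0 1 \<Longrightarrow> f z = g z"
  then have "ev l f = ev l g" if "l \<in> bpts" for l using bptsD [OF that] by (intro ev_cong) blast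
  then show ?thesis by (auto simp: rk_bound_iff)
qed

lemma hnorm2_cong: assumes "\<And>z. z \<in> ball 0 1 \<Longrightarrow> f z = g z" shows "hnorm2 K f = hnorm2 K g"
proof -
  have "rk_bound K f C = rk_bound K g C" for C by (rule rk_bound_cong) (rule assms)
  then show ?thesis by (simp add: hnorm2_def)
qed

text \<open>Discrete Fourier filter. The exponent \<open>M - n\<close> stands for
  \<open>- n\<close>; under the size condition \<open>m + (M - n)\<close> lies strictly between 0
  and \<open>2 * M\<close>, so \<open>M\<close> divides it only if \<open>m = n\<close>.\<close>

lemma root_unity_average:
  fixes m n :: nat
  defines "\<omega> M \<equiv> exp (2 * of_real pi * \<i> / of_nat M)"
  assumes "m \<noteq> n" "m + n < M"
  shows "(\<Sum>j<M. \<omega> M ^ (j * (M - n)) * (\<omega> M ^ j) ^ m) = 0"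
proof -
  define y where "y = \<omega> M ^ (m + (M - n))"
  have M: "1 \<le> M" using assms by simp
  have \<omega>: "\<omega> M ^ k = exp (2 * of_real pi * \<i> * of_nat k / of_nat M)" for k
    unfolding \<omega>_def by (simp add: exp_of_nat_mult [symmetric] mult_ac)
  have "\<not> M dvd m + (M - n)"
  proof
    assume "M dvd m + (M - n)"
    then obtain c where c: "m + (M - n) = M * c" by (auto simp: dvd_def)
    have "0 < m + (M - n)" "m + (M - n) < 2 * M" using assms by auto
    then have "M * 0 < M * c" "M * c < M * 2" unfolding c by auto
    then have "c = 1" by simp
    then show False using c assms by simp
  qed
  then have y: "y \<noteq> 1" unfolding y_def \<omega> using complex_root_unity_eq_1 [OF M, of "m + (M - n)"] by blast
  have "\<omega> M ^ M = 1" unfolding \<omega> using complex_root_unity_eq_1 [OF M, of M] by simp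
  then have yM: "y ^ M = 1" unfolding y_def by (simp flip: power_mult add: mult.commute) (simp add: power_mult)
  have "(\<Sum>j<M. \<omega> M ^ (j * (M - n)) * (\<omega> M ^ j) ^ m) = (\<Sum>j<M. y ^ j)"
    unfolding y_def by (simp flip: power_mult power_add add: algebra_simps)
  then show ?thesis using y yM sum_gp_strict [of y M] by simp
qed

section \<open>Homogeneous expansions and row contractions\<close>

context pick_space
begin

text \<open>The coefficient of \<open>t ^ n\<close> in \<open>h (t *s z)\<close>.\<close>

definition hom_part :: "(complex^'d \<Rightarrow> complex) \<Rightarrow> nat \<Rightarrow> complex^'d \<Rightarrow> complex" where
  "hom_part h n z = of_real (a n) * hinner K h (\<lambda>\<zeta>. cinner \<zeta> z ^ n)"

lemma cinner_is_poly: "is_poly (\<lambda>\<zeta>. cinner \<zeta> z)"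
  unfolding cinner_def by (intro is_poly_sum is_poly_mult is_poly_coord is_poly_const)

lemma is_poly_power: "is_poly p \<Longrightarrow> is_poly (\<lambda>z. p z ^ n)"
  by (induction n) (auto intro: is_poly_mult is_poly_const)

text \<open>Conjugate linearity in the second argument turns the factors \<open>cnj (z $ i)\<close>
  of \<open>cinner\<close> into \<open>z $ i\<close>. The power is expanded one factor at a time,
  and \<open>g\<close> in the induction carries the coordinates of the integration variable split
  off so far.\<close>

lemma hom_part_poly: assumes h: "in_H K h" shows "is_poly (hom_part h n)"
proof -
  have "is_poly g \<Longrightarrow> is_poly (\<lambda>z. hinner K h (\<lambda>\<zeta>. cinner \<zeta> z ^ n * g \<zeta>))" for g
  proof (induction n arbitrary: g)
    case 0 then show ?case by (simp add: is_poly_const)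
  next
    case (Suc n)
    have "hinner K h (\<lambda>\<zeta>. cinner \<zeta> z ^ Suc n * g \<zeta>) =
        (\<Sum>i\<in>UNIV. z $ i * hinner K h (\<lambda>\<zeta>. cinner \<zeta> z ^ n * (\<zeta> $ i * g \<zeta>)))" for z
    proof -
      let ?u = "\<lambda>i \<zeta>. cinner \<zeta> z ^ n * (\<zeta> $ i * g \<zeta>)"
      have u: "in_H K (?u i)" for i
        by (intro poly_in_H is_poly_mult is_poly_power cinner_is_poly is_poly_coord Suc)
      have "(\<lambda>\<zeta>. cinner \<zeta> z ^ Suc n * g \<zeta>) = (\<lambda>\<zeta>. \<Sum>i\<in>UNIV. cnj (z $ i) * ?u i \<zeta>)"
        by (simp add: fun_eq_iff cinner_def [of _ z] sum_distrib_left sum_distrib_right mult_ac)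
      then have "hinner K h (\<lambda>\<zeta>. cinner \<zeta> z ^ Suc n * g \<zeta>) = cnj (hinner K (\<lambda>\<zeta>. \<Sum>i\<in>UNIV. cnj (z $ i) * ?u i \<zeta>) h)"
        using hinner_sym [OF in_H_sum [OF in_H_cmul(1) [OF u]] h] by simp
      also have "\<dots> = (\<Sum>i\<in>UNIV. cnj (cnj (z $ i) * hinner K (?u i) h))"
        using u h by (simp add: hinner_sum hinner_cmul in_H_cmul(1))
      also have "\<dots> = (\<Sum>i\<in>UNIV. z $ i * hinner K h (?u i))"
        using hinner_sym [OF h u] by simp
      finally show ?thesis .
    qed
    then show ?case using Suc by (simp add: is_poly_sum is_poly_mult is_poly_coord)
  qed
  from this [of "\<lambda>_. 1"] show ?thesis unfolding hom_part_def by (simp add: is_poly_cmul is_poly_const)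
qed

lemma hom_part_scale: assumes h: "in_H K h" shows "hom_part h n (c *s z) = c ^ n * hom_part h n z"
proof -
  have p: "in_H K (\<lambda>\<zeta>. cinner \<zeta> z ^ n)" by (intro poly_in_H is_poly_power cinner_is_poly)
  have "hom_part h n (c *s z) = of_real (a n) * hinner K h (\<lambda>\<zeta>. cnj c ^ n * cinner \<zeta> z ^ n)"
    by (simp add: hom_part_def power_mult_distrib)
  also have "\<dots> = c ^ n * hom_part h n z" using hinner_cmul_right [OF h p, of "cnj c ^ n"]
    by (simp add: hom_part_def)
  finally show ?thesis .
qed

definition Kn :: "nat \<Rightarrow> complex^'d \<Rightarrow> complex^'d \<Rightarrow> complex" where
  "Kn r w \<zeta> = (\<Sum>n<r. of_real (a n) * cinner \<zeta> w ^ n)"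

lemma Kn_poly: "is_poly (Kn r w)"
  unfolding Kn_def by (intro is_poly_sum is_poly_cmul is_poly_power cinner_is_poly)

lemma K_in_H: assumes z: "z \<in> ball 0 1"
  shows "in_H K (\<lambda>\<zeta>. K \<zeta> z)" and hinner_K: "in_H K h \<Longrightarrow> hinner K h (\<lambda>\<zeta>. K \<zeta> z) = h z"
proof -
  have zb: "[(1, z)] \<in> bpts" using z by simp
  have sec: "sec [(1, z)] = (\<lambda>\<zeta>. K \<zeta> z)" by (simp add: sec_def)
  show "in_H K (\<lambda>\<zeta>. K \<zeta> z)" "in_H K h \<Longrightarrow> hinner K h (\<lambda>\<zeta>. K \<zeta> z) = h z"
    using in_H_sec(1) [OF zb] hinner_sec [OF _ zb] unfolding sec by simp_all
qed

text \<open>The tail of the series is a positive kernel dominated by \<open>K\<close>, so the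
  squared norm of its section is at most its diagonal value, which tends to 0.\<close>

lemma Kn_tendsto: assumes z: "z \<in> ball 0 1" shows "(\<lambda>r. hn K (\<lambda>\<zeta>. K \<zeta> z - Kn r z \<zeta>)) \<longlonglongrightarrow> 0"
proof -
  define R where "R r = (\<lambda>x y. K x y - Kn r y x)" for r
  have psdS: "psd (\<lambda>x y. Kn r y x)" for r
    unfolding Kn_def using psd_sum [OF psd_cmul [OF psd_cinner_power [OF psd_one]], of "{..<r}" a "\<lambda>n. n"] a_pos
    by (simp add: less_imp_le)
  have psdR: "psd (R r)" for r
  proof -
    have "psd (\<lambda>x y. R r x y * 1)"
    proof (rule psd_series [OF psd_one])
      show "0 \<le> (if n < r then 0 else a n)" for n using a_pos by (simp add: less_imp_le)
      fix x y :: "complex^'d" assume xy: "x \<in> ball 0 1" "y \<in> ball 0 1"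
      have "(\<lambda>n. if n \<in> {..<r} then of_real (a n) * cinner x y ^ n else 0) sums Kn r y x"
        unfolding Kn_def by (rule sums_If_finite_set) simp
      from sums_diff [OF K_sums [OF xy] this]
      show "(\<lambda>n. of_real (if n < r then 0 else a n) * cinner x y ^ n) sums R r x y"
        unfolding R_def by (rule sums_cong [THEN iffD1, rotated]) auto
    qed
    then show ?thesis by simp
  qed
  have H: "in_H K (\<lambda>\<zeta>. R r \<zeta> z)" "hnorm2 K (\<lambda>\<zeta>. R r \<zeta> z) \<le> Re (R r z z)" for r
    using in_H_part [OF psdR _ z] psdS by (auto simp: R_def)
  show ?thesis
  proof (rule Lim_null_comparison)
    show "\<forall>\<^sub>F r in sequentially. norm (hn K (\<lambda>\<zeta>. K \<zeta> z - Kn r z \<zeta>)) \<le> sqrt (Re (R r z z))"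
      using H hn_nonneg [OF H(1)] by (intro always_eventually allI) (simp add: R_def hn_def)
    have "(\<lambda>r. Kn r z z) \<longlonglongrightarrow> K z z" using K_sums [OF z z] by (simp add: Kn_def sums_def)
    then have "(\<lambda>r. sqrt (Re (R r z z))) \<longlonglongrightarrow> sqrt (Re (K z z - K z z))"
      unfolding R_def by (intro tendsto_intros)
    then show "(\<lambda>r. sqrt (Re (R r z z))) \<longlonglongrightarrow> 0" by simp
  qed
qed

lemma hom_part_sums: assumes h: "in_H K h" and z: "z \<in> ball 0 1" shows "(\<lambda>n. hom_part h n z) sums h z"
proof -
  have HS: "in_H K (Kn r z)" for r by (rule poly_in_H [OF Kn_poly])
  have part: "(\<Sum>n<r. hom_part h n z) = hinner K h (Kn r z)" for r
  proof -
    have p: "in_H K (\<lambda>\<zeta>. cinner \<zeta> z ^ n)" for n by (intro poly_in_H is_poly_power cinner_is_poly)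
    have "hinner K h (Kn r z) = cnj (hinner K (Kn r z) h)" by (rule hinner_sym [OF HS h])
    also have "\<dots> = (\<Sum>n<r. cnj (of_real (a n) * hinner K (\<lambda>\<zeta>. cinner \<zeta> z ^ n) h))"
      unfolding Kn_def using p h by (simp add: hinner_sum hinner_cmul in_H_cmul(1))
    also have "\<dots> = (\<Sum>n<r. hom_part h n z)" unfolding hom_part_def using hinner_sym [OF h p] by simp
    finally show ?thesis by simp
  qed
  have "(\<lambda>r. h z - (\<Sum>n<r. hom_part h n z)) \<longlonglongrightarrow> 0"
  proof (rule Lim_null_comparison)
    show "\<forall>\<^sub>F r in sequentially. norm (h z - (\<Sum>n<r. hom_part h n z)) \<le> hn K h * hn K (\<lambda>\<zeta>. K \<zeta> z - Kn r z \<zeta>)"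
    proof (intro always_eventually allI)
      fix r
      have "h z - (\<Sum>n<r. hom_part h n z) = hinner K h (\<lambda>\<zeta>. K \<zeta> z - Kn r z \<zeta>)"
        unfolding part using hinner_diff_right [OF h K_in_H(1) [OF z] HS] hinner_K [OF z h] by simp
      then show "norm (h z - (\<Sum>n<r. hom_part h n z)) \<le> hn K h * hn K (\<lambda>\<zeta>. K \<zeta> z - Kn r z \<zeta>)"
        using hinner_le [OF h in_H_diff(1) [OF K_in_H(1) [OF z] HS]] by simp
    qed
    show "(\<lambda>r. hn K h * hn K (\<lambda>\<zeta>. K \<zeta> z - Kn r z \<zeta>)) \<longlonglongrightarrow> 0"
      by (rule tendsto_mult_right_zero [OF Kn_tendsto [OF z]])
  qed
  then have "(\<lambda>r. h z - (h z - (\<Sum>n<r. hom_part h n z))) \<longlonglongrightarrow> h z - 0" by (intro tendsto_intros)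
  then show ?thesis by (simp add: sums_def)
qed

text \<open>The homogeneous parts of a multiplier are limits of averages of its rotations.\<close>

lemma kmult_hom_part: assumes k: "kmult \<phi> C" shows "kmult (hom_part \<phi> n) C"
proof -
  define \<omega> where "\<omega> M = exp (2 * of_real pi * \<i> / of_nat M)" for M :: nat
  have n\<omega>: "cmod (\<omega> M ^ k) = 1" for M k by (simp add: \<omega>_def norm_power)
  have H: "in_H K \<phi>" by (rule kmult_in_H [OF k])
  \<comment> \<open>The additional dilation by \<open>s\<close> supplies the geometric majorant that
    permits exchanging limit and series; it is removed at the end by letting \<open>s\<close> tend
    to 1.\<close>
  have s: "kmult (\<lambda>z. of_real s ^ n * hom_part \<phi> n z) C" if s: "0 < s" "s < 1" for s :: real
  proof (rule kmult_tendsto)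
    \<comment> \<open>The average runs over \<open>Suc M\<close> rotations, so the divisor is never
      0. The truncated difference \<open>Suc M - n\<close> is the intended one as soon as
      \<open>M\<close> is at least \<open>n\<close>, which suffices for the limit.\<close>
    let ?A = "\<lambda>M z. \<Sum>j<Suc M. (\<omega> (Suc M) ^ (j * (Suc M - n)) / of_nat (Suc M)) * \<phi> ((of_real s * \<omega> (Suc M) ^ j) *s z)"
    show "kmult (?A M) C" for M
    proof -
      have "kmult (?A M) (\<Sum>j<Suc M. cmod (\<omega> (Suc M) ^ (j * (Suc M - n)) / of_nat (Suc M)) * C)"
        using s n\<omega> by (intro kmult_sum kmult_cmul kmult_dilate [OF k]) (simp add: norm_mult)
      also have "(\<Sum>j<Suc M. cmod (\<omega> (Suc M) ^ (j * (Suc M - n)) / of_nat (Suc M)) * C) = C"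
        using n\<omega> by (simp add: norm_divide del: of_nat_Suc)
      finally show ?thesis .
    qed
    fix z :: "complex^'d" assume z: "z \<in> ball 0 1"
    let ?p = "\<lambda>m. hom_part \<phi> m z"
    have "?p \<longlonglongrightarrow> 0" using hom_part_sums [OF H z] sums_summable summable_LIMSEQ_zero by blast
    then have "Bseq ?p" by (rule convergent_imp_Bseq [OF convergentI])
    then obtain D where D: "\<And>m. cmod (?p m) \<le> D" by (auto simp: Bseq_def)
    let ?avg = "\<lambda>M m. (\<Sum>j<Suc M. \<omega> (Suc M) ^ (j * (Suc M - n)) * (\<omega> (Suc M) ^ j) ^ m) / of_nat (Suc M)"
    have A: "?A M z = (\<Sum>m. of_real s ^ m * ?p m * ?avg M m)" for M
    proof -
      have "(\<lambda>m. (\<omega> (Suc M) ^ (j * (Suc M - n)) / of_nat (Suc M)) * ((of_real s * \<omega> (Suc M) ^ j) ^ m * ?p m))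
        sums ((\<omega> (Suc M) ^ (j * (Suc M - n)) / of_nat (Suc M)) * \<phi> ((of_real s * \<omega> (Suc M) ^ j) *s z))" for j
      proof (rule sums_mult)
        have "(of_real s * \<omega> (Suc M) ^ j) *s z \<in> ball 0 1"
          using s z n\<omega> mult_strict_mono' [of s 1 "norm z" 1] by (simp add: norm_mult)
        from hom_part_sums [OF H this]
        show "(\<lambda>m. (of_real s * \<omega> (Suc M) ^ j) ^ m * ?p m) sums \<phi> ((of_real s * \<omega> (Suc M) ^ j) *s z)"
          by (simp add: hom_part_scale [OF H])
      qed
      then have "(\<lambda>m. \<Sum>j<Suc M. (\<omega> (Suc M) ^ (j * (Suc M - n)) / of_nat (Suc M)) * ((of_real s * \<omega> (Suc M) ^ j) ^ m * ?p m)) sums ?A M z"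
        by (rule sums_sum)
      moreover have "(\<Sum>j<Suc M. (\<omega> (Suc M) ^ (j * (Suc M - n)) / of_nat (Suc M)) * ((of_real s * \<omega> (Suc M) ^ j) ^ m * ?p m))
          = of_real s ^ m * ?p m * ?avg M m" for m
        unfolding sum_divide_distrib sum_distrib_left by (intro sum.cong refl) (simp add: power_mult_distrib)
      ultimately show ?thesis by (simp add: sums_iff)
    qed
    have "(\<lambda>M. \<Sum>m. of_real s ^ m * ?p m * ?avg M m) \<longlonglongrightarrow> (\<Sum>m. of_real s ^ m * ?p m * (if m = n then 1 else 0))"
    proof (rule tannerys_theorem [THEN conjunct2, THEN conjunct2])
      fix m
      have "\<forall>\<^sub>F M in sequentially. ?avg M m = (if m = n then 1 else 0)"
      proof (rule eventually_sequentiallyI [of "m + n"])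
        fix M assume M: "m + n \<le> M"
        show "?avg M m = (if m = n then 1 else 0)"
        proof (cases "m = n")
          case True
          have "\<omega> (Suc M) ^ (Suc M) = 1"
            using complex_root_unity_eq_1 [of "Suc M" "Suc M"] unfolding \<omega>_def
            by (simp add: exp_of_nat_mult [symmetric] mult_ac del: of_nat_Suc power_Suc)
          then have "\<omega> (Suc M) ^ (j * (Suc M - n)) * (\<omega> (Suc M) ^ j) ^ n = 1" for j
          proof -
            have "j * (Suc M - n) + j * n = Suc M * j" using M by (simp add: distrib_left [symmetric])
            then have "\<omega> (Suc M) ^ (j * (Suc M - n)) * (\<omega> (Suc M) ^ j) ^ n = (\<omega> (Suc M) ^ Suc M) ^ j"
              by (simp only: power_mult [symmetric] power_add [symmetric])
            then show ?thesis using \<open>\<omega> (Suc M) ^ (Suc M) = 1\<close> by simp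
          qed
          then show ?thesis using True by (simp del: of_nat_Suc sum.lessThan_Suc)
        next
          case False
          then show ?thesis using root_unity_average [of m n "Suc M"] M unfolding \<omega>_def by simp
        qed
      qed
      then show "(\<lambda>M. of_real s ^ m * ?p m * ?avg M m) \<longlonglongrightarrow> of_real s ^ m * ?p m * (if m = n then 1 else 0)"
        by (intro tendsto_mult tendsto_const tendsto_eventually)
    next
      have "cmod (of_real s ^ m * ?p m * ?avg M m) \<le> s ^ m * D" for m M
      proof -
        have "cmod (\<Sum>j<Suc M. \<omega> (Suc M) ^ (j * (Suc M - n)) * (\<omega> (Suc M) ^ j) ^ m) \<le> (\<Sum>j<Suc M. 1)"
          by (rule sum_norm_le) (simp only: norm_mult n\<omega> norm_power [of "\<omega> (Suc M) ^ _"] power_one mult_1 order_refl)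
        then have "cmod (?avg M m) \<le> 1" by (simp add: norm_divide del: of_nat_Suc sum.lessThan_Suc)
        then have "(s ^ m * cmod (?p m)) * cmod (?avg M m) \<le> (s ^ m * D) * 1"
          using s D [of m] norm_ge_zero order_trans by (intro mult_mono mult_left_mono mult_nonneg_nonneg) (auto intro: order_trans [OF norm_ge_zero])
        then show ?thesis using s unfolding norm_mult norm_power by simp
      qed
      then show "\<forall>\<^sub>F (m, M) in sequentially \<times>\<^sub>F sequentially. cmod (of_real s ^ m * ?p m * ?avg M m) \<le> s ^ m * D"
        by (intro always_eventually) auto
      show "summable (\<lambda>m. s ^ m * D)" using s by (intro summable_mult2 summable_geometric) simp
    qed simp
    moreover have "(\<Sum>m. of_real s ^ m * ?p m * (if m = n then 1 else 0)) = of_real s ^ n * ?p n"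
      using sums_single [of n "\<lambda>m. of_real s ^ m * ?p m"] by (simp add: sums_iff if_distrib cong: if_cong)
    ultimately show "(\<lambda>M. ?A M z) \<longlonglongrightarrow> of_real s ^ n * hom_part \<phi> n z" unfolding A by simp
  qed
  show ?thesis
  proof (rule kmult_tendsto)
    show "kmult (\<lambda>z. of_real (1 - 1 / real (k + 2)) ^ n * hom_part \<phi> n z) C" for k by (rule s) auto
    have "(\<lambda>k. 1 / real (k + 2)) \<longlonglongrightarrow> 0" using LIMSEQ_ignore_initial_segment [OF lim_1_over_n, of 2] by simp
    then have "(\<lambda>k. complex_of_real (1 - 1 / real (k + 2)) ^ n * hom_part \<phi> n z) \<longlonglongrightarrow> of_real (1 - 0) ^ n * hom_part \<phi> n z" for z
      by (intro tendsto_intros)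
    then show "(\<lambda>k. complex_of_real (1 - 1 / real (k + 2)) ^ n * hom_part \<phi> n z) \<longlonglongrightarrow> hom_part \<phi> n z" for z by simp
  qed
qed

lemma poly_bound_closed:
  assumes p: "is_poly p" and k: "kmult p C" and z: "z \<in> cball 0 1" shows "cmod (p z) \<le> C"
  using continuous_on_closure_norm_le [OF is_poly_continuous [OF p], of "ball 0 1" C z] kmult_bound [OF k] z
  by (simp add: closure_ball)

text \<open>Positivity of the kernel says that the row of the \<open>\<beta> k\<close> is a
  contraction from a finite direct sum of copies of \<open>H\<close>. On a functional
  \<open>l\<close> this is Cauchy--Schwarz over \<open>k\<close> with the twisted lists.\<close>

lemma row_contraction:
  assumes D: "psd (\<lambda>z w. (1 - (\<Sum>k\<in>I. \<beta> k z * cnj (\<beta> k w))) * K z w)"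
    and \<xi>: "\<And>k. k \<in> I \<Longrightarrow> in_H K (\<xi> k)" and l: "l \<in> bpts"
  shows "(cmod (ev l (\<lambda>z. \<Sum>k\<in>I. \<beta> k z * \<xi> k z)))\<^sup>2 \<le> (\<Sum>k\<in>I. hnorm2 K (\<xi> k)) * N l"
proof -
  have "cmod (ev l (\<lambda>z. \<Sum>k\<in>I. \<beta> k z * \<xi> k z)) \<le> (\<Sum>k\<in>I. cmod (ev (twist (\<beta> k) l) (\<xi> k)))"
    by (simp add: ev_sum norm_sum)
  also have "\<dots> \<le> (\<Sum>k\<in>I. \<bar>hn K (\<xi> k)\<bar> * \<bar>sqrt (N (twist (\<beta> k) l))\<bar>)"
    using \<xi> l N_nonneg hn_nonneg by (intro sum_mono) (simp add: ev_le_hn del: ev_twist)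
  also have "\<dots> \<le> L2_set (\<lambda>k. hn K (\<xi> k)) I * L2_set (\<lambda>k. sqrt (N (twist (\<beta> k) l))) I"
    by (rule L2_set_mult_ineq)
  also have "\<dots> = sqrt (\<Sum>k\<in>I. hnorm2 K (\<xi> k)) * sqrt (\<Sum>k\<in>I. N (twist (\<beta> k) l))"
    unfolding L2_set_def using \<xi> l N_nonneg by (simp add: hn_power2)
  finally have "(cmod (ev l (\<lambda>z. \<Sum>k\<in>I. \<beta> k z * \<xi> k z)))\<^sup>2 \<le>
      (sqrt (\<Sum>k\<in>I. hnorm2 K (\<xi> k)) * sqrt (\<Sum>k\<in>I. N (twist (\<beta> k) l)))\<^sup>2"
    by (rule power_mono) simp
  also have "\<dots> = (\<Sum>k\<in>I. hnorm2 K (\<xi> k)) * (\<Sum>k\<in>I. N (twist (\<beta> k) l))"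
    using \<xi> l N_nonneg hnorm2_nonneg by (simp add: power_mult_distrib sum_nonneg)
  also have "\<dots> \<le> (\<Sum>k\<in>I. hnorm2 K (\<xi> k)) * N l"
  proof (rule mult_left_mono)
    have "form (\<lambda>z w. (1 - (\<Sum>k\<in>I. \<beta> k z * cnj (\<beta> k w))) * K z w) l l = form K l l - (\<Sum>k\<in>I. form K (twist (\<beta> k) l) (twist (\<beta> k) l))"
      unfolding form_twist left_diff_distrib form_diff sum_distrib_right form_sum by simp
    then show "(\<Sum>k\<in>I. N (twist (\<beta> k) l)) \<le> N l" using psd_nonneg [OF D l] by simp
  qed (use \<xi> hnorm2_nonneg in \<open>auto intro: sum_nonneg\<close>)
  finally show ?thesis .
qed

text \<open>Words in the variables are the components of \<open>\<langle>z, w\<rangle> ^ n\<close> as an inner product of tensor powers, so that the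
  truncations of \<^term>\<open>B\<close> become finite sums.\<close>

definition word :: "'d list \<Rightarrow> complex^'d \<Rightarrow> complex" where
  "word xs z = (\<Prod>i\<leftarrow>xs. z $ i)"

lemma word_sum: "(\<Sum>xs | length xs = n. word xs z * cnj (word xs w)) = cinner z w ^ n"
proof (induction n)
  case 0 then show ?case by (simp add: word_def)
next
  case (Suc n)
  have "{xs :: 'd list. length xs = Suc n} = (\<lambda>(i, xs). i # xs) ` (UNIV \<times> {xs. length xs = n})"
    by (force simp: length_Suc_conv image_iff)
  moreover have "inj_on (\<lambda>(i, xs). i # xs) (UNIV \<times> {xs :: 'd list. length xs = n})" by (auto simp: inj_on_def)
  ultimately have "(\<Sum>xs | length xs = Suc n. word xs z * cnj (word xs w)) =
      (\<Sum>x\<in>UNIV \<times> {xs. length xs = n}. word (fst x # snd x) z * cnj (word (fst x # snd x) w))"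
    by (simp only: sum.reindex comp_def case_prod_unfold)
  also have "\<dots> = (\<Sum>i\<in>UNIV. \<Sum>xs | length xs = n. (z $ i * cnj (w $ i)) * (word xs z * cnj (word xs w)))"
    by (simp add: sum.cartesian_product word_def mult_ac case_prod_unfold)
  also have "\<dots> = cinner z w * cinner z w ^ n"
    unfolding sum_product [symmetric] Suc cinner_def ..
  finally show ?case by simp
qed

definition BN :: "nat \<Rightarrow> complex^'d \<Rightarrow> complex^'d \<Rightarrow> complex" where
  "BN r z w = (\<Sum>n\<le>r. of_real (b n) * cinner z w ^ n)"

text \<open>Components of a feature map of \<open>B\<close>; those of length at most
  \<open>r\<close> reproduce \<open>BN r\<close>, and \<open>wb [i]\<close> is
  \<open>\<kappa>\<close> times the coordinate \<open>i\<close>.\<close>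

definition wb :: "'d list \<Rightarrow> complex^'d \<Rightarrow> complex" where
  "wb xs z = of_real (sqrt (b (length xs))) * word xs z"

lemma finite_words: "finite {xs :: 'd list. length xs \<le> r}"
  using finite_lists_length_le [of "UNIV :: 'd set" r] by simp

lemma BN_words: "(\<Sum>xs | length xs \<le> r. wb xs z * cnj (wb xs w)) = BN r z w"
proof -
  have "{xs :: 'd list. length xs \<le> r} = (\<Union>n\<in>{..r}. {xs. length xs = n})" by auto
  then have "(\<Sum>xs | length xs \<le> r. wb xs z * cnj (wb xs w)) = (\<Sum>n\<le>r. \<Sum>xs | length xs = n. wb xs z * cnj (wb xs w))"
    using finite_lists_length_eq [of "UNIV :: 'd set"] by (simp add: sum.UNION_disjoint disjoint_iff)
  also have "\<dots> = (\<Sum>n\<le>r. of_real (b n) * (\<Sum>xs | length xs = n. word xs z * cnj (word xs w)))"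
  proof (rule sum.cong [OF refl])
    fix n
    have "complex_of_real (sqrt (b n)) * complex_of_real (sqrt (b n)) = of_real (b n)"
      using b_nonneg [of n] by (simp flip: of_real_mult)
    then show "(\<Sum>xs | length xs = n. wb xs z * cnj (wb xs w)) = of_real (b n) * (\<Sum>xs | length xs = n. word xs z * cnj (word xs w))"
      unfolding sum_distrib_left wb_def by (intro sum.cong refl) (auto simp: mult_ac)
  qed
  finally show ?thesis by (simp add: word_sum BN_def)
qed

lemma BN_tendsto: "z \<in> ball 0 1 \<Longrightarrow> w \<in> ball 0 1 \<Longrightarrow> (\<lambda>r. BN r z w) \<longlonglongrightarrow> B z w"
  unfolding BN_def using B_sums [of z w] by (simp add: sums_def_le)

lemma psd_BN: "psd (\<lambda>z w. (1 - BN r z w) * K z w)"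
proof (rule psd_K_minus_part [where c = "\<lambda>n. if n \<le> r then b n else 0"])
  show "(\<lambda>n. of_real (if n \<le> r then b n else 0) * cinner z w ^ n) sums BN r z w" for z w
    using sums_If_finite_set [of "{..r}" "\<lambda>n. of_real (b n) * cinner z w ^ n"]
    unfolding BN_def by (simp add: if_distrib if_distribR cong: if_cong)
qed (auto simp: b_nonneg)

text \<open>The row of feature components maps the column with entries
  \<open>\<Sum>m\<in>J. cnj (wb k (w m)) * u m\<close>, plus \<open>v\<close> in the entry
  \<open>[i]\<close>, to \<open>h\<close>. The bound is the squared norm of that column, first for
  truncations of \<open>B\<close> and then in the limit.\<close>

lemma contraction:
  fixes i :: 'd
  assumes J: "finite J" and u: "\<And>m. m \<in> J \<Longrightarrow> in_H K (u m)" and v: "in_H K v"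
    and w: "\<And>m. m \<in> J \<Longrightarrow> w m \<in> ball 0 1"
  defines "h \<equiv> \<lambda>z. (\<Sum>m\<in>J. B z (w m) * u m z) + of_real \<kappa> * z $ i * v z"
  shows "in_H K h"
    "hnorm2 K h \<le> Re (\<Sum>m\<in>J. \<Sum>m'\<in>J. B (w m') (w m) * hinner K (u m) (u m'))
      + 2 * Re (\<Sum>m\<in>J. of_real \<kappa> * cnj (w m $ i) * hinner K (u m) v) + hnorm2 K v"
proof -
  define T where "T D = Re (\<Sum>m\<in>J. \<Sum>m'\<in>J. D (w m') (w m) * hinner K (u m) (u m'))
      + 2 * Re (\<Sum>m\<in>J. of_real \<kappa> * cnj (w m $ i) * hinner K (u m) v) + hnorm2 K v" for D
  have "rk_bound K h (T B)" unfolding rk_bound_iff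
  proof
    fix l :: "(complex \<times> (complex^'d)) list" assume l: "l \<in> bpts"
    let ?h = "\<lambda>N z. (\<Sum>m\<in>J. BN N z (w m) * u m z) + of_real \<kappa> * z $ i * v z"
    \<comment> \<open>A truncation at degree at least 1 contains the one-letter word that carries
      \<open>v\<close>.\<close>
    have le: "(cmod (ev l (?h N)))\<^sup>2 \<le> T (BN N) * Re (form K l l)" if N: "N \<ge> 1" for N
    proof -
      let ?I = "{xs :: 'd list. length xs \<le> N}"
      define \<xi> where "\<xi> k = (\<lambda>z. (\<Sum>m\<in>J. cnj (wb k (w m)) * u m z) + (if k = [i] then 1 else 0) * v z)" for k
      have us: "in_H K (\<lambda>z. \<Sum>m\<in>J. cnj (wb k (w m)) * u m z)" for k
        by (intro in_H_sum in_H_cmul(1) u)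
      have \<xi>: "in_H K (\<xi> k)" for k
        unfolding \<xi>_def by (intro in_H_add(1) us in_H_cmul(1) v)
      have iI: "[i] \<in> ?I" using N by simp
      have wi: "wb [i] z = of_real \<kappa> * z $ i" for z by (simp add: wb_def word_def \<kappa>_def)
      have h: "?h N z = (\<Sum>k\<in>?I. wb k z * \<xi> k z)" for z
      proof -
        have "(\<Sum>k\<in>?I. wb k z * \<xi> k z) = (\<Sum>k\<in>?I. \<Sum>m\<in>J. wb k z * cnj (wb k (w m)) * u m z) + (\<Sum>k\<in>?I. if k = [i] then wb k z * v z else 0)"
          unfolding \<xi>_def by (simp add: distrib_left sum.distrib sum_distrib_left mult.assoc) (auto intro!: sum.cong)
        also have "(\<Sum>k\<in>?I. \<Sum>m\<in>J. wb k z * cnj (wb k (w m)) * u m z) = (\<Sum>m\<in>J. BN N z (w m) * u m z)"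
          by (subst sum.swap) (simp add: sum_distrib_right [symmetric] BN_words)
        also have "(\<Sum>k\<in>?I. if k = [i] then wb k z * v z else 0) = of_real \<kappa> * z $ i * v z"
          using sum.delta [OF finite_words, of "[i]" "\<lambda>k. wb k z * v z"] iI wi by (simp cong: if_cong)
        finally show ?thesis by simp
      qed
      have n: "hnorm2 K (\<xi> k) = Re (\<Sum>m\<in>J. \<Sum>m'\<in>J. cnj (wb k (w m)) * wb k (w m') * hinner K (u m) (u m'))
          + (if k = [i] then 2 * Re (\<Sum>m\<in>J. of_real \<kappa> * cnj (w m $ i) * hinner K (u m) v) + hnorm2 K v else 0)" for k
      proof -
        let ?U = "\<lambda>z. \<Sum>m\<in>J. cnj (wb k (w m)) * u m z"
        have UU: "hinner K ?U ?U = (\<Sum>m\<in>J. \<Sum>m'\<in>J. cnj (wb k (w m)) * wb k (w m') * hinner K (u m) (u m'))"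
        proof -
          have "hinner K ?U ?U = (\<Sum>m\<in>J. cnj (wb k (w m)) * hinner K (u m) ?U)"
            using u us by (simp add: hinner_sum hinner_cmul in_H_cmul(1))
          also have "\<dots> = (\<Sum>m\<in>J. cnj (wb k (w m)) * (\<Sum>m'\<in>J. wb k (w m') * hinner K (u m) (u m')))"
          proof (intro sum.cong refl arg_cong2 [where f = "(*)"])
            fix m assume m: "m \<in> J"
            have "hinner K (u m) ?U = cnj (\<Sum>m'\<in>J. cnj (wb k (w m')) * hinner K (u m') (u m))"
              using hinner_sym [OF us u [OF m]] u m by (simp add: hinner_sum hinner_cmul in_H_cmul(1))
            also have "\<dots> = (\<Sum>m'\<in>J. wb k (w m') * hinner K (u m) (u m'))"
              unfolding cnj_sum using hinner_sym [OF u u [OF m]] by (intro sum.cong refl) simp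
            finally show "hinner K (u m) ?U = (\<Sum>m'\<in>J. wb k (w m') * hinner K (u m) (u m'))" .
          qed
          finally show ?thesis by (simp add: sum_distrib_left mult.assoc)
        qed
        have "hinner K ?U v = (\<Sum>m\<in>J. cnj (wb k (w m)) * hinner K (u m) v)"
          using u v by (simp add: hinner_sum hinner_cmul in_H_cmul(1))
        then have Uv: "hinner K ?U v = (\<Sum>m\<in>J. of_real \<kappa> * cnj (w m $ i) * hinner K (u m) v)" if "k = [i]"
          using that wi by simp
        have "of_real (hnorm2 K (\<xi> k)) = hinner K (\<xi> k) (\<xi> k)" by (simp add: hinner_self \<xi>)
        also have "\<dots> = hinner K ?U ?U + (if k = [i] then hinner K ?U v + cnj (hinner K ?U v) + of_real (hnorm2 K v) else 0)"
          unfolding \<xi>_def using us v hinner_sym [OF us v]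
          by (simp add: hinner_add hinner_add_right in_H_add(1) hinner_self)
        finally have "hnorm2 K (\<xi> k) = Re (hinner K ?U ?U + (if k = [i] then hinner K ?U v + cnj (hinner K ?U v) + of_real (hnorm2 K v) else 0))"
          by (metis Re_complex_of_real)
        then show ?thesis using Uv UU by simp
      qed
      have "(\<Sum>k\<in>?I. hnorm2 K (\<xi> k)) = T (BN N)"
      proof -
        have "(\<Sum>k\<in>?I. \<Sum>m\<in>J. \<Sum>m'\<in>J. cnj (wb k (w m)) * wb k (w m') * hinner K (u m) (u m')) =
            (\<Sum>m\<in>J. \<Sum>m'\<in>J. (\<Sum>k\<in>?I. wb k (w m') * cnj (wb k (w m))) * hinner K (u m) (u m'))"
        proof -
          have "(\<Sum>k\<in>?I. \<Sum>m\<in>J. \<Sum>m'\<in>J. cnj (wb k (w m)) * wb k (w m') * hinner K (u m) (u m')) =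
            (\<Sum>m\<in>J. \<Sum>k\<in>?I. \<Sum>m'\<in>J. cnj (wb k (w m)) * wb k (w m') * hinner K (u m) (u m'))" by (rule sum.swap)
          also have "\<dots> = (\<Sum>m\<in>J. \<Sum>m'\<in>J. \<Sum>k\<in>?I. cnj (wb k (w m)) * wb k (w m') * hinner K (u m) (u m'))"
            by (intro sum.cong refl sum.swap)
          finally show ?thesis by (simp add: sum_distrib_right sum_distrib_left mult_ac)
        qed
        moreover have "(\<Sum>k\<in>?I. if k = [i] then X else 0) = X" for X :: real
          by (subst sum.delta [OF finite_words]) (use iI in simp)
        ultimately show ?thesis
          unfolding n sum.distrib Re_sum [symmetric] T_def BN_words by (simp only: add.assoc)
      qed
      moreover have "psd (\<lambda>z w. (1 - (\<Sum>k\<in>?I. wb k z * cnj (wb k w))) * K z w)"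
        unfolding BN_words by (rule psd_BN)
      ultimately show ?thesis
        using row_contraction [where \<beta> = wb and \<xi> = \<xi> and I = "{xs. length xs \<le> N}", OF _ \<xi> l] unfolding h by simp
    qed
    have "(\<lambda>N. (cmod (ev l (?h N)))\<^sup>2) \<longlonglongrightarrow> (cmod (ev l h))\<^sup>2"
      unfolding h_def using bptsD [OF l] w by (intro tendsto_intros ev_tendsto BN_tendsto) auto
    moreover have "(\<lambda>N. T (BN N) * Re (form K l l)) \<longlonglongrightarrow> T B * Re (form K l l)"
      unfolding T_def using w by (intro tendsto_intros BN_tendsto) auto
    ultimately show "(cmod (ev l h))\<^sup>2 \<le> T B * N l"
      by (rule LIMSEQ_le) (use le in blast)
  qed
  then show "in_H K h" and "hnorm2 K h \<le> Re (\<Sum>m\<in>J. \<Sum>m'\<in>J. B (w m') (w m) * hinner K (u m) (u m'))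
      + 2 * Re (\<Sum>m\<in>J. of_real \<kappa> * cnj (w m $ i) * hinner K (u m) v) + hnorm2 K v"
    unfolding T_def by (auto simp: in_H_def intro: hnorm2_le)
qed

end

section \<open>Multipliers associated with a unit vector\<close>

lemma form_eq_sum:
  "form P l l' = (\<Sum>m<length l. \<Sum>m'<length l'. fst (l ! m) * cnj (fst (l' ! m')) * P (snd (l ! m)) (snd (l' ! m')))"
proof -
  have ev: "ev l g = (\<Sum>m<length l. fst (l ! m) * g (snd (l ! m)))" for l g
    by (simp add: ev_def case_prod_beta sum_list_sum_nth atLeast0LessThan)
  show ?thesis by (simp add: form_def ev sum_distrib_left mult.assoc)
qed

lemma psd_sumI:
  fixes P :: "complex^'d \<Rightarrow> complex^'d \<Rightarrow> complex"
  assumes "\<And>z w. z \<in> ball 0 1 \<Longrightarrow> w \<in> ball 0 1 \<Longrightarrow> P z w = cnj (P w z)"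
    and "\<And>(k :: nat) \<gamma> w. (\<And>m. m < k \<Longrightarrow> w m \<in> ball 0 1) \<Longrightarrow>
      0 \<le> Re (\<Sum>m<k. \<Sum>m'<k. \<gamma> m' * cnj (\<gamma> m) * P (w m') (w m))"
  shows "psd P"
proof (rule psdI)
  fix l :: "(complex \<times> (complex^'d)) list" assume l: "l \<in> bpts"
  have "snd (l ! m) \<in> ball 0 1" if "m < length l" for m
    using l that nth_mem unfolding bpts_def by blast
  then have "0 \<le> Re (\<Sum>m<length l. \<Sum>m'<length l. fst (l ! m') * cnj (fst (l ! m)) * P (snd (l ! m')) (snd (l ! m)))"
    by (rule assms(2))
  then show "0 \<le> Re (form P l l)" unfolding form_eq_sum by (subst sum.swap)
qed (rule assms(1))

lemma psd_point: "psd P \<Longrightarrow> z \<in> ball 0 1 \<Longrightarrow> 0 \<le> Re (P z z)"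
  using psd_nonneg [of P "[(1, z)]"] by (simp add: form_def)

context pick_space
begin

definition mu :: "(complex^'d \<Rightarrow> complex) \<Rightarrow> bool" where "mu u \<longleftrightarrow> (\<exists>C. kmult u C)"

lemma mu_add: "mu u \<Longrightarrow> mu v \<Longrightarrow> mu (\<lambda>z. u z + v z)"
  unfolding mu_def using kmult_add by blast

lemma mu_mult: "mu u \<Longrightarrow> mu v \<Longrightarrow> mu (\<lambda>z. u z * v z)"
  unfolding mu_def using kmult_mult by blast

lemma mu_const: "mu (\<lambda>z. c)"
  unfolding mu_def using kmult_const by blast

lemma mu_cmul: "mu u \<Longrightarrow> mu (\<lambda>z. c * u z)"
  by (rule mu_mult [OF mu_const])

lemma mu_sum: "(\<And>m. m \<in> J \<Longrightarrow> mu (u m)) \<Longrightarrow> mu (\<lambda>z. \<Sum>m\<in>J. u m z)"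
  by (induction J rule: infinite_finite_induct) (auto intro: mu_add mu_const)

lemma mu_K: "w \<in> ball 0 1 \<Longrightarrow> mu (\<lambda>z. K z w)"
  unfolding mu_def by (rule kmult_K)

lemma mu_coord: "mu (\<lambda>z. z $ i)"
  unfolding mu_def using kmult_coord by blast

lemma mu_poly: "is_poly p \<Longrightarrow> mu p"
  unfolding mu_def by (rule kmult_poly)

lemma mu_H: "mu u \<Longrightarrow> in_H K f \<Longrightarrow> in_H K (\<lambda>z. u z * f z)"
  unfolding mu_def using kmult_H by blast

end

locale pick_state = pick_space a K for a and K :: "complex^'d \<Rightarrow> complex^'d \<Rightarrow> complex" +
  fixes F :: "nat \<Rightarrow> complex^'d \<Rightarrow> complex"
  assumes F_H: "\<And>j. in_H K (F j)" and F_sums: "(\<lambda>j. hnorm2 K (F j)) sums 1"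
begin

text \<open>\<^term>\<open>F\<close> is a unit vector \<open>f\<close> of \<open>H \<otimes> \<ell>\<^sup>2\<close>, and \<open>R u v = \<langle>u f, v f\<rangle>\<close>.\<close>

definition R :: "(complex^'d \<Rightarrow> complex) \<Rightarrow> (complex^'d \<Rightarrow> complex) \<Rightarrow> complex" where
  "R u v = (\<Sum>j. hinner K (\<lambda>z. u z * F j z) (\<lambda>z. v z * F j z))"

lemma R_sums: assumes "mu u" "mu v"
  shows "(\<lambda>j. hinner K (\<lambda>z. u z * F j z) (\<lambda>z. v z * F j z)) sums R u v"
proof -
  obtain C D where C: "kmult u C" and D: "kmult v D" using assms unfolding mu_def by blast
  have "norm (hinner K (\<lambda>z. u z * F j z) (\<lambda>z. v z * F j z)) \<le> C * D * hnorm2 K (F j)" for j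
  proof -
    have "norm (hinner K (\<lambda>z. u z * F j z) (\<lambda>z. v z * F j z)) \<le> hn K (\<lambda>z. u z * F j z) * hn K (\<lambda>z. v z * F j z)"
      by (intro hinner_le kmult_H [OF C] kmult_H [OF D] F_H)
    also have "\<dots> \<le> (C * hn K (F j)) * (D * hn K (F j))"
      by (intro mult_mono hn_kmult C D F_H hn_nonneg mult_nonneg_nonneg kmult_nonneg [OF C] kmult_H [OF D])
    also have "\<dots> = C * D * (hn K (F j))\<^sup>2" by (simp add: power2_eq_square)
    finally show ?thesis by (simp add: hn_power2 F_H)
  qed
  then have "summable (\<lambda>j. hinner K (\<lambda>z. u z * F j z) (\<lambda>z. v z * F j z))"
    by (rule summable_comparison_test' [OF summable_mult [OF sums_summable [OF F_sums]]])
  then show ?thesis unfolding R_def by (rule summable_sums)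
qed

lemma R_add: assumes "mu u" "mu u'" "mu v" shows "R (\<lambda>z. u z + u' z) v = R u v + R u' v"
proof (rule sums_unique2 [OF R_sums])
  have "hinner K (\<lambda>z. (u z + u' z) * F j z) (\<lambda>z. v z * F j z) =
      hinner K (\<lambda>z. u z * F j z) (\<lambda>z. v z * F j z) + hinner K (\<lambda>z. u' z * F j z) (\<lambda>z. v z * F j z)" for j
    using hinner_add [OF mu_H [OF assms(1) F_H] mu_H [OF assms(2) F_H] mu_H [OF assms(3) F_H], of j j j]
    by (simp add: distrib_right)
  then show "(\<lambda>j. hinner K (\<lambda>z. (u z + u' z) * F j z) (\<lambda>z. v z * F j z)) sums (R u v + R u' v)"
    using sums_add [OF R_sums R_sums] assms by simp
qed (use assms mu_add in auto)

lemma R_cmul: assumes "mu u" "mu v" shows "R (\<lambda>z. c * u z) v = c * R u v"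
proof (rule sums_unique2 [OF R_sums])
  have "hinner K (\<lambda>z. (c * u z) * F j z) (\<lambda>z. v z * F j z) =
      c * hinner K (\<lambda>z. u z * F j z) (\<lambda>z. v z * F j z)" for j
    using hinner_cmul [OF mu_H [OF assms(1) F_H] mu_H [OF assms(2) F_H], of c j j] by (simp add: mult.assoc)
  then show "(\<lambda>j. hinner K (\<lambda>z. (c * u z) * F j z) (\<lambda>z. v z * F j z)) sums (c * R u v)"
    using sums_mult [OF R_sums] assms by simp
qed (use assms mu_cmul in auto)

lemma R_sym: assumes "mu u" "mu v" shows "R v u = cnj (R u v)"
proof (rule sums_unique2 [OF R_sums])
  show "(\<lambda>j. hinner K (\<lambda>z. v z * F j z) (\<lambda>z. u z * F j z)) sums cnj (R u v)"
    using sums_cnj [THEN iffD2, OF R_sums [OF assms]] hinner_sym [OF mu_H [OF assms(1) F_H] mu_H [OF assms(2) F_H]] by simp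
qed (use assms in auto)

lemma R_comb: assumes "\<And>m. m \<in> J \<Longrightarrow> mu (x m)" "mu v"
  shows "R (\<lambda>z. \<Sum>m\<in>J. c m * x m z) v = (\<Sum>m\<in>J. c m * R (x m) v)"
  using assms(1)
proof (induction J rule: infinite_finite_induct)
  case (insert m J)
  have "R (\<lambda>z. c m * x m z + (\<Sum>m\<in>J. c m * x m z)) v = R (\<lambda>z. c m * x m z) v + R (\<lambda>z. \<Sum>m\<in>J. c m * x m z) v"
    using insert by (intro R_add mu_cmul mu_sum assms(2)) auto
  then show ?case using insert R_cmul [of "x m" v "c m"] assms by simp
qed (use R_cmul [OF mu_const assms(2), of 0] in auto)

lemma R_comb_right: assumes "\<And>m. m \<in> J \<Longrightarrow> mu (x m)" "mu v"
  shows "R v (\<lambda>z. \<Sum>m\<in>J. c m * x m z) = (\<Sum>m\<in>J. cnj (c m) * R v (x m))"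
proof -
  have "R v (\<lambda>z. \<Sum>m\<in>J. c m * x m z) = cnj (R (\<lambda>z. \<Sum>m\<in>J. c m * x m z) v)"
    using assms by (intro R_sym mu_sum mu_cmul) auto
  also have "\<dots> = (\<Sum>m\<in>J. cnj (c m * R (x m) v))" by (simp add: R_comb assms)
  also have "\<dots> = (\<Sum>m\<in>J. cnj (c m) * R v (x m))"
    using R_sym [OF assms(1) assms(2)] by (intro sum.cong refl) simp
  finally show ?thesis .
qed

lemma R_comb_comb: assumes "\<And>m. m \<in> J \<Longrightarrow> mu (x m)"
  shows "R (\<lambda>z. \<Sum>m\<in>J. c m * x m z) (\<lambda>z. \<Sum>m\<in>J. c m * x m z) = (\<Sum>m\<in>J. \<Sum>m'\<in>J. cnj (c m') * c m * R (x m) (x m'))"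
proof -
  have "R (\<lambda>z. \<Sum>m\<in>J. c m * x m z) (\<lambda>z. \<Sum>m\<in>J. c m * x m z) = (\<Sum>m\<in>J. c m * R (x m) (\<lambda>z. \<Sum>m\<in>J. c m * x m z))"
    using assms by (intro R_comb mu_sum mu_cmul) auto
  also have "\<dots> = (\<Sum>m\<in>J. c m * (\<Sum>m'\<in>J. cnj (c m') * R (x m) (x m')))"
    using assms by (intro sum.cong refl arg_cong2 [where f = "(*)"] R_comb_right) auto
  finally show ?thesis by (simp add: sum_distrib_left mult_ac)
qed

lemma R_add_right: assumes "mu u" "mu u'" "mu v" shows "R v (\<lambda>z. u z + u' z) = R v u + R v u'"
  using R_add [OF assms] R_sym [OF mu_add [OF assms(1,2)] assms(3)] R_sym [OF assms(1,3)] R_sym [OF assms(2,3)]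
  by simp

lemma R_cmul_right: assumes "mu u" "mu v" shows "R v (\<lambda>z. c * u z) = cnj c * R v u"
  using R_cmul [OF assms] R_sym [OF mu_cmul [OF assms(1)] assms(2)] R_sym [OF assms] by simp

lemma R_self_sums: assumes "mu u" shows "(\<lambda>j. hnorm2 K (\<lambda>z. u z * F j z)) sums Re (R u u)"
  using sums_Re [OF R_sums [OF assms assms]] hinner_self [OF mu_H [OF assms F_H]] by simp

lemma R_self_nonneg: assumes "mu u" shows "0 \<le> Re (R u u)"
  using sums_le [OF _ sums_zero R_self_sums [OF assms]] hnorm2_nonneg [OF mu_H [OF assms F_H]] by blast

lemma R_self_real: assumes "mu u" shows "R u u = of_real (Re (R u u))"
  using R_sym [OF assms assms] by (simp add: complex_eq_iff)

lemma R_one: "R (\<lambda>z. 1) (\<lambda>z. 1) = 1"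
proof -
  have "Re (R (\<lambda>z. 1) (\<lambda>z. 1)) = 1" using sums_unique2 [OF R_self_sums [OF mu_const, of 1] ] F_sums by simp
  then show ?thesis using R_self_real [OF mu_const, of 1] by simp
qed

lemma R_const_const: "R (\<lambda>z. c) (\<lambda>z. d) = c * cnj d"
  using R_cmul [OF mu_const [of 1] mu_const [of d], of c] R_cmul_right [OF mu_const [of 1] mu_const [of 1], of d] R_one by simp

text \<open>\<open>contraction\<close> applied to the products with each component of the unit
  vector and summed. Values off the ball are immaterial for the norm, so the formula for
  \<open>h\<close> is required only there.\<close>

lemma R_contraction:
  fixes i :: 'd
  assumes J: "finite J" and u: "\<And>m. m \<in> J \<Longrightarrow> mu (u m)" and v: "mu v"
    and w: "\<And>m. m \<in> J \<Longrightarrow> w m \<in> ball 0 1" and h: "mu h"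
    and heq: "\<And>z. z \<in> ball 0 1 \<Longrightarrow> h z = (\<Sum>m\<in>J. B z (w m) * u m z) + of_real \<kappa> * z $ i * v z"
  shows "Re (R h h) \<le> Re (\<Sum>m\<in>J. \<Sum>m'\<in>J. B (w m') (w m) * R (u m) (u m'))
      + 2 * Re (\<Sum>m\<in>J. of_real \<kappa> * cnj (w m $ i) * R (u m) v) + Re (R v v)"
proof (rule sums_le [OF _ R_self_sums [OF h]])
  let ?T = "\<lambda>j. Re (\<Sum>m\<in>J. \<Sum>m'\<in>J. B (w m') (w m) * hinner K (\<lambda>z. u m z * F j z) (\<lambda>z. u m' z * F j z))
      + 2 * Re (\<Sum>m\<in>J. of_real \<kappa> * cnj (w m $ i) * hinner K (\<lambda>z. u m z * F j z) (\<lambda>z. v z * F j z))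
      + hnorm2 K (\<lambda>z. v z * F j z)"
  show "?T sums (Re (\<Sum>m\<in>J. \<Sum>m'\<in>J. B (w m') (w m) * R (u m) (u m'))
      + 2 * Re (\<Sum>m\<in>J. of_real \<kappa> * cnj (w m $ i) * R (u m) v) + Re (R v v))"
    using u v by (intro sums_add sums_mult sums_Re sums_sum R_sums R_self_sums) auto
  fix j
  have "hnorm2 K (\<lambda>z. h z * F j z) =
      hnorm2 K (\<lambda>z. (\<Sum>m\<in>J. B z (w m) * (u m z * F j z)) + of_real \<kappa> * z $ i * (v z * F j z))"
    by (rule hnorm2_cong) (simp add: heq distrib_right sum_distrib_right mult.assoc)
  also have "\<dots> \<le> ?T j" using u v w by (intro contraction J mu_H F_H)
  finally show "hnorm2 K (\<lambda>z. h z * F j z) \<le> ?T j" .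
qed

text \<open>For the Szego kernel on the disc, \<open>2 * V - 1\<close> is the Herglotz integral of
  the probability density given by the squared modulus of the unit vector.\<close>

definition V :: "complex^'d \<Rightarrow> complex" where "V w = R (\<lambda>z. 1) (\<lambda>z. K z w)"
definition W :: "'d \<Rightarrow> complex^'d \<Rightarrow> complex" where "W i w = R (\<lambda>z. 1) (\<lambda>z. z $ i * K z w)"
text \<open>The Cayley transform of \<open>2 * V - 1\<close>, whose real part is nonnegative by
  \<open>V_ge\<close>; \<open>V = 1 / (1 - \<psi>)\<close>.\<close>

definition \<psi> :: "complex^'d \<Rightarrow> complex" where "\<psi> w = 1 - 1 / V w"
text \<open>Normalised so that the vectors \<open>\<eta> w\<close> of \<open>psd_column\<close> are
  orthogonal to the constants.\<close>

definition q :: "'d \<Rightarrow> complex^'d \<Rightarrow> complex" where "q i w = of_real \<kappa> * W i w / V w"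

text \<open>Contractivity compares \<open>K - 1 = B * K\<close> with \<open>K\<close>, both acting
  on the unit vector. Expanding the square leaves
  \<open>1 + r * (1 - B z z) \<le> 2 * Re (V z)\<close> with \<open>r\<close> the squared norm for
  \<open>K\<close>; then \<open>1 - B z z = 1 / K z z\<close>, and evaluation at \<open>z\<close>
  bounds \<open>r\<close> from below.\<close>

lemma V_ge: assumes z: "z \<in> ball 0 1"
  shows "summable (\<lambda>j. (cmod (F j z))\<^sup>2)" "1 + (\<Sum>j. (cmod (F j z))\<^sup>2) \<le> 2 * Re (V z)"
proof -
  let ?k = "\<lambda>x. K x z"
  have k: "mu ?k" by (rule mu_K [OF z])
  have k1: "mu (\<lambda>x. ?k x + -1)" by (intro mu_add k mu_const)
  let ?r = "Re (R ?k ?k)"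
  have z0: "R ?k (\<lambda>x. 0) = 0" using R_cmul_right [OF mu_const k, of 0 0] by simp
  have ImB: "Im (B z z) = 0" using arg_cong [OF B_real [OF z], of Im] by simp
  \<comment> \<open>One point with \<open>u\<close> the kernel function and \<open>v = 0\<close>;
    the coordinate is arbitrary because it multiplies \<open>v\<close>.\<close>
  have "Re (R (\<lambda>x. ?k x + -1) (\<lambda>x. ?k x + -1)) \<le>
      Re (\<Sum>m\<in>{0 :: nat}. \<Sum>m'\<in>{0 :: nat}. B z z * R ?k ?k)
      + 2 * Re (\<Sum>m\<in>{0 :: nat}. of_real \<kappa> * cnj (z $ undefined) * R ?k (\<lambda>x. 0)) + Re (R (\<lambda>x. 0) (\<lambda>x. 0))"
    by (rule R_contraction [where w = "\<lambda>_. z"]) (use k k1 z mu_const B_mult_K [OF _ z] in auto)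
  also have "\<dots> = Re (B z z) * ?r"
    by (simp add: z0 R_const_const ImB del: times_complex.sel) (simp add: ImB)
  also have "R (\<lambda>x. ?k x + -1) (\<lambda>x. ?k x + -1) = R ?k ?k + R ?k (\<lambda>x. -1) + (R (\<lambda>x. -1) ?k + R (\<lambda>x. -1) (\<lambda>x. -1))"
    unfolding R_add [OF k mu_const [of "-1"] k1] R_add_right [OF k mu_const [of "-1"] k]
      R_add_right [OF k mu_const [of "-1"] mu_const [of "-1"]] ..
  also have "R (\<lambda>x. -1) ?k = - V z" using R_cmul [OF mu_const k, of "-1" 1] by (simp add: V_def)
  also have "R ?k (\<lambda>x. -1) = cnj (- V z)" using R_sym [OF mu_const k, of "-1"] R_cmul [OF mu_const k, of "-1" 1] by (simp add: V_def)
  finally have "?r - 2 * Re (V z) + 1 \<le> Re (B z z) * ?r" by (simp add: R_const_const)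
  then have "1 + ?r * (1 - Re (B z z)) \<le> 2 * Re (V z)" by (simp add: algebra_simps)
  then have *: "1 + ?r / Re (K z z) \<le> 2 * Re (V z)" using B_less_1(3) [OF z] by simp
  have s: "(\<lambda>j. hnorm2 K (\<lambda>x. ?k x * F j x) / Re (K z z)) sums (?r / Re (K z z))"
    by (intro sums_divide R_self_sums k)
  \<comment> \<open>Evaluation at \<open>z\<close> has squared norm \<open>K z z\<close>, while the
    product takes the value \<open>K z z * F j z\<close> there.\<close>
  have le: "(cmod (F j z))\<^sup>2 \<le> hnorm2 K (\<lambda>x. ?k x * F j x) / Re (K z z)" for j
  proof -
    have "(cmod (ev [(1, z)] (\<lambda>x. ?k x * F j x)))\<^sup>2 \<le> hnorm2 K (\<lambda>x. ?k x * F j x) * N [(1, z)]"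
      using z by (intro ev_le mu_H k F_H) auto
    then have "(Re (K z z))\<^sup>2 * (cmod (F j z))\<^sup>2 \<le> hnorm2 K (\<lambda>x. ?k x * F j x) * Re (K z z)"
      using K_real [OF z] K_pos [OF z] by (simp add: form_def norm_mult power_mult_distrib) (metis norm_of_real power2_abs)
    then show ?thesis using K_pos [OF z] by (simp add: field_simps power2_eq_square)
  qed
  show sm: "summable (\<lambda>j. (cmod (F j z))\<^sup>2)"
    by (rule summable_comparison_test' [OF sums_summable [OF s]]) (use le in simp)
  have "(\<Sum>j. (cmod (F j z))\<^sup>2) \<le> ?r / Re (K z z)" by (rule sums_le [OF le summable_sums [OF sm] s])
  with * show "1 + (\<Sum>j. (cmod (F j z))\<^sup>2) \<le> 2 * Re (V z)" by simp
qed

lemma V_pos: assumes z: "z \<in> ball 0 1" shows "1 \<le> 2 * Re (V z)" "V z \<noteq> 0"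
proof -
  have "0 \<le> (\<Sum>j. (cmod (F j z))\<^sup>2)" by (rule suminf_nonneg [OF V_ge(1) [OF z]]) simp
  then show "1 \<le> 2 * Re (V z)" using V_ge(2) [OF z] by simp
  then show "V z \<noteq> 0" by auto
qed

text \<open>Write \<^term>\<open>B z w\<close> as the inner product of \<^term>\<open>b z\<close> and \<^term>\<open>b w\<close> in a sequence space and let
  \<^term>\<open>e i\<close> be the basis vector of the coordinate \<^term>\<open>\<kappa> * z $ i\<close>; then \<^term>\<open>cc s t i z w\<close> below is the
  inner product of \<^term>\<open>s z * b z + t z * e i\<close> and \<^term>\<open>s w * b w + t w * e i\<close>.\<close>

definition cc :: "(complex^'d \<Rightarrow> complex) \<Rightarrow> (complex^'d \<Rightarrow> complex) \<Rightarrow> 'd \<Rightarrow> complex^'d \<Rightarrow> complex^'d \<Rightarrow> complex" where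
  "cc s t i z w = s z * cnj (s w) * B z w + s z * cnj (t w) * of_real \<kappa> * z $ i
    + t z * cnj (s w) * of_real \<kappa> * cnj (w $ i) + t z * cnj (t w)"

text \<open>Lurking isometry in inequality form. \<open>Q\<close> is the value that makes
  \<open>\<eta> w\<close> orthogonal to 1 for \<open>R\<close>, and \<open>G\<close> is the Gram
  kernel of these vectors. Row contractivity sends combinations of
  \<open>\<eta> w + cnj (s w)\<close>, joined with the \<open>t w\<close> in the extra direction, to
  combinations of \<open>\<eta> w + cnj (Q w)\<close>. Comparing norms makes \<open>P\<close>
  positive, and adding \<open>G\<close> to \<open>K * P\<close> eliminates \<open>G\<close>.\<close>

lemma psd_column:
  fixes s t :: "complex^'d \<Rightarrow> complex" and i :: 'd
  defines "Q \<equiv> \<lambda>z. s z * \<psi> z + t z * q i z"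
  shows "psd (\<lambda>z w. (cc s t i z w - Q z * cnj (Q w)) * K z w)"
proof -
  define \<eta> where "\<eta> w = (\<lambda>z. (cnj (s w) - cnj (Q w)) * K z w + ((cnj (t w) * of_real \<kappa>) * (z $ i * K z w) + - cnj (s w)))" for w
  define G where "G z w = R (\<eta> w) (\<eta> z)" for z w
  have mu\<eta>: "mu (\<eta> w)" if "w \<in> ball 0 1" for w
    unfolding \<eta>_def by (intro mu_add mu_cmul mu_mult mu_coord mu_K mu_const that)
  \<comment> \<open>Orthogonality removes all cross terms between \<open>\<eta> w\<close> and
    constants in the norms below.\<close>
  have \<eta>1: "R (\<lambda>z. 1) (\<eta> w) = 0" if w: "w \<in> ball 0 1" for w
  proof -
    have m: "mu (\<lambda>z. K z w)" "mu (\<lambda>z. z $ i * K z w)" by (intro mu_mult mu_coord mu_K w)+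
    have "R (\<lambda>z. 1) (\<eta> w) = (s w - Q w) * V w + (t w * of_real \<kappa> * W i w - s w)"
      unfolding \<eta>_def R_add_right [OF mu_cmul [OF m(1)] mu_add [OF mu_cmul [OF m(2)] mu_const] mu_const]
        R_add_right [OF mu_cmul [OF m(2)] mu_const mu_const] R_cmul_right [OF m(1) mu_const] R_cmul_right [OF m(2) mu_const]
        R_const_const V_def W_def by simp
    also have "\<dots> = 0" using V_pos(2) [OF w] by (simp add: Q_def \<psi>_def q_def field_simps)
    finally show ?thesis .
  qed
  have \<eta>1': "R (\<eta> w) (\<lambda>z. 1) = 0" if w: "w \<in> ball 0 1" for w
    using R_sym [OF mu_const mu\<eta> [OF w], of 1] \<eta>1 [OF w] by simp
  have Gsym: "G z w = cnj (G w z)" if "z \<in> ball 0 1" "w \<in> ball 0 1" for z w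
    unfolding G_def using that by (intro R_sym mu\<eta>)
  have psdG: "psd G"
  proof (rule psd_sumI [OF Gsym])
    fix k \<gamma> and w :: "nat \<Rightarrow> complex^'d" assume w: "\<And>m. m < k \<Longrightarrow> w m \<in> ball 0 1"
    have "R (\<lambda>z. \<Sum>m<k. cnj (\<gamma> m) * \<eta> (w m) z) (\<lambda>z. \<Sum>m<k. cnj (\<gamma> m) * \<eta> (w m) z) =
        (\<Sum>m<k. \<Sum>m'<k. cnj (cnj (\<gamma> m')) * cnj (\<gamma> m) * R (\<eta> (w m)) (\<eta> (w m')))"
      using w by (intro R_comb_comb mu\<eta>) auto
    moreover have "0 \<le> Re (R (\<lambda>z. \<Sum>m<k. cnj (\<gamma> m) * \<eta> (w m) z) (\<lambda>z. \<Sum>m<k. cnj (\<gamma> m) * \<eta> (w m) z))"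
      using w by (intro R_self_nonneg mu_sum mu_cmul mu\<eta>) auto
    ultimately show "0 \<le> Re (\<Sum>m<k. \<Sum>m'<k. \<gamma> m' * cnj (\<gamma> m) * G (w m') (w m))"
      by (simp add: G_def)
  qed auto
  define P where "P z w = B z w * G z w + cc s t i z w - G z w - Q z * cnj (Q w)" for z w
  have psdP: "psd P"
  proof (rule psd_sumI)
    fix z w :: "complex^'d" assume zw: "z \<in> ball 0 1" "w \<in> ball 0 1"
    show "P z w = cnj (P w z)"
      unfolding P_def cc_def using Gsym [OF zw] psd_herm [OF psd_B zw] by (simp add: mult_ac)
  next
    fix k \<gamma> and w :: "nat \<Rightarrow> complex^'d" assume w: "\<And>m. m < k \<Longrightarrow> w m \<in> ball 0 1"
    define u where "u m = (\<lambda>z. cnj (\<gamma> m) * (\<eta> (w m) z + cnj (s (w m))))" for m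
    define v where "v = (\<Sum>m<k. cnj (\<gamma> m) * cnj (t (w m)))"
    define h where "h = (\<lambda>z. \<Sum>m<k. cnj (\<gamma> m) * (\<eta> (w m) z + cnj (Q (w m))))"
    have mu: "mu (u m)" if "m < k" for m
      unfolding u_def using w that by (intro mu_cmul mu_add mu\<eta> mu_const)
    have muh: "mu h"
      unfolding h_def using w by (intro mu_sum mu_cmul mu_add mu\<eta> mu_const) auto
    have muc: "mu (\<lambda>z. \<eta> (w m) z + c)" if "m < k" for m c
      using w that by (intro mu_add mu\<eta> mu_const)
    have Rc: "R (\<lambda>z. \<eta> (w m) z + c) (\<lambda>z. \<eta> (w m') z + d) = G (w m') (w m) + c * cnj d"
      if m: "m < k" "m' < k" for m m' c d
    proof -
      have "R (\<lambda>z. \<eta> (w m) z + c) (\<lambda>z. \<eta> (w m') z + d) =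
        (R (\<eta> (w m)) (\<eta> (w m')) + R (\<eta> (w m)) (\<lambda>z. d)) + (R (\<lambda>z. c) (\<eta> (w m')) + R (\<lambda>z. c) (\<lambda>z. d))"
        using R_add [OF mu\<eta> [OF w [OF m(1)]] mu_const muc [OF m(2)]]
          R_add_right [OF mu\<eta> [OF w [OF m(2)]] mu_const mu\<eta> [OF w [OF m(1)]]]
          R_add_right [OF mu\<eta> [OF w [OF m(2)]] mu_const mu_const] by simp
      moreover have "R (\<eta> (w m)) (\<lambda>z. d) = 0"
        using R_cmul_right [OF mu_const mu\<eta> [OF w [OF m(1)]], of d 1] \<eta>1' [OF w [OF m(1)]] by simp
      moreover have "R (\<lambda>z. c) (\<eta> (w m')) = 0"
        using R_cmul [OF mu_const mu\<eta> [OF w [OF m(2)]], of c 1] \<eta>1 [OF w [OF m(2)]] by simp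
      ultimately show ?thesis by (simp add: R_const_const G_def)
    qed
    \<comment> \<open>By \<open>B * K = K - 1\<close>, multiplication by \<open>B\<close> turns
      \<open>\<eta> w + cnj (s w)\<close> into \<open>\<eta> w + cnj (Q w)\<close> up to the term
      with coordinate \<open>i\<close>, which the \<open>v\<close> term restores.\<close>
    have heq: "h z = (\<Sum>m<k. B z (w m) * u m z) + of_real \<kappa> * z $ i * v" if z: "z \<in> ball 0 1" for z
    proof -
      have "B z (w m) * u m z + of_real \<kappa> * z $ i * (cnj (\<gamma> m) * cnj (t (w m))) = cnj (\<gamma> m) * (\<eta> (w m) z + cnj (Q (w m)))"
        if m: "m < k" for m
      proof -
        have e: "B z (w m) * (\<eta> (w m) z + cnj (s (w m))) =
            (cnj (s (w m)) - cnj (Q (w m)) + (cnj (t (w m)) * of_real \<kappa>) * z $ i) * (B z (w m) * K z (w m))"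
          unfolding \<eta>_def by (simp add: algebra_simps)
        have "B z (w m) * u m z = cnj (\<gamma> m) * (B z (w m) * (\<eta> (w m) z + cnj (s (w m))))"
          unfolding u_def by (simp add: mult_ac)
        also have "\<dots> = cnj (\<gamma> m) * ((cnj (s (w m)) - cnj (Q (w m)) + (cnj (t (w m)) * of_real \<kappa>) * z $ i) * (K z (w m) - 1))"
          unfolding e B_mult_K [OF z w [OF m]] ..
        finally show ?thesis unfolding \<eta>_def by (simp add: algebra_simps)
      qed
      then show ?thesis unfolding h_def v_def sum_distrib_left sum.distrib [symmetric] by (intro sum.cong refl) simp
    qed
    have Rh: "R h h = (\<Sum>m<k. \<Sum>m'<k. \<gamma> m' * cnj (\<gamma> m) * (G (w m') (w m) + cnj (Q (w m)) * Q (w m')))"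
    proof -
      have "R h h = (\<Sum>m<k. \<Sum>m'<k. cnj (cnj (\<gamma> m')) * cnj (\<gamma> m) * R (\<lambda>z. \<eta> (w m) z + cnj (Q (w m))) (\<lambda>z. \<eta> (w m') z + cnj (Q (w m'))))"
        unfolding h_def using muc by (intro R_comb_comb) auto
      then show ?thesis using Rc by simp
    qed
    have Ru: "R (u m) (u m') = \<gamma> m' * cnj (\<gamma> m) * (G (w m') (w m) + cnj (s (w m)) * s (w m'))" if "m < k" "m' < k" for m m'
      unfolding u_def using R_cmul [OF muc [OF that(1)] mu_cmul [OF muc [OF that(2)]]]
        R_cmul_right [OF muc [OF that(2)] muc [OF that(1)]] Rc [OF that] by simp
    have Rv: "R (u m) (\<lambda>z. v) = (\<Sum>m'<k. \<gamma> m' * cnj (\<gamma> m) * (cnj (s (w m)) * t (w m')))" if m: "m < k" for m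
    proof -
      have "R (\<lambda>z. \<eta> (w m) z + cnj (s (w m))) (\<lambda>z. v) = cnj (s (w m)) * cnj v"
        using R_add [OF mu\<eta> [OF w [OF m]] mu_const mu_const]
          R_cmul_right [OF mu_const mu\<eta> [OF w [OF m]], of v 1] \<eta>1' [OF w [OF m]] by (simp add: R_const_const)
      then have "R (u m) (\<lambda>z. v) = cnj (\<gamma> m) * (cnj (s (w m)) * cnj v)"
        unfolding u_def using R_cmul [OF muc [OF m] mu_const] by simp
      then show ?thesis unfolding v_def by (simp add: sum_distrib_left mult_ac)
    qed
    let ?S = "\<lambda>f. \<Sum>m<k. \<Sum>m'<k. \<gamma> m' * cnj (\<gamma> m) * f m m'"
    have S_add: "?S (\<lambda>m m'. f m m' + g m m') = ?S f + ?S g" for f g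
      by (simp add: distrib_left sum.distrib)
    have S_diff: "?S (\<lambda>m m'. f m m' - g m m') = ?S f - ?S g" for f g
      by (simp add: right_diff_distrib sum_subtractf)
    \<comment> \<open>Exchanging the two indices conjugates the sum. So twice the real part of the
      mixed term in the contraction bound equals the two conjugate mixed terms of
      \<open>cc\<close>.\<close>
    have S_cnj: "Re (?S (\<lambda>m m'. cnj (f m' m))) = Re (?S f)" for f
    proof -
      have "cnj (?S f) = (\<Sum>m<k. \<Sum>m'<k. \<gamma> m * cnj (\<gamma> m') * cnj (f m m'))" by (simp add: mult_ac)
      also have "\<dots> = ?S (\<lambda>m m'. cnj (f m' m))" by (rule sum.swap)
      finally have e: "cnj (?S f) = ?S (\<lambda>m m'. cnj (f m' m))" .
      show ?thesis unfolding e [symmetric] by (rule cnj.sel(1))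
    qed
    have "Re (R h h) \<le> Re (\<Sum>m<k. \<Sum>m'<k. B (w m') (w m) * R (u m) (u m'))
      + 2 * Re (\<Sum>m<k. of_real \<kappa> * cnj (w m $ i) * R (u m) (\<lambda>z. v)) + Re (R (\<lambda>z. v) (\<lambda>z. v))"
      using mu w muh heq by (intro R_contraction mu_const) auto
    also have "(\<Sum>m<k. \<Sum>m'<k. B (w m') (w m) * R (u m) (u m')) =
        ?S (\<lambda>m m'. B (w m') (w m) * (G (w m') (w m) + cnj (s (w m)) * s (w m')))"
      using Ru by (intro sum.cong refl) (simp add: mult_ac)
    also have "(\<Sum>m<k. of_real \<kappa> * cnj (w m $ i) * R (u m) (\<lambda>z. v)) =
        ?S (\<lambda>m m'. of_real \<kappa> * cnj (w m $ i) * (cnj (s (w m)) * t (w m')))"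
      using Rv by (intro sum.cong refl) (simp add: sum_distrib_left mult_ac)
    also have "R (\<lambda>z. v) (\<lambda>z. v) = ?S (\<lambda>m m'. cnj (t (w m)) * t (w m'))"
      unfolding R_const_const v_def by (simp add: sum_product mult_ac) (subst sum.swap, simp add: mult_ac)
    also note Rh
    finally have le: "Re (?S (\<lambda>m m'. G (w m') (w m) + cnj (Q (w m)) * Q (w m'))) \<le>
        Re (?S (\<lambda>m m'. B (w m') (w m) * (G (w m') (w m) + cnj (s (w m)) * s (w m'))))
      + 2 * Re (?S (\<lambda>m m'. of_real \<kappa> * cnj (w m $ i) * (cnj (s (w m)) * t (w m'))))
      + Re (?S (\<lambda>m m'. cnj (t (w m)) * t (w m')))" .
    let ?f1 = "\<lambda>m m'. B (w m') (w m) * (G (w m') (w m) + cnj (s (w m)) * s (w m'))"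
    let ?f2 = "\<lambda>m m'. of_real \<kappa> * cnj (w m $ i) * (cnj (s (w m)) * t (w m'))"
    let ?f2' = "\<lambda>m m'. cnj (?f2 m' m)"
    let ?f3 = "\<lambda>m m'. cnj (t (w m)) * t (w m')"
    let ?f4 = "\<lambda>m m'. G (w m') (w m) + cnj (Q (w m)) * Q (w m')"
    have "P (w m') (w m) = ((?f1 m m' + ?f2 m m') + (?f2' m m' + ?f3 m m')) - ?f4 m m'" for m m'
      unfolding P_def cc_def by (simp add: algebra_simps)
    then have "?S (\<lambda>m m'. P (w m') (w m)) = ?S (\<lambda>m m'. ((?f1 m m' + ?f2 m m') + (?f2' m m' + ?f3 m m')) - ?f4 m m')"
      by presburger
    also have "\<dots> = ((?S ?f1 + ?S ?f2) + (?S ?f2' + ?S ?f3)) - ?S ?f4"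
      unfolding S_diff S_add ..
    finally have "Re (?S (\<lambda>m m'. P (w m') (w m))) = Re (?S ?f1) + Re (?S ?f2) + (Re (?S ?f2') + Re (?S ?f3)) - Re (?S ?f4)"
      by (simp only: plus_complex.sel minus_complex.sel)
    then show "0 \<le> Re (?S (\<lambda>m m'. P (w m') (w m)))" using le S_cnj [of ?f2] by linarith
  qed
  \<comment> \<open>The coefficient of \<open>G\<close> in this sum is
    \<open>1 + B * K - K = 0\<close>.\<close>
  have "psd (\<lambda>z w. K z w * P z w + G z w)" by (intro psd_add psd_K_mult psdP psdG)
  then show ?thesis
  proof (rule psd_cong)
    fix z w :: "complex^'d" assume zw: "z \<in> ball 0 1" "w \<in> ball 0 1"
    have "K z w * P z w + G z w = G z w * (1 + B z w * K z w - K z w) + (cc s t i z w - Q z * cnj (Q w)) * K z w"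
      unfolding P_def by (simp add: algebra_simps)
    then show "K z w * P z w + G z w = (cc s t i z w - Q z * cnj (Q w)) * K z w" using B_mult_K [OF zw] by simp
  qed
qed

text \<open>With \<open>s = 1\<close>, \<open>t = 0\<close> the kernel \<open>cc\<close> is
  \<open>B\<close>, and adding the constant kernel 1 replaces \<open>B * K\<close> by
  \<open>K\<close>. For \<open>q i\<close> the choice \<open>s = 0\<close>, \<open>t = 1\<close>
  gives \<open>cc = 1\<close> directly.\<close>

lemma kmult_psi: "kmult \<psi> 1"
proof -
  have "psd (\<lambda>z w. (cc (\<lambda>_. 1) (\<lambda>_. 0) undefined z w - \<psi> z * cnj (\<psi> w)) * K z w + 1)"
    using psd_add [OF psd_column [of "\<lambda>_. 1" "\<lambda>_. 0"] psd_one] by simp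
  then have "psd (\<lambda>z w. (of_real (1\<^sup>2) - \<psi> z * cnj (\<psi> w)) * K z w)"
    by (rule psd_cong) (simp add: cc_def left_diff_distrib B_mult_K)
  then show ?thesis by (subst kmult_iff_psd) auto
qed

lemma kmult_q: "kmult (q i) 1"
proof -
  have "psd (\<lambda>z w. (of_real (1\<^sup>2) - q i z * cnj (q i w)) * K z w)"
    using psd_column [of "\<lambda>_. 0" "\<lambda>_. 1" i] by (simp add: cc_def)
  then show ?thesis by (subst kmult_iff_psd) auto
qed

text \<open>The diagonal of \<open>psd_column\<close> for constant \<open>s\<close> and
  \<open>t\<close>; these free scalars are optimised in the estimates below.\<close>

lemma column_point:
  assumes z: "z \<in> ball 0 1"
  shows "(cmod (s * \<psi> z + t * q i z))\<^sup>2 \<le> (cmod s)\<^sup>2 * Re (B z z) + 2 * Re (s * cnj t * of_real \<kappa> * z $ i) + (cmod t)\<^sup>2"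
proof -
  let ?Q = "s * \<psi> z + t * q i z"
  have "0 \<le> Re ((cc (\<lambda>_. s) (\<lambda>_. t) i z z - ?Q * cnj ?Q) * K z z)"
    using psd_point [OF psd_column [of "\<lambda>_. s" "\<lambda>_. t" i] z] .
  also have "\<dots> = Re (cc (\<lambda>_. s) (\<lambda>_. t) i z z - ?Q * cnj ?Q) * Re (K z z)"
    using K_real [OF z] by (metis Im_complex_of_real times_complex.sel(1) mult_zero_right diff_zero)
  finally have "0 \<le> Re (cc (\<lambda>_. s) (\<lambda>_. t) i z z - ?Q * cnj ?Q)" using K_pos [OF z] by (simp add: zero_le_mult_iff)
  moreover have "?Q * cnj ?Q = of_real ((cmod ?Q)\<^sup>2)" by (rule complex_norm_square [symmetric])
  moreover have "Re (cc (\<lambda>_. s) (\<lambda>_. t) i z z) = (cmod s)\<^sup>2 * Re (B z z) + 2 * Re (s * cnj t * of_real \<kappa> * z $ i) + (cmod t)\<^sup>2"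
  proof -
    have "s * cnj s = of_real ((cmod s)\<^sup>2)" "t * cnj t = of_real ((cmod t)\<^sup>2)" by (rule complex_norm_square [symmetric])+
    then have "Re (s * cnj s * B z z) = (cmod s)\<^sup>2 * Re (B z z)" "Re (t * cnj t) = (cmod t)\<^sup>2"
      by (simp_all only: Re_complex_of_real times_complex.sel Im_complex_of_real mult_zero_left diff_zero)
    moreover have "Re (t * cnj s * of_real \<kappa> * cnj (z $ i)) = Re (s * cnj t * of_real \<kappa> * z $ i)"
      by (simp add: algebra_simps)
    ultimately show ?thesis unfolding cc_def by (simp only: plus_complex.sel)
  qed
  ultimately show ?thesis by (simp only: minus_complex.sel Re_complex_of_real)
qed

lemma psi_less_1: assumes z: "z \<in> ball 0 1" shows "cmod (\<psi> z) < 1"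
proof -
  have "(cmod (\<psi> z))\<^sup>2 < 1\<^sup>2" using column_point [OF z, of 1 0] B_less_1(1) [OF z] by simp
  then show ?thesis by (rule power_less_imp_less_base) simp
qed

text \<open>Take \<open>s = 1\<close> and \<open>t\<close> the conjugate of the deviation
  \<open>\<delta>\<close> in \<open>column_point\<close>, and bound the left side below by
  \<open>2 * Re x - 1 \<le> (cmod x)\<^sup>2\<close>. The mixed terms combine to
  \<open>2 * (cmod \<delta>)\<^sup>2\<close>, one half of which survives.\<close>

lemma q_near: assumes z: "z \<in> ball 0 1"
  shows "(cmod (q i z - of_real \<kappa> * cnj (z $ i)))\<^sup>2 \<le> 2 - 2 * Re (\<psi> z)"
proof -
  define \<delta> where "\<delta> = q i z - of_real \<kappa> * cnj (z $ i)"
  define \<theta> where "\<theta> = cnj \<delta>"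
  have 1: "(cmod (\<psi> z + \<theta> * q i z))\<^sup>2 \<le> 1 + 2 * Re (cnj \<theta> * of_real \<kappa> * z $ i) + (cmod \<theta>)\<^sup>2"
    using column_point [OF z, of 1 \<theta> i] B_less_1(1) [OF z] by simp
  have 2: "2 * Re x - 1 \<le> (cmod x)\<^sup>2" for x
  proof -
    have "0 \<le> (Re x - 1)\<^sup>2 + (Im x)\<^sup>2" by simp
    then show ?thesis by (simp add: cmod_power2 power2_diff)
  qed
  have 2: "2 * Re (\<psi> z + \<theta> * q i z) - 1 \<le> (cmod (\<psi> z + \<theta> * q i z))\<^sup>2" by (rule 2)
  have 3: "Re (\<theta> * q i z) - Re (cnj \<theta> * of_real \<kappa> * z $ i) = Re (\<theta> * \<delta>)"
    unfolding \<delta>_def by (simp add: algebra_simps)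
  have "\<theta> * \<delta> = of_real ((cmod \<delta>)\<^sup>2)" unfolding \<theta>_def by (simp only: complex_norm_square mult.commute)
  then have 4: "Re (\<theta> * \<delta>) = (cmod \<delta>)\<^sup>2" by (simp only: Re_complex_of_real)
  have 5: "cmod \<theta> = cmod \<delta>" by (simp add: \<theta>_def)
  show ?thesis using 1 2 3 4 unfolding 5 \<delta>_def [symmetric] by simp
qed

end

section \<open>Measure-theoretic tools: selection, averaging, vanishing densities\<close>

text \<open>Elements of almost minimal norm in the shrinking midpoint-convex sets \<^term>\<open>C n\<close> form a Cauchy
  sequence by the parallelogram law; this replaces weak compactness of balls in \<open>L\<^sup>2\<close>.\<close>

lemma (in finite_measure) midpoint_selection:
  fixes C :: "nat \<Rightarrow> ('a \<Rightarrow> 'b :: euclidean_space) set"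
  assumes ne: "\<And>n. C n \<noteq> {}" and dec: "\<And>m n. n \<le> m \<Longrightarrow> C m \<subseteq> C n"
    and mid: "\<And>n f g. f \<in> C n \<Longrightarrow> g \<in> C n \<Longrightarrow> (\<lambda>x. (1 / 2) *\<^sub>R (f x + g x)) \<in> C n"
    and meas: "\<And>n f. f \<in> C n \<Longrightarrow> f \<in> borel_measurable M"
    and bd: "\<And>n f x. f \<in> C n \<Longrightarrow> norm (f x) \<le> D"
  obtains f where "\<And>n. f n \<in> C n" "AE x in M. Cauchy (\<lambda>n. f n x)"
proof -
  define I where "I f = (\<integral>x. (norm (f x))\<^sup>2 \<partial>M)" for f :: "'a \<Rightarrow> 'b"
  define d where "d n = Inf (I ` C n)" for n
  have Dn: "norm (norm (f x)) \<le> D" "norm ((norm (f x))\<^sup>2) \<le> D\<^sup>2" if "f \<in> C n" for f n x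
    using bd [OF that, of x] by (auto intro: power_mono)
  have int: "integrable M (\<lambda>x. (norm (f x))\<^sup>2)" if f: "f \<in> C n" for f n
    by (intro integrable_const_bound [where B = "D\<^sup>2"] AE_I2 borel_measurable_power Dn(2) [OF f]
      measurable_compose [OF meas [OF f] borel_measurable_norm])
  have I0: "0 \<le> I f" for f by (simp add: I_def)
  have bdd: "bdd_below (I ` C n)" for n using I0 by (intro bdd_belowI [of _ 0]) auto
  have dI: "d n \<le> I f" if "f \<in> C n" for f n unfolding d_def using that bdd by (intro cInf_lower) auto
  have IB: "I f \<le> D\<^sup>2 * measure M (space M)" if f: "f \<in> C n" for f n
  proof -
    have "I f \<le> (\<integral>x. D\<^sup>2 \<partial>M)" unfolding I_def using Dn(2) [OF f] by (intro integral_mono int [OF f]) auto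
    then show ?thesis by (simp add: mult.commute)
  qed
  have "incseq d" unfolding incseq_def d_def using dec ne bdd by (auto intro!: cInf_superset_mono image_mono)
  moreover have "d n \<le> D\<^sup>2 * measure M (space M)" for n using ne [of n] dI IB by (meson all_not_in_conv order_trans)
  ultimately obtain L where L: "d \<longlonglongrightarrow> L" "\<And>n. d n \<le> L" using incseq_convergent by metis
  have "\<forall>n. \<exists>f. f \<in> C n \<and> I f < d n + 1 / real (Suc n)"
  proof
    fix n
    have "Inf (I ` C n) < d n + 1 / real (Suc n)" by (simp add: d_def)
    moreover have "I ` C n \<noteq> {}" using ne by simp
    ultimately obtain y where "y \<in> I ` C n" "y < d n + 1 / real (Suc n)" by (meson cInf_lessD)
    then show "\<exists>f. f \<in> C n \<and> I f < d n + 1 / real (Suc n)" by blast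
  qed
  from choice [OF this] obtain f where f: "\<And>n. f n \<in> C n" "\<And>n. I (f n) < d n + 1 / real (Suc n)" by blast
  have int1: "integrable M (f n)" for n
    using meas [OF f(1)] bd [OF f(1)] by (intro integrable_const_bound [where B = D]) auto
  \<comment> \<open>The midpoint of two late members again lies in \<open>C n\<close>, so its energy
    is at least \<open>d n\<close>; the parallelogram law converts this into closeness in mean
    square.\<close>
  have diff: "(\<integral>x. (norm (f i x - f j x))\<^sup>2 \<partial>M) \<le> 4 * (L + 1 / real (Suc n) - d n)" if ij: "n \<le> i" "n \<le> j" for i j n
  proof -
    have fij: "f i \<in> C n" "f j \<in> C n" using f(1) dec ij by auto
    let ?m = "\<lambda>x. (1 / 2) *\<^sub>R (f i x + f j x)"
    have m: "?m \<in> C n" by (rule mid [OF fij])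
    have "(norm (f i x - f j x))\<^sup>2 = 2 * (norm (f i x))\<^sup>2 + 2 * (norm (f j x))\<^sup>2 - 4 * (norm (?m x))\<^sup>2" for x
      by (simp add: power_mult_distrib power2_norm_eq_inner inner_add_left inner_add_right inner_diff_left
        inner_diff_right inner_commute power_divide field_simps)
    then have "(\<integral>x. (norm (f i x - f j x))\<^sup>2 \<partial>M) = (\<integral>x. 2 * (norm (f i x))\<^sup>2 + 2 * (norm (f j x))\<^sup>2 - 4 * (norm (?m x))\<^sup>2 \<partial>M)"
      by presburger
    also have "\<dots> = 2 * I (f i) + 2 * I (f j) - 4 * I ?m"
      unfolding I_def using int [OF fij(1)] int [OF fij(2)] int [OF m] by simp
    also have "\<dots> \<le> 4 * (L + 1 / real (Suc n) - d n)"
      using f(2)[of i] f(2)[of j] L(2)[of i] L(2)[of j] dI [OF m]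
        divide_left_mono [of "real (Suc n)" "real (Suc i)" 1] divide_left_mono [of "real (Suc n)" "real (Suc j)" 1] ij
      by simp
    finally show ?thesis .
  qed
  have "\<exists>N. \<forall>i\<ge>N. \<forall>j\<ge>N. (\<integral>x. norm (f i x - f j x) \<partial>M) < e" if e: "e > 0" for e
  proof -
    define V where "V = measure M (space M) + 1"
    have V: "V > 0" using measure_nonneg [of M "space M"] by (simp add: V_def add_nonneg_pos del: measure_nonneg)
    \<comment> \<open>Weight in \<open>g \<le> s + g\<^sup>2 / s\<close>, which passes from mean
      square to mean; it makes the constant part contribute at most \<open>e / 2\<close>.\<close>
    define s where "s = e / (2 * V)"
    have s: "s > 0" using e V by (simp add: s_def)
    have "(\<lambda>n. 4 * (L + 1 / real (Suc n) - d n)) \<longlonglongrightarrow> 4 * (L + 0 - L)"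
      using LIMSEQ_inverse_real_of_nat L(1) by (intro tendsto_intros) (simp add: inverse_eq_divide)
    then have "\<forall>\<^sub>F n in sequentially. 4 * (L + 1 / real (Suc n) - d n) < s * (e / 2)"
      using s e by (intro order_tendstoD(2) [of _ 0]) auto
    then obtain N where N: "4 * (L + 1 / real (Suc N) - d N) < s * (e / 2)"
      unfolding eventually_sequentially by blast
    show ?thesis
    proof (intro exI allI impI)
      fix i j assume ij: "N \<le> i" "N \<le> j"
      let ?g = "\<lambda>x. norm (f i x - f j x)"
      have am: "?g x \<le> s + (?g x)\<^sup>2 / s" for x
      proof -
        have "0 \<le> (?g x - s)\<^sup>2" by simp
        then have "2 * (s * ?g x) \<le> s\<^sup>2 + (?g x)\<^sup>2" by (simp add: power2_diff mult_ac)
        moreover have "0 \<le> s * ?g x" using s by simp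
        ultimately have "s * ?g x \<le> s\<^sup>2 + (?g x)\<^sup>2" by linarith
        then show ?thesis using s by (simp add: field_simps power2_eq_square)
      qed
      have gb: "norm ((?g x)\<^sup>2) \<le> (2 * D)\<^sup>2" for x
      proof -
        have "?g x \<le> 2 * D"
          using norm_triangle_ineq4 [of "f i x" "f j x"] bd [OF f(1), of i x] bd [OF f(1), of j x] by linarith
        then have "(?g x)\<^sup>2 \<le> (2 * D)\<^sup>2" by (rule power_mono) simp
        then show ?thesis by simp
      qed
      have ig2: "integrable M (\<lambda>x. (?g x)\<^sup>2)"
        using meas [OF f(1), of i] meas [OF f(1), of j] gb by (intro integrable_const_bound [where B = "(2 * D)\<^sup>2"]) auto
      have "(\<integral>x. ?g x \<partial>M) \<le> (\<integral>x. s + (?g x)\<^sup>2 / s \<partial>M)"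
        using am ig2 int1 by (intro integral_mono) auto
      also have "\<dots> = s * measure M (space M) + (\<integral>x. (?g x)\<^sup>2 \<partial>M) / s" using ig2 by (simp add: mult.commute)
      also have "\<dots> < e / 2 + e / 2"
      proof (rule add_le_less_mono)
        have "s * measure M (space M) \<le> s * V" using s by (intro mult_left_mono) (auto simp: V_def)
        then show "s * measure M (space M) \<le> e / 2" using V by (simp add: s_def)
        show "(\<integral>x. (?g x)\<^sup>2 \<partial>M) / s < e / 2"
          unfolding pos_divide_less_eq [OF s] using le_less_trans [OF diff [OF ij] N] by (simp add: mult.commute)
      qed
      finally show "(\<integral>x. ?g x \<partial>M) < e" by simp
    qed
  qed
  \<comment> \<open>Passing to a subsequence keeps the n-th member in \<open>C n\<close>, since its
    index is at least n and the sets decrease.\<close>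
  from cauchy_L1_AE_cauchy_subseq [OF int1 this] obtain r where r: "strict_mono r" "AE x in M. Cauchy (\<lambda>n. f (r n) x)"
    by blast
  have "f (r n) \<in> C n" for n using f(1)[of "r n"] dec [OF strict_mono_imp_increasing [OF r(1), of n]] by blast
  then show ?thesis using that [of "\<lambda>n. f (r n)"] r(2) by blast
qed

text \<open>For \<^term>\<open>cmod s \<le> 1\<close> the averages of \<^term>\<open>s ^ k\<close> over \<open>m \<le> k < 2 * m\<close> tend to the indicator of
  \<^term>\<open>s = 1\<close>; starting at \<open>m\<close> makes the corresponding averages of a null sequence trivially null.\<close>

lemma power_average_tendsto:
  assumes s: "cmod s \<le> 1"
  shows "(\<lambda>m. (\<Sum>k<Suc m. s ^ (Suc m + k)) / of_nat (Suc m)) \<longlonglongrightarrow> (if s = 1 then 1 else 0)"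
proof (cases "s = 1")
  case True then show ?thesis by (simp del: of_nat_Suc sum.lessThan_Suc)
next
  case False
  have "(\<lambda>m. (\<Sum>k<Suc m. s ^ (Suc m + k)) / of_nat (Suc m)) \<longlonglongrightarrow> 0"
  proof (rule Lim_null_comparison)
    show "\<forall>\<^sub>F m in sequentially. norm ((\<Sum>k<Suc m. s ^ (Suc m + k)) / of_nat (Suc m)) \<le> (2 / cmod (1 - s)) * inverse (real (Suc m))"
    proof (intro always_eventually allI)
      fix m
      have "(\<Sum>k<Suc m. s ^ (Suc m + k)) = s ^ Suc m * ((1 - s ^ Suc m) / (1 - s))"
        using False sum_gp_strict [of s "Suc m"] by (simp only: power_add sum_distrib_left [symmetric] if_False)
      then have "cmod (\<Sum>k<Suc m. s ^ (Suc m + k)) = cmod (s ^ Suc m) * cmod (1 - s ^ Suc m) / cmod (1 - s)"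
        by (simp only: norm_mult norm_divide times_divide_eq_right)
      also have "\<dots> \<le> 1 * 2 / cmod (1 - s)"
      proof (intro divide_right_mono mult_mono)
        have p: "cmod (s ^ Suc m) \<le> 1" using s power_le_one [of "cmod s" "Suc m"] by (simp only: norm_power norm_ge_zero)
        then show "cmod (s ^ Suc m) \<le> 1" .
        show "cmod (1 - s ^ Suc m) \<le> 2" using norm_triangle_ineq4 [of 1 "s ^ Suc m"] p by simp
      qed auto
      finally have "cmod (\<Sum>k<Suc m. s ^ (Suc m + k)) / real (Suc m) \<le> 1 * 2 / cmod (1 - s) / real (Suc m)"
        by (rule divide_right_mono) simp
      then show "norm ((\<Sum>k<Suc m. s ^ (Suc m + k)) / of_nat (Suc m)) \<le> (2 / cmod (1 - s)) * inverse (real (Suc m))"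
        by (simp only: norm_divide norm_of_nat mult_1 divide_inverse norm_mult norm_inverse)
    qed
    show "(\<lambda>m. (2 / cmod (1 - s)) * inverse (real (Suc m))) \<longlonglongrightarrow> 0"
      using tendsto_mult_right_zero [OF LIMSEQ_inverse_real_of_nat] .
  qed
  then show ?thesis using False by simp
qed

text \<open>If the integrals of all continuous functions against \<^term>\<open>H\<close> vanish, then so do those over closed sets.\<close>

lemma AE_zero_of_continuous:
  fixes M :: "'a :: euclidean_space measure" and H :: "'a \<Rightarrow> complex"
  assumes "finite_measure M" and sets: "sets M = sets borel" and H: "integrable M H"
    and c: "\<And>g :: 'a \<Rightarrow> real. continuous_on UNIV g \<Longrightarrow> (\<And>x. \<bar>g x\<bar> \<le> 1) \<Longrightarrow> (\<integral>x. of_real (g x) * H x \<partial>M) = 0"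
  shows "AE x in M. H x = 0"
proof -
  interpret finite_measure M by fact
  show ?thesis
  proof (rule density_zero [OF H])
  have mb: "borel_measurable M = (borel_measurable borel :: ('a \<Rightarrow> 'c :: topological_space) set)" by (rule measurable_cong_sets [OF sets refl])
  have Hm: "H \<in> borel_measurable M" using H by simp
  have c1: "(\<integral>x. H x \<partial>M) = 0" using c [of "\<lambda>_. 1"] by simp
  have cl: "(\<integral>x. indicat_real A x *\<^sub>R H x \<partial>M) = 0" if A: "closed A" for A
  proof (cases "A = {}")
    case False
    \<comment> \<open>Continuous functions with values in the unit interval that decrease to the
      indicator of the closed set.\<close>
    let ?g = "\<lambda>n x. max 0 (1 - real n * infdist x A)"
    have "(\<lambda>n. \<integral>x. ?g n x *\<^sub>R H x \<partial>M) \<longlonglongrightarrow> (\<integral>x. indicat_real A x *\<^sub>R H x \<partial>M)"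
    proof (rule integral_dominated_convergence)
      show "integrable M (\<lambda>x. norm (H x))" using H by simp
      show "(\<lambda>x. indicat_real A x *\<^sub>R H x) \<in> borel_measurable M"
        using A Hm by (intro borel_measurable_scaleR borel_measurable_indicator) (auto simp: sets)
      show "(\<lambda>x. ?g n x *\<^sub>R H x) \<in> borel_measurable M" for n
      proof (intro borel_measurable_scaleR Hm)
        have "continuous_on UNIV (?g n)" by (intro continuous_intros)
        then show "?g n \<in> borel_measurable M" unfolding mb by (rule borel_measurable_continuous_onI)
      qed
      show "AE x in M. (\<lambda>n. ?g n x *\<^sub>R H x) \<longlonglongrightarrow> indicat_real A x *\<^sub>R H x"
      proof (intro AE_I2 tendsto_scaleR tendsto_const)
        fix x
        show "(\<lambda>n. ?g n x) \<longlonglongrightarrow> indicat_real A x"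
        proof (cases "x \<in> A")
          case False
          then have i: "infdist x A > 0" using A \<open>A \<noteq> {}\<close> in_closed_iff_infdist_zero infdist_nonneg
            by (metis less_eq_real_def)
          obtain N :: nat where N: "1 / infdist x A < real N" using reals_Archimedean2 by blast
          have "\<forall>\<^sub>F n in sequentially. ?g n x = 0"
          proof (rule eventually_sequentiallyI)
            fix n assume "N \<le> n"
            then have "1 / infdist x A < real n" using N by linarith
            then show "?g n x = 0" using i by (simp add: field_simps)
          qed
          then show ?thesis using False by (simp add: tendsto_eventually)
        qed simp
      qed
      show "AE x in M. norm (?g n x *\<^sub>R H x) \<le> norm (H x)" for n
      proof (intro AE_I2)
        fix x
        have "\<bar>?g n x\<bar> \<le> 1" using infdist_nonneg [of x A] by auto
        then show "norm (?g n x *\<^sub>R H x) \<le> norm (H x)" using mult_right_mono [of "\<bar>?g n x\<bar>" 1 "norm (H x)"] by simp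
      qed
    qed
    moreover have "(\<integral>x. ?g n x *\<^sub>R H x \<partial>M) = 0" for n
    proof -
      have "(\<integral>x. of_real (?g n x) * H x \<partial>M) = 0"
        using infdist_nonneg [of _ A] by (intro c continuous_intros) auto
      then show ?thesis by (simp add: scaleR_conv_of_real)
    qed
    ultimately show ?thesis using LIMSEQ_unique [OF _ tendsto_const] by fastforce
  qed simp
  fix A assume "A \<in> sets M"
  \<comment> \<open>The closed sets are an intersection-stable generator of the Borel sets, so
    induction over disjoint unions and complements applies.\<close>
  then have A: "A \<in> sigma_sets UNIV (Collect closed)" by (simp add: sets borel_eq_closed)
  have "Int_stable (Collect (closed :: 'a set \<Rightarrow> bool))" "Collect closed \<subseteq> Pow (UNIV :: 'a set)"
    by (auto simp: Int_stable_def)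
  from this A have "(\<integral>x. indicat_real A x *\<^sub>R H x \<partial>M) = 0"
  proof (induction rule: sigma_sets_induct_disjoint)
    case (basic A) then show ?case using cl by simp
  next
    case empty then show ?case by simp
  next
    case (compl A)
    then have Am: "A \<in> sets M" by (simp add: sets borel_eq_closed)
    have "(\<integral>x. indicat_real (UNIV - A) x *\<^sub>R H x \<partial>M) = (\<integral>x. H x - indicat_real A x *\<^sub>R H x \<partial>M)"
      by (intro Bochner_Integration.integral_cong) (auto simp: indicator_def)
    also have "\<dots> = 0" using compl c1 H Am integrable_mult_indicator [OF Am H] by simp
    finally show ?case .
  next
    case (union A)
    then have Am: "\<And>i. A i \<in> sets M" by (auto simp: sets borel_eq_closed)
    have "(\<Sum>i. set_lebesgue_integral M (A i) H) = set_lebesgue_integral M (\<Union>i. A i) H"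
      using union(1) Am H integrable_mult_indicator [OF _ H]
      by (intro lebesgue_integral_countable_add [symmetric]) (auto simp: disjoint_family_on_def set_integrable_def)
    then show ?case using union(3) by (simp add: set_lebesgue_integral_def)
  qed
  then show "set_lebesgue_integral M A H = 0" by (simp add: set_lebesgue_integral_def)
  qed
qed

section \<open>Boundary functions for Henkin measures\<close>

lemma average_tendsto_zero:
  fixes c :: "nat \<Rightarrow> complex"
  assumes c: "c \<longlonglongrightarrow> 0"
  shows "(\<lambda>m. (\<Sum>k<Suc m. c (Suc m + k)) / of_nat (Suc m)) \<longlonglongrightarrow> 0"
proof (rule LIMSEQ_I)
  fix e :: real assume e: "e > 0"
  obtain N where N: "\<And>n. n \<ge> N \<Longrightarrow> cmod (c n) < e / 2" using LIMSEQ_D [OF c, of "e / 2"] e by auto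
  show "\<exists>no. \<forall>m\<ge>no. norm ((\<Sum>k<Suc m. c (Suc m + k)) / of_nat (Suc m) - 0) < e"
  proof (intro exI allI impI)
    fix m assume m: "m \<ge> N"
    have "cmod (\<Sum>k<Suc m. c (Suc m + k)) \<le> (\<Sum>k<Suc m. e / 2)"
      using m N by (intro sum_norm_le less_imp_le) simp
    also have "\<dots> = real (Suc m) * (e / 2)" by simp
    finally have "cmod (\<Sum>k<Suc m. c (Suc m + k)) / real (Suc m) \<le> e / 2"
      by (simp only: pos_divide_le_eq of_nat_0_less_iff zero_less_Suc mult.commute)
    then show "norm ((\<Sum>k<Suc m. c (Suc m + k)) / of_nat (Suc m) - 0) < e"
      using e unfolding diff_zero norm_divide norm_of_nat by linarith
  qed
qed

locale henkin_state = pick_state a K F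
  for a and K :: "complex^'d \<Rightarrow> complex^'d \<Rightarrow> complex" and F +
  fixes \<nu> :: "(complex^'d) measure" and h :: "complex^'d \<Rightarrow> complex"
    and L :: "(complex^'d \<Rightarrow> complex) \<Rightarrow> complex"
  assumes rep: "cmeasure_rep \<nu> h" and wstar: "wstar_cont_functional K L"
    and L_poly: "\<And>p. is_poly p \<Longrightarrow> L p = (\<integral>z. p z * h z \<partial>\<nu>)"
begin

lemma nu_sets: "sets \<nu> = sets borel" and h_meas: "h \<in> borel_measurable borel" and h_norm: "cmod (h z) = 1"
  using rep by (auto simp: cmeasure_rep_def)

sublocale nu: finite_measure \<nu>
  using rep by (simp add: cmeasure_rep_def)

lemma nu_meas: "borel_measurable \<nu> = (borel_measurable borel :: (complex^'d \<Rightarrow> 'b :: topological_space) set)"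
  by (rule measurable_cong_sets [OF nu_sets refl])

lemma nu_sphere: "AE z in \<nu>. z \<in> sphere 0 1"
proof (rule AE_I)
  show "emeasure \<nu> (UNIV - sphere 0 1) = 0" using rep by (simp add: cmeasure_rep_def)
qed (auto simp: nu_sets)

text \<open>The bound is required only almost everywhere, because polynomials are bounded on the
  sphere but not on the whole space.\<close>

definition bdm :: "(complex^'d \<Rightarrow> complex) \<Rightarrow> bool" where
  "bdm g \<longleftrightarrow> g \<in> borel_measurable borel \<and> (\<exists>D. AE z in \<nu>. cmod (g z) \<le> D)"

lemma bdmI: "g \<in> borel_measurable borel \<Longrightarrow> AE z in \<nu>. cmod (g z) \<le> D \<Longrightarrow> bdm g"
  unfolding bdm_def by blast

lemma bdm_integrable: "bdm g \<Longrightarrow> integrable \<nu> g"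
  unfolding bdm_def nu_meas [symmetric] using nu.integrable_const_bound by blast

lemma bdm_mult: assumes "bdm g" "bdm g'" shows "bdm (\<lambda>z. g z * g' z)"
proof -
  obtain D D' where D: "AE z in \<nu>. cmod (g z) \<le> D" "AE z in \<nu>. cmod (g' z) \<le> D'" using assms unfolding bdm_def by blast
  show ?thesis
  proof (rule bdmI)
    show "AE z in \<nu>. cmod (g z * g' z) \<le> D * D'"
      using D by eventually_elim (auto simp: norm_mult intro!: mult_mono order_trans [OF norm_ge_zero])
  qed (use assms in \<open>auto simp: bdm_def\<close>)
qed

lemma bdm_add: assumes "bdm g" "bdm g'" shows "bdm (\<lambda>z. g z + g' z)"
proof -
  obtain D D' where D: "AE z in \<nu>. cmod (g z) \<le> D" "AE z in \<nu>. cmod (g' z) \<le> D'" using assms unfolding bdm_def by blast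
  show ?thesis
  proof (rule bdmI)
    show "AE z in \<nu>. cmod (g z + g' z) \<le> D + D'"
      using D by eventually_elim (auto intro: norm_triangle_le)
  qed (use assms in \<open>auto simp: bdm_def\<close>)
qed

lemma bdm_const: "bdm (\<lambda>z. c)"
  by (rule bdmI [of _ "cmod c"]) auto

lemma bdm_h: "bdm h"
  by (rule bdmI [OF h_meas, of 1]) (simp add: h_norm)

lemma bdm_continuous: assumes "continuous_on UNIV g" shows "bdm g"
proof -
  have "compact (g ` sphere 0 1)" using assms continuous_on_subset by (intro compact_continuous_image) auto
  then obtain D where D: "\<And>z. z \<in> sphere 0 1 \<Longrightarrow> cmod (g z) \<le> D" using compact_imp_bounded bounded_iff by (metis imageI)
  have "AE z in \<nu>. cmod (g z) \<le> D" by (rule eventually_mono [OF nu_sphere D])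
  then show ?thesis by (intro bdmI borel_measurable_continuous_onI assms)
qed

lemma bdm_poly: "is_poly p \<Longrightarrow> bdm p"
  by (rule bdm_continuous [OF is_poly_continuous])

lemma L_add: "mu u \<Longrightarrow> mu v \<Longrightarrow> L (\<lambda>z. u z + v z) = L u + L v"
  using wstar kmult_is_mult unfolding wstar_cont_functional_def mu_def by blast

lemma L_cmul: "mu u \<Longrightarrow> L (\<lambda>z. c * u z) = c * L u"
  using wstar kmult_is_mult unfolding wstar_cont_functional_def mu_def by blast

text \<open>\<^term>\<open>g\<close> serves as the boundary function of the multiplier \<^term>\<open>\<theta>\<close>.\<close>

definition good :: "(complex^'d \<Rightarrow> complex) \<Rightarrow> (complex^'d \<Rightarrow> complex) \<Rightarrow> bool" where
  "good \<theta> g \<longleftrightarrow> mu \<theta> \<and> bdm g \<and> (\<forall>p. is_poly p \<longrightarrow> L (\<lambda>z. \<theta> z * p z) = (\<integral>z. g z * p z * h z \<partial>\<nu>))"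

lemma good_one: "good (\<lambda>z. 1) (\<lambda>z. 1)"
  unfolding good_def by (auto simp: L_poly mu_const bdm_const)

lemma good_int: "good \<theta> g \<Longrightarrow> is_poly p \<Longrightarrow> integrable \<nu> (\<lambda>z. g z * p z * h z)"
  unfolding good_def by (intro bdm_integrable bdm_mult [OF bdm_mult [OF _ bdm_poly] bdm_h]) auto

lemma good_poly: assumes g: "good \<theta> g" and r: "is_poly r" shows "good (\<lambda>z. \<theta> z * r z) (\<lambda>z. g z * r z)"
  unfolding good_def
proof (intro conjI allI impI)
  fix p :: "complex^'d \<Rightarrow> complex" assume "is_poly p"
  then have "L (\<lambda>z. \<theta> z * (r z * p z)) = (\<integral>z. g z * (r z * p z) * h z \<partial>\<nu>)"
    using g is_poly_mult [OF r] unfolding good_def by blast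
  then show "L (\<lambda>z. \<theta> z * r z * p z) = (\<integral>z. g z * r z * p z * h z \<partial>\<nu>)" by (simp add: mult.assoc)
qed (use g r in \<open>auto simp: good_def intro: mu_mult mu_poly bdm_mult bdm_poly\<close>)

lemma good_add: assumes "good \<theta> g" "good \<theta>' g'" shows "good (\<lambda>z. \<theta> z + \<theta>' z) (\<lambda>z. g z + g' z)"
  unfolding good_def
proof (intro conjI allI impI)
  fix p :: "complex^'d \<Rightarrow> complex" assume p: "is_poly p"
  have "L (\<lambda>z. \<theta> z * p z + \<theta>' z * p z) = L (\<lambda>z. \<theta> z * p z) + L (\<lambda>z. \<theta>' z * p z)"
    using assms p by (intro L_add mu_mult [OF _ mu_poly]) (auto simp: good_def)
  also have "\<dots> = (\<integral>z. g z * p z * h z \<partial>\<nu>) + (\<integral>z. g' z * p z * h z \<partial>\<nu>)"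
    using assms p by (simp add: good_def)
  also have "\<dots> = (\<integral>z. g z * p z * h z + g' z * p z * h z \<partial>\<nu>)"
    using assms p by (intro Bochner_Integration.integral_add [symmetric] good_int)
  finally show "L (\<lambda>z. (\<theta> z + \<theta>' z) * p z) = (\<integral>z. (g z + g' z) * p z * h z \<partial>\<nu>)" by (simp add: distrib_right)
qed (use assms in \<open>auto simp: good_def intro: mu_add bdm_add\<close>)

text \<open>Two independent limits are matched: \<open>L\<close> follows the multipliers in the open
  ball through weak-* continuity, the integrals follow the boundary functions on the sphere through
  dominated convergence.\<close>

lemma good_limit:
  assumes good: "\<And>n. good (\<theta> n) (g n)" and k: "\<And>n. kmult (\<theta> n) C"
    and lim: "\<And>z. z \<in> ball 0 1 \<Longrightarrow> (\<lambda>n. \<theta> n z) \<longlonglongrightarrow> \<theta>' z"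
    and glim: "AE z in \<nu>. (\<lambda>n. g n z) \<longlonglongrightarrow> g' z" and gm: "g' \<in> borel_measurable borel"
    and gb: "\<And>n. AE z in \<nu>. cmod (g n z) \<le> D"
  shows "good \<theta>' g'"
  unfolding good_def
proof (intro conjI allI impI)
  show "mu \<theta>'" using kmult_tendsto [OF k lim] unfolding mu_def by blast
  have "AE z in \<nu>. \<forall>n. cmod (g n z) \<le> D" using gb by (simp add: AE_all_countable)
  then have "AE z in \<nu>. cmod (g' z) \<le> D"
    using glim by eventually_elim (auto intro: LIMSEQ_le_const2 [OF tendsto_norm])
  then show "bdm g'" by (rule bdmI [OF gm])
  fix p :: "complex^'d \<Rightarrow> complex" assume p: "is_poly p"
  obtain Cp where Cp: "kmult p Cp" using kmult_poly [OF p] by blast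
  have "(\<lambda>n. L (\<lambda>z. \<theta> n z * p z)) \<longlonglongrightarrow> L (\<lambda>z. \<theta>' z * p z)"
    by (rule wstar_cont_tendsto [OF wstar kmult_mult [OF k Cp]]) (intro tendsto_intros lim)
  moreover have "(\<lambda>n. \<integral>z. g n z * p z * h z \<partial>\<nu>) \<longlonglongrightarrow> (\<integral>z. g' z * p z * h z \<partial>\<nu>)"
  proof -
    obtain M where M: "AE z in \<nu>. cmod (p z) \<le> M" using bdm_poly [OF p] unfolding bdm_def by blast
    have pm: "p \<in> borel_measurable borel" using bdm_poly [OF p] unfolding bdm_def by blast
    have gnm: "g n \<in> borel_measurable borel" for n using good unfolding good_def bdm_def by blast
    show ?thesis
    proof (rule integral_dominated_convergence)
      show "integrable \<nu> (\<lambda>z. D * M)" by simp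
      show "(\<lambda>z. g' z * p z * h z) \<in> borel_measurable \<nu>" "(\<lambda>z. g n z * p z * h z) \<in> borel_measurable \<nu>" for n
        unfolding nu_meas using gm gnm pm h_meas by measurable
      show "AE z in \<nu>. (\<lambda>n. g n z * p z * h z) \<longlonglongrightarrow> g' z * p z * h z"
        using glim by eventually_elim (intro tendsto_intros)
      show "AE z in \<nu>. norm (g n z * p z * h z) \<le> D * M" for n
        using gb [of n] M by eventually_elim
          (auto simp: norm_mult h_norm intro!: mult_mono order_trans [OF norm_ge_zero])
    qed
  qed
  ultimately show "L (\<lambda>z. \<theta>' z * p z) = (\<integral>z. g' z * p z * h z \<partial>\<nu>)"
    using good p LIMSEQ_unique unfolding good_def by (metis (no_types, lifting) LIMSEQ_unique ext)
qed

text \<open>\<open>\<psi>\<close> and all \<open>q i\<close> are packed into one family so that a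
  single selection makes all their boundary functions converge along the same combinations.\<close>

definition T :: "'d option \<Rightarrow> complex^'d \<Rightarrow> complex" where
  "T x = (case x of None \<Rightarrow> \<psi> | Some i \<Rightarrow> q i)"

definition \<rho> :: "nat \<Rightarrow> real" where "\<rho> k = 1 - 1 / real (k + 2)"

text \<open>The cut-off outside the closed ball gives a globally bounded Borel function; nothing is
  known about the multipliers off the open ball.\<close>

definition dl :: "nat \<Rightarrow> 'd option \<Rightarrow> complex^'d \<Rightarrow> complex" where
  "dl k x z = (if z \<in> cball 0 1 then T x (of_real (\<rho> k) *s z) else 0)"

lemma kmult_T: "kmult (T x) 1"
  by (auto simp: T_def kmult_psi kmult_q split: option.split)

lemma rho: "0 < \<rho> k" "\<rho> k < 1" "n \<le> k \<Longrightarrow> 1 - \<rho> k \<le> 1 - \<rho> n"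
  by (auto simp: \<rho>_def field_simps)

lemma rho_tendsto: "\<rho> \<longlonglongrightarrow> 1"
proof -
  have "(\<lambda>k. 1 - 1 / real (k + 2)) \<longlonglongrightarrow> 1 - 0"
    using LIMSEQ_ignore_initial_segment [OF lim_1_over_n, of 2] by (intro tendsto_intros) simp
  then show ?thesis unfolding \<rho>_def by simp
qed

definition Pn :: "nat \<Rightarrow> 'd option \<Rightarrow> nat \<Rightarrow> complex^'d \<Rightarrow> complex" where
  "Pn k x m z = (\<Sum>n<m. of_real (\<rho> k) ^ n * hom_part (T x) n z)"

lemma T_H: "in_H K (T x)"
  by (rule kmult_in_H [OF kmult_T])

lemma Pn_poly: "is_poly (Pn k x m)"
  unfolding Pn_def by (intro is_poly_sum is_poly_mult is_poly_const hom_part_poly T_H)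

lemma dilate_ball: "(z :: complex^'d) \<in> cball 0 1 \<Longrightarrow> of_real (\<rho> k) *s z \<in> ball 0 1"
  using rho(1,2) [of k] mult_left_mono [of "norm z" 1 "\<rho> k"] le_less_trans [of "\<rho> k * norm z" "\<rho> k" 1] by auto

lemma Pn_tendsto: assumes z: "z \<in> cball 0 1" shows "(\<lambda>m. Pn k x m z) \<longlonglongrightarrow> dl k x z"
  using hom_part_sums [OF T_H [of x] dilate_ball [OF z, of k]] z
  by (simp add: hom_part_scale [OF T_H] sums_def Pn_def dl_def)

lemma kmult_Pn: "kmult (Pn k x m) (1 / (1 - \<rho> k))"
proof -
  have "kmult (Pn k x m) (\<Sum>n<m. cmod (of_real (\<rho> k) ^ n) * 1)"
    unfolding Pn_def by (intro kmult_sum kmult_cmul kmult_hom_part kmult_T)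
  moreover have "(\<Sum>n<m. cmod (of_real (\<rho> k) ^ n) * 1) \<le> (\<Sum>n. \<rho> k ^ n)"
    using rho [of k] by (simp add: norm_power) (intro sum_le_suminf summable_geometric, auto)
  moreover have "(\<Sum>n. \<rho> k ^ n) = 1 / (1 - \<rho> k)" using rho [of k] by (intro suminf_geometric) auto
  ultimately show ?thesis by (metis kmult_mono)
qed

text \<open>\<open>L\<close> is known only on polynomials. The Taylor polynomials \<open>Pn\<close>
  of a dilation are bounded in multiplier norm by a geometric series and converge on the closed
  ball, hence both in the ball and on the sphere.\<close>

lemma good_dl: assumes g: "good \<theta> g" shows "good (\<lambda>z. \<theta> z * dl k x z) (\<lambda>z. g z * dl k x z)"
proof -
  obtain C where C: "kmult \<theta> C" using g unfolding good_def mu_def by blast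
  obtain D where D: "AE z in \<nu>. cmod (g z) \<le> D" and gm: "g \<in> borel_measurable borel" using g unfolding good_def bdm_def by blast
  have cb: "AE z in \<nu>. z \<in> cball 0 1" using nu_sphere by eventually_elim auto
  show ?thesis
  proof (rule good_limit)
    show "good (\<lambda>z. \<theta> z * Pn k x n z) (\<lambda>z. g z * Pn k x n z)" for n by (rule good_poly [OF g Pn_poly])
    show "kmult (\<lambda>z. \<theta> z * Pn k x n z) (C * (1 / (1 - \<rho> k)))" for n by (rule kmult_mult [OF C kmult_Pn])
    show "(\<lambda>n. \<theta> z * Pn k x n z) \<longlonglongrightarrow> \<theta> z * dl k x z" if "z \<in> ball 0 1" for z
      using that by (intro tendsto_intros Pn_tendsto) auto
    show "AE z in \<nu>. (\<lambda>n. g z * Pn k x n z) \<longlonglongrightarrow> g z * dl k x z"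
      using cb by eventually_elim (intro tendsto_intros Pn_tendsto)
    show "AE z in \<nu>. cmod (g z * Pn k x n z) \<le> D * (1 / (1 - \<rho> k))" for n
      using cb D by eventually_elim
        (auto simp only: norm_mult intro!: mult_mono poly_bound_closed [OF Pn_poly kmult_Pn] intro: order_trans [OF norm_ge_zero])
    have "dl k x \<in> borel_measurable borel"
    proof (rule borel_measurable_LIMSEQ_metric)
      show "(\<lambda>z. if z \<in> cball 0 1 then Pn k x m z else 0) \<in> borel_measurable borel" for m
        by (intro borel_measurable_continuous_on_if is_poly_continuous Pn_poly continuous_on_const) auto
      show "(\<lambda>m. if z \<in> cball 0 1 then Pn k x m z else 0) \<longlonglongrightarrow> dl k x z" for z
        using Pn_tendsto [of z k x] by (cases "z \<in> cball 0 1") (auto simp: dl_def)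
    qed
    then show "(\<lambda>z. g z * dl k x z) \<in> borel_measurable borel" using gm by measurable
  qed
qed

text \<open>The midpoint hull of the dilations of index at least \<open>n\<close>, in the form that
  \<open>midpoint_selection\<close> requires. Its members are finite combinations, so each property
  below follows by induction from a linear or convex one of dilations.\<close>

inductive_set mid :: "nat \<Rightarrow> (complex^'d \<Rightarrow> complex^('d option)) set" for n where
  base: "n \<le> k \<Longrightarrow> (\<lambda>z. \<chi> x. dl k x z) \<in> mid n"
| avg: "Y \<in> mid n \<Longrightarrow> Y' \<in> mid n \<Longrightarrow> (\<lambda>z. (1 / 2) *\<^sub>R (Y z + Y' z)) \<in> mid n"

lemma avg_nth: "((1 / 2) *\<^sub>R (Y z + Y' z)) $ x = (1 / 2) * (Y z $ x) + (1 / 2) * (Y' z $ x :: complex)"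
  unfolding vector_scaleR_component vector_add_component by (simp add: scaleR_conv_of_real distrib_left)

lemma mid_mono: assumes "n \<le> m" shows "mid m \<subseteq> mid n"
proof
  fix Y assume "Y \<in> mid m" then show "Y \<in> mid n"
    by induction (use assms in \<open>auto intro: mid.intros\<close>)
qed

lemma mid_good: "Y \<in> mid n \<Longrightarrow> good \<theta> g \<Longrightarrow> good (\<lambda>z. \<theta> z * Y z $ x) (\<lambda>z. g z * Y z $ x)"
proof (induction rule: mid.induct)
  case (base k) then show ?case using good_dl by simp
next
  case (avg Y Y')
  have "good (\<lambda>z. \<theta> z * Y z $ x * (1 / 2) + \<theta> z * Y' z $ x * (1 / 2)) (\<lambda>z. g z * Y z $ x * (1 / 2) + g z * Y' z $ x * (1 / 2))"
    using avg by (intro good_add good_poly [OF _ is_poly_const]) auto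
  then show ?case unfolding avg_nth by (simp add: distrib_left mult_ac)
qed

lemma mid_kmult: "Y \<in> mid n \<Longrightarrow> kmult (\<lambda>z. Y z $ x) 1"
proof (induction rule: mid.induct)
  case (base k)
  have "kmult (\<lambda>z. T x (of_real (\<rho> k) *s z)) 1" using rho [of k] by (intro kmult_dilate kmult_T) auto
  then show ?case by (rule kmult_cong) (simp add: dl_def)
next
  case (avg Y Y')
  have "kmult (\<lambda>z. (1 / 2) * (Y z $ x) + (1 / 2) * (Y' z $ x)) (cmod (1 / 2) * 1 + cmod (1 / 2) * 1)"
    by (intro kmult_add kmult_cmul avg)
  then show ?case unfolding avg_nth by simp
qed

lemma mid_meas: "Y \<in> mid n \<Longrightarrow> Y \<in> borel_measurable borel"
proof (induction rule: mid.induct)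
  case (base k)
  show ?case
  proof (rule borel_measurable_LIMSEQ_metric)
    show "(\<lambda>z. if z \<in> cball 0 1 then (\<chi> x. Pn k x m z) else 0) \<in> borel_measurable borel" for m
      by (intro borel_measurable_continuous_on_if continuous_on_vec_lambda is_poly_continuous Pn_poly continuous_on_const) auto
    show "(\<lambda>m. if z \<in> cball 0 1 then (\<chi> x. Pn k x m z) else 0) \<longlonglongrightarrow> (\<chi> x. dl k x z)" for z
    proof (cases "z \<in> cball 0 1")
      case True
      then have "(\<lambda>m. \<chi> x. Pn k x m z) \<longlonglongrightarrow> (\<chi> x. dl k x z)"
        by (intro vec_tendstoI) (simp add: Pn_tendsto)
      then show ?thesis using True by simp
    next
      case False
      then have "(\<chi> x. dl k x z) = 0" by (simp add: dl_def vec_eq_iff)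
      then show ?thesis using False by simp
    qed
  qed
next
  case (avg Y Y') then show ?case by measurable
qed

text \<open>Closed discs are convex. Consequently, wherever the dilations themselves converge, every
  choice of members of \<open>mid n\<close> has the same limit.\<close>

lemma mid_close:
  assumes "Y \<in> mid n" "\<And>k. n \<le> k \<Longrightarrow> cmod (dl k x z - c) \<le> e"
  shows "cmod (Y z $ x - c) \<le> e"
  using assms(1)
proof (induction rule: mid.induct)
  case (base k) then show ?case using assms(2) by simp
next
  case (avg Y Y')
  have "((1 / 2) *\<^sub>R (Y z + Y' z)) $ x - c = (1 / 2) * (Y z $ x - c) + (1 / 2) * (Y' z $ x - c)"
    unfolding avg_nth by (simp add: algebra_simps)
  then have "cmod (((1 / 2) *\<^sub>R (Y z + Y' z)) $ x - c) \<le> (1 / 2) * cmod (Y z $ x - c) + (1 / 2) * cmod (Y' z $ x - c)"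
    by (metis (no_types) norm_triangle_ineq norm_mult norm_divide norm_one norm_numeral)
  then show ?case using avg.IH by linarith
qed

lemma dl_le: "cmod (dl k x z) \<le> 1"
  using kmult_bound [OF kmult_T dilate_ball [of z k]] by (auto simp: dl_def)

lemma mid_le: "Y \<in> mid n \<Longrightarrow> cmod (Y z $ x) \<le> 1"
  using mid_close [of Y n x z 0 1] dl_le by simp

lemma mid_norm: assumes "Y \<in> mid n" shows "norm (Y z) \<le> real CARD('d option)"
proof -
  have "norm (Y z) \<le> (\<Sum>x\<in>UNIV. norm (Y z $ x))" unfolding norm_vec_def by (rule L2_set_le_sum) auto
  also have "\<dots> \<le> (\<Sum>x\<in>(UNIV :: 'd option set). 1)" by (intro sum_mono mid_le [OF assms])
  finally show ?thesis by simp
qed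

text \<open>\<open>q_near\<close> at the dilated point, where replacing the dilated coordinate by
  the original one costs at most \<open>\<kappa> * (1 - \<rho> n)\<close>. The doubled constants
  come from squaring a sum; the right side is affine in the member and the left side convex, so
  midpoints inherit the estimate.\<close>

lemma mid_near:
  assumes "Y \<in> mid n" and z: "z \<in> sphere 0 1"
  shows "(cmod (Y z $ Some i - of_real \<kappa> * cnj (z $ i)))\<^sup>2 \<le> 4 - 4 * Re (Y z $ None) + 2 * (\<kappa> * (1 - \<rho> n))\<^sup>2"
  using assms(1)
proof (induction rule: mid.induct)
  case (base k)
  let ?w = "of_real (\<rho> k) *s z"
  have zc: "z \<in> cball 0 1" using z by simp
  have w: "?w \<in> ball 0 1" by (rule dilate_ball [OF zc])
  let ?a = "q i ?w - of_real \<kappa> * cnj (?w $ i)" and ?b = "of_real (\<kappa> * (1 - \<rho> k)) * cnj (z $ i)"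
  have zi: "cmod (z $ i) \<le> 1" using member_le_L2_set [of UNIV i "\<lambda>i. norm (z $ i)"] z by (simp add: norm_vec_def)
  have b: "cmod ?b \<le> \<kappa> * (1 - \<rho> n)"
  proof -
    have "cmod ?b = (\<kappa> * (1 - \<rho> k)) * cmod (z $ i)" using rho(2)[of k] kappa_pos by (simp add: norm_mult del: of_real_mult)
    also have "\<dots> \<le> (\<kappa> * (1 - \<rho> n)) * 1"
      using zi rho(2)[of n] rho(2)[of k] rho(3)[OF base] kappa_pos by (intro mult_mono mult_nonneg_nonneg) auto
    finally show ?thesis by simp
  qed
  have "(cmod (?a - ?b))\<^sup>2 \<le> (cmod ?a + cmod ?b)\<^sup>2" by (intro power_mono norm_triangle_ineq4) auto
  also have "\<dots> \<le> 2 * (cmod ?a)\<^sup>2 + 2 * (cmod ?b)\<^sup>2"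
    using zero_le_power2 [of "cmod ?a - cmod ?b"] by (simp add: power2_sum power2_diff)
  also have "(cmod ?a)\<^sup>2 \<le> 2 - 2 * Re (\<psi> ?w)" by (rule q_near [OF w])
  also have "(cmod ?b)\<^sup>2 \<le> (\<kappa> * (1 - \<rho> n))\<^sup>2" by (rule power_mono [OF b]) simp
  finally have *: "(cmod (?a - ?b))\<^sup>2 \<le> 2 * (2 - 2 * Re (\<psi> ?w)) + 2 * (\<kappa> * (1 - \<rho> n))\<^sup>2" by simp
  have e: "?a - ?b = q i ?w - of_real \<kappa> * cnj (z $ i)" by (simp add: algebra_simps)
  show ?case using * [unfolded e] zc by (simp add: dl_def T_def)
next
  case (avg Y Y')
  let ?a = "Y z $ Some i - of_real \<kappa> * cnj (z $ i)" and ?b = "Y' z $ Some i - of_real \<kappa> * cnj (z $ i)"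
  have e: "((1 / 2) *\<^sub>R (Y z + Y' z)) $ Some i - of_real \<kappa> * cnj (z $ i) = (?a + ?b) / 2"
    unfolding avg_nth by (simp add: field_simps)
  have "(cmod ((?a + ?b) / 2))\<^sup>2 = (cmod (?a + ?b))\<^sup>2 / 4" by (simp add: norm_divide power_divide)
  also have "(cmod (?a + ?b))\<^sup>2 \<le> (cmod ?a + cmod ?b)\<^sup>2" by (intro power_mono norm_triangle_ineq) auto
  also have "\<dots> \<le> 2 * (cmod ?a)\<^sup>2 + 2 * (cmod ?b)\<^sup>2"
    using zero_le_power2 [of "cmod ?a - cmod ?b"] by (simp add: power2_sum power2_diff)
  finally have "(cmod ((?a + ?b) / 2))\<^sup>2 \<le> ((cmod ?a)\<^sup>2 + (cmod ?b)\<^sup>2) / 2" by (simp add: field_simps)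
  moreover have "Re (((1 / 2) *\<^sub>R (Y z + Y' z)) $ None) = (Re (Y z $ None) + Re (Y' z $ None)) / 2"
    by simp
  moreover have "x \<le> 4 - 4 * v + k" if "x \<le> (y + y') / 2" "v = (r + r') / 2" "y \<le> 4 - 4 * r + k" "y' \<le> 4 - 4 * r' + k"
    for x y y' v r r' k :: real using that by simp
  ultimately show ?case unfolding e using avg.IH by blast
qed

lemma dl_tendsto: assumes z: "z \<in> ball 0 1" shows "(\<lambda>k. dl k x z) \<longlonglongrightarrow> T x z"
proof -
  \<comment> \<open>Between 1 and \<open>1 / norm z\<close>, so the expansion along the line through
    \<open>z\<close> converges beyond 1 and is continuous there.\<close>
  define s where "s = 2 / (1 + norm z)"
  have s: "s > 1" "s * norm z < 1" using z by (auto simp: s_def pos_divide_less_eq pos_less_divide_eq add_pos_nonneg)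
  have sz: "of_real s *s z \<in> ball 0 1" using s by simp
  have "(\<lambda>n. hom_part (T x) n z * of_real s ^ n) sums T x (of_real s *s z)"
    using hom_part_sums [OF T_H sz, of x] by (simp add: hom_part_scale [OF T_H] mult.commute)
  then have "isCont (\<lambda>t. \<Sum>n. hom_part (T x) n z * t ^ n) (1 :: complex)"
    using s by (intro isCont_powser [where K = "of_real s"] sums_summable) auto
  moreover have "(\<lambda>k. complex_of_real (\<rho> k)) \<longlonglongrightarrow> of_real 1" by (intro tendsto_of_real rho_tendsto)
  ultimately have "(\<lambda>k. \<Sum>n. hom_part (T x) n z * of_real (\<rho> k) ^ n) \<longlonglongrightarrow> (\<Sum>n. hom_part (T x) n z * 1 ^ n)"
    using isCont_tendsto_compose by fastforce
  moreover have "(\<Sum>n. hom_part (T x) n z * of_real (\<rho> k) ^ n) = dl k x z" for k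
    using hom_part_sums [OF T_H dilate_ball, of z x k] z by (simp add: hom_part_scale [OF T_H] sums_iff mult.commute dl_def)
  moreover have "(\<Sum>n. hom_part (T x) n z * 1 ^ n) = T x z"
    using hom_part_sums [OF T_H z] by (simp add: sums_iff)
  ultimately show ?thesis by simp
qed

lemma mid_tendsto:
  assumes Y: "\<And>n. Y n \<in> mid n" and d: "(\<lambda>k. dl k x z) \<longlonglongrightarrow> c"
  shows "(\<lambda>n. Y n z $ x) \<longlonglongrightarrow> c"
proof (rule LIMSEQ_I)
  fix e :: real assume e: "e > 0"
  obtain N where N: "\<And>k. k \<ge> N \<Longrightarrow> cmod (dl k x z - c) < e / 2" using LIMSEQ_D [OF d, of "e / 2"] e by auto
  show "\<exists>no. \<forall>n\<ge>no. norm (Y n z $ x - c) < e"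
  proof (intro exI allI impI)
    fix n assume "n \<ge> N"
    then have "cmod (Y n z $ x - c) \<le> e / 2" using N by (intro mid_close [OF Y]) (auto intro: less_imp_le)
    then show "norm (Y n z $ x - c) < e" using e by simp
  qed
qed

text \<open>The boundary functions are almost everywhere limits of selected midpoint combinations.
  The fourth property is the limit of \<open>mid_near\<close> as the dilations tend to 1. The last
  one rests on \<open>mid_close\<close>; it concerns arbitrary sets \<open>A\<close>, measurable or
  not.\<close>

lemma boundary_functions:
  obtains t :: "complex^'d \<Rightarrow> complex^('d option)" where
    "\<And>x. (\<lambda>z. t z $ x) \<in> borel_measurable borel"
    "\<And>\<theta> g x. good \<theta> g \<Longrightarrow> good (\<lambda>z. \<theta> z * T x z) (\<lambda>z. g z * t z $ x)"
    "AE z in \<nu>. cmod (t z $ None) \<le> 1"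
    "AE z in \<nu>. t z $ None = 1 \<longrightarrow> (\<forall>i. t z $ Some i = of_real \<kappa> * cnj (z $ i))"
    "\<And>A. (\<And>z. z \<in> A \<Longrightarrow> z \<in> sphere 0 1 \<and> (\<lambda>k. dl k None z) \<longlonglongrightarrow> 1) \<Longrightarrow> AE z in \<nu>. z \<in> A \<longrightarrow> t z $ None = 1"
proof -
  obtain Y where Y: "\<And>n. Y n \<in> mid n" and C: "AE z in \<nu>. Cauchy (\<lambda>n. Y n z)"
  proof (rule nu.midpoint_selection [of mid "real CARD('d option)"])
    show "mid n \<noteq> {}" for n using mid.base [of n n] by blast
    show "f \<in> borel_measurable \<nu>" if "f \<in> mid n" for f n unfolding nu_meas by (rule mid_meas [OF that])
  qed (use mid_mono mid_norm in \<open>auto intro: mid.avg\<close>)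
  define t where "t z = lim (\<lambda>n. Y n z)" for z
  have tm: "t \<in> borel_measurable borel" unfolding t_def by (intro borel_measurable_lim_metric mid_meas [OF Y])
  have tmx: "(\<lambda>z. t z $ x) \<in> borel_measurable borel" for x
    using measurable_compose [OF tm borel_measurable_continuous_onI [OF continuous_on_component, OF continuous_on_id]] .
  have lim: "AE z in \<nu>. (\<lambda>n. Y n z) \<longlonglongrightarrow> t z"
    using C by eventually_elim (simp add: t_def Cauchy_convergent convergent_LIMSEQ_iff [symmetric])
  have limx: "AE z in \<nu>. (\<lambda>n. Y n z $ x) \<longlonglongrightarrow> t z $ x" for x
    using lim by eventually_elim (rule tendsto_vec_nth)
  show ?thesis
  proof (rule that [of t, OF tmx])
    show "good (\<lambda>z. \<theta> z * T x z) (\<lambda>z. g z * t z $ x)" if g: "good \<theta> g" for \<theta> g x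
    proof -
      obtain C where C: "kmult \<theta> C" using g unfolding good_def mu_def by blast
      obtain D where D: "AE z in \<nu>. cmod (g z) \<le> D" and gm: "g \<in> borel_measurable borel" using g unfolding good_def bdm_def by blast
      show ?thesis
      proof (rule good_limit)
        show "good (\<lambda>z. \<theta> z * Y n z $ x) (\<lambda>z. g z * Y n z $ x)" for n by (rule mid_good [OF Y g])
        show "kmult (\<lambda>z. \<theta> z * Y n z $ x) (C * 1)" for n by (rule kmult_mult [OF C mid_kmult [OF Y]])
        show "(\<lambda>n. \<theta> z * Y n z $ x) \<longlonglongrightarrow> \<theta> z * T x z" if "z \<in> ball 0 1" for z
          by (intro tendsto_intros mid_tendsto [OF Y] dl_tendsto that)
        show "AE z in \<nu>. (\<lambda>n. g z * Y n z $ x) \<longlonglongrightarrow> g z * t z $ x"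
          using limx [of x] by eventually_elim (rule tendsto_mult [OF tendsto_const])
        show "(\<lambda>z. g z * t z $ x) \<in> borel_measurable borel" using gm tmx by measurable
        show "AE z in \<nu>. cmod (g z * Y n z $ x) \<le> D * 1" for n
          using D by eventually_elim (auto simp only: norm_mult intro!: mult_mono mid_le [OF Y] intro: order_trans [OF norm_ge_zero])
      qed
    qed
    show "AE z in \<nu>. cmod (t z $ None) \<le> 1"
      using limx [of None] by eventually_elim (rule LIMSEQ_le_const2 [OF tendsto_norm], use mid_le [OF Y] in auto)
    have "AE z in \<nu>. \<forall>x. (\<lambda>n. Y n z $ x) \<longlonglongrightarrow> t z $ x" using limx by (simp add: AE_all_countable)
    then show "AE z in \<nu>. t z $ None = 1 \<longrightarrow> (\<forall>i. t z $ Some i = of_real \<kappa> * cnj (z $ i))"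
      using nu_sphere
    proof eventually_elim
      case (elim z)
      show ?case
      proof (intro impI allI)
        fix i assume 1: "t z $ None = 1"
        have "(\<lambda>n. (cmod (Y n z $ Some i - of_real \<kappa> * cnj (z $ i)))\<^sup>2) \<longlonglongrightarrow> (cmod (t z $ Some i - of_real \<kappa> * cnj (z $ i)))\<^sup>2"
          using elim(1) by (intro tendsto_power tendsto_norm tendsto_diff tendsto_const) auto
        moreover have "(\<lambda>n. 4 - 4 * Re (Y n z $ None) + 2 * (\<kappa> * (1 - \<rho> n))\<^sup>2) \<longlonglongrightarrow> 4 - 4 * Re (t z $ None) + 2 * (\<kappa> * (1 - 1))\<^sup>2"
          using elim(1) by (intro tendsto_add tendsto_diff tendsto_mult tendsto_power tendsto_const tendsto_Re rho_tendsto) auto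
        ultimately have "(cmod (t z $ Some i - of_real \<kappa> * cnj (z $ i)))\<^sup>2 \<le> 4 - 4 * Re (t z $ None) + 2 * (\<kappa> * (1 - 1))\<^sup>2"
          by (rule LIMSEQ_le) (use mid_near [OF Y elim(2)] in blast)
        then show "t z $ Some i = of_real \<kappa> * cnj (z $ i)" using 1 by simp
      qed
    qed
    show "AE z in \<nu>. z \<in> A \<longrightarrow> t z $ None = 1"
      if A: "\<And>z. z \<in> A \<Longrightarrow> z \<in> sphere 0 1 \<and> (\<lambda>k. dl k None z) \<longlonglongrightarrow> 1" for A
      using limx [of None]
    proof eventually_elim
      case (elim z)
      show ?case using LIMSEQ_unique [OF elim mid_tendsto [OF Y]] A by blast
    qed
  qed
qed

end

section \<open>Henkin measures do not charge unboundedness sets\<close>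

context henkin_state
begin

text \<open>\<open>V_ge\<close> with \<open>2 * sqrt s \<le> 1 + s\<close> shows that the modulus of
  \<open>V\<close> is at least the norm of the vector-valued function, so \<open>1 / V\<close>
  vanishes in the limit.\<close>

lemma psi_at_unbounded:
  assumes z: "z \<in> sphere 0 1"
    and u: "filterlim (\<lambda>r :: real. sqrt (\<Sum>n. (cmod (F n (r *\<^sub>R z)))\<^sup>2)) at_top (at_left 1)"
  shows "(\<lambda>k. dl k None z) \<longlonglongrightarrow> 1"
proof -
  have "filterlim \<rho> (at_left 1) sequentially"
    unfolding filterlim_at using rho_tendsto rho(2) by (auto intro!: always_eventually simp: less_imp_neq)
  from filterlim_compose [OF u this]
  have S: "filterlim (\<lambda>k. sqrt (\<Sum>n. (cmod (F n (\<rho> k *\<^sub>R z)))\<^sup>2)) at_top sequentially" .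
  have w: "of_real (\<rho> k) *s z \<in> ball 0 1" for k using z by (intro dilate_ball) simp
  have "filterlim (\<lambda>k. cmod (V (of_real (\<rho> k) *s z))) at_top sequentially"
  proof (rule filterlim_at_top_mono [OF S])
    show "\<forall>\<^sub>F k in sequentially. sqrt (\<Sum>n. (cmod (F n (\<rho> k *\<^sub>R z)))\<^sup>2) \<le> cmod (V (of_real (\<rho> k) *s z))"
    proof (intro always_eventually allI)
      fix k
      let ?w = "of_real (\<rho> k) *s z" and ?s = "\<Sum>n. (cmod (F n (of_real (\<rho> k) *s z)))\<^sup>2"
      have s0: "0 \<le> ?s" by (rule suminf_nonneg [OF V_ge(1) [OF w]]) simp
      have "0 \<le> (sqrt ?s - 1)\<^sup>2" by simp
      then have "2 * sqrt ?s \<le> 1 + ?s" using s0 by (simp add: power2_diff)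
      also have "\<dots> \<le> 2 * Re (V ?w)" by (rule V_ge(2) [OF w])
      finally have "sqrt ?s \<le> Re (V ?w)" by simp
      also have "\<dots> \<le> cmod (V ?w)" by (rule complex_Re_le_cmod)
      finally show "sqrt (\<Sum>n. (cmod (F n (\<rho> k *\<^sub>R z)))\<^sup>2) \<le> cmod (V ?w)" by (simp add: scaleR_eq_cscale)
    qed
  qed
  then have "(\<lambda>k. inverse (V (of_real (\<rho> k) *s z))) \<longlonglongrightarrow> 0"
    by (intro tendsto_inverse_0 [THEN filterlim_compose] filterlim_norm_at_top_imp_at_infinity)
  then have "(\<lambda>k. 1 - inverse (V (of_real (\<rho> k) *s z))) \<longlonglongrightarrow> 1 - 0" by (intro tendsto_intros)
  then show ?thesis using z by (simp add: dl_def T_def \<psi>_def inverse_eq_divide)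
qed

theorem AE_not_unbounded:
  assumes E: "E \<subseteq> sphere 0 1"
    and u: "\<And>z. z \<in> E \<Longrightarrow> filterlim (\<lambda>r :: real. sqrt (\<Sum>n. (cmod (F n (r *\<^sub>R z)))\<^sup>2)) at_top (at_left 1)"
  shows "AE z in \<nu>. z \<notin> E"
proof (rule boundary_functions)
  fix t :: "complex^'d \<Rightarrow> complex^('d option)"
  assume
    tm: "\<And>x. (\<lambda>z. t z $ x) \<in> borel_measurable borel" and
    tg: "\<And>\<theta> g x. good \<theta> g \<Longrightarrow> good (\<lambda>z. \<theta> z * T x z) (\<lambda>z. g z * t z $ x)" and
    t1: "AE z in \<nu>. cmod (t z $ None) \<le> 1" and
    tq: "AE z in \<nu>. t z $ None = 1 \<longrightarrow> (\<forall>i. t z $ Some i = of_real \<kappa> * cnj (z $ i))" and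
    tE: "\<And>A. (\<And>z. z \<in> A \<Longrightarrow> z \<in> sphere 0 1 \<and> (\<lambda>k. dl k None z) \<longlonglongrightarrow> 1) \<Longrightarrow> AE z in \<nu>. z \<in> A \<longrightarrow> t z $ None = 1"
  define s where "s z = t z $ None" for z
  define I where "I z = (if s z = 1 then 1 else 0 :: complex)" for z
  have sm [measurable]: "s \<in> borel_measurable borel" unfolding s_def by (rule tm)
  have Im: "I \<in> borel_measurable borel"
    unfolding I_def by measurable
  have bI: "bdm I" by (rule bdmI [OF Im, of 1]) (simp add: I_def)
  have power: "good (\<lambda>z. \<theta> z * \<psi> z ^ n) (\<lambda>z. g z * s z ^ n)" if "good \<theta> g" for \<theta> g n
  proof (induction n)
    case 0 then show ?case using that by simp
  next
    case (Suc n)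
    from tg [OF this, of None] show ?case by (simp add: T_def s_def mult_ac)
  qed
  \<comment> \<open>The integrals against \<open>s ^ n\<close> equal \<open>L\<close> of products
    with \<open>\<psi> ^ n\<close> and tend to 0. Averages of these powers converge almost
    everywhere to \<open>I\<close>, even where \<open>s\<close> is unimodular and its powers have no
    limit.\<close>
  have kill: "(\<integral>z. I z * (g z * p z * h z) \<partial>\<nu>) = 0" if g: "good \<theta> g" and p: "is_poly p" for \<theta> g p
  proof -
    define c where "c n = (\<integral>z. s z ^ n * (g z * p z * h z) \<partial>\<nu>)" for n
    have ig: "integrable \<nu> (\<lambda>z. g z * p z * h z)" by (rule good_int [OF g p])
    have isn: "integrable \<nu> (\<lambda>z. s z ^ n * (g z * p z * h z))" for n
      using good_int [OF power [OF g] p, of n] by (simp add: mult_ac)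
    have cL: "c n = L (\<lambda>z. \<theta> z * \<psi> z ^ n * p z)" for n
    proof -
      have "L (\<lambda>z. \<theta> z * \<psi> z ^ n * p z) = (\<integral>z. g z * s z ^ n * p z * h z \<partial>\<nu>)"
        using power [OF g, of n] p unfolding good_def by blast
      then show ?thesis by (simp add: c_def mult_ac)
    qed
    obtain C Cp where C: "kmult \<theta> C" "kmult p Cp" using g kmult_poly [OF p] unfolding good_def mu_def by blast
    have "(\<lambda>n. L (\<lambda>z. \<theta> z * \<psi> z ^ n * p z)) \<longlonglongrightarrow> L (\<lambda>z. 0)"
    proof (rule wstar_cont_tendsto [OF wstar])
      have "kmult (\<lambda>z. \<theta> z * \<psi> z ^ n * p z) (C * 1 ^ n * Cp)" for n
        by (intro kmult_mult C kmult_power kmult_psi)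
      then show "kmult (\<lambda>z. \<theta> z * \<psi> z ^ n * p z) (C * Cp)" for n by simp
      fix z :: "complex^'d" assume "z \<in> ball 0 1"
      then have "(\<lambda>n. \<psi> z ^ n) \<longlonglongrightarrow> 0" by (rule LIMSEQ_power_zero [OF psi_less_1])
      then have "(\<lambda>n. \<theta> z * \<psi> z ^ n * p z) \<longlonglongrightarrow> \<theta> z * 0 * p z" by (intro tendsto_mult tendsto_const)
      then show "(\<lambda>n. \<theta> z * \<psi> z ^ n * p z) \<longlonglongrightarrow> 0" by simp
    qed
    moreover have "L (\<lambda>z. 0) = 0" using L_cmul [OF mu_const, of 0 0] by simp
    ultimately have c0: "c \<longlonglongrightarrow> 0" by (simp add: cL [abs_def])
    let ?A = "\<lambda>m z. (\<Sum>k<Suc m. s z ^ (Suc m + k)) / of_nat (Suc m)"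
    have "(\<lambda>m. \<integral>z. ?A m z * (g z * p z * h z) \<partial>\<nu>) \<longlonglongrightarrow> (\<integral>z. I z * (g z * p z * h z) \<partial>\<nu>)"
    proof (rule integral_dominated_convergence)
      show "integrable \<nu> (\<lambda>z. norm (g z * p z * h z))" by (rule integrable_norm [OF ig])
      show "(\<lambda>z. I z * (g z * p z * h z)) \<in> borel_measurable \<nu>"
        using Im borel_measurable_integrable [OF ig] unfolding nu_meas by (rule borel_measurable_times)
      have "?A m \<in> borel_measurable borel" for m by measurable
      then show "(\<lambda>z. ?A m z * (g z * p z * h z)) \<in> borel_measurable \<nu>" for m
        using borel_measurable_integrable [OF ig] unfolding nu_meas by (rule borel_measurable_times)
      show "AE z in \<nu>. (\<lambda>m. ?A m z * (g z * p z * h z)) \<longlonglongrightarrow> I z * (g z * p z * h z)"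
        using t1 unfolding I_def s_def [symmetric]
        by eventually_elim (rule tendsto_mult [OF power_average_tendsto tendsto_const])
      show "AE z in \<nu>. norm (?A m z * (g z * p z * h z)) \<le> norm (g z * p z * h z)" for m
        using t1 unfolding s_def [symmetric]
      proof eventually_elim
        case (elim z)
        have "cmod (\<Sum>k<Suc m. s z ^ (Suc m + k)) \<le> (\<Sum>k<Suc m. 1)"
          using elim by (intro sum_norm_le) (simp only: norm_power power_le_one norm_ge_zero)
        then have "cmod (?A m z) \<le> 1" unfolding norm_divide norm_of_nat by simp
        then show ?case using mult_right_mono [of "cmod (?A m z)" 1 "norm (g z * p z * h z)"]
          unfolding norm_mult [of "?A m z"] by simp
      qed
    qed
    moreover have "(\<integral>z. ?A m z * (g z * p z * h z) \<partial>\<nu>) = (\<Sum>k<Suc m. c (Suc m + k)) / of_nat (Suc m)" for m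
    proof -
      have "(\<integral>z. ?A m z * (g z * p z * h z) \<partial>\<nu>) = (\<integral>z. (\<Sum>k<Suc m. s z ^ (Suc m + k) * (g z * p z * h z)) / of_nat (Suc m) \<partial>\<nu>)"
        by (simp only: sum_distrib_right times_divide_eq_left)
      also have "\<dots> = (\<Sum>k<Suc m. c (Suc m + k)) / of_nat (Suc m)"
        unfolding c_def integral_divide_zero by (subst Bochner_Integration.integral_sum [OF isn]) rule
      finally show ?thesis .
    qed
    ultimately have "(\<lambda>m. (\<Sum>k<Suc m. c (Suc m + k)) / of_nat (Suc m)) \<longlonglongrightarrow> (\<integral>z. I z * (g z * p z * h z) \<partial>\<nu>)"
      by (simp only:)
    from LIMSEQ_unique [OF this average_tendsto_zero [OF c0]] show ?thesis .
  qed
  \<comment> \<open>Words in the conjugate coordinates. The class \<open>X\<close> below tests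
    against all words and polynomials, which makes it stable under multiplication by coordinates and
    by their conjugates; from 1 it thus reaches all real polynomial functions.\<close>
  define cw where "cw w z = (\<Prod>i\<leftarrow>w. cnj (z $ i))" for w :: "'d list" and z :: "complex^'d"
  define X where "X = {u. bdm u \<and> (\<forall>w p. is_poly p \<longrightarrow> (\<integral>z. I z * (u z * cw w z * p z * h z) \<partial>\<nu>) = 0)}"
  have X1: "(\<lambda>z. 1) \<in> X"
    unfolding X_def
  proof (intro CollectI conjI allI impI bdm_const)
    fix w :: "'d list" and p :: "complex^'d \<Rightarrow> complex" assume p: "is_poly p"
    define tw where "tw z = (\<Prod>i\<leftarrow>w. t z $ Some i)" for z
    have "\<exists>\<theta>. good \<theta> (\<lambda>z. \<Prod>i\<leftarrow>w. t z $ Some i)"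
    proof (induction w)
      case Nil then show ?case using good_one by auto
    next
      case (Cons i w)
      then obtain \<theta> where "good \<theta> (\<lambda>z. \<Prod>i\<leftarrow>w. t z $ Some i)" by blast
      from tg [OF this, of "Some i"] show ?case by (auto simp: mult.commute)
    qed
    then obtain \<theta> where "good \<theta> tw" unfolding tw_def by blast
    from kill [OF this p] have 0: "(\<integral>z. I z * (tw z * p z * h z) \<partial>\<nu>) = 0" .
    have twm: "tw \<in> borel_measurable borel" using \<open>good \<theta> tw\<close> unfolding good_def bdm_def by blast
    have cwm: "bdm (cw w)" unfolding cw_def
    proof (rule bdm_continuous, induction w)
      case (Cons i w) then show ?case by (auto intro!: continuous_intros)
    qed simp
    \<comment> \<open>Where \<open>s = 1\<close> the product of the boundary functions of the
      \<open>q i\<close> is the conjugate word up to a power of \<open>\<kappa>\<close>; elsewhere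
      \<open>I\<close> vanishes. Division by that power is possible since \<open>\<kappa>\<close> is
      positive.\<close>
    have "(\<integral>z. I z * (tw z * p z * h z) \<partial>\<nu>) = (\<integral>z. of_real \<kappa> ^ length w * (I z * (1 * cw w z * p z * h z)) \<partial>\<nu>)"
    proof (rule integral_cong_AE)
      have pm: "p \<in> borel_measurable borel" "cw w \<in> borel_measurable borel" using bdm_poly [OF p] cwm unfolding bdm_def by auto
      show "(\<lambda>z. I z * (tw z * p z * h z)) \<in> borel_measurable \<nu>"
        "(\<lambda>z. of_real \<kappa> ^ length w * (I z * (1 * cw w z * p z * h z))) \<in> borel_measurable \<nu>"
        unfolding nu_meas using Im twm pm h_meas by measurable
      show "AE z in \<nu>. I z * (tw z * p z * h z) = of_real \<kappa> ^ length w * (I z * (1 * cw w z * p z * h z))"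
        using tq
      proof eventually_elim
        case (elim z)
        show ?case
        proof (cases "s z = 1")
          case True
          then have "tw z = (\<Prod>i\<leftarrow>w. of_real \<kappa> * cnj (z $ i))" using elim by (simp add: tw_def s_def)
          also have "\<dots> = of_real \<kappa> ^ length w * cw w z" unfolding cw_def by (induction w) auto
          finally show ?thesis by (simp add: mult_ac)
        qed (simp add: I_def)
      qed
    qed
    with 0 show "(\<integral>z. I z * (1 * cw w z * p z * h z) \<partial>\<nu>) = 0" using kappa_pos by simp
  qed
  have cwb: "bdm (cw w)" for w unfolding cw_def
  proof (rule bdm_continuous, induction w)
    case (Cons i w) then show ?case by (auto intro!: continuous_intros)
  qed simp
  have int: "integrable \<nu> (\<lambda>z. I z * (u z * cw w z * p z * h z))" if "bdm u" "is_poly p" for u w p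
    by (intro bdm_integrable bdm_mult [OF bI] bdm_mult [OF bdm_mult [OF bdm_mult [OF that(1) cwb] bdm_poly [OF that(2)]] bdm_h])
  have Xadd: "(\<lambda>z. u z + v z) \<in> X" if "u \<in> X" "v \<in> X" for u v
  proof -
    have "(\<integral>z. I z * ((u z + v z) * cw w z * p z * h z) \<partial>\<nu>) = 0" if p: "is_poly p" for w p
    proof -
      have "(\<integral>z. I z * ((u z + v z) * cw w z * p z * h z) \<partial>\<nu>) = (\<integral>z. I z * (u z * cw w z * p z * h z) + I z * (v z * cw w z * p z * h z) \<partial>\<nu>)"
        by (simp add: algebra_simps)
      also have "\<dots> = (\<integral>z. I z * (u z * cw w z * p z * h z) \<partial>\<nu>) + (\<integral>z. I z * (v z * cw w z * p z * h z) \<partial>\<nu>)"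
        using \<open>u \<in> X\<close> \<open>v \<in> X\<close> p by (intro Bochner_Integration.integral_add int) (auto simp: X_def)
      finally show ?thesis using \<open>u \<in> X\<close> \<open>v \<in> X\<close> p by (simp add: X_def)
    qed
    then show ?thesis using that by (auto simp: X_def intro: bdm_add)
  qed
  have Xpoly: "(\<lambda>z. r z * u z) \<in> X" if r: "is_poly r" and u: "u \<in> X" for r u
  proof -
    have "(\<integral>z. I z * (r z * u z * cw w z * p z * h z) \<partial>\<nu>) = 0" if p: "is_poly p" for w p
    proof -
      have "(\<integral>z. I z * (u z * cw w z * (r z * p z) * h z) \<partial>\<nu>) = 0" using u is_poly_mult [OF r p] by (simp add: X_def)
      then show ?thesis by (simp add: mult_ac)
    qed
    then show ?thesis using u by (auto simp: X_def intro: bdm_mult bdm_poly r)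
  qed
  have Xcnj: "(\<lambda>z. cnj (z $ i) * u z) \<in> X" if u: "u \<in> X" for i u
  proof -
    have "(\<integral>z. I z * (cnj (z $ i) * u z * cw w z * p z * h z) \<partial>\<nu>) = 0" if p: "is_poly p" for w p
    proof -
      have "(\<integral>z. I z * (u z * cw (i # w) z * p z * h z) \<partial>\<nu>) = 0" using u p unfolding X_def by blast
      then show ?thesis by (simp add: mult_ac cw_def)
    qed
    moreover have "bdm (\<lambda>z. cnj (z $ i))" by (intro bdm_continuous continuous_intros)
    ultimately show ?thesis using u by (auto simp: X_def intro: bdm_mult)
  qed
  \<comment> \<open>The real coordinates are real and imaginary parts of the complex ones, hence
    combinations of \<open>z $ i\<close> and its conjugate.\<close>
  have Xlin: "(\<lambda>z. of_real (z \<bullet> b) * u z) \<in> X" if b: "b \<in> Basis" and u: "u \<in> X" for b :: "complex^'d" and u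
  proof -
    obtain i e where be: "b = axis i e" "e = 1 \<or> e = \<i>" using b by (auto simp: Basis_vec_def Basis_complex_def)
    have "of_real (z \<bullet> b) = (if e = 1 then 1 / 2 else - \<i> / 2) * z $ i + (if e = 1 then 1 / 2 else \<i> / 2) * cnj (z $ i)" for z
      using be by (auto simp: inner_axis complex_eq_iff inner_complex_def)
    then have "(\<lambda>z. of_real (z \<bullet> b) * u z) = (\<lambda>z. (if e = 1 then 1 / 2 else - \<i> / 2) * (z $ i * u z) + (if e = 1 then 1 / 2 else \<i> / 2) * (cnj (z $ i) * u z))"
      by (simp add: fun_eq_iff algebra_simps)
    then show ?thesis
      by (simp only:) (intro Xadd Xpoly [OF is_poly_const] Xpoly [OF is_poly_coord] Xcnj u)
  qed
  have Xsum: "(\<lambda>z. \<Sum>b\<in>J. f b z) \<in> X" if "\<And>b. b \<in> J \<Longrightarrow> f b \<in> X" for J :: "(complex^'d) set" and f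
    using that
  proof (induction J rule: infinite_finite_induct)
    case (insert b J) then show ?case using Xadd [of "f b" "\<lambda>z. \<Sum>b\<in>J. f b z"] by simp
  qed (use Xpoly [OF is_poly_const X1, of 0] in auto)
  have Xreal: "u \<in> X \<Longrightarrow> (\<lambda>z. of_real (r z) * u z) \<in> X" if "real_polynomial_function r" for r u
    using that
  proof (induction arbitrary: u rule: real_polynomial_function.induct)
    case (linear f)
    have fe: "f z = (\<Sum>b\<in>Basis. (z \<bullet> b) * f b)" for z
    proof -
      have "f z = f (\<Sum>b\<in>Basis. (z \<bullet> b) *\<^sub>R b)" by (simp add: euclidean_representation)
      also have "\<dots> = (\<Sum>b\<in>Basis. (z \<bullet> b) * f b)"
        using bounded_linear.linear [OF linear(1)] by (simp add: linear_sum linear_scale)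
      finally show ?thesis .
    qed
    have "of_real (f z) * u z = (\<Sum>b\<in>Basis. of_real (f b) * (of_real (z \<bullet> b) * u z))" for z
      by (subst fe) (simp add: sum_distrib_right sum_distrib_left mult_ac)
    then show ?case by (simp only:) (intro Xsum Xpoly [OF is_poly_const] Xlin linear)
  next
    case (const c) then show ?case using Xpoly [OF is_poly_const] by simp
  next
    case (add f g) then show ?case using Xadd [of "\<lambda>z. of_real (f z) * u z" "\<lambda>z. of_real (g z) * u z"]
      by (simp add: distrib_right)
  next
    case (mult f g)
    from mult.IH(1) [OF mult.IH(2) [OF mult.prems]] show ?case by (simp add: mult.assoc)
  qed
  have rp: "(\<integral>z. of_real (r z) * (I z * h z) \<partial>\<nu>) = 0" if "real_polynomial_function r" for r
  proof -
    have "(\<lambda>z. of_real (r z) * 1) \<in> X" by (rule Xreal [OF that X1])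
    then have "(\<integral>z. I z * (of_real (r z) * 1 * cw [] z * 1 * h z) \<partial>\<nu>) = 0" using is_poly_const [of 1] unfolding X_def by blast
    then show ?thesis by (simp add: cw_def mult_ac)
  qed
  have iIh: "integrable \<nu> (\<lambda>z. I z * h z)" by (intro bdm_integrable bdm_mult bI bdm_h)
  have "AE z in \<nu>. I z * h z = 0"
  proof (rule AE_zero_of_continuous [OF nu.finite_measure_axioms nu_sets iIh])
    fix g :: "complex^'d \<Rightarrow> real" assume g: "continuous_on UNIV g" "\<And>x. \<bar>g x\<bar> \<le> 1"
    let ?J = "\<integral>z. of_real (g z) * (I z * h z) \<partial>\<nu>"
    have bg: "bdm (\<lambda>z. of_real (g z))" by (intro bdm_continuous continuous_intros g)
    have ig: "integrable \<nu> (\<lambda>z. of_real (g z) * (I z * h z))" by (intro bdm_integrable bdm_mult bI bdm_h bg)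
    have le: "cmod ?J \<le> e * measure \<nu> (space \<nu>)" if e: "e > 0" for e
    proof -
      obtain r where r: "real_polynomial_function r" "\<And>x. x \<in> sphere 0 1 \<Longrightarrow> \<bar>g x - r x\<bar> < e"
        using Stone_Weierstrass_real_polynomial_function [OF compact_sphere continuous_on_subset [OF g(1) subset_UNIV] e] by blast
      have "(\<lambda>z. of_real (r z) * 1) \<in> X" by (rule Xreal [OF r(1) X1])
      then have br: "bdm (\<lambda>z. of_real (r z))" by (simp add: X_def)
      have ir: "integrable \<nu> (\<lambda>z. of_real (r z) * (I z * h z))" by (intro bdm_integrable bdm_mult bI bdm_h br)
      have "?J = ?J - (\<integral>z. of_real (r z) * (I z * h z) \<partial>\<nu>)" using rp [OF r(1)] by simp
      also have "\<dots> = (\<integral>z. of_real (g z) * (I z * h z) - of_real (r z) * (I z * h z) \<partial>\<nu>)"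
        by (rule Bochner_Integration.integral_diff [OF ig ir, symmetric])
      finally have J: "?J = (\<integral>z. of_real (g z) * (I z * h z) - of_real (r z) * (I z * h z) \<partial>\<nu>)" .
      have "cmod ?J \<le> (\<integral>z. norm (of_real (g z) * (I z * h z) - of_real (r z) * (I z * h z)) \<partial>\<nu>)"
        unfolding J by (rule integral_norm_bound)
      also have "\<dots> \<le> (\<integral>z. e \<partial>\<nu>)"
      proof (rule integral_mono_AE)
        show "integrable \<nu> (\<lambda>z. norm (of_real (g z) * (I z * h z) - of_real (r z) * (I z * h z)))"
          using ig ir by (intro integrable_norm Bochner_Integration.integrable_diff)
        show "AE z in \<nu>. norm (of_real (g z) * (I z * h z) - of_real (r z) * (I z * h z)) \<le> e"
          using nu_sphere
        proof eventually_elim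
          case (elim z)
          have "of_real (g z) * (I z * h z) - of_real (r z) * (I z * h z) = of_real (g z - r z) * (I z * h z)"
            by (simp add: algebra_simps)
          then have "norm (of_real (g z) * (I z * h z) - of_real (r z) * (I z * h z)) = \<bar>g z - r z\<bar> * cmod (I z)"
            by (simp only: norm_mult norm_of_real h_norm mult_1_right)
          also have "\<dots> \<le> e * 1" using r(2) [OF elim] e by (intro mult_mono) (auto simp: I_def)
          finally show ?case by simp
        qed
      qed simp
      finally show ?thesis by (simp add: mult.commute)
    qed
    have "cmod ?J \<le> 0 + e" if "e > 0" for e
    proof -
      have M: "0 < measure \<nu> (space \<nu>) + 1" using measure_nonneg [of \<nu> "space \<nu>"] by linarith
      have "cmod ?J \<le> (e / (measure \<nu> (space \<nu>) + 1)) * measure \<nu> (space \<nu>)" using M that by (intro le) simp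
      also have "\<dots> \<le> e" using M that by (simp add: field_simps)
      finally show ?thesis by simp
    qed
    then have "cmod ?J \<le> 0" by (rule field_le_epsilon)
    then show "?J = 0" by simp
  qed
  moreover have "AE z in \<nu>. z \<in> E \<longrightarrow> t z $ None = 1"
    by (rule tE) (use E u psi_at_unbounded in blast)
  ultimately show ?thesis
  proof eventually_elim
    case (elim z)
    have "h z \<noteq> 0" using h_norm [of z] by auto
    then show ?case using elim by (auto simp: I_def s_def)
  qed
qed

end

text \<open>What remains is to normalise the given vector to norm 1, as required by
  \<open>pick_state\<close>; scaling by a positive constant preserves infinite radial
  limits.\<close>

lemma weak_unbounded_imp_totally_null:
  assumes P: "pick_space a K" and E: "compact E" "E \<subseteq> sphere 0 1"
    and wu: "weak_unboundedness_set K (E :: (complex^'d) set)"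
  shows "totally_null K E"
proof (cases "E = {}")
  case True then show ?thesis by (simp add: totally_null_def)
next
  case False
  interpret pick_space a K by (rule P)
  obtain f where f: "\<And>n. in_H K (f n)" "summable (\<lambda>n. hnorm2 K (f n))"
    and u: "\<And>z. z \<in> E \<Longrightarrow> filterlim (\<lambda>r :: real. sqrt (\<Sum>n. (cmod (f n (r *\<^sub>R z)))\<^sup>2)) at_top (at_left 1)"
    using wu unfolding weak_unboundedness_set_def by blast
  define S where "S = (\<Sum>n. hnorm2 K (f n))"
  have Eb: "E \<in> sets borel" using borel_closed [OF compact_imp_closed [OF E(1)]] by simp
  have S0: "0 \<le> S" unfolding S_def using f hnorm2_nonneg by (intro suminf_nonneg) auto
  \<comment> \<open>A vector of norm 0 vanishes on the ball, which contradicts the infinite limit at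
    some point of the nonempty set.\<close>
  have "S \<noteq> 0"
  proof
    assume "S = 0"
    then have h0: "hnorm2 K (f n) = 0" for n
      using suminf_eq_zero_iff [OF f(2)] hnorm2_nonneg f(1) unfolding S_def by blast
    obtain z where z: "z \<in> E" using False by blast
    have "f n (r *\<^sub>R z) = 0" if r: "\<bar>r\<bar> < 1" for n and r :: real
    proof -
      have "r *\<^sub>R z \<in> ball 0 1" using z E r by auto
      then have "(cmod (ev [(1, r *\<^sub>R z)] (f n)))\<^sup>2 \<le> hnorm2 K (f n) * N [(1, r *\<^sub>R z)]" by (intro ev_le f) simp
      then show ?thesis by (simp add: h0)
    qed
    then have "\<forall>\<^sub>F r in at_left 1. sqrt (\<Sum>n. (cmod (f n (r *\<^sub>R z)))\<^sup>2) = 0"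
      by (auto simp: eventually_at_left_field intro!: exI [of _ "0 :: real"])
    moreover have "\<forall>\<^sub>F r in at_left 1. 1 \<le> sqrt (\<Sum>n. (cmod (f n (r *\<^sub>R z)))\<^sup>2)"
      using u [OF z] unfolding filterlim_at_top by blast
    ultimately have "\<forall>\<^sub>F r in at_left (1 :: real). False" by eventually_elim simp
    then show False by simp
  qed
  with S0 have S: "S > 0" by simp
  define F where "F n = (\<lambda>z. of_real (1 / sqrt S) * f n z)" for n
  have F: "in_H K (F n)" "hnorm2 K (F n) = hnorm2 K (f n) / S" for n
  proof -
    show "in_H K (F n)" unfolding F_def by (rule in_H_cmul(1) [OF f(1)])
    show "hnorm2 K (F n) = hnorm2 K (f n) / S"
      unfolding F_def hnorm2_cmul [OF f(1)] using S by (simp add: norm_divide power_divide)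
  qed
  have state: "pick_state a K F"
  proof
    show "in_H K (F n)" for n by (rule F)
    show "(\<lambda>n. hnorm2 K (F n)) sums 1"
      unfolding F using sums_divide [OF summable_sums [OF f(2)], of S] S by (simp add: S_def)
  qed
  have uF: "filterlim (\<lambda>r :: real. sqrt (\<Sum>n. (cmod (F n (r *\<^sub>R z)))\<^sup>2)) at_top (at_left 1)" if z: "z \<in> E" for z
  proof -
    have eq: "(1 / sqrt S) * sqrt (\<Sum>n. (cmod (f n (r *\<^sub>R z)))\<^sup>2) = sqrt (\<Sum>n. (cmod (F n (r *\<^sub>R z)))\<^sup>2)" if r: "0 < r" "r < 1" for r
    proof -
      have b: "r *\<^sub>R z \<in> ball 0 1" using z E r by auto
      have "summable (\<lambda>n. (cmod (f n (r *\<^sub>R z)))\<^sup>2)"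
      proof (rule summable_comparison_test' [OF summable_mult2 [OF f(2)]])
        fix n
        have "(cmod (ev [(1, r *\<^sub>R z)] (f n)))\<^sup>2 \<le> hnorm2 K (f n) * N [(1, r *\<^sub>R z)]" using b by (intro ev_le f) simp
        then show "norm ((cmod (f n (r *\<^sub>R z)))\<^sup>2) \<le> hnorm2 K (f n) * N [(1, r *\<^sub>R z)]" by simp
      qed
      from suminf_mult [OF this, of "1 / S"] have "(\<Sum>n. (cmod (F n (r *\<^sub>R z)))\<^sup>2) = (1 / S) * (\<Sum>n. (cmod (f n (r *\<^sub>R z)))\<^sup>2)"
        using S by (simp add: F_def norm_mult norm_divide power_mult_distrib power_divide)
      then show ?thesis by (simp add: real_sqrt_mult real_sqrt_divide)
    qed
    have "filterlim (\<lambda>r :: real. (1 / sqrt S) * sqrt (\<Sum>n. (cmod (f n (r *\<^sub>R z)))\<^sup>2)) at_top (at_left 1)"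
      using S by (intro filterlim_tendsto_pos_mult_at_top [OF tendsto_const _ u [OF z]]) simp
    moreover have "\<forall>\<^sub>F r in at_left 1. (1 / sqrt S) * sqrt (\<Sum>n. (cmod (f n (r *\<^sub>R z)))\<^sup>2) = sqrt (\<Sum>n. (cmod (F n (r *\<^sub>R z)))\<^sup>2)"
      using eq by (auto simp: eventually_at_left_field intro!: exI [of _ "0 :: real"])
    ultimately show ?thesis using filterlim_cong [OF refl refl] by fastforce
  qed
  show ?thesis unfolding totally_null_def
  proof (intro conjI allI impI Eb)
    fix \<nu> h assume "henkin K \<nu> h"
    then obtain L where "cmeasure_rep \<nu> h" "wstar_cont_functional K L" "\<And>p. is_poly p \<Longrightarrow> L p = (\<integral>z. p z * h z \<partial>\<nu>)"
      unfolding henkin_def by blast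
    then interpret henkin_state a K F \<nu> h L
      using state by (intro henkin_state.intro henkin_state_axioms.intro)
    have "AE z in \<nu>. z \<notin> E" by (rule AE_not_unbounded [OF E(2) uF])
    moreover have "E \<in> sets \<nu>" using Eb nu_sets by simp
    ultimately show "emeasure \<nu> E = 0" using AE_iff_null_sets null_setsD1 by blast
  qed
qed

section \<open>Positive functionals and measures\<close>

definition sublinear :: "('a :: real_vector \<Rightarrow> real) \<Rightarrow> bool" where
  "sublinear p \<longleftrightarrow> (\<forall>x y. p (x + y) \<le> p x + p y) \<and> (\<forall>t x. 0 \<le> t \<longrightarrow> p (t *\<^sub>R x) = t * p x)"

lemma sublinearD:
  assumes "sublinear p"
  shows "p (x + y) \<le> p x + p y" "0 \<le> t \<Longrightarrow> p (t *\<^sub>R x) = t * p x" "p 0 = 0" "- p (- x) \<le> p x"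
proof -
  show 1: "p (x + y) \<le> p x + p y" for x y using assms by (simp add: sublinear_def)
  show 2: "p (t *\<^sub>R x) = t * p x" if "0 \<le> t" for t x using assms that by (simp add: sublinear_def)
  show 0: "p 0 = 0" using 2 [of 0 0] by simp
  show "- p (- x) \<le> p x" using 1 [of x "- x"] 0 by simp
qed

text \<open>Hahn--Banach: a minimal sublinear functional below \<^term>\<open>p\<close> is linear.\<close>

lemma sublinear_dominates_linear:
  fixes p :: "'a :: real_vector \<Rightarrow> real"
  assumes p: "sublinear p"
  shows "\<exists>f. linear f \<and> (\<forall>x. f x \<le> p x)"
proof -
  let ?A = "{q :: 'a \<Rightarrow> real. sublinear q \<and> (\<forall>x. q x \<le> p x)}"
  \<comment> \<open>The order is reversed: maximal elements in Zorn's lemma are pointwise minimal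
    sublinear functionals, and chains are bounded by their infima.\<close>
  let ?P = "\<lambda>q q' :: 'a \<Rightarrow> real. \<forall>x. q' x \<le> q x"
  have "\<exists>m\<in>?A. \<forall>q\<in>?A. ?P m q \<longrightarrow> q = m"
  proof (rule predicate_Zorn)
    show "partial_order_on ?A (relation_of ?P ?A)"
      by (rule partial_order_on_relation_ofI) (auto intro: order_trans intro!: ext antisym)
    fix C assume C: "C \<in> Chains (relation_of ?P ?A)"
    have CA: "C \<subseteq> ?A" using Chains_relation_of [OF C] .
    have tot: "?P q q' \<or> ?P q' q" if "q \<in> C" "q' \<in> C" for q q'
      using C that unfolding Chains_def relation_of_def by blast
    show "\<exists>u\<in>?A. \<forall>q\<in>C. ?P q u"
    proof (cases "C = {}")
      case True then show ?thesis using p by auto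
    next
      case False
      define u where "u x = (INF q\<in>C. q x)" for x
      have bdd: "bdd_below ((\<lambda>q. q x) ` C)" for x
      proof (rule bdd_belowI2 [where m = "- p (- x)"])
        fix q assume "q \<in> C"
        then have "sublinear q" "q (- x) \<le> p (- x)" using CA by auto
        then show "- p (- x) \<le> q x" using sublinearD(4) [of q x] by linarith
      qed
      have le: "u x \<le> q x" if "q \<in> C" for q x unfolding u_def by (rule cINF_lower [OF bdd that])
      have "sublinear u"
        unfolding sublinear_def
      proof (intro conjI allI impI)
        fix x y
        have "u (x + y) - q y \<le> u x" if q: "q \<in> C" for q
          unfolding u_def [of x]
        proof (rule cINF_greatest [OF False])
          fix q' assume q': "q' \<in> C"
          show "u (x + y) - q y \<le> q' x"
          proof (cases "?P q q'")
            case True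
            have "u (x + y) \<le> q' x + q' y" using le [OF q', of "x + y"] sublinearD(1) [of q' x y] CA q' by force
            then show ?thesis using True by (simp add: algebra_simps) (smt (verit))
          next
            case False
            then have "?P q' q" using tot q q' by blast
            moreover have "u (x + y) \<le> q x + q y" using le [OF q, of "x + y"] sublinearD(1) [of q x y] CA q by force
            ultimately show ?thesis by (simp add: algebra_simps) (smt (verit))
          qed
        qed
        then have "u (x + y) - u x \<le> u y" unfolding u_def [of y] by (intro cINF_greatest [OF False]) (simp add: algebra_simps)
        then show "u (x + y) \<le> u x + u y" by simp
      next
        fix t :: real and x assume t: "0 \<le> t"
        show "u (t *\<^sub>R x) = t * u x"
        proof (cases "t = 0")
          case True
          have "q 0 = 0" if "q \<in> C" for q using that CA sublinearD(3) by blast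
          then have "(\<lambda>q. q 0) ` C = {0}" using False by (auto simp: image_iff)
          then show ?thesis using True by (simp add: u_def)
        next
          case tp: False
          have a: "t * u x \<le> u (t *\<^sub>R x)" unfolding u_def [of "t *\<^sub>R x"]
          proof (rule cINF_greatest [OF False])
            fix q assume "q \<in> C"
            then show "t * u x \<le> q (t *\<^sub>R x)" using le [of q x] sublinearD(2) [of q t x] CA t by (auto intro!: mult_left_mono)
          qed
          have "u (t *\<^sub>R x) / t \<le> u x" unfolding u_def [of x]
          proof (rule cINF_greatest [OF False])
            fix q assume "q \<in> C"
            then show "u (t *\<^sub>R x) / t \<le> q x" using le [of q "t *\<^sub>R x"] sublinearD(2) [of q t x] CA t tp
              by (auto simp: field_simps)
          qed
          then show ?thesis using a t tp by (simp add: field_simps)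
        qed
      qed
      moreover have "u x \<le> p x" for x
      proof -
        obtain q where "q \<in> C" using False by blast
        then show ?thesis using le [of q x] CA order_trans by blast
      qed
      ultimately show ?thesis using le by blast
    qed
  qed
  then obtain q where q: "sublinear q" "\<And>x. q x \<le> p x" and min: "\<And>q'. sublinear q' \<Longrightarrow> (\<And>x. q' x \<le> p x) \<Longrightarrow> (\<And>x. q' x \<le> q x) \<Longrightarrow> q' = q"
    by blast
  have super: "q x + q y \<le> q (x + y)" for x y
  proof -
    \<comment> \<open>The largest sublinear functional below \<open>q\<close> whose value at
      \<open>- x\<close> is at most \<open>- q x\<close>. Minimality gives \<open>q' = q\<close>,
      and \<open>t = 1\<close> then yields superadditivity.\<close>
    define q' where "q' y = (INF t\<in>{0..}. q (y + t *\<^sub>R x) - t * q x)" for y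
    have bdd: "bdd_below ((\<lambda>t. q (y + t *\<^sub>R x) - t * q x) ` {0..})" for y
    proof (rule bdd_belowI2 [where m = "- q (- y)"])
      fix t :: real assume "t \<in> {0..}"
      then have "t * q x = q ((y + t *\<^sub>R x) + - y)" using sublinearD(2) [OF q(1), of t x] by simp
      also have "\<dots> \<le> q (y + t *\<^sub>R x) + q (- y)" by (rule sublinearD(1) [OF q(1)])
      finally show "- q (- y) \<le> q (y + t *\<^sub>R x) - t * q x" by simp
    qed
    have le: "q' y \<le> q (y + t *\<^sub>R x) - t * q x" if "0 \<le> t" for t y
      unfolding q'_def using that by (intro cINF_lower [OF bdd]) simp
    have ne: "{0 :: real..} \<noteq> {}" by auto
    have leq: "q' y \<le> q y" for y using le [of 0 y] by simp
    have "sublinear q'" unfolding sublinear_def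
    proof (intro conjI allI impI)
      fix y z
      have "q' (y + z) - (q (z + s *\<^sub>R x) - s * q x) \<le> q' y" if s: "0 \<le> s" for s
        unfolding q'_def [of y]
      proof (rule cINF_greatest [OF ne])
        fix t :: real assume t: "t \<in> {0..}"
        have "q' (y + z) \<le> q ((y + z) + (t + s) *\<^sub>R x) - (t + s) * q x" using s t by (intro le) simp
        also have "(y + z) + (t + s) *\<^sub>R x = (y + t *\<^sub>R x) + (z + s *\<^sub>R x)" by (simp add: algebra_simps)
        also have "q \<dots> \<le> q (y + t *\<^sub>R x) + q (z + s *\<^sub>R x)" by (rule sublinearD(1) [OF q(1)])
        finally show "q' (y + z) - (q (z + s *\<^sub>R x) - s * q x) \<le> q (y + t *\<^sub>R x) - t * q x"
          by (simp add: algebra_simps)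
      qed
      then have "q' (y + z) - q' y \<le> q' z" unfolding q'_def [of z] by (intro cINF_greatest [OF ne]) (simp add: algebra_simps)
      then show "q' (y + z) \<le> q' y + q' z" by simp
    next
      fix s :: real and y assume s: "0 \<le> s"
      show "q' (s *\<^sub>R y) = s * q' y"
      proof (cases "s = 0")
        case True
        have "(\<lambda>t. q (0 + t *\<^sub>R x) - t * q x) ` {0..} = {0}" using sublinearD(2) [OF q(1)] by (auto simp: image_iff)
        then have "q' 0 = 0" unfolding q'_def by simp
        then show ?thesis using True by simp
      next
        case sp: False
        have a: "s * q' y \<le> q' (s *\<^sub>R y)" unfolding q'_def [of "s *\<^sub>R y"]
        proof (rule cINF_greatest [OF ne])
          fix t :: real assume t: "t \<in> {0..}"
          have "q (s *\<^sub>R y + t *\<^sub>R x) = q (s *\<^sub>R (y + (t / s) *\<^sub>R x))" using sp by (simp add: scaleR_add_right)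
          also have "\<dots> = s * q (y + (t / s) *\<^sub>R x)" by (rule sublinearD(2) [OF q(1) s])
          finally have "q (s *\<^sub>R y + t *\<^sub>R x) - t * q x = s * (q (y + (t / s) *\<^sub>R x) - (t / s) * q x)"
            using sp by (simp add: right_diff_distrib)
          moreover have "q' y \<le> q (y + (t / s) *\<^sub>R x) - (t / s) * q x" using s t by (intro le) simp
          ultimately show "s * q' y \<le> q (s *\<^sub>R y + t *\<^sub>R x) - t * q x" using s by (simp add: mult_left_mono)
        qed
        have "q' (s *\<^sub>R y) / s \<le> q' y" unfolding q'_def [of y]
        proof (rule cINF_greatest [OF ne])
          fix t :: real assume t: "t \<in> {0..}"
          have "q' (s *\<^sub>R y) \<le> q (s *\<^sub>R y + (s * t) *\<^sub>R x) - (s * t) * q x" using s t by (intro le) simp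
          also have "s *\<^sub>R y + (s * t) *\<^sub>R x = s *\<^sub>R (y + t *\<^sub>R x)" by (simp add: scaleR_add_right)
          also have "q \<dots> = s * q (y + t *\<^sub>R x)" by (rule sublinearD(2) [OF q(1) s])
          finally show "q' (s *\<^sub>R y) / s \<le> q (y + t *\<^sub>R x) - t * q x" using s sp by (simp add: field_simps)
        qed
        then show ?thesis using a s sp by (simp add: field_simps)
      qed
    qed
    then have "q' = q" using min [of q'] leq q(2) order_trans by blast
    then have "q y \<le> q (y + 1 *\<^sub>R x) - 1 * q x" using le [of 1 y] by simp
    then show ?thesis by (simp add: add.commute)
  qed
  have add: "q (x + y) = q x + q y" for x y using super [of x y] sublinearD(1) [OF q(1), of x y] by simp
  have neg: "q (- x) = - q x" for x using add [of x "- x"] sublinearD(3) [OF q(1)] by simp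
  have "linear q"
  proof (rule linearI)
    fix r :: real and x
    show "q (r *\<^sub>R x) = r *\<^sub>R q x"
    proof (cases "0 \<le> r")
      case False
      then show ?thesis using neg [of "(- r) *\<^sub>R x"] sublinearD(2) [OF q(1), of "- r" x] by simp
    qed (simp add: sublinearD(2) [OF q(1)])
  qed (rule add)
  then show ?thesis using q(2) by blast
qed

section \<open>The Riesz--Markov theorem for functionals carried by a compact set\<close>

locale positive_functional =
  fixes \<Lambda> :: "('a :: euclidean_space \<Rightarrow>\<^sub>C real) \<Rightarrow> real" and S :: "'a set"
  assumes lin: "linear \<Lambda>" and pos: "\<And>g. (\<And>x. x \<in> S \<Longrightarrow> 0 \<le> apply_bcontfun g x) \<Longrightarrow> 0 \<le> \<Lambda> g"
    and compact_S: "compact S"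
begin

text \<open>\<open>\<Lambda>\<close> on ordinary functions. Since \<open>Bcontfun\<close> is
  unspecified outside \<open>bcontfun\<close>, the rules below carry membership hypotheses.\<close>

definition lam :: "('a \<Rightarrow> real) \<Rightarrow> real" where "lam g = \<Lambda> (Bcontfun g)"

lemma bc_arith:
  fixes f g :: "'a \<Rightarrow> real"
  assumes "f \<in> bcontfun" "g \<in> bcontfun"
  shows "(\<lambda>x. f x + g x) \<in> bcontfun" "(\<lambda>x. f x - g x) \<in> bcontfun" "(\<lambda>x. c * f x) \<in> bcontfun"
  using plus_cont [OF assms] minus_cont [OF assms] scaleR_cont [OF assms(1), of c] by simp_all

lemma bc_sum: fixes f :: "'i \<Rightarrow> 'a \<Rightarrow> real" shows "(\<And>i. i \<in> I \<Longrightarrow> f i \<in> bcontfun) \<Longrightarrow> (\<lambda>x. \<Sum>i\<in>I. f i x :: real) \<in> bcontfun"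
proof (induction I rule: infinite_finite_induct)
  case (insert i I)
  then show ?case using bc_arith(1) [of "f i" "\<lambda>x. \<Sum>i\<in>I. f i x"] by simp
qed (simp_all add: const_bcontfun)

lemma lam_add: assumes "f \<in> bcontfun" "g \<in> bcontfun" shows "lam (\<lambda>x. f x + g x) = lam f + lam g"
proof -
  have "Bcontfun (\<lambda>x. f x + g x) = Bcontfun f + Bcontfun g"
    by (rule bcontfun_eqI) (simp add: Bcontfun_inverse assms bc_arith plus_bcontfun.rep_eq)
  then show ?thesis by (simp add: lam_def linear_add [OF lin])
qed

lemma lam_cmul: assumes "f \<in> bcontfun" shows "lam (\<lambda>x. c * f x) = c * lam f"
proof -
  have "Bcontfun (\<lambda>x. c * f x) = c *\<^sub>R Bcontfun f"
    by (rule bcontfun_eqI) (simp add: Bcontfun_inverse assms bc_arith(3) [OF assms assms] scaleR_bcontfun.rep_eq)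
  then show ?thesis by (simp add: lam_def linear_scale [OF lin])
qed

lemma lam_diff: assumes "f \<in> bcontfun" "g \<in> bcontfun" shows "lam (\<lambda>x. f x - g x) = lam f - lam g"
  using lam_add [OF assms(1) bc_arith(3) [OF assms(2,2)], of "-1"] lam_cmul [OF assms(2), of "-1"] by simp

lemma lam_nonneg: "f \<in> bcontfun \<Longrightarrow> (\<And>x. x \<in> S \<Longrightarrow> 0 \<le> f x) \<Longrightarrow> 0 \<le> lam f"
  unfolding lam_def by (rule pos) (simp add: Bcontfun_inverse)

lemma lam_mono: assumes "f \<in> bcontfun" "g \<in> bcontfun" "\<And>x. x \<in> S \<Longrightarrow> f x \<le> g x" shows "lam f \<le> lam g"
  using lam_nonneg [OF bc_arith(2) [OF assms(2,1)]] lam_diff [OF assms(2,1)] assms(3) by simp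

lemma lam_sum: "(\<And>i. i \<in> I \<Longrightarrow> f i \<in> bcontfun) \<Longrightarrow> lam (\<lambda>x. \<Sum>i\<in>I. f i x) = (\<Sum>i\<in>I. lam (f i))"
proof (induction I rule: infinite_finite_induct)
  case (insert i I)
  then show ?case using lam_add [of "f i" "\<lambda>x. \<Sum>i\<in>I. f i x"] bc_sum [of I f] by simp
qed (use lam_cmul [OF const_bcontfun, of 0 0] in simp_all)

abbreviation T where "T \<equiv> lam (\<lambda>x. 1)"

lemma T_nonneg: "0 \<le> T"
  by (rule lam_nonneg [OF const_bcontfun]) simp

definition below :: "'a set \<Rightarrow> ('a \<Rightarrow> real) set" where
  "below U = {g. continuous_on UNIV g \<and> (\<forall>x. 0 \<le> g x \<and> g x \<le> 1) \<and> (\<forall>x. x \<notin> U \<longrightarrow> g x = 0)}"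

lemma belowD: assumes "g \<in> below U"
  shows "g \<in> bcontfun" "0 \<le> g x" "g x \<le> 1" "x \<notin> U \<Longrightarrow> g x = 0" "continuous_on UNIV g"
  using assms by (auto simp: below_def intro!: bcontfun_normI [where b = 1])

text \<open>For open \<open>U\<close> this is the measure of \<open>U\<close>. The competitors
  vanish off \<open>U\<close> instead of having compact support inside it; compactness comes from
  \<open>S\<close>.\<close>

definition m :: "'a set \<Rightarrow> real" where "m U = Sup (lam ` below U)"

lemma zero_below: "(\<lambda>x. 0) \<in> below U"
  by (simp add: below_def)

lemma lam_zero: "lam (\<lambda>x. 0) = 0"
  using lam_cmul [OF const_bcontfun, of 0 0] by simp

lemma lam_below_bounds: assumes "g \<in> below U" shows "0 \<le> lam g" "lam g \<le> T"
  using belowD [OF assms] by (auto intro!: lam_nonneg lam_mono const_bcontfun)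

lemma lam_le_m: "g \<in> below U \<Longrightarrow> lam g \<le> m U"
  unfolding m_def by (rule cSup_upper) (auto intro!: bdd_aboveI [of _ T] lam_below_bounds)

lemma m_le: "(\<And>g. g \<in> below U \<Longrightarrow> lam g \<le> c) \<Longrightarrow> m U \<le> c"
  unfolding m_def using zero_below by (intro cSup_least) auto

lemma m_nonneg: "0 \<le> m U"
  using lam_le_m [OF zero_below, of U] by (simp add: lam_zero)

lemma m_mono: "U \<subseteq> V \<Longrightarrow> m U \<le> m V"
  by (rule m_le, rule lam_le_m) (auto simp: below_def)

lemma m_le_T: "m U \<le> T"
  by (rule m_le) (rule lam_below_bounds)

lemma m_UNIV: "m UNIV = T"
  by (rule antisym [OF m_le_T]) (rule lam_le_m, simp add: below_def)

text \<open>Positivity tests values on \<open>S\<close> only, so functions vanishing on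
  \<open>S\<close> are null for the functional. This is why the measure is carried by
  \<open>S\<close>.\<close>

lemma m_disjoint_S: assumes "U \<inter> S = {}" shows "m U = 0"
proof (rule antisym [OF m_le m_nonneg])
  fix g assume g: "g \<in> below U"
  have "lam g \<le> lam (\<lambda>x. 0)" 
  proof (intro lam_mono const_bcontfun belowD(1) [OF g])
    fix x assume "x \<in> S"
    then have "x \<notin> U" using assms by blast
    then show "g x \<le> 0" using belowD(4) [OF g] by simp
  qed
  then show "lam g \<le> 0" by (simp add: lam_zero)
qed

text \<open>Increases to the indicator of an open set. The whole space is a separate case because
  \<open>infdist\<close> to the empty set is 0.\<close>

definition bump :: "'a set \<Rightarrow> nat \<Rightarrow> 'a \<Rightarrow> real" where
  "bump U k x = (if U = UNIV then 1 else min 1 (real k * infdist x (- U)))"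

lemma bump_below: "bump U k \<in> below U"
proof (cases "U = UNIV")
  case False
  have "bump U k = (\<lambda>x. min 1 (real k * infdist x (- U)))" using False by (simp add: bump_def fun_eq_iff)
  then have "continuous_on UNIV (bump U k)" by (simp only:) (intro continuous_intros)
  then show ?thesis using False by (auto simp: below_def bump_def infdist_nonneg)
qed (simp add: below_def bump_def)

lemma bump_mono: assumes "j \<le> k" shows "bump U j x \<le> bump U k x"
proof -
  have "real j * infdist x (- U) \<le> real k * infdist x (- U)"
    using assms by (intro mult_right_mono) (auto simp: infdist_nonneg)
  then show ?thesis by (auto simp: bump_def)
qed

lemma bump_eq_1: assumes "open U" "x \<in> U" obtains k where "bump U k x = 1"
proof (cases "U = UNIV")
  case False
  then have ne: "- U \<noteq> {}" by auto
  have "infdist x (- U) > 0"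
    using in_closed_iff_infdist_zero [OF closed_Compl [OF assms(1)] ne, of x] infdist_nonneg [of x "- U"] assms(2) by auto
  then obtain k :: nat where "1 / infdist x (- U) < real k" using reals_Archimedean2 by blast
  then have "1 \<le> real k * infdist x (- U)" using \<open>infdist x (- U) > 0\<close> by (simp add: field_simps)
  then show ?thesis using that [of k] False by (simp add: bump_def)
qed (use that in \<open>simp add: bump_def\<close>)

text \<open>On the compact set where \<open>g \<ge> \<delta>\<close> inside \<open>S\<close>,
  finitely many bumps already sum to more than \<open>1 - \<delta>\<close>, so \<open>g\<close> is
  at most \<open>\<delta>\<close> plus that sum on \<open>S\<close>. The error
  \<open>\<delta> * T\<close> is arbitrarily small.\<close>

lemma m_Union_le:
  fixes U :: "nat \<Rightarrow> 'a set"
  assumes op: "\<And>i. open (U i)"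
  shows "ennreal (m (\<Union>i. U i)) \<le> (\<Sum>i. ennreal (m (U i)))"
proof -
  have *: "ennreal (lam g) \<le> (\<Sum>i. ennreal (m (U i)))" if g: "g \<in> below (\<Union>i. U i)" for g
  proof (rule ennreal_le_epsilon)
    fix e :: real assume e: "0 < e"
    define \<delta> where "\<delta> = e / (T + 1)"
    have \<delta>: "\<delta> > 0" "\<delta> * T \<le> e" using e T_nonneg by (auto simp: \<delta>_def field_simps)
    define D where "D k x = (\<Sum>i<k. bump (U i) k x)" for k x
    have Dc: "continuous_on UNIV (D k)" and Db: "D k \<in> bcontfun" for k
      unfolding D_def by (intro continuous_on_sum belowD [OF bump_below] bc_sum)+
    have bn: "0 \<le> bump (U i) k x" for i k x by (rule belowD(2) [OF bump_below])
    have Dm: "D j x \<le> D k x" if "j \<le> k" for j k x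
    proof -
      have "D j x \<le> (\<Sum>i<j. bump (U i) k x)" unfolding D_def using that by (intro sum_mono bump_mono)
      also have "\<dots> \<le> D k x" unfolding D_def using that bn by (intro sum_mono2) auto
      finally show ?thesis .
    qed
    let ?W = "\<lambda>k. {x. D k x > 1 - \<delta>}"
    let ?C = "S \<inter> {x. g x \<ge> \<delta>}"
    have "compact ?C" using belowD(5) [OF g] by (intro compact_Int_closed compact_S closed_Collect_le continuous_on_const)
    moreover have "open (?W k)" for k using Dc by (intro open_Collect_less continuous_on_const)
    moreover have "?C \<subseteq> (\<Union>k. ?W k)"
    proof
      fix x assume x: "x \<in> ?C"
      then have "x \<in> (\<Union>i. U i)" using belowD(4) [OF g, of x] \<delta> by force
      then obtain i where i: "x \<in> U i" by blast
      obtain k where k: "bump (U i) k x = 1" using bump_eq_1 [OF op i] by blast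
      let ?k = "max k (Suc i)"
      have "1 \<le> bump (U i) ?k x" using bump_mono [of k ?k "U i" x] k by simp
      also have "\<dots> \<le> D ?k x" unfolding D_def using bn by (intro member_le_sum) auto
      finally have "x \<in> ?W ?k" using \<delta> by auto
      then show "x \<in> (\<Union>k. ?W k)" by blast
    qed
    ultimately obtain J where J: "finite J" "?C \<subseteq> (\<Union>k\<in>J. ?W k)" by (rule compactE_image) auto
    define k where "k = Max (insert 0 J)"
    have cover: "x \<in> ?W k" if xC: "x \<in> ?C" for x
    proof -
      obtain j where j: "j \<in> J" "x \<in> ?W j" using subsetD [OF J(2) xC] by blast
      then have "j \<le> k" using J by (simp add: k_def)
      then show ?thesis using Dm [of j k x] j by simp
    qed
    have Dn: "0 \<le> D k x" for x unfolding D_def using bn by (intro sum_nonneg) auto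
    have "g x \<le> \<delta> * 1 + D k x" if "x \<in> S" for x
      using cover [of x] that belowD(3) [OF g, of x] Dn [of x] by (cases "g x \<ge> \<delta>") auto
    then have "lam g \<le> lam (\<lambda>x. \<delta> * 1 + D k x)"
      by (intro lam_mono belowD [OF g] bc_arith Db const_bcontfun)
    also have "\<dots> = \<delta> * T + (\<Sum>i<k. lam (bump (U i) k))"
      using lam_add [OF bc_arith(3) [OF const_bcontfun const_bcontfun] Db, of \<delta> 1 k] lam_cmul [OF const_bcontfun, of \<delta> 1]
        lam_sum [of "{..<k}" "\<lambda>i. bump (U i) k"] belowD(1) [OF bump_below] unfolding D_def by simp
    also have "\<dots> \<le> e + (\<Sum>i<k. m (U i))" using \<delta> by (intro add_mono sum_mono lam_le_m bump_below)
    finally have "ennreal (lam g) \<le> ennreal (e + (\<Sum>i<k. m (U i)))" by (rule ennreal_leI)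
    also have "\<dots> = (\<Sum>i<k. ennreal (m (U i))) + ennreal e"
      using e m_nonneg by (simp add: sum_nonneg ennreal_plus add.commute)
    also have "\<dots> \<le> (\<Sum>i. ennreal (m (U i))) + ennreal e"
      by (intro add_right_mono sum_le_suminf) auto
    finally show "ennreal (lam g) \<le> (\<Sum>i. ennreal (m (U i))) + ennreal e" .
  qed
  show ?thesis
  proof (cases "(\<Sum>i. ennreal (m (U i)))")
    case (real r)
    have "m (\<Union>i. U i) \<le> r"
    proof (rule m_le)
      fix g assume "g \<in> below (\<Union>i. U i)"
      then have "ennreal (lam g) \<le> ennreal r" using * real by simp
      then show "lam g \<le> r" using real(1) by (simp add: ennreal_le_iff)
    qed
    then show ?thesis using real by (simp add: ennreal_leI)
  qed simp
qed

text \<open>The outer measure; \<^term>\<open>m\<close> is its restriction to open sets.\<close>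

definition om :: "'a set \<Rightarrow> ennreal" where
  "om A = (INF U\<in>{U. open U \<and> A \<subseteq> U}. ennreal (m U))"

lemma om_le: "open U \<Longrightarrow> A \<subseteq> U \<Longrightarrow> om A \<le> ennreal (m U)"
  unfolding om_def by (rule INF_lower) simp

lemma om_open: "open U \<Longrightarrow> om U = ennreal (m U)"
  by (rule antisym [OF om_le]) (auto simp: om_def intro!: INF_greatest ennreal_leI m_mono)

lemma om_greatest: "(\<And>U. open U \<Longrightarrow> A \<subseteq> U \<Longrightarrow> c \<le> ennreal (m U)) \<Longrightarrow> c \<le> om A"
  unfolding om_def by (rule INF_greatest) simp

lemma om_finite: "om A \<noteq> \<infinity>"
  using om_le [of UNIV A] by (auto simp: top_unique)

lemma outer: "outer_measure_space UNIV om"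
  unfolding outer_measure_space_def
proof (intro conjI)
  show "positive UNIV om"
    unfolding positive_def using om_open [of "{}"] m_disjoint_S [of "{}"] by simp
  show "increasing UNIV om"
    unfolding increasing_def by (auto intro!: om_greatest om_le)
  show "countably_subadditive UNIV om"
    unfolding countably_subadditive_def
  proof (intro allI impI)
    fix A :: "nat \<Rightarrow> 'a set"
    show "om (\<Union>i. A i) \<le> (\<Sum>i. om (A i))"
    proof (rule ennreal_le_epsilon)
      fix e :: real assume e: "0 < e"
      have "\<exists>U. open U \<and> A i \<subseteq> U \<and> ennreal (m U) \<le> om (A i) + ennreal (e * (1 / 2) ^ Suc i)" for i
      proof -
        have "om (A i) < om (A i) + ennreal (e * (1 / 2) ^ Suc i)"
          using om_finite [of "A i"] e by (simp add: ennreal_add_left_cancel_less [of _ 0, simplified] less_top)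
        then obtain U where "open U" "A i \<subseteq> U" "ennreal (m U) < om (A i) + ennreal (e * (1 / 2) ^ Suc i)"
          unfolding om_def [of "A i"] INF_less_iff by auto
        then show ?thesis by (auto intro: less_imp_le)
      qed
      then obtain U where U: "\<And>i. open (U i)" "\<And>i. A i \<subseteq> U i"
        "\<And>i. ennreal (m (U i)) \<le> om (A i) + ennreal (e * (1 / 2) ^ Suc i)" by metis
      have "om (\<Union>i. A i) \<le> ennreal (m (\<Union>i. U i))" using U by (intro om_le) auto
      also have "\<dots> \<le> (\<Sum>i. ennreal (m (U i)))" by (rule m_Union_le [OF U(1)])
      also have "\<dots> \<le> (\<Sum>i. om (A i) + ennreal (e * (1 / 2) ^ Suc i))" by (intro suminf_le U(3)) auto
      also have "\<dots> = (\<Sum>i. om (A i)) + (\<Sum>i. ennreal (e * (1 / 2) ^ Suc i))" by (rule suminf_add [symmetric]) auto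
      also have "(\<Sum>i. ennreal (e * (1 / 2) ^ Suc i)) = ennreal e"
      proof -
        have "(\<lambda>i. e * (1 / 2) ^ Suc i) sums (e * 1)" by (intro sums_mult power_half_series)
        then show ?thesis using e by (intro suminf_ennreal_eq) auto
      qed
      finally show "om (\<Union>i. A i) \<le> (\<Sum>i. om (A i)) + ennreal e" .
    qed
  qed
qed

text \<open>Let \<open>g\<close> almost attain the value of \<open>U \<inter> W\<close>. The part of
  \<open>g\<close> above \<open>\<delta>\<close> and any competitor for the part of \<open>W\<close>
  where \<open>g < \<delta>\<close> have disjoint supports, so their sum competes for
  \<open>W\<close>; and \<open>W - U\<close> lies in that part.\<close>

lemma om_split:
  assumes U: "open U"
  shows "om (U \<inter> X) + om ((UNIV - U) \<inter> X) \<le> om X"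
proof (rule om_greatest)
  fix W assume W: "open W" "X \<subseteq> W"
  have "om (U \<inter> X) + om ((UNIV - U) \<inter> X) \<le> ennreal (m (U \<inter> W)) + om (W - U)"
  proof (rule add_mono)
    show "om (U \<inter> X) \<le> ennreal (m (U \<inter> W))" using U W by (intro om_le) auto
    have "(UNIV - U) \<inter> X \<subseteq> W - U" using W by auto
    then show "om ((UNIV - U) \<inter> X) \<le> om (W - U)" using outer unfolding outer_measure_space_def increasing_def by simp
  qed
  also have "\<dots> \<le> ennreal (m W)"
  proof (rule ennreal_le_epsilon)
    fix e :: real assume e: "0 < e"
    define \<delta> where "\<delta> = e / (2 * (T + 1))"
    have \<delta>: "\<delta> > 0" "\<delta> * T \<le> e / 2" using e T_nonneg by (auto simp: \<delta>_def field_simps)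
    have "\<exists>g\<in>below (U \<inter> W). m (U \<inter> W) - e / 2 < lam g"
    proof (rule ccontr)
      assume "\<not> ?thesis"
      then have "m (U \<inter> W) \<le> m (U \<inter> W) - e / 2" by (intro m_le) (auto simp: not_less)
      then show False using e by simp
    qed
    then obtain g where g: "g \<in> below (U \<inter> W)" "m (U \<inter> W) - e / 2 < lam g" by blast
    let ?W' = "W \<inter> {x. g x < \<delta>}"
    have oW: "open ?W'" using belowD(5) [OF g(1)] W by (intro open_Int open_Collect_less continuous_on_const)
    have sub: "W - U \<subseteq> ?W'" using belowD(4) [OF g(1)] \<delta> by auto
    let ?g = "\<lambda>x. max 0 (g x - \<delta>)"
    have gb: "?g \<in> below W"
      unfolding below_def
    proof (intro CollectI conjI allI impI)
      show "continuous_on UNIV ?g" using belowD(5) [OF g(1)] by (intro continuous_intros)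
      fix x
      show "?g x \<le> 1" using belowD(3) [OF g(1), of x] \<delta> by simp
      show "?g x = 0" if "x \<notin> W" using that belowD(4) [OF g(1), of x] \<delta> by auto
    qed simp
    have le: "lam ?g + lam g' \<le> m W" if g': "g' \<in> below ?W'" for g'
    proof -
      have "(\<lambda>x. ?g x + g' x) \<in> below W"
        unfolding below_def
      proof (intro CollectI conjI allI impI)
        show "continuous_on UNIV (\<lambda>x. ?g x + g' x)" by (rule continuous_on_add [OF belowD(5) [OF gb] belowD(5) [OF g']])
        fix x
        show "0 \<le> ?g x + g' x" using belowD(2) [OF g', of x] by simp
        show "?g x + g' x \<le> 1" using belowD(3) [OF gb, of x] belowD(3,4) [OF g', of x] by (cases "g x < \<delta>") auto
        show "?g x + g' x = 0" if "x \<notin> W" using that belowD(4) [OF gb, of x] belowD(4) [OF g', of x] by auto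
      qed
      then show ?thesis using lam_le_m lam_add [OF belowD(1) [OF gb] belowD(1) [OF g']] by metis
    qed
    have "lam g - \<delta> * T \<le> lam ?g"
    proof -
      have "lam (\<lambda>x. g x - \<delta> * 1) \<le> lam ?g"
        by (intro lam_mono bc_arith(2) [OF belowD(1) [OF g(1)] bc_arith(3) [OF const_bcontfun const_bcontfun]] belowD(1) [OF gb]) simp
      then show ?thesis
        using lam_diff [OF belowD(1) [OF g(1)] bc_arith(3) [OF const_bcontfun const_bcontfun], of \<delta> 1] lam_cmul [OF const_bcontfun, of \<delta> 1] by simp
    qed
    then have "m ?W' \<le> m W - (m (U \<inter> W) - e)" using le g(2) \<delta> by (intro m_le) fastforce
    then have r: "m (U \<inter> W) + m ?W' \<le> m W + e" by simp
    have "ennreal (m (U \<inter> W)) + om (W - U) \<le> ennreal (m (U \<inter> W)) + ennreal (m ?W')"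
      by (intro add_left_mono om_le oW sub)
    also have "\<dots> = ennreal (m (U \<inter> W) + m ?W')" using m_nonneg by (simp add: ennreal_plus)
    also have "\<dots> \<le> ennreal (m W + e)" by (rule ennreal_leI [OF r])
    also have "\<dots> = ennreal (m W) + ennreal e" using m_nonneg e by (simp add: ennreal_plus)
    finally show "ennreal (m (U \<inter> W)) + om (W - U) \<le> ennreal (m W) + ennreal e" .
  qed
  finally show "om (U \<inter> X) + om ((UNIV - U) \<inter> X) \<le> ennreal (m W)" .
qed

definition \<sigma> :: "'a measure" where "\<sigma> = measure_of UNIV (sets borel) om"

text \<open>By Caratheodory the sets that split all sets additively form a sigma-algebra;
  \<open>om_split\<close> and subadditivity place the open sets in it.\<close>

lemma om_measure_space: "measure_space UNIV (sets (borel :: 'a measure)) om"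
proof -
  let ?L = "lambda_system UNIV UNIV om"
  have ms: "measure_space UNIV ?L om"
    using sigma_algebra.caratheodory_lemma [of UNIV "UNIV :: 'a set set" om] sigma_algebra_Pow [of "UNIV :: 'a set"] outer by simp
  have "U \<in> ?L" if U: "open U" for U
    unfolding lambda_system_def
  proof (intro CollectI conjI ballI UNIV_I antisym om_split [OF U])
    fix X
    have "ring_of_sets UNIV (UNIV :: 'a set set)" using sigma_algebra_Pow [of "UNIV :: 'a set"]
      by (simp add: sigma_algebra_def algebra_def)
    then have "subadditive UNIV om"
      using ring_of_sets.countably_subadditive_subadditive outer unfolding outer_measure_space_def by blast
    then have "om ((U \<inter> X) \<union> ((UNIV - U) \<inter> X)) \<le> om (U \<inter> X) + om ((UNIV - U) \<inter> X)"
      unfolding subadditive_def by (metis (no_types, lifting) Diff_disjoint Int_assoc Int_commute Int_empty_right UNIV_I)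
    moreover have "(U \<inter> X) \<union> ((UNIV - U) \<inter> X) = X" by auto
    ultimately show "om X \<le> om (U \<inter> X) + om ((UNIV - U) \<inter> X)" by simp
  qed
  moreover have "sigma_algebra UNIV ?L" using ms by (simp add: measure_space_def)
  ultimately have "sigma_sets UNIV {S :: 'a set. open S} \<subseteq> ?L" by (intro sigma_algebra.sigma_sets_subset) auto
  then have "sets (borel :: 'a measure) \<subseteq> ?L" by (simp add: borel_def)
  then show ?thesis by (intro measure_down [OF ms]) (use sets.sigma_algebra_axioms [of "borel :: 'a measure"] in simp)
qed

lemma sets_sigma: "sets \<sigma> = sets borel"
  using sets.sigma_sets_eq [of "borel :: 'a measure"] by (simp add: \<sigma>_def)

lemma emeasure_sigma: "A \<in> sets borel \<Longrightarrow> emeasure \<sigma> A = om A"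
  unfolding \<sigma>_def using om_measure_space by (intro emeasure_measure_of_sigma) (auto simp: measure_space_def)

lemma space_sigma: "space \<sigma> = UNIV"
  by (simp add: \<sigma>_def)

lemma emeasure_sigma_open: "open U \<Longrightarrow> emeasure \<sigma> U = ennreal (m U)"
  by (simp add: emeasure_sigma om_open)

lemma measure_sigma_open: "open U \<Longrightarrow> measure \<sigma> U = m U"
  by (simp add: measure_def emeasure_sigma_open m_nonneg)

sublocale \<sigma>: finite_measure \<sigma>
  by (rule finite_measureI) (simp add: space_sigma emeasure_sigma_open)

lemma sigma_null: "emeasure \<sigma> (UNIV - S) = 0"
proof -
  have "m (UNIV - S) = 0" by (rule m_disjoint_S) auto
  then show ?thesis using compact_imp_closed [OF compact_S] by (subst emeasure_sigma_open) (auto intro: open_Diff)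
qed

lemma bc_integrable: fixes g :: "'a \<Rightarrow> real" assumes "g \<in> bcontfun" shows "integrable \<sigma> g"
proof -
  obtain B where B: "\<And>x. norm (g x) \<le> B" using assms unfolding bcontfun_def bounded_iff by auto
  have "g \<in> borel_measurable \<sigma>"
    using assms measurable_cong_sets [OF sets_sigma refl] by (auto simp: bcontfun_def intro: borel_measurable_continuous_onI)
  then show ?thesis by (intro \<sigma>.integrable_const_bound [where B = B]) (use B in auto)
qed

lemma sum_clamp:
  fixes y :: real
  assumes "0 \<le> y" shows "(\<Sum>k<n. max 0 (min 1 (y - real k))) = min y (real n)"
  by (induction n) (use assms in auto)

text \<open>Cut \<open>N * g\<close> into \<open>N\<close> layers of height 1. The layer
  \<open>G k\<close> lies between the indicators of \<open>U (Suc k)\<close> and \<open>U k\<close>,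
  hence functional and integral both lie between \<open>m (U (Suc k))\<close> and
  \<open>m (U k)\<close>; the differences telescope to at most \<open>T\<close>, and dividing by
  \<open>N\<close> finishes.\<close>

lemma lam_eq_integral_unit:
  assumes g: "g \<in> below UNIV"
  shows "lam g = (\<integral>x. g x \<partial>\<sigma>)"
proof -
  have close: "\<bar>lam g - (\<integral>x. g x \<partial>\<sigma>)\<bar> \<le> T * inverse (real (Suc n))" for n
  proof -
    define N where "N = Suc n"
    have N: "real N > 0" by (simp add: N_def)
    define G where "G k x = max 0 (min 1 (real N * g x - real k))" for k x
    define U where "U k = {x. g x > real k / real N}" for k
    have Uo: "open (U k)" for k unfolding U_def using belowD(5) [OF g] by (intro open_Collect_less continuous_on_const)
    have Gb: "G k \<in> below (U k)" for k
      unfolding below_def G_def U_def using belowD(5) [OF g] N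
      by (auto intro!: continuous_intros simp: field_simps not_less)
    have Gbc: "G k \<in> bcontfun" for k by (rule belowD(1) [OF Gb])
    have G1: "G k x = 1" if "x \<in> U (Suc k)" for k x
      using that N unfolding G_def U_def by (simp add: field_simps)
    have sumG: "(\<Sum>k<N. G k x) = real N * g x" for x
      unfolding G_def using sum_clamp [of "real N * g x" N] belowD(2,3) [OF g, of x] N by (simp add: min_def)
    have up: "lam (G k) \<le> m (U k)" for k by (rule lam_le_m [OF Gb])
    have lo: "m (U (Suc k)) \<le> lam (G k)" for k
    proof (rule m_le)
      fix f assume f: "f \<in> below (U (Suc k))"
      have "f x \<le> G k x" for x
        using belowD(3,4) [OF f, of x] G1 [of x k] belowD(2) [OF Gb [of k], of x] by (cases "x \<in> U (Suc k)") auto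
      then show "lam f \<le> lam (G k)" by (intro lam_mono belowD(1) [OF f] Gbc)
    qed
    have Us: "U k \<in> sets \<sigma>" for k using Uo by (simp add: sets_sigma)
    have iU: "integrable \<sigma> (indicat_real (U k))" "(\<integral>x. indicat_real (U k) x \<partial>\<sigma>) = m (U k)" for k
      using integrable_real_indicator [OF Us, of k] measure_sigma_open [OF Uo, of k]
      by (simp_all add: space_sigma emeasure_sigma_open Uo)
    have up': "(\<integral>x. G k x \<partial>\<sigma>) \<le> m (U k)" for k
      unfolding iU(2) [symmetric]
      using belowD(3,4) [OF Gb [of k]] by (intro integral_mono bc_integrable Gbc iU) (auto simp: indicator_def)
    have lo': "m (U (Suc k)) \<le> (\<integral>x. G k x \<partial>\<sigma>)" for k
      unfolding iU(2) [symmetric]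
      using belowD(2) [OF Gb [of k]] G1 [of _ k] by (intro integral_mono bc_integrable Gbc iU) (auto simp: indicator_def)
    have "real N * lam g = (\<Sum>k<N. lam (G k))"
      using lam_sum [of "{..<N}" G] Gbc lam_cmul [OF belowD(1) [OF g], of "real N"] by (simp add: sumG)
    moreover have "real N * (\<integral>x. g x \<partial>\<sigma>) = (\<Sum>k<N. \<integral>x. G k x \<partial>\<sigma>)"
    proof -
      have "(\<Sum>k<N. \<integral>x. G k x \<partial>\<sigma>) = (\<integral>x. (\<Sum>k<N. G k x) \<partial>\<sigma>)"
        by (rule Bochner_Integration.integral_sum [symmetric]) (rule bc_integrable [OF Gbc])
      then show ?thesis by (simp add: sumG)
    qed
    ultimately have "real N * (lam g - (\<integral>x. g x \<partial>\<sigma>)) = (\<Sum>k<N. lam (G k) - (\<integral>x. G k x \<partial>\<sigma>))"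
      by (simp add: right_diff_distrib sum_subtractf)
    then have "\<bar>real N * (lam g - (\<integral>x. g x \<partial>\<sigma>))\<bar> \<le> (\<Sum>k<N. \<bar>lam (G k) - (\<integral>x. G k x \<partial>\<sigma>)\<bar>)" by simp
    also have "\<dots> \<le> (\<Sum>k<N. m (U k) - m (U (Suc k)))"
    proof (rule sum_mono)
      fix k show "\<bar>lam (G k) - (\<integral>x. G k x \<partial>\<sigma>)\<bar> \<le> m (U k) - m (U (Suc k))"
        using up [of k] lo [of k] up' [of k] lo' [of k] by linarith
    qed
    also have "\<dots> = m (U 0) - m (U N)" by (rule sum_lessThan_telescope')
    also have "\<dots> \<le> T" using m_le_T [of "U 0"] m_nonneg [of "U N"] by linarith
    finally have "real N * \<bar>lam g - (\<integral>x. g x \<partial>\<sigma>)\<bar> \<le> T" using N by (simp add: abs_mult)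
    then show ?thesis using N unfolding N_def by (simp add: field_simps del: of_nat_Suc)
  qed
  have "(\<lambda>n. T * inverse (real (Suc n))) \<longlonglongrightarrow> 0"
    using tendsto_mult_right_zero [OF LIMSEQ_inverse_real_of_nat] .
  then have "\<bar>lam g - (\<integral>x. g x \<partial>\<sigma>)\<bar> \<le> 0" by (rule LIMSEQ_le_const) (use close in blast)
  then show ?thesis by simp
qed

theorem riesz_markov: "\<Lambda> g = (\<integral>x. apply_bcontfun g x \<partial>\<sigma>)"
proof -
  let ?g = "apply_bcontfun g"
  have g: "?g \<in> bcontfun" by (rule apply_bcontfun)
  obtain B where "B > 0" and B: "\<And>x. \<bar>?g x\<bar> \<le> B"
    using bounded_apply_bcontfun [of g] unfolding bounded_pos by auto
  \<comment> \<open>An affine change moves the values of \<open>g\<close> into the unit interval, to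
    which layers apply.\<close>
  let ?f = "\<lambda>x. (1 / (2 * B)) * (?g x + B)"
  have f: "?f \<in> below UNIV"
    unfolding below_def
  proof (intro CollectI conjI allI impI)
    fix x
    have "- B \<le> ?g x" "?g x \<le> B" using B [of x] by auto
    then show "0 \<le> ?f x" "?f x \<le> 1" using \<open>B > 0\<close> by (auto simp: field_simps)
  qed (use \<open>B > 0\<close> in \<open>auto intro!: continuous_intros\<close>)
  have T: "T = measure \<sigma> UNIV" using measure_sigma_open [of UNIV] by (simp add: m_UNIV)
  have "lam ?f = (1 / (2 * B)) * (lam ?g + B * T)"
    using lam_cmul [OF bc_arith(1) [OF g const_bcontfun], of "1 / (2 * B)" B] lam_add [OF g const_bcontfun, of B]
      lam_cmul [OF const_bcontfun, of B 1] by simp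
  moreover have "(\<integral>x. ?f x \<partial>\<sigma>) = (1 / (2 * B)) * ((\<integral>x. ?g x \<partial>\<sigma>) + B * T)"
    using bc_integrable [OF g] by (simp add: T space_sigma mult.commute)
  ultimately have "lam ?g = (\<integral>x. ?g x \<partial>\<sigma>)" using lam_eq_integral_unit [OF f] \<open>B > 0\<close> by simp
  then show ?thesis by (simp add: lam_def apply_bcontfun_inverse)
qed

end

section \<open>Functions with large boundary values\<close>

text \<open>Maximum modulus principle for \<open>exp (- p)\<close> on the complex disc through
  \<open>z\<close> and the origin, whose boundary lies on the sphere.\<close>

lemma poly_Re_nonneg_ball:
  assumes p: "is_poly p" and S: "\<And>z. z \<in> sphere 0 1 \<Longrightarrow> 0 \<le> Re (p z)" and z: "(z :: complex^'d) \<in> ball 0 1"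
  shows "0 \<le> Re (p z)"
proof -
  obtain \<zeta> :: "complex^'d" and s :: complex where \<zeta>: "norm \<zeta> = 1" "z = s *s \<zeta>" "cmod s \<le> 1"
  proof (cases "z = 0")
    case True
    then show ?thesis using that [of "axis undefined 1" 0] by simp
  next
    case False
    then show ?thesis using z that [of "of_real (1 / norm z) *s z" "of_real (norm z)"]
      by (simp add: norm_divide vector_smult_assoc)
  qed
  obtain A c where A: "finite A" "p = (\<lambda>z. \<Sum>\<alpha>\<in>A. c \<alpha> * (\<Prod>i\<in>UNIV. (z $ i) ^ (\<alpha> i)))"
    using p unfolding is_poly_def by blast
  have hol: "(\<lambda>t. exp (- p (t *s \<zeta>))) holomorphic_on X" for X
    unfolding A(2) by (auto intro!: holomorphic_intros)
  have "norm (exp (- p (s *s \<zeta>))) \<le> 1"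
  proof (rule maximum_modulus_frontier [where f = "\<lambda>t. exp (- p (t *s \<zeta>))" and S = "cball 0 1" and \<xi> = s])
    fix t assume "t \<in> frontier (cball (0 :: complex) 1)"
    then have "t *s \<zeta> \<in> sphere 0 1" using \<zeta> by simp
    then show "norm (exp (- p (t *s \<zeta>))) \<le> 1" using S by simp
  qed (use \<zeta> hol holomorphic_on_imp_continuous_on in auto)
  then show ?thesis using \<zeta> by simp
qed

section \<open>From norm-bounded positive measures to functions with infinite radial limits\<close>

context pick_space
begin

text \<open>Riesz representation for a functional defined on polynomials only. The representing
  function would be the conjugate of its value on kernel functions; as these are not polynomials,
  their truncations \<open>Kn\<close> are used and the limit exists by boundedness.\<close>

lemma bounded_functional_repr:
  assumes add: "\<And>p q. is_poly p \<Longrightarrow> is_poly q \<Longrightarrow> f (\<lambda>z. p z + q z) = f p + f q"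
    and cmul: "\<And>p c. is_poly p \<Longrightarrow> f (\<lambda>z. c * p z) = c * f p"
    and bd: "\<And>p. is_poly p \<Longrightarrow> cmod (f p) \<le> M * hn K p" and M: "0 \<le> M"
  obtains k where "in_H K k" "\<And>p. is_poly p \<Longrightarrow> f p = hinner K p k"
proof -
  have diff: "f (\<lambda>z. p z - q z) = f p - f q" if "is_poly p" "is_poly q" for p q
    using add [OF that(1) is_poly_cmul [OF that(2), of "-1"]] cmul [OF that(2), of "-1"] by simp
  have zero: "f (\<lambda>z. 0) = 0" using cmul [OF is_poly_zero, of 0] by simp
  have KnH: "in_H K (Kn r w)" for r w by (rule poly_in_H [OF Kn_poly])
  have conv: "convergent (\<lambda>r. f (Kn r w))" if w: "w \<in> ball 0 1" for w
  proof -
    have "Cauchy (\<lambda>r. f (Kn r w))"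
    proof (rule CauchyI)
      fix e :: real assume e: "0 < e"
      have "(\<lambda>r. M * hn K (\<lambda>\<zeta>. K \<zeta> w - Kn r w \<zeta>)) \<longlonglongrightarrow> 0"
        by (rule tendsto_mult_right_zero [OF Kn_tendsto [OF w]])
      then have "\<forall>\<^sub>F r in sequentially. M * hn K (\<lambda>\<zeta>. K \<zeta> w - Kn r w \<zeta>) < e / 2"
        by (rule order_tendstoD(2)) (use e in simp)
      then obtain r0 where r0: "\<And>r. r \<ge> r0 \<Longrightarrow> M * hn K (\<lambda>\<zeta>. K \<zeta> w - Kn r w \<zeta>) < e / 2"
        unfolding eventually_sequentially by blast
      have "cmod (f (Kn r w) - f (Kn r' w)) < e" if "r \<ge> r0" "r' \<ge> r0" for r r'
      proof -
        have d: "in_H K (\<lambda>\<zeta>. K \<zeta> w - Kn r w \<zeta>)" for r by (rule in_H_diff(1) [OF K_in_H(1) [OF w] KnH])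
        have "hn K (\<lambda>\<zeta>. Kn r w \<zeta> - Kn r' w \<zeta>) = hn K (\<lambda>\<zeta>. (K \<zeta> w - Kn r' w \<zeta>) - (K \<zeta> w - Kn r w \<zeta>))" by simp
        also have "\<dots> \<le> hn K (\<lambda>\<zeta>. K \<zeta> w - Kn r' w \<zeta>) + hn K (\<lambda>\<zeta>. K \<zeta> w - Kn r w \<zeta>)" by (rule hn_diff [OF d d])
        finally have "M * hn K (\<lambda>\<zeta>. Kn r w \<zeta> - Kn r' w \<zeta>) \<le>
          M * hn K (\<lambda>\<zeta>. K \<zeta> w - Kn r' w \<zeta>) + M * hn K (\<lambda>\<zeta>. K \<zeta> w - Kn r w \<zeta>)"
          unfolding distrib_left [symmetric] by (rule mult_left_mono [OF _ M])
        moreover have "cmod (f (Kn r w) - f (Kn r' w)) \<le> M * hn K (\<lambda>\<zeta>. Kn r w \<zeta> - Kn r' w \<zeta>)"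
          using bd [OF is_poly_diff [OF Kn_poly Kn_poly], of r w r' w] diff [OF Kn_poly Kn_poly, of r w r' w] by simp
        ultimately show ?thesis using r0 [OF that(1)] r0 [OF that(2)] by linarith
      qed
      then show "\<exists>M. \<forall>m\<ge>M. \<forall>n\<ge>M. norm (f (Kn m w) - f (Kn n w)) < e" by blast
    qed
    then show ?thesis by (simp add: Cauchy_convergent)
  qed
  define k where "k w = cnj (lim (\<lambda>r. f (Kn r w)))" for w
  have klim: "(\<lambda>r. cnj (f (Kn r w))) \<longlonglongrightarrow> k w" if "w \<in> ball 0 1" for w
    unfolding k_def using conv [OF that] by (intro tendsto_cnj) (simp add: convergent_LIMSEQ_iff)
  \<comment> \<open>Polynomial approximations of the section \<open>sec l\<close>; they carry the
    bound for \<open>f\<close> over to \<open>k\<close>.\<close>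
  define P where "P r l = (\<lambda>\<zeta>. cnj (ev l (\<lambda>w. cnj (Kn r w \<zeta>))))" for r and l :: "(complex \<times> (complex^'d)) list"
  have P_Cons: "P r (x # l) = (\<lambda>\<zeta>. cnj (fst x) * Kn r (snd x) \<zeta> + P r l \<zeta>)" for r x l
    by (simp add: P_def)
  have P_Nil: "P r [] = (\<lambda>\<zeta>. 0)" for r by (simp add: P_def)
  have Ppoly: "is_poly (P r l)" for r l
  proof (induction l)
    case Nil show ?case unfolding P_Nil by (rule is_poly_zero)
  next
    case (Cons x l) show ?case unfolding P_Cons by (rule is_poly_add [OF is_poly_cmul [OF Kn_poly] Cons.IH])
  qed
  have fP: "f (P r l) = cnj (ev l (\<lambda>w. cnj (f (Kn r w))))" for r l
    by (induction l) (simp_all add: P_Nil P_Cons zero add is_poly_cmul Kn_poly Ppoly cmul)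
  have PH: "in_H K (P r l)" for r l by (rule poly_in_H [OF Ppoly])
  have Plim: "(\<lambda>r. hn K (\<lambda>\<zeta>. P r l \<zeta> - sec l \<zeta>)) \<longlonglongrightarrow> 0" if "l \<in> bpts" for l
    using that
  proof (induction l)
    case Nil then show ?case by (simp add: P_Nil)
  next
    case (Cons x l)
    let ?w = "snd x"
    have w: "?w \<in> ball 0 1" and l: "l \<in> bpts" using Cons.prems by auto
    have d: "in_H K (\<lambda>\<zeta>. K \<zeta> ?w - Kn r ?w \<zeta>)" "in_H K (\<lambda>\<zeta>. P r l \<zeta> - sec l \<zeta>)" for r
      by (rule in_H_diff(1) [OF K_in_H(1) [OF w] KnH], rule in_H_diff(1) [OF PH in_H_sec(1) [OF l]])
    show ?case
    proof (rule Lim_null_comparison)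
      show "\<forall>\<^sub>F r in sequentially. norm (hn K (\<lambda>\<zeta>. P r (x # l) \<zeta> - sec (x # l) \<zeta>)) \<le>
        cmod (fst x) * hn K (\<lambda>\<zeta>. K \<zeta> ?w - Kn r ?w \<zeta>) + hn K (\<lambda>\<zeta>. P r l \<zeta> - sec l \<zeta>)"
      proof (intro always_eventually allI)
        fix r
        have e: "(\<lambda>\<zeta>. P r (x # l) \<zeta> - sec (x # l) \<zeta>) = (\<lambda>\<zeta>. (- cnj (fst x)) * (K \<zeta> ?w - Kn r ?w \<zeta>) + (P r l \<zeta> - sec l \<zeta>))"
          unfolding P_Cons by (simp add: sec_def algebra_simps)
        have "hn K (\<lambda>\<zeta>. P r (x # l) \<zeta> - sec (x # l) \<zeta>) \<le> hn K (\<lambda>\<zeta>. (- cnj (fst x)) * (K \<zeta> ?w - Kn r ?w \<zeta>)) + hn K (\<lambda>\<zeta>. P r l \<zeta> - sec l \<zeta>)"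
          unfolding e by (rule hn_add [OF in_H_cmul(1) [OF d(1)] d(2)])
        moreover have "0 \<le> hn K (\<lambda>\<zeta>. P r (x # l) \<zeta> - sec (x # l) \<zeta>)"
          by (rule hn_nonneg [OF in_H_diff(1) [OF PH in_H_sec(1) [OF Cons.prems]]])
        ultimately show "norm (hn K (\<lambda>\<zeta>. P r (x # l) \<zeta> - sec (x # l) \<zeta>)) \<le>
          cmod (fst x) * hn K (\<lambda>\<zeta>. K \<zeta> ?w - Kn r ?w \<zeta>) + hn K (\<lambda>\<zeta>. P r l \<zeta> - sec l \<zeta>)"
          using hn_cmul [OF d(1), of "- cnj (fst x)"] by simp
      qed
      show "(\<lambda>r. cmod (fst x) * hn K (\<lambda>\<zeta>. K \<zeta> ?w - Kn r ?w \<zeta>) + hn K (\<lambda>\<zeta>. P r l \<zeta> - sec l \<zeta>)) \<longlonglongrightarrow> 0"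
        using tendsto_add [OF tendsto_mult_right_zero [OF Kn_tendsto [OF w]] Cons.IH [OF l]] by simp
    qed
  qed
  have evk: "(\<lambda>r. ev l (\<lambda>w. cnj (f (Kn r w)))) \<longlonglongrightarrow> ev l k" if l: "l \<in> bpts" for l
    using bptsD [OF l] by (intro ev_tendsto klim)
  have kb: "cmod (ev l k) \<le> M * sqrt (N l)" if l: "l \<in> bpts" for l
  proof (rule LIMSEQ_le [OF tendsto_norm [OF evk [OF l]]])
    show "(\<lambda>r. M * hn K (P r l)) \<longlonglongrightarrow> M * sqrt (N l)"
      using tendsto_mult_left [OF hn_tendsto [OF PH in_H_sec(1) [OF l] Plim [OF l]], of M] l
      by (simp add: hn_def [of K "sec l"] hnorm2_sec)
    have "cmod (ev l (\<lambda>w. cnj (f (Kn r w)))) \<le> M * hn K (P r l)" for r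
      using bd [OF Ppoly, of r l] unfolding fP by simp
    then show "\<exists>n0. \<forall>r\<ge>n0. cmod (ev l (\<lambda>w. cnj (f (Kn r w)))) \<le> M * hn K (P r l)" by blast
  qed
  have kH: "in_H K k" by (rule hn_leI(1) [OF kb M])
  have "f p = hinner K p k" if p: "is_poly p" for p
  proof -
    have pH: "in_H K p" by (rule poly_in_H [OF p])
    obtain l where l: "\<And>j. l j \<in> bpts" "(\<lambda>j. hn K (\<lambda>z. sec (l j) z - p z)) \<longlonglongrightarrow> 0"
      using sec_seq [OF pH] by blast
    have fsec: "cmod (f p - hinner K (sec (l j)) k) \<le> M * hn K (\<lambda>z. p z - sec (l j) z)" for j
    proof (rule LIMSEQ_le)
      have "(\<lambda>r. f p - cnj (ev (l j) (\<lambda>w. cnj (f (Kn r w))))) \<longlonglongrightarrow> f p - cnj (ev (l j) k)"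
        by (intro tendsto_intros evk l)
      moreover have "hinner K (sec (l j)) k = cnj (ev (l j) k)"
        using hinner_sym [OF kH in_H_sec(1) [OF l(1)]] hinner_sec [OF kH l(1)] by simp
      ultimately show "(\<lambda>r. cmod (f p - f (P r (l j)))) \<longlonglongrightarrow> cmod (f p - hinner K (sec (l j)) k)"
        unfolding fP by (intro tendsto_norm) simp
      have d: "in_H K (\<lambda>z. p z - sec (l j) z)" "in_H K (\<lambda>z. p z - P r (l j) z)" for r
        by (rule in_H_diff(1) [OF pH in_H_sec(1) [OF l(1)]], rule in_H_diff(1) [OF pH PH])
      have lim0: "(\<lambda>r. hn K (\<lambda>z. (p z - P r (l j) z) - (p z - sec (l j) z))) \<longlonglongrightarrow> 0"
      proof -
        have "hn K (\<lambda>z. (p z - P r (l j) z) - (p z - sec (l j) z)) = hn K (\<lambda>\<zeta>. P r (l j) \<zeta> - sec (l j) \<zeta>)" for r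
          using hn_diff_commute [OF in_H_sec(1) [OF l(1)] PH] by simp
        then show ?thesis using Plim [OF l(1)] by simp
      qed
      show "(\<lambda>r. M * hn K (\<lambda>z. p z - P r (l j) z)) \<longlonglongrightarrow> M * hn K (\<lambda>z. p z - sec (l j) z)"
        by (intro tendsto_mult tendsto_const hn_tendsto d lim0)
      have "cmod (f p - f (P r (l j))) \<le> M * hn K (\<lambda>z. p z - P r (l j) z)" for r
        using bd [OF is_poly_diff [OF p Ppoly], of r "l j"] diff [OF p Ppoly, of r "l j"] by simp
      then show "\<exists>n0. \<forall>r\<ge>n0. cmod (f p - f (P r (l j))) \<le> M * hn K (\<lambda>z. p z - P r (l j) z)" by blast
    qed
    have "(\<lambda>j. f p - hinner K (sec (l j)) k) \<longlonglongrightarrow> 0"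
    proof (rule Lim_null_comparison)
      show "\<forall>\<^sub>F j in sequentially. norm (f p - hinner K (sec (l j)) k) \<le> M * hn K (\<lambda>z. sec (l j) z - p z)"
        using fsec hn_diff_commute [OF pH in_H_sec(1) [OF l(1)]] by (intro always_eventually allI) simp
      show "(\<lambda>j. M * hn K (\<lambda>z. sec (l j) z - p z)) \<longlonglongrightarrow> 0" by (rule tendsto_mult_right_zero [OF l(2)])
    qed
    moreover have "(\<lambda>j. f p - hinner K (sec (l j)) k) \<longlonglongrightarrow> f p - hinner K p k"
      by (intro tendsto_diff tendsto_const hinner_tendsto in_H_sec pH kH l) simp
    ultimately show ?thesis using LIMSEQ_unique by fastforce
  qed
  then show ?thesis using that [OF kH] by blast
qed

text \<open>Once integration is \<open>p \<mapsto> hinner K p k\<close>, it is the sigma-weak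
  functional with the single pair \<open>1\<close>, \<open>k\<close>, since multiplication by
  \<open>p\<close> sends 1 to \<open>p\<close>.\<close>

lemma henkin_of_bounded:
  assumes rep: "cmeasure_rep \<sigma> (\<lambda>_. 1)"
    and bd: "\<And>p. is_poly p \<Longrightarrow> cmod (\<integral>z. p z \<partial>\<sigma>) \<le> M * hn K p" and M: "0 \<le> M"
  shows "henkin K \<sigma> (\<lambda>_. 1)"
proof -
  interpret \<sigma>: finite_measure \<sigma> using rep by (simp add: cmeasure_rep_def)
  have sets: "sets \<sigma> = sets borel" using rep by (simp add: cmeasure_rep_def)
  have sph: "AE z in \<sigma>. z \<in> sphere 0 1"
    using rep by (intro AE_I [where N = "UNIV - sphere 0 1"]) (auto simp: cmeasure_rep_def)
  have int: "integrable \<sigma> p" if p: "is_poly p" for p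
  proof -
    have c: "continuous_on UNIV p" by (rule is_poly_continuous [OF p])
    have "compact (p ` sphere 0 1)" using c continuous_on_subset by (intro compact_continuous_image) auto
    then obtain D where D: "\<And>z. z \<in> sphere 0 1 \<Longrightarrow> cmod (p z) \<le> D" using compact_imp_bounded bounded_iff by (metis imageI)
    have "p \<in> borel_measurable \<sigma>"
      using borel_measurable_continuous_onI [OF c] measurable_cong_sets [OF sets refl] by blast
    then show ?thesis by (intro \<sigma>.integrable_const_bound [OF eventually_mono [OF sph D]])
  qed
  obtain k where k: "in_H K k" "\<And>p. is_poly p \<Longrightarrow> (\<integral>z. p z \<partial>\<sigma>) = hinner K p k"
  proof (rule bounded_functional_repr [where f = "\<lambda>p. \<integral>z. p z \<partial>\<sigma>" and M = M])
    show "(\<integral>z. p z + q z \<partial>\<sigma>) = (\<integral>z. p z \<partial>\<sigma>) + (\<integral>z. q z \<partial>\<sigma>)" if "is_poly p" "is_poly q" for p q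
      using that by (intro Bochner_Integration.integral_add int)
  qed (use bd M in auto)
  let ?F = "\<lambda>n :: nat. if n = 0 then (\<lambda>z :: complex^'d. 1) else (\<lambda>z. 0)"
  let ?G = "\<lambda>n :: nat. if n = 0 then k else (\<lambda>z. 0)"
  have adm: "admissible_pair K ?F ?G"
  proof -
    have "summable (\<lambda>n. hnorm2 K (?F n))" "summable (\<lambda>n. hnorm2 K (?G n))"
      by (rule summable_finite [of "{0}"]; simp)+
    then show ?thesis using k(1) in_H_one unfolding admissible_pair_def by simp
  qed
  have sw: "sw_functional K ?F ?G \<phi> = hinner K \<phi> k" for \<phi>
  proof -
    have "(\<Sum>n. hinner K (\<lambda>z. \<phi> z * ?F n z) (?G n)) = (\<Sum>n\<in>{0}. hinner K (\<lambda>z. \<phi> z * ?F n z) (?G n))"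
      by (rule suminf_finite) auto
    then show ?thesis by (simp add: sw_functional_def)
  qed
  have mH: "in_H K \<phi>" if "is_mult K \<phi>" for \<phi>
    using that in_H_one unfolding is_mult_def by fastforce
  have "wstar_cont_functional K (\<lambda>\<phi>. hinner K \<phi> k)"
    unfolding wstar_cont_functional_def
  proof (intro conjI allI impI)
    show "continuous_map (wstar_top K) euclidean (\<lambda>\<phi>. hinner K \<phi> k)"
      unfolding continuous_map_def
    proof (intro conjI allI impI)
      fix U :: "complex set" assume "openin euclidean U"
      then have U: "open U" by simp
      let ?S = "{{\<phi>. sw_functional K F G \<phi> \<in> U} | F G U. admissible_pair K F G \<and> open U}"
      have "{\<phi>. sw_functional K ?F ?G \<phi> \<in> U} \<in> ?S" using adm U by blast
      then have o: "openin (topology_generated_by ?S) {\<phi>. hinner K \<phi> k \<in> U}"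
        unfolding sw openin_topology_generated_by_iff by (rule generate_topology_on.Basis)
      have UN: "\<phi> \<in> \<Union>?S" for \<phi>
      proof -
        have "{\<phi>. sw_functional K ?F ?G \<phi> \<in> UNIV} \<in> ?S" using adm open_UNIV by blast
        then show ?thesis by blast
      qed
      have "{\<phi> \<in> topspace (wstar_top K). hinner K \<phi> k \<in> U} = {\<phi>. hinner K \<phi> k \<in> U} \<inter> {\<phi>. is_mult K \<phi>}"
        using UN by (auto simp: wstar_top_def)
      then show "openin (wstar_top K) {\<phi> \<in> topspace (wstar_top K). hinner K \<phi> k \<in> U}"
        unfolding wstar_top_def openin_subtopology using o by blast
    qed simp
  qed (use mH k(1) in \<open>auto simp: hinner_add hinner_cmul\<close>)
  then show ?thesis unfolding henkin_def using rep k(2)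
    by (intro conjI exI [of _ "\<lambda>\<phi>. hinner K \<phi> k"]) auto
qed

text \<open>If no such polynomial existed, then the sublinear functional \<open>pp\<close> below would dominate a positive
  functional, that is a measure with mass at least 1 on \<^term>\<open>E\<close>, which is bounded for the norm of \<open>H\<close>
  and hence Henkin.\<close>

lemma small_polynomial:
  assumes tn: "totally_null K E" and E: "compact E" "E \<subseteq> sphere 0 1" and e: "0 < e"
  shows "\<exists>q. is_poly q \<and> (\<forall>z\<in>sphere 0 1. 0 \<le> Re (q z)) \<and> (\<forall>z\<in>E. 1 \<le> Re (q z)) \<and> hn K q < e"
proof (rule ccontr)
  assume contr: "\<not> ?thesis"
  have H: "e \<le> hn K q" if "is_poly q" "\<And>z. z \<in> sphere 0 1 \<Longrightarrow> 0 \<le> Re (q z)" "\<And>z. z \<in> E \<Longrightarrow> 1 \<le> Re (q z)" for q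
    using contr that by (meson not_le)
  have "E \<noteq> {}"
  proof
    assume "E = {}"
    then have "e \<le> hn K (\<lambda>z. 0)" by (intro H is_poly_zero) auto
    then show False using e by simp
  qed
  let ?S = "sphere (0 :: complex^'d) 1"
  have hn0: "0 \<le> hn K q" if "is_poly q" for q by (rule hn_nonneg [OF poly_in_H [OF that]])
  have H': "t \<le> hn K q / e" if q: "is_poly q" and t: "0 \<le> t"
    and S: "\<And>z. z \<in> ?S \<Longrightarrow> 0 \<le> Re (q z)" and E1: "\<And>z. z \<in> E \<Longrightarrow> t \<le> Re (q z)" for q t
  proof (cases "t = 0")
    case True then show ?thesis using hn0 [OF q] e by simp
  next
    case False
    then have t: "t > 0" using t by simp
    have "e \<le> hn K (\<lambda>z. of_real (1 / t) * q z)"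
    proof (rule H)
      show "is_poly (\<lambda>z. of_real (1 / t) * q z)" by (rule is_poly_cmul [OF q])
      show "0 \<le> Re (of_real (1 / t) * q z)" if "z \<in> ?S" for z using S [OF that] t by simp
      show "1 \<le> Re (of_real (1 / t) * q z)" if "z \<in> E" for z using E1 [OF that] t by simp
    qed
    also have "\<dots> = hn K q / t" using hn_cmul [OF poly_in_H [OF q], of "of_real (1 / t)"] t by (simp add: norm_divide)
    finally show ?thesis using t e by (simp add: field_simps)
  qed
  \<comment> \<open>Every element of \<open>A g\<close> is an upper bound for the integral of
    \<open>g\<close> against the desired measure: integrals of \<open>Re q\<close> are to be at most
    \<open>hn K q / e\<close>, and the excess \<open>t\<close> on \<open>E\<close> is subtracted
    because the mass there is to be at least 1. The assumption enters through \<open>A0\<close>,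
    which keeps all infima finite.\<close>
  define A where "A g = {hn K q / e - t | q t. is_poly q \<and> 0 \<le> t \<and> (\<forall>z\<in>?S. apply_bcontfun g z \<le> Re (q z)) \<and>
      (\<forall>z\<in>E. apply_bcontfun g z + t \<le> Re (q z))}" for g :: "(complex^'d) \<Rightarrow>\<^sub>C real"
  have AI: "hn K q / e - t \<in> A g" if "is_poly q" "0 \<le> t" "\<And>z. z \<in> ?S \<Longrightarrow> apply_bcontfun g z \<le> Re (q z)"
      "\<And>z. z \<in> E \<Longrightarrow> apply_bcontfun g z + t \<le> Re (q z)" for q t g
    unfolding A_def using that by blast
  have ne: "A g \<noteq> {}" for g
  proof -
    obtain b where b: "\<And>z. \<bar>apply_bcontfun g z\<bar> \<le> b" using bounded_apply_bcontfun [of g] unfolding bounded_iff by auto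
    then have "apply_bcontfun g z \<le> b" for z using abs_le_D1 by blast
    then have "hn K (\<lambda>z. of_real b) / e - 0 \<in> A g" by (intro AI is_poly_const) auto
    then show ?thesis by blast
  qed
  have Aadd: "\<exists>u\<in>A (g + g'). u \<le> x + y" if "x \<in> A g" "y \<in> A g'" for x y g g'
  proof -
    obtain q t where q: "x = hn K q / e - t" "is_poly q" "0 \<le> t" "\<And>z. z \<in> ?S \<Longrightarrow> apply_bcontfun g z \<le> Re (q z)"
      "\<And>z. z \<in> E \<Longrightarrow> apply_bcontfun g z + t \<le> Re (q z)" using \<open>x \<in> A g\<close> unfolding A_def by blast
    obtain r s where r: "y = hn K r / e - s" "is_poly r" "0 \<le> s" "\<And>z. z \<in> ?S \<Longrightarrow> apply_bcontfun g' z \<le> Re (r z)"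
      "\<And>z. z \<in> E \<Longrightarrow> apply_bcontfun g' z + s \<le> Re (r z)" using \<open>y \<in> A g'\<close> unfolding A_def by blast
    have "hn K (\<lambda>z. q z + r z) / e - (t + s) \<in> A (g + g')"
    proof (intro AI is_poly_add q r add_nonneg_nonneg)
      show "apply_bcontfun (g + g') z \<le> Re (q z + r z)" if "z \<in> ?S" for z
        using q(4) [OF that] r(4) [OF that] by (simp add: plus_bcontfun.rep_eq)
      show "apply_bcontfun (g + g') z + (t + s) \<le> Re (q z + r z)" if "z \<in> E" for z
        using q(5) [OF that] r(5) [OF that] by (simp add: plus_bcontfun.rep_eq)
    qed
    moreover have "hn K (\<lambda>z. q z + r z) / e \<le> hn K q / e + hn K r / e"
      using divide_right_mono [OF hn_add [OF poly_in_H [OF q(2)] poly_in_H [OF r(2)]], of e] e by (simp add: add_divide_distrib)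
    ultimately show ?thesis using q(1) r(1) by (intro bexI) auto
  qed
  have A0: "0 \<le> x" if x: "x \<in> A 0" for x
  proof -
    obtain q t where q: "x = hn K q / e - t" "is_poly q" "0 \<le> t" "\<And>z. z \<in> ?S \<Longrightarrow> 0 \<le> Re (q z)"
      "\<And>z. z \<in> E \<Longrightarrow> t \<le> Re (q z)" using x unfolding A_def zero_bcontfun.rep_eq add_0_left by blast
    then show ?thesis using H' [OF q(2,3,4,5)] by simp
  qed
  have Ascale: "c * x \<in> A (c *\<^sub>R g)" if x: "x \<in> A g" and c: "0 < c" for c x g
  proof -
    obtain q t where q: "x = hn K q / e - t" "is_poly q" "0 \<le> t" "\<And>z. z \<in> ?S \<Longrightarrow> apply_bcontfun g z \<le> Re (q z)"
      "\<And>z. z \<in> E \<Longrightarrow> apply_bcontfun g z + t \<le> Re (q z)" using x unfolding A_def by blast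
    have "hn K (\<lambda>z. of_real c * q z) / e - c * t \<in> A (c *\<^sub>R g)"
    proof (intro AI is_poly_cmul q)
      show "0 \<le> c * t" using c q by simp
      show "apply_bcontfun (c *\<^sub>R g) z \<le> Re (of_real c * q z)" if "z \<in> ?S" for z
        using q(4) [OF that] c by (simp add: scaleR_bcontfun.rep_eq)
      show "apply_bcontfun (c *\<^sub>R g) z + c * t \<le> Re (of_real c * q z)" if "z \<in> E" for z
        using mult_left_mono [OF q(5) [OF that], of c] c by (simp add: scaleR_bcontfun.rep_eq distrib_left)
    qed
    then show ?thesis using hn_cmul [OF poly_in_H [OF q(2)], of "of_real c"] c by (simp add: q(1) algebra_simps)
  qed
  define pp where "pp g = Inf (A g)" for g
  have bdd: "bdd_below (A g)" for g
  proof -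
    obtain y where y: "y \<in> A (- g)" using ne by blast
    have "- y \<le> x" if "x \<in> A g" for x
      using Aadd [OF that y] A0 by fastforce
    then show ?thesis by (rule bdd_belowI)
  qed
  have pp_le: "pp g \<le> x" if "x \<in> A g" for g x unfolding pp_def by (rule cInf_lower [OF that bdd])
  have pp_ge: "c \<le> pp g" if "\<And>x. x \<in> A g \<Longrightarrow> c \<le> x" for g c unfolding pp_def by (rule cInf_greatest [OF ne that])
  have "sublinear pp" unfolding sublinear_def
  proof (intro conjI allI impI)
    fix g g'
    have "pp (g + g') - y \<le> pp g" if y: "y \<in> A g'" for y
    proof (rule pp_ge)
      fix x assume "x \<in> A g"
      then obtain u where "u \<in> A (g + g')" "u \<le> x + y" using Aadd [OF _ y] by blast
      then show "pp (g + g') - y \<le> x" using pp_le [of u "g + g'"] by simp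
    qed
    then have "pp (g + g') - pp g \<le> pp g'" by (intro pp_ge) (simp add: algebra_simps)
    then show "pp (g + g') \<le> pp g + pp g'" by simp
  next
    fix c :: real and g :: "(complex^'d) \<Rightarrow>\<^sub>C real" assume c: "0 \<le> c"
    show "pp (c *\<^sub>R g) = c * pp g"
    proof (cases "c = 0")
      case True
      have "hn K (\<lambda>z. 0) / e - 0 \<in> A 0" by (intro AI is_poly_zero) (auto simp: zero_bcontfun.rep_eq)
      then have "pp 0 \<le> 0" using pp_le by force
      moreover have "0 \<le> pp 0" using A0 by (rule pp_ge)
      ultimately show ?thesis using True by simp
    next
      case False
      then have c: "c > 0" using c by simp
      have "pp (c *\<^sub>R g) / c \<le> pp g"
      proof (rule pp_ge)
        fix x assume "x \<in> A g"
        show "pp (c *\<^sub>R g) / c \<le> x" using pp_le [OF Ascale [OF \<open>x \<in> A g\<close> c]] c by (simp add: divide_le_eq mult.commute)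
      qed
      moreover have "c * pp g \<le> pp (c *\<^sub>R g)"
      proof (rule pp_ge)
        fix x assume "x \<in> A (c *\<^sub>R g)"
        then have "(1 / c) * x \<in> A ((1 / c) *\<^sub>R (c *\<^sub>R g))" using c by (intro Ascale) auto
        then have "pp g \<le> (1 / c) * x" using c by (intro pp_le) simp
        then show "c * pp g \<le> x" using c by (simp add: field_simps)
      qed
      ultimately show ?thesis using c by (simp add: field_simps)
    qed
  qed
  from sublinear_dominates_linear [OF this] obtain \<Lambda> where \<Lambda>: "linear \<Lambda>" "\<And>g. \<Lambda> g \<le> pp g" by blast
  have \<Lambda>neg: "\<Lambda> (- g) = - \<Lambda> g" for g by (rule linear_neg [OF \<Lambda>(1)])
  \<comment> \<open>The zero polynomial dominates \<open>- g + t\<close> on \<open>E\<close>, so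
    \<open>\<Lambda> (- g) \<le> - t\<close>. The case \<open>t = 0\<close> is positivity, the case
    \<open>t = 1\<close> gives the mass on \<open>E\<close>.\<close>
  have pos: "t \<le> \<Lambda> g" if t: "0 \<le> t" and g: "\<And>z. z \<in> ?S \<Longrightarrow> 0 \<le> apply_bcontfun g z" "\<And>z. z \<in> E \<Longrightarrow> t \<le> apply_bcontfun g z" for g t
  proof -
    have "hn K (\<lambda>z. 0) / e - t \<in> A (- g)"
      using g by (intro AI is_poly_zero t) (auto simp: uminus_bcontfun.rep_eq)
    from pp_le [OF this] show ?thesis using \<Lambda>(2) [of "- g"] by (simp add: \<Lambda>neg)
  qed
  interpret PF: positive_functional \<Lambda> ?S
  proof (rule positive_functional.intro)
    show "linear \<Lambda>" by (rule \<Lambda>)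
    show "0 \<le> \<Lambda> g" if "\<And>x. x \<in> ?S \<Longrightarrow> 0 \<le> apply_bcontfun g x" for g
      using that E by (intro pos) auto
    show "compact ?S" by (rule compact_sphere)
  qed
  let ?\<sigma> = PF.\<sigma>
  have rep: "cmeasure_rep ?\<sigma> (\<lambda>_. 1)"
    unfolding cmeasure_rep_def using PF.sets_sigma PF.sigma_null PF.\<sigma>.finite_measure_axioms by simp
  have sph: "AE z in ?\<sigma>. z \<in> ?S"
    using PF.sigma_null PF.sets_sigma by (intro AE_I [where N = "UNIV - ?S"]) auto
  have meas: "borel_measurable ?\<sigma> = (borel_measurable borel :: (complex^'d \<Rightarrow> 'b :: topological_space) set)"
    by (rule measurable_cong_sets [OF PF.sets_sigma refl])
  have pm: "p \<in> borel_measurable borel" if "is_poly p" for p :: "complex^'d \<Rightarrow> complex"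
    by (rule borel_measurable_continuous_onI [OF is_poly_continuous [OF that]])
  have int: "integrable ?\<sigma> p" if p: "is_poly p" for p
  proof -
    have "compact (p ` ?S)" by (intro compact_continuous_image is_poly_continuous p compact_sphere)
    then obtain D where D: "\<And>z. z \<in> ?S \<Longrightarrow> cmod (p z) \<le> D" using compact_imp_bounded bounded_iff by (metis imageI)
    show ?thesis using pm [OF p] unfolding meas [symmetric]
      by (intro PF.\<sigma>.integrable_const_bound [OF eventually_mono [OF sph D]])
  qed
  have Re_le: "Re (\<integral>z. p z \<partial>?\<sigma>) \<le> (1 / e) * hn K p" if p: "is_poly p" for p
  proof -
    \<comment> \<open>Polynomials are not bounded on the whole space; composing with the projection
      onto the ball gives a bounded continuous function with the same values on the sphere.\<close>
    let ?c = "closest_point (cball (0 :: complex^'d) 1)"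
    let ?u = "\<lambda>z. Re (p (?c z))"
    have cc: "?c z \<in> cball 0 1" for z by (rule closest_point_in_set) auto
    have cont: "continuous_on UNIV ?u"
      by (intro continuous_on_Re continuous_on_compose2 [OF is_poly_continuous [OF p, of UNIV]] continuous_on_closest_point) auto
    have "compact (p ` cball 0 1)" by (intro compact_continuous_image is_poly_continuous p compact_cball)
    then obtain D where D: "\<And>z. z \<in> cball 0 1 \<Longrightarrow> cmod (p z) \<le> D" using compact_imp_bounded bounded_iff by (metis imageI)
    have "norm (?u z) \<le> D" for z using abs_Re_le_cmod [of "p (?c z)"] D [OF cc, of z] by simp
    then have ub: "?u \<in> bcontfun" by (rule bcontfun_normI [OF cont])
    have us: "?u z = Re (p z)" if "z \<in> ?S" for z using that closest_point_self [of z "cball 0 1"] by simp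
    have "\<Lambda> (Bcontfun ?u) \<le> hn K p / e - 0"
      using us E by (intro order_trans [OF \<Lambda>(2) pp_le] AI p) (auto simp: Bcontfun_inverse [OF ub])
    moreover have "\<Lambda> (Bcontfun ?u) = (\<integral>z. ?u z \<partial>?\<sigma>)" using PF.riesz_markov [of "Bcontfun ?u"] by (simp add: Bcontfun_inverse [OF ub])
    moreover have "(\<integral>z. ?u z \<partial>?\<sigma>) = (\<integral>z. Re (p z) \<partial>?\<sigma>)"
    proof (rule integral_cong_AE)
      show "?u \<in> borel_measurable ?\<sigma>" unfolding meas by (rule borel_measurable_continuous_onI [OF cont])
      show "(\<lambda>z. Re (p z)) \<in> borel_measurable ?\<sigma>" unfolding meas using pm [OF p] by measurable
      show "AE z in ?\<sigma>. ?u z = Re (p z)" by (rule eventually_mono [OF sph us])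
    qed
    ultimately show ?thesis using int [OF p] by simp
  qed
  have bd: "cmod (\<integral>z. p z \<partial>?\<sigma>) \<le> (1 / e) * hn K p" if p: "is_poly p" for p
  proof (cases "(\<integral>z. p z \<partial>?\<sigma>) = 0")
    case True then show ?thesis using hn0 [OF p] e by simp
  next
    case False
    let ?J = "\<integral>z. p z \<partial>?\<sigma>"
    \<comment> \<open>A unimodular factor makes the integral real, so the bound for real parts
      becomes one for the modulus.\<close>
    let ?c = "cnj ?J / of_real (cmod ?J)"
    have "cmod ?c = 1" using False by (simp add: norm_divide)
    have "?c * ?J = of_real (cmod ?J)"
      using False complex_norm_square [of ?J] by (simp add: mult.commute [of "cnj ?J"] power2_eq_square field_simps)
    then have "cmod ?J = Re (?c * ?J)" by simp
    also have "\<dots> = Re (\<integral>z. ?c * p z \<partial>?\<sigma>)" by simp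
    also have "\<dots> \<le> (1 / e) * hn K (\<lambda>z. ?c * p z)" by (rule Re_le [OF is_poly_cmul [OF p]])
    also have "hn K (\<lambda>z. ?c * p z) = hn K p" using hn_cmul [OF poly_in_H [OF p], of ?c] \<open>cmod ?c = 1\<close> by simp
    finally show ?thesis .
  qed
  have "henkin K ?\<sigma> (\<lambda>_. 1)" by (rule henkin_of_bounded [OF rep bd]) (use e in auto)
  then have null: "emeasure ?\<sigma> E = 0" using tn unfolding totally_null_def by blast
  have Ec: "closed E" using E compact_imp_closed by blast
  \<comment> \<open>Continuous functions equal to 1 on \<open>E\<close> that decrease to its
    indicator. Their integrals stay at least 1, so in the limit \<open>E\<close> would have positive
    measure.\<close>
  let ?g = "\<lambda>n x. max 0 (1 - real n * infdist x E)"
  have gc: "continuous_on UNIV (?g n)" for n by (intro continuous_intros)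
  have g1: "\<bar>?g n x\<bar> \<le> 1" for n x using infdist_nonneg [of x E] by auto
  have gb: "?g n \<in> bcontfun" for n by (rule bcontfun_normI [OF gc, where b = 1]) (use g1 in simp)
  have ge: "1 \<le> (\<integral>x. ?g n x \<partial>?\<sigma>)" for n
  proof -
    have "1 \<le> \<Lambda> (Bcontfun (?g n))" by (rule pos) (auto simp: Bcontfun_inverse [OF gb])
    then show ?thesis using PF.riesz_markov [of "Bcontfun (?g n)"] by (simp add: Bcontfun_inverse [OF gb])
  qed
  have "(\<lambda>n. \<integral>x. ?g n x \<partial>?\<sigma>) \<longlonglongrightarrow> (\<integral>x. indicat_real E x \<partial>?\<sigma>)"
  proof (rule integral_dominated_convergence)
    show "integrable ?\<sigma> (\<lambda>x. 1 :: real)" by simp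
    show "indicat_real E \<in> borel_measurable ?\<sigma>" unfolding meas using Ec by (intro borel_measurable_indicator) auto
    show "?g n \<in> borel_measurable ?\<sigma>" for n unfolding meas by (rule borel_measurable_continuous_onI [OF gc])
    show "AE x in ?\<sigma>. norm (?g n x) \<le> 1" for n using g1 by (intro AE_I2) auto
    show "AE x in ?\<sigma>. (\<lambda>n. ?g n x) \<longlonglongrightarrow> indicat_real E x"
    proof (intro AE_I2)
      fix x
      show "(\<lambda>n. ?g n x) \<longlonglongrightarrow> indicat_real E x"
      proof (cases "x \<in> E")
        case False
        then have i: "infdist x E > 0" using in_closed_iff_infdist_zero [OF Ec \<open>E \<noteq> {}\<close>, of x] infdist_nonneg [of x E] by linarith
        obtain m :: nat where m: "1 / infdist x E < real m" using reals_Archimedean2 by blast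
        have "\<forall>\<^sub>F n in sequentially. ?g n x = 0"
        proof (rule eventually_sequentiallyI)
          fix n assume "m \<le> n"
          then have "1 / infdist x E < real n" using m by linarith
          then show "?g n x = 0" using i by (simp add: field_simps)
        qed
        then show ?thesis using False by (simp add: tendsto_eventually)
      qed simp
    qed
  qed
  moreover have "(\<integral>x. indicat_real E x \<partial>?\<sigma>) = 0"
    using null by (simp add: PF.space_sigma measure_def)
  ultimately have "1 \<le> (0 :: real)" using LIMSEQ_le_const [of _ 0 1] ge by fastforce
  then show False by simp
qed

lemma totally_null_imp_unbounded:
  assumes tn: "totally_null K E" and E: "compact E" "E \<subseteq> sphere 0 1"
  shows "unboundedness_set K E"
proof -
  have "\<forall>n. \<exists>q. is_poly q \<and> (\<forall>z\<in>sphere 0 1. 0 \<le> Re (q z)) \<and> (\<forall>z\<in>E. 1 \<le> Re (q z)) \<and> hn K q < (1 / 2) ^ n"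
    by (intro allI small_polynomial [OF tn E]) simp
  from choice [OF this] obtain q where q: "\<And>n. is_poly (q n)" "\<And>n z. z \<in> sphere 0 1 \<Longrightarrow> 0 \<le> Re (q n z)"
    "\<And>n z. z \<in> E \<Longrightarrow> 1 \<le> Re (q n z)" "\<And>n. hn K (q n) < (1 / 2) ^ n" by blast
  have qH: "in_H K (q n)" for n by (rule poly_in_H [OF q(1)])
  have sum: "summable (\<lambda>n. q n z)" if z: "z \<in> ball 0 1" for z
  proof (rule summable_comparison_test' [OF summable_mult2 [OF summable_geometric, of "1 / 2" "sqrt (N [(1, z)])"]])
    fix n
    have b: "[(1, z)] \<in> bpts" using z by simp
    have "cmod (q n z) \<le> hn K (q n) * sqrt (N [(1, z)])" using ev_le_hn [OF qH b] by simp
    also have "\<dots> \<le> (1 / 2) ^ n * sqrt (N [(1, z)])" using q(4) [of n] N_nonneg [OF b] by (intro mult_right_mono) auto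
    finally show "norm (q n z) \<le> (1 / 2) ^ n * sqrt (N [(1, z)])" .
  qed simp
  define f where "f z = (\<Sum>n. q n z)" for z
  have fH: "in_H K f"
  proof (rule hn_leI(1))
    fix l :: "(complex \<times> (complex^'d)) list" assume l: "l \<in> bpts"
    have "(\<lambda>m. ev l (\<lambda>z. \<Sum>n<m. q n z)) \<longlonglongrightarrow> ev l f"
      unfolding f_def using bptsD [OF l] by (intro ev_tendsto summable_LIMSEQ sum)
    moreover have "cmod (ev l (\<lambda>z. \<Sum>n<m. q n z)) \<le> 2 * sqrt (N l)" for m
    proof -
      have "(\<Sum>n<m. hn K (q n)) \<le> (\<Sum>n<m. (1 / 2) ^ n)" using q(4) by (intro sum_mono less_imp_le)
      also have "\<dots> \<le> (\<Sum>n. (1 / 2) ^ n)" by (intro sum_le_suminf summable_geometric) auto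
      also have "\<dots> = (2 :: real)" by (simp add: suminf_geometric)
      finally have "hn K (\<lambda>z. \<Sum>n<m. q n z) \<le> 2" using hn_sum [of "{..<m}" q] qH by fastforce
      then have "hn K (\<lambda>z. \<Sum>n<m. q n z) * sqrt (N l) \<le> 2 * sqrt (N l)" using N_nonneg [OF l] by (intro mult_right_mono) auto
      then show ?thesis using ev_le_hn [OF in_H_sum [of "{..<m}" q, OF qH] l] by (meson order_trans)
    qed
    ultimately show "cmod (ev l f) \<le> 2 * sqrt (N l)" by (intro LIMSEQ_le_const2 [OF tendsto_norm]) auto
  qed simp
  have "filterlim (\<lambda>r :: real. cmod (f (r *\<^sub>R z))) at_top (at_left 1)" if z: "z \<in> E" for z
    unfolding filterlim_at_top
  proof
    fix Z :: real
    \<comment> \<open>On \<open>E\<close> the first \<open>m\<close> real parts already sum to at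
      least \<open>m\<close>, and by continuity to more than \<open>Z\<close> near the end of the
      radius; the remaining terms are nonnegative in the ball by
      \<open>poly_Re_nonneg_ball\<close>.\<close>
    obtain m :: nat where m: "Z + 1 < real m" using reals_Archimedean2 by blast
    have cont: "continuous_on UNIV (\<lambda>r :: real. \<Sum>n<m. Re (q n (r *\<^sub>R z)))"
      by (intro continuous_on_sum continuous_on_Re continuous_on_compose2 [OF is_poly_continuous [OF q(1), of UNIV]] continuous_intros) auto
    have "((\<lambda>r :: real. \<Sum>n<m. Re (q n (r *\<^sub>R z))) \<longlongrightarrow> (\<Sum>n<m. Re (q n (1 *\<^sub>R z)))) (at_left 1)"
      using cont unfolding continuous_on_def by (meson UNIV_I subset_UNIV tendsto_within_subset)
    moreover have "(\<Sum>n<m. 1) \<le> (\<Sum>n<m. Re (q n (1 *\<^sub>R z)))" using q(3) [OF z] by (intro sum_mono) simp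
    then have "Z < (\<Sum>n<m. Re (q n (1 *\<^sub>R z)))" using m by simp
    ultimately have "\<forall>\<^sub>F r in at_left 1. Z < (\<Sum>n<m. Re (q n (r *\<^sub>R z)))" by (rule order_tendstoD(1))
    moreover have "\<forall>\<^sub>F r :: real in at_left 1. 0 < r \<and> r < 1" unfolding eventually_at_left_field by (intro exI [of _ 0]) auto
    ultimately show "\<forall>\<^sub>F r in at_left 1. Z \<le> cmod (f (r *\<^sub>R z))"
    proof eventually_elim
      case (elim r)
      have b: "r *\<^sub>R z \<in> ball 0 1" using elim z E by auto
      have nn: "0 \<le> Re (q n (r *\<^sub>R z))" for n by (rule poly_Re_nonneg_ball [OF q(1) q(2) b])
      have "(\<lambda>n. Re (q n (r *\<^sub>R z))) sums Re (f (r *\<^sub>R z))" unfolding f_def by (intro sums_Re summable_sums sum b)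
      then have "(\<Sum>n<m. Re (q n (r *\<^sub>R z))) \<le> Re (f (r *\<^sub>R z))" using sum_le_suminf [of "\<lambda>n. Re (q n (r *\<^sub>R z))" "{..<m}"] nn by (simp add: sums_iff)
      also have "\<dots> \<le> cmod (f (r *\<^sub>R z))" by (rule complex_Re_le_cmod)
      finally show ?case using elim by simp
    qed
  qed
  then show ?thesis unfolding unboundedness_set_def using fH by blast
qed

lemma unbounded_imp_weak_unbounded:
  assumes "unboundedness_set K E" shows "weak_unboundedness_set K E"
proof -
  obtain f where f: "in_H K f" and u: "\<And>z. z \<in> E \<Longrightarrow> filterlim (\<lambda>r :: real. cmod (f (r *\<^sub>R z))) at_top (at_left 1)"
    using assms unfolding unboundedness_set_def by blast
  let ?F = "\<lambda>n :: nat. if n = 0 then f else (\<lambda>z. 0)"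
  have "sqrt (\<Sum>n. (cmod (?F n z))\<^sup>2) = cmod (f z)" for z
  proof -
    have "(\<Sum>n. (cmod (?F n z))\<^sup>2) = (\<Sum>n\<in>{0}. (cmod (?F n z))\<^sup>2)" by (rule suminf_finite) auto
    then show ?thesis by simp
  qed
  moreover have "summable (\<lambda>n. hnorm2 K (?F n))" by (rule summable_finite [of "{0}"]) auto
  ultimately show ?thesis unfolding weak_unboundedness_set_def using f u by (intro exI [of _ ?F]) auto
qed

end

theorem theorem4p1:
  fixes a :: "nat \<Rightarrow> real" and E :: "(complex^'d) set"
  assumes "regular_ui a" and "complete_pick a"
    and "compact E" and "E \<subseteq> sphere 0 1"
  shows "(totally_null (ui_kernel a) E \<longleftrightarrow> unboundedness_set (ui_kernel a) E) \<and>
         (unboundedness_set (ui_kernel a) E \<longleftrightarrow> weak_unboundedness_set (ui_kernel a) E)"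
proof -
  have P: "pick_space a (ui_kernel a :: complex^'d \<Rightarrow> complex^'d \<Rightarrow> complex)"
    using assms(1,2) by (simp add: pick_space_def)
  interpret pick_space a "ui_kernel a :: complex^'d \<Rightarrow> complex^'d \<Rightarrow> complex" by (rule P)
  show ?thesis
    using totally_null_imp_unbounded [OF _ assms(3,4)] unbounded_imp_weak_unbounded
      weak_unbounded_imp_totally_null [OF P assms(3,4)] by blast
qed

end
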